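(* Assume that $X$ is complete and supports a $(1,p)$-Poincar\'e inequality, that $\mu$ is doubling and that $p>1$. Let $E\subset X$ be arbitrary. Then the following are equivalent: (a) $N^{1,p}_0(E)$ is nontrivial (i.e. it is not the case that every $u\in N^{1,p}_0(E)$ satisfies $u=0$ q.e.); (b) $E$ contains a nonempty finely open set, or in other terms the fine interior of $E$ is nonempty; (c) there is a point $x\in E$ such that $X\setminus E$ is thin at $x$; (d) there are a point $x\in E$ and $s>0$ such that $$\mathrm{cap}_p(B(x,s)\setminus E,B(x,2s))<\mathrm{cap}_p(B(x,s),B(x,2s)).$$
   Context: $1\le p<\infty$ and $X=(X,d,\mu)$ is a metric space with a Borel regular measure $\mu$ (defined on the completion of the Borel $\sigma$-algebra) such that $0<\mu(B)<\infty$ for all balls $B=B(x,r)=\{y:d(x,y)<r\}$; $\lambda B=B(x,\lambda r)$. $\mu$ is doubling if $\mu(2B)\le C\mu(B)$ for all balls $B$ with a fixed $C$. Curves are nonconstant, compact and rectifiable, parameterized by arc length as $\gamma:[0,l_\gamma]\to X$. A property holds for $p$-almost every curve if the family $\Gamma$ of curves for which it fails has zero $p$-modulus, i.e. there is a nonnegative Borel $\rho\in L^p(X)$ with $\int_\gamma\rho\,ds=\infty$ for every $\gamma\in\Gamma$. A nonnegative Borel function $g$ is an upper gradient of $u:X\to[-\infty,\infty]$ if $|u(\gamma(0))-u(\gamma(l_\gamma))|\le\int_\gamma g\,ds$ for all curves $\gamma$ (the left-hand side is $\infty$ whenever both terms are infinite); a nonnegative measurable $g$ is a $p$-weak upper gradient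 if this holds for $p$-almost every curve. If $u$ has an upper gradient in $L^p_{\rm loc}(X)$ (local: each point has a ball on which the property holds), its minimal $p$-weak upper gradient $g_u\in L^p_{\rm loc}(X)$ is the (a.e. unique) $p$-weak upper gradient satisfying $g_u\le g$ a.e. for every $p$-weak upper gradient $g\in L^p_{\rm loc}(X)$ of $u$. $N^{1,p}(X)$ is the set of everywhere defined measurable $u:X\to[-\infty,\infty]$ having an upper gradient in $L^p_{\rm loc}(X)$ with $\|u\|_{N^{1,p}(X)}=(\int_X|u|^p\,d\mu+\int_X g_u^p\,d\mu)^{1/p}<\infty$. $D^p_{\rm loc}(X)$: everywhere defined measurable functions which near each point (on some ball) have an upper gradient in $L^p$. $X$ supports a $(1,p)$-Poincar\'e inequality if there are $C>0$, $\lambda\ge1$ such that for all balls $B$ and all integrable $u\in D^p_{\rm loc}(X)$, $\frac1{\mu(B)}\int_B|u-u_B|\,d\mu\le C(\mathrm{diam}\,B)\bigl(\frac1{\mu(\lambda B)}\int_{\lambda B}g_u^p\,d\mu\bigr)^{1/p}$, where $u_B=\frac1{\mu(B)}\int_B u\,d\mu$. The capacity of $A\subset X$ is $C_p(A)=\inf\|u\|_{N^{1,p}(X)}^p$ over all $u\in N^{1,p}(X)$ with $u=1$ on $A$; q.e. means outside a set of $C_p$-capacity zero. For any $E\subset X$ (not necessarily measurable), $N^{1,p}_0(E)=\{h|_E: h\in N^{1,p}(X),\ h=0 \text{ on } X\setminus E\}$; such functions are regarded as extended by $0$ when needed. For a nonempty bounded $G\subset X$ and $A\subset G$, the variational capacity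 is $\mathrm{cap}_p(A,G)=\inf\int_X g_u^p\,d\mu$ over all $u\in N^{1,p}_0(G)$ (extended by $0$) with $u\ge1$ on $A$. A set $A$ is thin at $x$ if $$\int_0^1\Bigl(\frac{\mathrm{cap}_p(A\cap B(x,r),B(x,2r))}{\mathrm{cap}_p(B(x,r),B(x,2r))}\Bigr)^{1/(p-1)}\frac{dr}{r}<\infty ,$$ where the integrand is $1$ (by convention) whenever $\mathrm{cap}_p(B(x,r),B(x,2r))=0$. A set $U$ is finely open if $X\setminus U$ is thin at every $x\in U$; finely open sets form a topology. The fine interior of $E$ is the largest finely open set contained in $E$.
   Formalization: The formal theorem additionally assumes that X has at least two points; for a one-point X with E = X, (a) holds but (d) fails since cap_p(B,2B)=0 for every ball, so the equivalence is false there. *)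

theory Defs
  imports "HOL-Analysis.Analysis"
begin

text \<open>
  The metric space is the whole type \<open>'a::metric_space\<close>. Gradients take values in
  \<open>ennreal\<close>, functions \<open>u : X \<rightarrow> [-\<infinity>, \<infinity>]\<close> values in \<open>ereal\<close>. In \<open>ereal\<close> one has
  \<open>\<infinity> - \<infinity> = \<infinity>\<close> and \<open>(-\<infinity>) - (-\<infinity>) = -\<infinity>\<close>, so \<open>\<bar>a - b\<bar> = \<infinity>\<close> whenever both terms are infinite,
  as required in the definition of an upper gradient.
\<close>

definition epowr :: "ennreal \<Rightarrow> real \<Rightarrow> ennreal" (infixr "epowr" 80) where
  \<comment> \<open>only used with positive exponents\<close>
  "a epowr q = (if a = \<infinity> then \<infinity> else ennreal (enn2real a powr q))"

definition eabs :: "ereal \<Rightarrow> ennreal" where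
  "eabs a = e2ennreal \<bar>a\<bar>"


subsection \<open>The measure\<close>

definition metric_measure :: "'a::metric_space measure \<Rightarrow> bool" where
  \<comment> \<open>a measure on the completion of the Borel sets is automatically Borel regular\<close>
  "metric_measure M \<longleftrightarrow>
     (\<exists>N. sets N = sets borel \<and> M = completion N) \<and>
     (\<forall>x r. 0 < r \<longrightarrow> 0 < emeasure M (ball x r) \<and> emeasure M (ball x r) < \<infinity>)"

definition doubling_measure :: "'a::metric_space measure \<Rightarrow> bool" where
  "doubling_measure M \<longleftrightarrow>
     (\<exists>C::real. \<forall>x r. 0 < r \<longrightarrow> emeasure M (ball x (2 * r)) \<le> ennreal C * emeasure M (ball x r))"


subsection \<open>Curves and modulus\<close>

definition curve_length :: "(real \<Rightarrow> 'a::metric_space) \<Rightarrow> real \<Rightarrow> real \<Rightarrow> ennreal" where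
  "curve_length \<gamma> a b =
     (SUP (n, t) \<in> {(n::nat, t::nat \<Rightarrow> real).
                      (\<forall>i\<le>n. t i \<in> {a..b}) \<and> (\<forall>i<n. t i \<le> t (Suc i))}.
        \<Sum>i<n. ennreal (dist (\<gamma> (t i)) (\<gamma> (t (Suc i)))))"

definition arc_length_curve :: "(real \<Rightarrow> 'a::metric_space) \<Rightarrow> real \<Rightarrow> bool" where
  \<comment> \<open>\<open>\<gamma>\<close> restricted to \<open>{0..l}\<close> is a nonconstant rectifiable curve parameterized by arc length
     (hence 1-Lipschitz); the values of \<open>\<gamma>\<close> outside \<open>{0..l}\<close> are irrelevant\<close>
  "arc_length_curve \<gamma> l \<longleftrightarrow>
     0 < l \<and> (\<forall>s t. 0 \<le> s \<and> s \<le> t \<and> t \<le> l \<longrightarrow> curve_length \<gamma> s t = ennreal (t - s))"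

definition curve_integral :: "('a::metric_space \<Rightarrow> ennreal) \<Rightarrow> (real \<Rightarrow> 'a) \<Rightarrow> real \<Rightarrow> ennreal" where
  \<comment> \<open>for \<open>g\<close> measurable with respect to the completed Borel sets, \<open>g \<circ> \<gamma>\<close> is Lebesgue measurable
     only for almost every curve; on the remaining curves this is a lower integral\<close>
  "curve_integral g \<gamma> l = (\<integral>\<^sup>+t\<in>{0..l}. g (\<gamma> t) \<partial>lebesgue)"

definition zero_modulus ::
  "'a::metric_space measure \<Rightarrow> real \<Rightarrow> ((real \<Rightarrow> 'a) \<times> real) set \<Rightarrow> bool" where
  "zero_modulus M p \<Gamma> \<longleftrightarrow>
     (\<exists>\<rho>::'a \<Rightarrow> ennreal. \<rho> \<in> borel_measurable borel \<and> (\<integral>\<^sup>+x. \<rho> x epowr p \<partial>M) < \<infinity> \<and>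
        (\<forall>(\<gamma>, l) \<in> \<Gamma>. curve_integral \<rho> \<gamma> l = \<infinity>))"


subsection \<open>Upper gradients\<close>

definition gradient_ineq ::
  "('a::metric_space \<Rightarrow> ennreal) \<Rightarrow> ('a \<Rightarrow> ereal) \<Rightarrow> (real \<Rightarrow> 'a) \<Rightarrow> real \<Rightarrow> bool" where
  "gradient_ineq g u \<gamma> l \<longleftrightarrow> eabs (u (\<gamma> 0) - u (\<gamma> l)) \<le> curve_integral g \<gamma> l"

definition upper_gradient_on ::
  "'a::metric_space set \<Rightarrow> ('a \<Rightarrow> ennreal) \<Rightarrow> ('a \<Rightarrow> ereal) \<Rightarrow> bool" where
  \<comment> \<open>\<open>A\<close> is either the whole space or a ball; a Borel function on a ball extends by zero
     to a Borel function on the whole space\<close>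
  "upper_gradient_on A g u \<longleftrightarrow>
     g \<in> borel_measurable borel \<and>
     (\<forall>\<gamma> l. arc_length_curve \<gamma> l \<and> \<gamma> ` {0..l} \<subseteq> A \<longrightarrow> gradient_ineq g u \<gamma> l)"

abbreviation upper_gradient :: "('a::metric_space \<Rightarrow> ennreal) \<Rightarrow> ('a \<Rightarrow> ereal) \<Rightarrow> bool" where
  "upper_gradient \<equiv> upper_gradient_on UNIV"

definition weak_upper_gradient ::
  "'a::metric_space measure \<Rightarrow> real \<Rightarrow> ('a \<Rightarrow> ennreal) \<Rightarrow> ('a \<Rightarrow> ereal) \<Rightarrow> bool" where
  "weak_upper_gradient M p g u \<longleftrightarrow>
     g \<in> borel_measurable M \<and>
     zero_modulus M p {(\<gamma>, l). arc_length_curve \<gamma> l \<and> \<not> gradient_ineq g u \<gamma> l}"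

definition Lp_loc :: "'a::metric_space measure \<Rightarrow> real \<Rightarrow> ('a \<Rightarrow> ennreal) set" where
  "Lp_loc M p = {g \<in> borel_measurable M. \<forall>x. \<exists>r>0. (\<integral>\<^sup>+y\<in>ball x r. g y epowr p \<partial>M) < \<infinity>}"

definition is_minimal_weak_upper_gradient ::
  "'a::metric_space measure \<Rightarrow> real \<Rightarrow> ('a \<Rightarrow> ennreal) \<Rightarrow> ('a \<Rightarrow> ereal) \<Rightarrow> bool" where
  "is_minimal_weak_upper_gradient M p g u \<longleftrightarrow>
     g \<in> Lp_loc M p \<and> weak_upper_gradient M p g u \<and>
     (\<forall>h \<in> Lp_loc M p. weak_upper_gradient M p h u \<longrightarrow> (AE x in M. g x \<le> h x))"

definition min_gradient ::
  "'a::metric_space measure \<Rightarrow> real \<Rightarrow> ('a \<Rightarrow> ereal) \<Rightarrow> 'a \<Rightarrow> ennreal" where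
  \<comment> \<open>unique only up to null sets, hence a choice; meaningful only for \<open>u\<close> with an upper gradient
     in \<open>Lp_loc\<close>\<close>
  "min_gradient M p u = (SOME g. is_minimal_weak_upper_gradient M p g u)"

definition p_energy :: "'a::metric_space measure \<Rightarrow> real \<Rightarrow> ('a \<Rightarrow> ereal) \<Rightarrow> ennreal" where
  "p_energy M p u = (\<integral>\<^sup>+x. min_gradient M p u x epowr p \<partial>M)"


subsection \<open>Newtonian spaces\<close>

definition newtonian_norm :: "'a::metric_space measure \<Rightarrow> real \<Rightarrow> ('a \<Rightarrow> ereal) \<Rightarrow> ennreal" where
  "newtonian_norm M p u = ((\<integral>\<^sup>+x. eabs (u x) epowr p \<partial>M) + p_energy M p u) epowr (1 / p)"

definition newtonian :: "'a::metric_space measure \<Rightarrow> real \<Rightarrow> ('a \<Rightarrow> ereal) set" where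
  "newtonian M p =
     {u \<in> borel_measurable M. (\<exists>g \<in> Lp_loc M p. upper_gradient g u) \<and> newtonian_norm M p u < \<infinity>}"

definition newtonian_zero ::
  "'a::metric_space measure \<Rightarrow> real \<Rightarrow> 'a set \<Rightarrow> ('a \<Rightarrow> ereal) set" where
  \<comment> \<open>the restriction of \<open>h\<close> to \<open>E\<close> is identified with its extension by zero, that is, with \<open>h\<close>\<close>
  "newtonian_zero M p E = {h \<in> newtonian M p. \<forall>x. x \<notin> E \<longrightarrow> h x = 0}"

definition Dirichlet_loc :: "'a::metric_space measure \<Rightarrow> real \<Rightarrow> ('a \<Rightarrow> ereal) set" where
  "Dirichlet_loc M p =
     {u \<in> borel_measurable M.
        \<forall>x. \<exists>r>0. \<exists>g. upper_gradient_on (ball x r) g u \<and>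
                       (\<integral>\<^sup>+y\<in>ball x r. g y epowr p \<partial>M) < \<infinity>}"


subsection \<open>Poincare inequality\<close>

definition ball_average ::
  "'a::metric_space measure \<Rightarrow> ('a \<Rightarrow> ereal) \<Rightarrow> 'a \<Rightarrow> real \<Rightarrow> real" where
  \<comment> \<open>used for integrable \<open>u\<close>, which is finite almost everywhere\<close>
  "ball_average M u x r = (LINT y:ball x r|M. real_of_ereal (u y)) / measure M (ball x r)"

definition poincare_inequality :: "'a::metric_space measure \<Rightarrow> real \<Rightarrow> bool" where
  "poincare_inequality M p \<longleftrightarrow>
     (\<exists>C K::real. 0 < C \<and> 1 \<le> K \<and>
        (\<forall>x r u. 0 < r \<and> u \<in> Dirichlet_loc M p \<and> (\<integral>\<^sup>+y. eabs (u y) \<partial>M) < \<infinity> \<longrightarrow>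
           (\<integral>\<^sup>+y\<in>ball x r. eabs (u y - ereal (ball_average M u x r)) \<partial>M) / emeasure M (ball x r)
           \<le> ennreal (C * diameter (ball x r)) *
             ((\<integral>\<^sup>+y\<in>ball x (K * r). min_gradient M p u y epowr p \<partial>M)
                / emeasure M (ball x (K * r))) epowr (1 / p)))"


subsection \<open>Capacities and fine topology\<close>

definition sobolev_capacity :: "'a::metric_space measure \<Rightarrow> real \<Rightarrow> 'a set \<Rightarrow> ennreal" where
  "sobolev_capacity M p A =
     (INF u \<in> {u \<in> newtonian M p. \<forall>x\<in>A. u x = 1}. newtonian_norm M p u epowr p)"

definition quasi_everywhere ::
  "'a::metric_space measure \<Rightarrow> real \<Rightarrow> ('a \<Rightarrow> bool) \<Rightarrow> bool" where
  "quasi_everywhere M p P \<longleftrightarrow> (\<exists>Z. sobolev_capacity M p Z = 0 \<and> (\<forall>x. x \<notin> Z \<longrightarrow> P x))"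

definition var_capacity ::
  "'a::metric_space measure \<Rightarrow> real \<Rightarrow> 'a set \<Rightarrow> 'a set \<Rightarrow> ennreal" where
  "var_capacity M p A G =
     (INF u \<in> {u \<in> newtonian_zero M p G. \<forall>x\<in>A. 1 \<le> u x}. p_energy M p u)"

definition thin_at :: "'a::metric_space measure \<Rightarrow> real \<Rightarrow> 'a set \<Rightarrow> 'a \<Rightarrow> bool" where
  \<comment> \<open>the convention concerns the function that is integrated against \<open>dr/r\<close>\<close>
  "thin_at M p A x \<longleftrightarrow>
     (\<integral>\<^sup>+r\<in>{0<..<1}.
        (if var_capacity M p (ball x r) (ball x (2 * r)) = 0 then 1
         else (var_capacity M p (A \<inter> ball x r) (ball x (2 * r))
                 / var_capacity M p (ball x r) (ball x (2 * r))) epowr (1 / (p - 1)))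
        / ennreal r \<partial>lborel) < \<infinity>"

definition finely_open :: "'a::metric_space measure \<Rightarrow> real \<Rightarrow> 'a set \<Rightarrow> bool" where
  "finely_open M p U \<longleftrightarrow> (\<forall>x\<in>U. thin_at M p (- U) x)"

definition fine_interior :: "'a::metric_space measure \<Rightarrow> real \<Rightarrow> 'a set \<Rightarrow> 'a set" where
  "fine_interior M p E = (GREATEST U. finely_open M p U \<and> U \<subseteq> E)"

end

theory Submission imports Defs
begin

text \<open>
  The essential implication is (a) to (b). Let \<open>0 \<le> u \<le> 1\<close> have bounded support and a weak upper gradient
  \<open>g\<close> in \<open>L^p\<close>, and put \<open>om k x = r^p \<nu>(B(x, L r)) / \<mu>(B(x, r))\<close> with \<open>r = 2^(-k)\<close> and \<open>\<nu> = g^p \<mu>\<close>.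
  Where \<open>u x = 1\<close> and the averages of \<open>u\<close> around \<open>x\<close> eventually exceed 1/2, truncating \<open>u\<close> minus its
  average gives test functions showing that the capacity of \<open>{u = 0} \<inter> B(x, r)\<close> is at most a constant
  times \<open>om k x\<close> times that of \<open>B(x, r)\<close>. Hence \<open>{u = 0}\<close> is thin at \<open>x\<close> as soon as the Wolff-type sum of
  \<open>om k x powr (1 / (p - 1))\<close> converges.
  This sum diverges only on a set of capacity zero: its partial sums have Lipschitz majorants, and
  truncating those at height \<open>t\<close> costs energy of order \<open>t\<close> only, whereas normalizing divides it by \<open>t^p\<close>.
  The set where \<open>u = 1\<close> and \<open>om k x\<close> tends to 0, but infinitely many averages are at most 1/2, is a null
  set by Lebesgue differentiation; a Vitali covering by well-chosen balls shows that it has capacity zero.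
  The implication (d) to (a) uses \<open>1 - u\<close> for an admissible \<open>u\<close>, cut off to the ball.
\<close>

section \<open>Powers of extended nonnegative reals\<close>

text \<open>Capacities involve a minimal gradient picked by \<open>SOME\<close>, so every estimate
  runs through certificates: any Borel weak upper gradient of finite energy bounds
  \<open>p_energy\<close> from above. That minimal gradients exist is proved so that the choice is
  meaningful. The exponent 1 / (p - 1) serves twice. It turns the quotient of capacities, at most a
  multiple of \<open>om\<close>, into a term \<open>c\<close> of the Wolff sum; and since
  \<open>c powr (p - 1)\<close> is linear in \<nu>, the (p-1)-th power of a fine gradient integrates
  by Fubini while one coarser factor stays, controlled by the truncation level. The obstacle is that
  almost everywhere convergence of averages says nothing on null sets, and these may have positive
  capacity. There, low averages together with \<open>om\<close> tending to 0 yield scales at which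
  \<nu> + \<mu> is doubling, so that a Vitali sum is bounded by the measure of a small open
  neighbourhood. Fine openness needs thinness at points where u does not vanish, not only where it
  is 1: multiplying by integers, cutting off and truncating at 1 gives countably many functions,
  hence a single exceptional set.\<close>

lemma epowr_ennreal: "0 \<le> x \<Longrightarrow> ennreal x epowr q = ennreal (x powr q)"
  by (simp add: epowr_def)

lemma epowr_zero [simp]: "0 epowr q = 0"
  by (simp add: epowr_def)

lemma epowr_one [simp]: "1 epowr q = 1"
  by (simp add: epowr_def)

lemma epowr_1 [simp]: "a epowr 1 = a"
  by (cases a) (auto simp: epowr_def)

lemma epowr_mono: "a \<le> b \<Longrightarrow> 0 \<le> q \<Longrightarrow> a epowr q \<le> b epowr q"
  by (cases a; cases b) (auto simp: epowr_def top_unique intro!: ennreal_leI powr_mono2)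

lemma epowr_mult: "(a * b) epowr q = a epowr q * b epowr q"
proof (cases a; cases b)
  fix x y assume "0 \<le> x" "a = ennreal x" "0 \<le> y" "b = ennreal y"
  then show ?thesis by (simp add: epowr_ennreal powr_mult flip: ennreal_mult)
next
  fix x assume *: "0 \<le> x" "a = ennreal x" "b = top"
  then show ?thesis by (cases "x = 0") (auto simp: epowr_def ennreal_mult_eq_top_iff ennreal_top_mult)
next
  fix y assume *: "0 \<le> y" "b = ennreal y" "a = top"
  then show ?thesis by (cases "y = 0") (auto simp: epowr_def ennreal_mult_eq_top_iff ennreal_top_mult)
qed (simp add: epowr_def)

lemma epowr_epowr: "(a epowr q) epowr r = a epowr (q * r)"
  by (cases a) (auto simp: epowr_def powr_powr)

lemma epowr_inverse_cancel: "0 < q \<Longrightarrow> (a epowr (1 / q)) epowr q = a" "0 < q \<Longrightarrow> (a epowr q) epowr (1 / q) = a"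
  by (simp_all add: epowr_epowr)

lemma epowr_less_top [simp]: "a epowr q < \<infinity> \<longleftrightarrow> a < \<infinity>" "a epowr q < top \<longleftrightarrow> a < top"
  by (auto simp: epowr_def less_top)

lemma epowr_eq_0 [simp]: "a epowr q = 0 \<longleftrightarrow> a = 0"
  by (cases a) (auto simp: epowr_def ennreal_eq_0_iff)

lemma epowr_le_iff: "0 < q \<Longrightarrow> a epowr q \<le> b \<longleftrightarrow> a \<le> b epowr (1 / q)"
  using epowr_mono[of "a epowr q" b "1/q"] epowr_mono[of a "b epowr (1/q)" q]
  by (auto simp: epowr_inverse_cancel)

lemma borel_measurable_epowr [measurable]:
  assumes [measurable]: "f \<in> borel_measurable M"
  shows "(\<lambda>x. f x epowr q) \<in> borel_measurable M"
  unfolding epowr_def by measurable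

lemma epowr_max: "0 \<le> q \<Longrightarrow> max a b epowr q = max (a epowr q) (b epowr q)"
  by (metis epowr_mono max_def order_antisym_conv linorder_le_cases)

lemma epowr_add_le: assumes "0 \<le> q"
  shows "(a + b) epowr q \<le> ennreal (2 powr q) * (a epowr q + b epowr q)"
proof -
  have "a + b \<le> 2 * max a b"
    by (metis add_mono max.cobounded1 max.cobounded2 mult_2)
  then have "(a + b) epowr q \<le> (2 * max a b) epowr q" using assms by (rule epowr_mono)
  also have "\<dots> = ennreal (2 powr q) * max (a epowr q) (b epowr q)"
    using epowr_ennreal[of 2 q] by (simp add: epowr_mult epowr_max assms)
  also have "\<dots> \<le> ennreal (2 powr q) * (a epowr q + b epowr q)"
    by (intro mult_left_mono) (auto simp: max_def)
  finally show ?thesis .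
qed

text \<open>Lets suprema replace sums when countably many functions or gradients are glued: their
  p-energies add up with constant 1, for every positive exponent.\<close>

lemma epowr_SUP_le_suminf:
  assumes "0 < q" shows "(SUP n. f n) epowr q \<le> (\<Sum>n::nat. f n epowr q)"
proof -
  have "f n epowr q \<le> (\<Sum>n. f n epowr q)" for n
    using sum_le_suminf[of "\<lambda>n. f n epowr q" "{n}"] by simp
  then show ?thesis by (simp add: epowr_le_iff assms SUP_le_iff)
qed

lemma epowr_le_self_add1: assumes "0 < q" "q \<le> 1" shows "a epowr q \<le> 1 + a"
proof (cases a)
  case (real x)
  have "x powr q \<le> 1 + x"
  proof (cases "x \<le> 1")
    case True then have "x powr q \<le> 1 powr q" using assms real by (intro powr_mono2) auto
    then show ?thesis using real by simp
  next
    case False then have "x powr q \<le> x powr 1" using assms by (intro powr_mono) auto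
    then show ?thesis using False by simp
  qed
  then have "ennreal (x powr q) \<le> ennreal (1 + x)" by (rule ennreal_leI)
  then show ?thesis using real by (simp add: epowr_ennreal)
qed simp

text \<open>A substitute for Minkowski's and Hoelder's inequalities that works for all positive exponents.\<close>
lemma epowr_suminf_le:
  fixes q e :: real
  assumes "0 < q" "0 < e"
  obtains K where "0 < K" "\<And>b :: nat \<Rightarrow> ennreal.
    (\<Sum>n. b n) epowr q \<le> ennreal K * (\<Sum>n. ennreal (2 powr (e * n)) * b n epowr q)"
proof
  define x where "x = (2::real) powr (- (e / q))"
  have x: "0 < x" "x < 1" using assms by (auto simp: x_def powr_less_one)
  have xn: "x ^ n = 2 powr (- (e / q) * n)" for n
    by (simp add: x_def powr_powr flip: powr_realpow)
  define K where "K = (1 / (1 - x)) powr q"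
  show "0 < K" using x by (simp add: K_def)
  fix b :: "nat \<Rightarrow> ennreal"
  define S where "S = (\<Sum>n. ennreal (2 powr (e * n)) * b n epowr q)"
  \<comment> \<open>Each term is at most x^n times the q-th root of the weighted sum; the geometric
    series in x then produces \<open>K\<close>.\<close>
  have "b n \<le> ennreal (x ^ n) * S epowr (1 / q)" for n
  proof -
    have "ennreal (2 powr (e * n)) * b n epowr q \<le> S"
      unfolding S_def using sum_le_suminf[of "\<lambda>n. ennreal (2 powr (e * n)) * b n epowr q" "{n}"] by simp
    then have "(ennreal (2 powr (e * n)) * b n epowr q) epowr (1 / q) \<le> S epowr (1 / q)"
      using assms by (intro epowr_mono) auto
    then have "ennreal (2 powr (e * n / q)) * b n \<le> S epowr (1 / q)"
      using assms by (simp add: epowr_mult epowr_inverse_cancel epowr_ennreal powr_powr)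
    then have "ennreal (x ^ n) * (ennreal (2 powr (e * n / q)) * b n) \<le> ennreal (x ^ n) * S epowr (1 / q)"
      by (intro mult_left_mono) auto
    moreover have "x ^ n * 2 powr (e * n / q) = 1"
      by (simp add: xn flip: powr_add)
    ultimately show ?thesis
      using x by (simp add: mult.assoc[symmetric] flip: ennreal_mult')
  qed
  then have "(\<Sum>n. b n) \<le> (\<Sum>n. ennreal (x ^ n) * S epowr (1 / q))"
    by (intro suminf_le) auto
  also have "\<dots> = (\<Sum>n. ennreal (x ^ n)) * S epowr (1 / q)"
    by simp
  also have "(\<Sum>n. ennreal (x ^ n)) = ennreal (1 / (1 - x))"
    using x by (subst suminf_ennreal2) (auto simp: suminf_geometric summable_geometric)
  finally have "(\<Sum>n. b n) epowr q \<le> (ennreal (1 / (1 - x)) * S epowr (1 / q)) epowr q"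
    using assms by (intro epowr_mono) auto
  then show "(\<Sum>n. b n) epowr q \<le> ennreal K * S"
    using assms x by (simp add: epowr_mult epowr_inverse_cancel K_def epowr_ennreal)
qed

lemma powr_diff_le:
  fixes x y p :: real assumes "1 < p" "0 \<le> y" "0 \<le> a"
  shows "(y + a) powr p \<le> y powr p + p * a * (y + a) powr (p - 1)"
proof (cases "a = 0")
  case False
  have diff: "((\<lambda>x. x powr p) has_real_derivative p * x powr (p - 1)) (at x)" if "y < x" for x
    using that assms by (auto intro!: derivative_eq_intros)
  have "\<exists>l z. y < z \<and> z < y + a \<and> ((\<lambda>x. x powr p) has_real_derivative l) (at z)
      \<and> (y + a) powr p - y powr p = (y + a - y) * l"
  proof (rule MVT)
    show "y < y + a" using False assms by simp
    show "continuous_on {y..y + a} (\<lambda>x. x powr p)"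
      by (intro continuous_on_powr' continuous_intros) (use assms in auto)
    show "\<And>x. y < x \<Longrightarrow> x < y + a \<Longrightarrow> (\<lambda>x. x powr p) differentiable (at x)"
      using diff real_differentiable_def by blast
  qed
  then obtain l z where z: "y < z" "z < y + a" "((\<lambda>x. x powr p) has_real_derivative l) (at z)"
      "(y + a) powr p - y powr p = a * l"
    by auto
  then have "l = p * z powr (p - 1)" using diff DERIV_unique by blast
  then have z: "y < z" "z < y + a" "(y + a) powr p - y powr p = a * (p * z powr (p - 1))"
    using z by auto
  have "z powr (p - 1) \<le> (y + a) powr (p - 1)" using z assms by (intro powr_mono2) auto
  then have "a * (p * z powr (p - 1)) \<le> a * (p * (y + a) powr (p - 1))"
    using assms by (intro mult_left_mono) auto
  then show ?thesis using z by (simp only: mult.left_commute[of p a] mult.assoc)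
qed simp

text \<open>Discrete counterpart of integrating p s^(p-1): peeling off a term costs p times that
  term times the (p-1)-th power of the tail sum starting at it. The induction shifts the sequence,
  so tails of the shifted sequence are tails of the original one.\<close>

lemma epowr_sum_tail_le:
  assumes p: "1 < p"
  shows "(\<Sum>j<N. a j :: ennreal) epowr p \<le> ennreal p * (\<Sum>j<N. a j * (\<Sum>i. a (j + i)) epowr (p - 1))"
proof (induction N arbitrary: a)
  case (Suc N)
  let ?b = "\<lambda>j. a (Suc j)"
  define y where "y = (\<Sum>j<N. ?b j)"
  have 1: "(y + a 0) epowr p \<le> y epowr p + ennreal p * a 0 * (y + a 0) epowr (p - 1)"
  proof (cases y; cases "a 0")
    fix u v assume "0 \<le> u" "y = ennreal u" "0 \<le> v" "a 0 = ennreal v"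
    then show ?thesis using powr_diff_le[OF p, of u v] p
      by (simp add: epowr_ennreal flip: ennreal_plus ennreal_mult)
  qed (use p in \<open>auto simp: epowr_def ennreal_mult_eq_top_iff\<close>)
  have "(y + a 0) \<le> (\<Sum>i. a (0 + i))"
  proof -
    have "y + a 0 = (\<Sum>j<Suc N. a j)" unfolding y_def by (subst sum.lessThan_Suc_shift) (simp add: add.commute)
    then show ?thesis using sum_le_suminf[of a "{..<Suc N}"] by simp
  qed
  then have "(y + a 0) epowr (p - 1) \<le> (\<Sum>i. a (0 + i)) epowr (p - 1)" using p by (intro epowr_mono) auto
  then have "ennreal p * a 0 * (y + a 0) epowr (p - 1) \<le> ennreal p * a 0 * (\<Sum>i. a (0 + i)) epowr (p - 1)"
    by (intro mult_left_mono) auto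
  moreover have "y epowr p \<le> ennreal p * (\<Sum>j<N. ?b j * (\<Sum>i. ?b (j + i)) epowr (p - 1))"
    unfolding y_def by (rule Suc.IH)
  ultimately have "(y + a 0) epowr p \<le> ennreal p * (\<Sum>j<N. ?b j * (\<Sum>i. ?b (j + i)) epowr (p - 1))
     + ennreal p * a 0 * (\<Sum>i. a (0 + i)) epowr (p - 1)"
    using 1 by (meson add_mono order_trans)
  then show ?case
    unfolding sum.lessThan_Suc_shift y_def by (simp add: add.commute distrib_left mult.assoc)
qed simp

text \<open>Prepares Fubini: each product pairs one coarse term with the (p-1)-th power of a single
  finer term. The weight 2^(i/2) is affordable because the finer scale will contribute a factor
  2^(-i).\<close>

lemma epowr_suminf_double_le:
  assumes p: "1 < p"
  obtains K where "0 < K" "\<And>a :: nat \<Rightarrow> ennreal.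
    (\<Sum>j. a j) epowr p \<le> ennreal K * (\<Sum>j. \<Sum>i. ennreal (2 powr (i / 2)) * a j * a (j + i) epowr (p - 1))"
proof -
  obtain K where K: "0 < K" "\<And>b :: nat \<Rightarrow> ennreal.
    (\<Sum>n. b n) epowr (p - 1) \<le> ennreal K * (\<Sum>n. ennreal (2 powr (1/2 * n)) * b n epowr (p - 1))"
    by (rule epowr_suminf_le[of "p - 1" "1/2"]) (use p in auto)
  show ?thesis
  proof
    show "0 < p * K" using K p by simp
    fix a :: "nat \<Rightarrow> ennreal"
    let ?R = "ennreal (p * K) * (\<Sum>j. \<Sum>i. ennreal (2 powr (i / 2)) * a j * a (j + i) epowr (p - 1))"
    have "(\<Sum>j<N. a j) epowr p \<le> ?R" for N
    proof -
      have "(\<Sum>j<N. a j) epowr p \<le> ennreal p * (\<Sum>j<N. a j * (\<Sum>i. a (j + i)) epowr (p - 1))"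
        by (rule epowr_sum_tail_le[OF p])
      also have "\<dots> \<le> ennreal p * (\<Sum>j<N. a j * (ennreal K * (\<Sum>i. ennreal (2 powr (1/2 * i)) * a (j + i) epowr (p - 1))))"
        by (intro mult_left_mono sum_mono K) auto
      also have "\<dots> = ennreal p * (\<Sum>j<N. ennreal K * (\<Sum>i. ennreal (2 powr (i/2)) * a j * a (j + i) epowr (p - 1)))"
      proof -
        have "a j * (ennreal K * (\<Sum>i. ennreal (2 powr (1/2 * i)) * a (j + i) epowr (p - 1)))
           = ennreal K * (\<Sum>i. ennreal (2 powr (i/2)) * a j * a (j + i) epowr (p - 1))" for j
        proof -
          have "(\<Sum>i. ennreal (2 powr (i/2)) * a j * a (j + i) epowr (p - 1))
            = a j * (\<Sum>i. ennreal (2 powr (1/2 * i)) * a (j + i) epowr (p - 1))"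
            by (subst ennreal_suminf_cmult[symmetric]) (simp add: mult_ac)
          then show ?thesis by (simp only: mult.left_commute)
        qed
        then show ?thesis by simp
      qed
      also have "\<dots> = ennreal (p * K) * (\<Sum>j<N. (\<Sum>i. ennreal (2 powr (i/2)) * a j * a (j + i) epowr (p - 1)))"
        using p K by (simp add: sum_distrib_left ennreal_mult mult.assoc)
      also have "\<dots> \<le> ?R"
        by (intro mult_left_mono sum_le_suminf) auto
      finally show ?thesis .
    qed
    then have "(\<Sum>j<N. a j) \<le> ?R epowr (1 / p)" for N using p by (simp add: epowr_le_iff)
    then have "(\<Sum>j. a j) \<le> ?R epowr (1 / p)"
      by (simp add: suminf_eq_SUP SUP_le_iff)
    then show "(\<Sum>j. a j) epowr p \<le> ?R" using p by (simp add: epowr_le_iff)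
  qed
qed

section \<open>Differences of extended real values\<close>

lemma eabs_real [simp]: "eabs (ereal x) = ennreal \<bar>x\<bar>"
  by (simp add: eabs_def)

lemma eabs_real_diff [simp]: "eabs (ereal x - ereal y) = ennreal \<bar>x - y\<bar>"
  by (simp add: eabs_def)

lemma eabs_triangle: "eabs (a - c) \<le> eabs (a - b) + eabs (b - c)"
proof -
  have "ennreal \<bar>x - z\<bar> \<le> ennreal \<bar>x - y\<bar> + ennreal \<bar>y - z\<bar>" for x y z :: real
    by (simp flip: ennreal_plus)
  then show ?thesis by (cases a; cases b; cases c) (auto simp: eabs_def)
qed

section \<open>Curves and weak upper gradients\<close>

text \<open>Keeping the interval as a parameter treats subcurves without reparametrizing them.
  \<open>lborel\<close> gives the same nonnegative integrals as its completion.\<close>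

definition path_int :: "('a::metric_space \<Rightarrow> ennreal) \<Rightarrow> (real \<Rightarrow> 'a) \<Rightarrow> real \<Rightarrow> real \<Rightarrow> ennreal" where
  "path_int g \<gamma> a b = (\<integral>\<^sup>+t. g (\<gamma> t) * indicator {a..b} t \<partial>lborel)"

lemma curve_integral_eq: "curve_integral g \<gamma> l = path_int g \<gamma> 0 l"
  by (simp add: curve_integral_def path_int_def nn_integral_completion)

lemma path_int_mono: "(\<And>x. g x \<le> h x) \<Longrightarrow> path_int g \<gamma> a b \<le> path_int h \<gamma> a b"
  unfolding path_int_def by (intro nn_integral_mono mult_right_mono) auto

lemma path_int_subset: "a \<le> a' \<Longrightarrow> b' \<le> b \<Longrightarrow> path_int g \<gamma> a' b' \<le> path_int g \<gamma> a b"
  unfolding path_int_def by (intro nn_integral_mono mult_left_mono) (auto simp: indicator_def)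

lemma path_measurable [measurable (raw)]:
  fixes \<gamma> :: "real \<Rightarrow> 'a::metric_space"
  assumes "g \<in> borel_measurable borel" "continuous_on {a..b} \<gamma>"
  shows "(\<lambda>t. g (\<gamma> t) * indicator {a..b} t :: ennreal) \<in> borel_measurable borel"
proof (cases "a \<le> b")
  case True
  \<comment> \<open>Clamping the parameter to [a, b] extends the curve to a globally continuous map
    and leaves the integrand unchanged.\<close>
  have "continuous_on UNIV (\<lambda>t. \<gamma> (max a (min b t)))"
    using True by (intro continuous_on_compose2[OF assms(2)] continuous_intros) auto
  then have "(\<lambda>t. \<gamma> (max a (min b t))) \<in> borel \<rightarrow>\<^sub>M borel"
    by (rule borel_measurable_continuous_onI)
  then have "(\<lambda>t. g (\<gamma> (max a (min b t))) * indicator {a..b} t) \<in> borel_measurable borel"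
    using assms(1) by measurable
  also have "(\<lambda>t. g (\<gamma> (max a (min b t))) * indicator {a..b} t) = (\<lambda>t. g (\<gamma> t) * indicator {a..b} t)"
    by (auto simp: indicator_def fun_eq_iff)
  finally show ?thesis .
qed simp

lemma path_int_add:
  assumes "g \<in> borel_measurable borel" "continuous_on {a..c} \<gamma>" "a \<le> b" "b \<le> c"
  shows "path_int g \<gamma> a c = path_int g \<gamma> a b + path_int g \<gamma> b c"
proof -
  have [measurable]: "continuous_on {a..b} \<gamma>" "continuous_on {b..c} \<gamma>" "g \<in> borel_measurable borel"
    using assms by (auto intro: continuous_on_subset)
  have "path_int g \<gamma> a c = (\<integral>\<^sup>+t. g (\<gamma> t) * indicator {a..b} t + g (\<gamma> t) * indicator {b..c} t \<partial>lborel)"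
    unfolding path_int_def
    by (intro nn_integral_cong_AE AE_I[of _ _ "{b}"]) (use assms in \<open>auto simp: indicator_def split: if_splits\<close>)
  then show ?thesis unfolding path_int_def by (subst (asm) nn_integral_add) simp_all
qed

lemma path_int_shift:
  assumes "g \<in> borel_measurable borel" "continuous_on {c + a..c + b} \<gamma>"
  shows "path_int g (\<lambda>t. \<gamma> (c + t)) a b = path_int g \<gamma> (c + a) (c + b)"
proof -
  have "path_int g \<gamma> (c + a) (c + b) = (\<integral>\<^sup>+t. g (\<gamma> (c + t)) * indicator {c + a..c + b} (c + t) \<partial>lborel)"
    unfolding path_int_def using assms by (subst nn_integral_real_affine[where c=1 and t=c]) auto
  also have "\<dots> = path_int g (\<lambda>t. \<gamma> (c + t)) a b"
    unfolding path_int_def by (intro nn_integral_cong) (auto simp: indicator_def)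
  finally show ?thesis by simp
qed

section \<open>Arc length parametrization and subcurves\<close>

lemma arc_length_curve_dist:
  assumes "arc_length_curve \<gamma> l" "0 \<le> s" "s \<le> t" "t \<le> l"
  shows "dist (\<gamma> s) (\<gamma> t) \<le> t - s"
proof -
  have "ennreal (dist (\<gamma> s) (\<gamma> t)) \<le> curve_length \<gamma> s t"
    unfolding curve_length_def
    by (intro SUP_upper2[where i="(1, \<lambda>i. if i = 0 then s else t)"]) (use assms in auto)
  also have "\<dots> = ennreal (t - s)" using assms by (auto simp: arc_length_curve_def)
  finally show ?thesis using assms by simp
qed

lemma arc_length_curve_continuous:
  assumes "arc_length_curve \<gamma> l" shows "continuous_on {0..l} \<gamma>"
proof -
  have "dist (\<gamma> s) (\<gamma> t) \<le> \<bar>s - t\<bar>" if "s \<in> {0..l}" "t \<in> {0..l}" for s t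
    using arc_length_curve_dist[OF assms, of s t] arc_length_curve_dist[OF assms, of t s] that
    by (auto simp: dist_commute abs_real_def)
  then have "1-lipschitz_on {0..l} \<gamma>" by (auto simp: lipschitz_on_def dist_real_def)
  then show ?thesis by (rule lipschitz_on_continuous_on)
qed

lemma curve_length_shift_le: "curve_length (\<lambda>t. \<gamma> (c + t)) a b \<le> curve_length \<gamma> (c + a) (c + b)"
  unfolding curve_length_def
proof (rule SUP_least, safe)
  fix n :: nat and t :: "nat \<Rightarrow> real"
  assume "\<forall>i\<le>n. t i \<in> {a..b}" "\<forall>i<n. t i \<le> t (Suc i)"
  then show "(\<Sum>i<n. ennreal (dist (\<gamma> (c + t i)) (\<gamma> (c + t (Suc i)))))
    \<le> (SUP (n, t) \<in> {(n::nat, t::nat \<Rightarrow> real). (\<forall>i\<le>n. t i \<in> {c + a..c + b}) \<and> (\<forall>i<n. t i \<le> t (Suc i))}.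
        \<Sum>i<n. ennreal (dist (\<gamma> (t i)) (\<gamma> (t (Suc i)))))"
    by (intro SUP_upper2[where i="(n, \<lambda>i. c + t i)"]) auto
qed

lemma curve_length_shift: "curve_length (\<lambda>t. \<gamma> (c + t)) a b = curve_length \<gamma> (c + a) (c + b)"
  using curve_length_shift_le[of \<gamma> c a b] curve_length_shift_le[of "\<lambda>t. \<gamma> (c + t)" "- c" "c + a" "c + b"]
  by simp

lemma arc_length_subcurve:
  assumes "arc_length_curve \<gamma> l" "0 \<le> a" "a < b" "b \<le> l"
  shows "arc_length_curve (\<lambda>t. \<gamma> (a + t)) (b - a)"
  using assms by (auto simp: arc_length_curve_def curve_length_shift)

text \<open>Naming the property instead of the exceptional family gives the calculus of an almost
  everywhere quantifier: it is monotone and closed under countable conjunctions and passage to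
  subcurves.\<close>

definition ae_curve :: "'a::metric_space measure \<Rightarrow> real \<Rightarrow> ((real \<Rightarrow> 'a) \<Rightarrow> real \<Rightarrow> bool) \<Rightarrow> bool" where
  "ae_curve M p P \<longleftrightarrow> zero_modulus M p {(\<gamma>, l). arc_length_curve \<gamma> l \<and> \<not> P \<gamma> l}"

lemma ae_curve_mono:
  assumes "ae_curve M p P" "\<And>\<gamma> l. arc_length_curve \<gamma> l \<Longrightarrow> P \<gamma> l \<Longrightarrow> Q \<gamma> l"
  shows "ae_curve M p Q"
  using assms unfolding ae_curve_def zero_modulus_def by fastforce

lemma ae_curveI: assumes "\<And>\<gamma> l. arc_length_curve \<gamma> l \<Longrightarrow> P \<gamma> l" shows "ae_curve M p P"
  unfolding ae_curve_def zero_modulus_def by (rule exI[of _ "\<lambda>_. 0"]) (use assms in auto)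

lemma ae_curve_witness:
  assumes "\<rho> \<in> borel_measurable borel" "(\<integral>\<^sup>+x. \<rho> x epowr p \<partial>M) < \<infinity>"
    and "\<And>\<gamma> l. arc_length_curve \<gamma> l \<Longrightarrow> path_int \<rho> \<gamma> 0 l < \<infinity> \<Longrightarrow> P \<gamma> l"
  shows "ae_curve M p P"
  unfolding ae_curve_def zero_modulus_def
proof (rule exI[of _ \<rho>], intro conjI assms(1,2), clarify)
  fix \<gamma> l assume "arc_length_curve \<gamma> l" "\<not> P \<gamma> l"
  then show "curve_integral \<rho> \<gamma> l = \<infinity>"
    using assms(3)[of \<gamma> l] unfolding curve_integral_eq by (metis infinity_ennreal_def top.not_eq_extremum)
qed

lemma ae_curve_obtain:
  assumes "ae_curve M p P"
  obtains \<rho> where "\<rho> \<in> borel_measurable borel" "(\<integral>\<^sup>+x. \<rho> x epowr p \<partial>M) < \<infinity>"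
    "\<And>\<gamma> l. arc_length_curve \<gamma> l \<Longrightarrow> path_int \<rho> \<gamma> 0 l < \<infinity> \<Longrightarrow> P \<gamma> l"
proof -
  obtain \<rho> where \<rho>: "\<rho> \<in> borel_measurable borel" "(\<integral>\<^sup>+x. \<rho> x epowr p \<partial>M) < \<infinity>"
    "\<forall>(\<gamma>, l) \<in> {(\<gamma>, l). arc_length_curve \<gamma> l \<and> \<not> P \<gamma> l}. curve_integral \<rho> \<gamma> l = \<infinity>"
    using assms unfolding ae_curve_def zero_modulus_def by blast
  have "P \<gamma> l" if "arc_length_curve \<gamma> l" "path_int \<rho> \<gamma> 0 l < \<infinity>" for \<gamma> l
    using \<rho>(3) that by (force simp: curve_integral_eq)
  then show ?thesis by (rule that[OF \<rho>(1,2)])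
qed

lemma ae_curve_finite:
  assumes "g \<in> borel_measurable borel" "(\<integral>\<^sup>+x. g x epowr p \<partial>M) < \<infinity>"
  shows "ae_curve M p (\<lambda>\<gamma> l. path_int g \<gamma> 0 l < \<infinity>)"
  using assms by (rule ae_curve_witness)

text \<open>Countable subadditivity of the modulus. The witnesses are scaled to energies at most
  2^(-n) and glued by a supremum, whose integral is still infinite along every bad curve.\<close>

lemma ae_curve_all:
  assumes p: "0 < p" and M: "sets borel \<subseteq> sets M" "space M = UNIV" and P: "\<And>n::nat. ae_curve M p (P n)"
  shows "ae_curve M p (\<lambda>\<gamma> l. \<forall>n. P n \<gamma> l)"
proof -
  have "\<forall>n. \<exists>\<rho>. \<rho> \<in> borel_measurable borel \<and> (\<integral>\<^sup>+x. \<rho> x epowr p \<partial>M) < \<infinity> \<and>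
    (\<forall>\<gamma> l. arc_length_curve \<gamma> l \<longrightarrow> path_int \<rho> \<gamma> 0 l < \<infinity> \<longrightarrow> P n \<gamma> l)"
    by (metis ae_curve_obtain P)
  then obtain \<rho> where [measurable]: "\<And>n. \<rho> n \<in> borel_measurable borel"
    and I: "\<And>n. (\<integral>\<^sup>+x. \<rho> n x epowr p \<partial>M) < \<infinity>"
    and \<rho>: "\<And>n \<gamma> l. arc_length_curve \<gamma> l \<Longrightarrow> path_int (\<rho> n) \<gamma> 0 l < \<infinity> \<Longrightarrow> P n \<gamma> l"
    by metis
  define I' where "I' n = enn2real (\<integral>\<^sup>+x. \<rho> n x epowr p \<partial>M)" for n
  have I': "(\<integral>\<^sup>+x. \<rho> n x epowr p \<partial>M) = ennreal (I' n)" "0 \<le> I' n" for n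
    using I[of n] by (auto simp: I'_def)
  \<comment> \<open>The summand 1 guards against dividing by a vanishing energy.\<close>
  define c where "c n = ((1/2) ^ n / (1 + I' n)) powr (1 / p)" for n
  have c: "0 < c n" "c n powr p = (1/2) ^ n / (1 + I' n)" for n
    using I'(2)[of n] p by (auto simp: c_def powr_powr)
  define r where "r x = (SUP n. ennreal (c n) * \<rho> n x)" for x
  show ?thesis
  proof (rule ae_curve_witness)
    show r [measurable]: "r \<in> borel_measurable borel" unfolding r_def by measurable
    have m: "\<And>f. f \<in> borel_measurable borel \<Longrightarrow> f \<in> borel_measurable M"
      using M by (auto simp: measurable_def)
    have "(\<integral>\<^sup>+x. r x epowr p \<partial>M) \<le> (\<integral>\<^sup>+x. (\<Sum>n. (ennreal (c n) * \<rho> n x) epowr p) \<partial>M)"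
      unfolding r_def by (intro nn_integral_mono epowr_SUP_le_suminf p)
    also have "\<dots> = (\<Sum>n. (\<integral>\<^sup>+x. (ennreal (c n) * \<rho> n x) epowr p \<partial>M))"
      by (intro nn_integral_suminf m) measurable
    also have "\<dots> = (\<Sum>n. ennreal (c n powr p) * (\<integral>\<^sup>+x. \<rho> n x epowr p \<partial>M))"
      by (subst nn_integral_cmult[symmetric]) (auto simp: epowr_mult epowr_ennreal c less_imp_le intro!: m)
    also have "\<dots> \<le> (\<Sum>n. ennreal ((1/2) ^ n))"
    proof (intro suminf_le)
      fix n
      have "c n powr p * I' n \<le> (1/2) ^ n" using I'(2)[of n] by (auto simp: c divide_simps)
      then show "ennreal (c n powr p) * (\<integral>\<^sup>+x. \<rho> n x epowr p \<partial>M) \<le> ennreal ((1/2) ^ n)"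
        using I' by (simp flip: ennreal_mult)
    qed auto
    also have "\<dots> < \<infinity>"
      by (subst suminf_ennreal2) (auto simp: summable_geometric)
    finally show "(\<integral>\<^sup>+x. r x epowr p \<partial>M) < \<infinity>" .
    fix \<gamma> l assume \<gamma>: "arc_length_curve \<gamma> l" and fin: "path_int r \<gamma> 0 l < \<infinity>"
    show "\<forall>n. P n \<gamma> l"
    proof
      fix n
      note [measurable] = arc_length_curve_continuous[OF \<gamma>]
      have "ennreal (c n) * path_int (\<rho> n) \<gamma> 0 l = path_int (\<lambda>x. ennreal (c n) * \<rho> n x) \<gamma> 0 l"
        unfolding path_int_def by (subst nn_integral_cmult[symmetric]) (auto simp: mult.assoc)
      also have "\<dots> \<le> path_int r \<gamma> 0 l"
        by (intro path_int_mono) (auto simp: r_def intro: SUP_upper)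
      finally have "ennreal (c n) * path_int (\<rho> n) \<gamma> 0 l < \<infinity>" using fin by simp
      then have "path_int (\<rho> n) \<gamma> 0 l < \<infinity>"
        using c(1)[of n] by (auto simp: ennreal_mult_less_top less_top)
      then show "P n \<gamma> l" using \<rho> \<gamma> by auto
    qed
  qed
qed

lemma ae_curve_conj:
  assumes "0 < p" "sets borel \<subseteq> sets M" "space M = UNIV" "ae_curve M p P" "ae_curve M p Q"
  shows "ae_curve M p (\<lambda>\<gamma> l. P \<gamma> l \<and> Q \<gamma> l)"
proof -
  have "ae_curve M p (\<lambda>\<gamma> l. \<forall>n::nat. (if n = 0 then P else Q) \<gamma> l)"
    using assms by (intro ae_curve_all) auto
  then show ?thesis by (rule ae_curve_mono) (metis zero_neq_one)
qed

text \<open>The same witness serves: a finite integral over the whole curve is finite over each of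
  its subcurves.\<close>

lemma ae_curve_sub:
  assumes "ae_curve M p P"
  shows "ae_curve M p (\<lambda>\<gamma> l. \<forall>a b. 0 \<le> a \<longrightarrow> a < b \<longrightarrow> b \<le> l \<longrightarrow> P (\<lambda>t. \<gamma> (a + t)) (b - a))"
proof -
  obtain \<rho> where \<rho>: "\<rho> \<in> borel_measurable borel" "(\<integral>\<^sup>+x. \<rho> x epowr p \<partial>M) < \<infinity>"
    "\<And>\<gamma> l. arc_length_curve \<gamma> l \<Longrightarrow> path_int \<rho> \<gamma> 0 l < \<infinity> \<Longrightarrow> P \<gamma> l"
    using ae_curve_obtain[OF assms] by blast
  show ?thesis
  proof (rule ae_curve_witness[OF \<rho>(1,2)], intro allI impI)
    fix \<gamma> l a b assume *: "arc_length_curve \<gamma> l" "path_int \<rho> \<gamma> 0 l < \<infinity>" "0 \<le> a" "a < b" "b \<le> l"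
    have "path_int \<rho> (\<lambda>t. \<gamma> (a + t)) 0 (b - a) = path_int \<rho> \<gamma> (a + 0) (a + (b - a))"
      using * by (intro path_int_shift \<rho> continuous_on_subset[OF arc_length_curve_continuous[OF *(1)]]) auto
    also have "\<dots> \<le> path_int \<rho> \<gamma> 0 l" using * by (intro path_int_subset) auto
    finally show "P (\<lambda>t. \<gamma> (a + t)) (b - a)"
      using * by (intro \<rho>(3) arc_length_subcurve) auto
  qed
qed

text \<open>Demanding the gradient inequality on all subcurves makes it stable under truncation and pasting;
  almost every curve has this property anyway.\<close>
definition good_curve :: "('a::metric_space \<Rightarrow> ennreal) \<Rightarrow> ('a \<Rightarrow> ereal) \<Rightarrow> (real \<Rightarrow> 'a) \<Rightarrow> real \<Rightarrow> bool" where
  "good_curve g u \<gamma> l \<longleftrightarrow> (\<forall>s t. 0 \<le> s \<longrightarrow> s < t \<longrightarrow> t \<le> l \<longrightarrow> eabs (u (\<gamma> s) - u (\<gamma> t)) \<le> path_int g \<gamma> s t)"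

section \<open>Weak upper gradients and their calculus\<close>

definition weak_grad :: "'a::metric_space measure \<Rightarrow> real \<Rightarrow> ('a \<Rightarrow> ennreal) \<Rightarrow> ('a \<Rightarrow> ereal) \<Rightarrow> bool" where
  "weak_grad M p g u \<longleftrightarrow> g \<in> borel_measurable borel \<and> ae_curve M p (good_curve g u)"

lemma good_curve_gradient_ineq: "arc_length_curve \<gamma> l \<Longrightarrow> good_curve g u \<gamma> l \<Longrightarrow> gradient_ineq g u \<gamma> l"
  by (auto simp: good_curve_def gradient_ineq_def curve_integral_eq arc_length_curve_def)

lemma good_curve_if_gradient_ineq:
  assumes "g \<in> borel_measurable borel" "arc_length_curve \<gamma> l"
    "\<And>a b. 0 \<le> a \<Longrightarrow> a < b \<Longrightarrow> b \<le> l \<Longrightarrow> gradient_ineq g u (\<lambda>t. \<gamma> (a + t)) (b - a)"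
  shows "good_curve g u \<gamma> l"
  unfolding good_curve_def
proof (intro allI impI)
  fix s t assume *: "0 \<le> s" "s < t" "t \<le> l"
  have "path_int g (\<lambda>r. \<gamma> (s + r)) 0 (t - s) = path_int g \<gamma> (s + 0) (s + (t - s))"
    using * by (intro path_int_shift assms continuous_on_subset[OF arc_length_curve_continuous[OF assms(2)]]) auto
  then show "eabs (u (\<gamma> s) - u (\<gamma> t)) \<le> path_int g \<gamma> s t"
    using assms(3)[OF *] by (simp add: gradient_ineq_def curve_integral_eq)
qed

lemma weak_grad_iff:
  assumes "g \<in> borel_measurable borel"
  shows "weak_grad M p g u \<longleftrightarrow> zero_modulus M p {(\<gamma>, l). arc_length_curve \<gamma> l \<and> \<not> gradient_ineq g u \<gamma> l}"
proof
  assume "weak_grad M p g u"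
  then show "zero_modulus M p {(\<gamma>, l). arc_length_curve \<gamma> l \<and> \<not> gradient_ineq g u \<gamma> l}"
    unfolding weak_grad_def ae_curve_def[symmetric] using ae_curve_mono good_curve_gradient_ineq by blast
next
  assume "zero_modulus M p {(\<gamma>, l). arc_length_curve \<gamma> l \<and> \<not> gradient_ineq g u \<gamma> l}"
  then have "ae_curve M p (gradient_ineq g u)" by (simp add: ae_curve_def)
  from ae_curve_sub[OF this] show "weak_grad M p g u"
    unfolding weak_grad_def using assms good_curve_if_gradient_ineq ae_curve_mono by (smt (verit))
qed

lemma weak_grad_borel: "weak_grad M p g u \<Longrightarrow> g \<in> borel_measurable borel"
  by (simp add: weak_grad_def)

lemma upper_gradient_weak_grad: "upper_gradient g u \<Longrightarrow> weak_grad M p g u"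
  unfolding weak_grad_def upper_gradient_on_def
  by (auto intro!: ae_curveI good_curve_if_gradient_ineq arc_length_subcurve)

lemma weak_grad_I0:
  assumes "g \<in> borel_measurable borel" "ae_curve M p (\<lambda>\<gamma> l. eabs (u (\<gamma> 0) - u (\<gamma> l)) \<le> path_int g \<gamma> 0 l)"
  shows "weak_grad M p g u"
  using assms by (simp add: weak_grad_iff ae_curve_def gradient_ineq_def curve_integral_eq)

lemma weak_grad_mono: "weak_grad M p g u \<Longrightarrow> (\<And>x. g x \<le> h x) \<Longrightarrow> h \<in> borel_measurable borel \<Longrightarrow> weak_grad M p h u"
  unfolding weak_grad_def good_curve_def
  by (auto elim!: ae_curve_mono intro: order_trans[OF _ path_int_mono[of g h]])

lemma weak_grad_SUP:
  fixes u :: "nat \<Rightarrow> 'a::metric_space \<Rightarrow> ereal"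
  assumes "0 < p" "sets borel \<subseteq> sets M" "space M = UNIV"
    and u: "\<And>n. weak_grad M p g (u n)"
    and v: "\<And>x y. eabs (v x - v y) \<le> (SUP n. eabs (u n x - u n y))"
  shows "weak_grad M p g v"
proof -
  have "ae_curve M p (\<lambda>\<gamma> l. \<forall>n. good_curve g (u n) \<gamma> l)"
    using assms by (intro ae_curve_all) (auto simp: weak_grad_def)
  then have "ae_curve M p (good_curve g v)"
  proof (rule ae_curve_mono)
    fix \<gamma> l assume *: "\<forall>n. good_curve g (u n) \<gamma> l"
    show "good_curve g v \<gamma> l" unfolding good_curve_def
      using * by (auto simp: good_curve_def intro!: order_trans[OF v] SUP_least)
  qed
  then show ?thesis using u[of 0] by (simp add: weak_grad_def)
qed

lemma weak_grad_cmult: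
  assumes u: "weak_grad M p g u" and v: "\<And>x y. eabs (v x - v y) \<le> ennreal c * eabs (u x - u y)"
  shows "weak_grad M p (\<lambda>x. ennreal c * g x) v"
proof -
  have [measurable]: "g \<in> borel_measurable borel" using u by (simp add: weak_grad_def)
  have "ae_curve M p (good_curve g u)" using u by (simp add: weak_grad_def)
  then have "ae_curve M p (good_curve (\<lambda>x. ennreal c * g x) v)"
  proof (rule ae_curve_mono)
    fix \<gamma> l assume \<gamma>: "arc_length_curve \<gamma> l" and *: "good_curve g u \<gamma> l"
    show "good_curve (\<lambda>x. ennreal c * g x) v \<gamma> l" unfolding good_curve_def
    proof (intro allI impI)
      fix s t assume st: "0 \<le> s" "s < t" "t \<le> l"
      have [measurable]: "continuous_on {s..t} \<gamma>"
        using st by (auto intro: continuous_on_subset[OF arc_length_curve_continuous[OF \<gamma>]])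
      have "eabs (v (\<gamma> s) - v (\<gamma> t)) \<le> ennreal c * path_int g \<gamma> s t"
        using * st by (intro order_trans[OF v] mult_left_mono) (auto simp: good_curve_def)
      also have "\<dots> = path_int (\<lambda>x. ennreal c * g x) \<gamma> s t"
        unfolding path_int_def by (subst nn_integral_cmult[symmetric]) (auto simp: mult.assoc)
      finally show "eabs (v (\<gamma> s) - v (\<gamma> t)) \<le> path_int (\<lambda>x. ennreal c * g x) \<gamma> s t" .
    qed
  qed
  then show ?thesis by (simp add: weak_grad_def)
qed

lemma weak_grad_contraction:
  assumes "weak_grad M p g u" "\<And>x y. eabs (v x - v y) \<le> eabs (u x - u y)"
  shows "weak_grad M p g v"
  using weak_grad_cmult[OF assms(1), of v 1] assms(2) by simp

lemma path_int_plus: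
  assumes [measurable]: "g \<in> borel_measurable borel" "h \<in> borel_measurable borel" "continuous_on {a..b} \<gamma>"
  shows "path_int (\<lambda>x. g x + h x) \<gamma> a b = path_int g \<gamma> a b + path_int h \<gamma> a b"
  unfolding path_int_def by (subst nn_integral_add[symmetric]) (auto simp: distrib_right)

lemma weak_grad_add:
  assumes M: "0 < p" "sets borel \<subseteq> sets M" "space M = UNIV"
    and u: "weak_grad M p g u" and v: "weak_grad M p h v"
    and w: "\<And>x y. eabs (w x - w y) \<le> eabs (u x - u y) + eabs (v x - v y)"
  shows "weak_grad M p (\<lambda>x. g x + h x) w"
proof -
  have [measurable]: "g \<in> borel_measurable borel" "h \<in> borel_measurable borel"
    using u v by (auto simp: weak_grad_def)
  have "ae_curve M p (\<lambda>\<gamma> l. good_curve g u \<gamma> l \<and> good_curve h v \<gamma> l)"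
    using u v by (intro ae_curve_conj M) (auto simp: weak_grad_def)
  then have "ae_curve M p (good_curve (\<lambda>x. g x + h x) w)"
  proof (rule ae_curve_mono)
    fix \<gamma> l assume \<gamma>: "arc_length_curve \<gamma> l" and *: "good_curve g u \<gamma> l \<and> good_curve h v \<gamma> l"
    show "good_curve (\<lambda>x. g x + h x) w \<gamma> l" unfolding good_curve_def
    proof (intro allI impI)
      fix s t assume st: "0 \<le> s" "s < t" "t \<le> l"
      have "continuous_on {s..t} \<gamma>"
        using st by (auto intro: continuous_on_subset[OF arc_length_curve_continuous[OF \<gamma>]])
      then show "eabs (w (\<gamma> s) - w (\<gamma> t)) \<le> path_int (\<lambda>x. g x + h x) \<gamma> s t"
        using * st by (subst path_int_plus) (auto simp: good_curve_def intro!: order_trans[OF w] add_mono)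
    qed
  qed
  then show ?thesis by (simp add: weak_grad_def)
qed

lemma Lipschitz_good_curve:
  assumes u: "\<And>x y. \<bar>u x - u y\<bar> \<le> L * dist x y" and L: "0 \<le> L" and \<gamma>: "arc_length_curve \<gamma> l"
  shows "good_curve (\<lambda>_. ennreal L) (\<lambda>x. ereal (u x)) \<gamma> l"
  unfolding good_curve_def
proof (intro allI impI)
  fix s t assume st: "0 \<le> s" "s < t" "t \<le> l"
  have "\<bar>u (\<gamma> s) - u (\<gamma> t)\<bar> \<le> L * (t - s)"
    using arc_length_curve_dist[OF \<gamma>, of s t] st L by (intro order_trans[OF u] mult_left_mono) auto
  moreover have "path_int (\<lambda>_. ennreal L) \<gamma> s t = ennreal (L * (t - s))"
    using st L by (simp add: path_int_def nn_integral_cmult ennreal_mult)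
  ultimately show "eabs (ereal (u (\<gamma> s)) - ereal (u (\<gamma> t))) \<le> path_int (\<lambda>_. ennreal L) \<gamma> s t"
    by (simp add: ennreal_leI)
qed

lemma Lipschitz_weak_grad:
  assumes "\<And>x y. \<bar>u x - u y\<bar> \<le> L * dist x y" "0 \<le> L"
  shows "weak_grad M p (\<lambda>_. ennreal L) (\<lambda>x. ereal (u x))"
  using assms by (auto simp: weak_grad_def intro!: ae_curveI Lipschitz_good_curve)

section \<open>Localization to level sets, minima and decreasing limits of gradients\<close>

lemma path_continuous:
  fixes \<phi> :: "real \<Rightarrow> real" and f :: "real \<Rightarrow> ennreal"
  assumes [measurable]: "f \<in> borel_measurable borel" and fin: "(\<integral>\<^sup>+t. f t \<partial>lborel) < \<infinity>"
    and \<phi>: "\<And>s t. a \<le> s \<Longrightarrow> s < t \<Longrightarrow> t \<le> b \<Longrightarrow> ennreal \<bar>\<phi> s - \<phi> t\<bar> \<le> (\<integral>\<^sup>+r. f r * indicator {s..t} r \<partial>lborel)"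
  shows "continuous_on {a..b} \<phi>"
  unfolding continuous_on_sequentially
proof (intro allI ballI impI, elim conjE)
  fix x :: "nat \<Rightarrow> real" and s assume s: "s \<in> {a..b}" and x: "\<forall>n. x n \<in> {a..b}" "x \<longlonglongrightarrow> s"
  define J where "J n = (\<integral>\<^sup>+r. f r * indicator {min s (x n)..max s (x n)} r \<partial>lborel)" for n
  have "J \<longlonglongrightarrow> (\<integral>\<^sup>+r. f r * indicator {s} r \<partial>lborel)"
    unfolding J_def
  proof (rule nn_integral_dominated_convergence[where w=f])
    show "AE r in lborel. (\<lambda>n. f r * indicator {min s (x n)..max s (x n)} r) \<longlonglongrightarrow> f r * indicator {s} r"
    proof (rule AE_I2)
      fix r
      have "eventually (\<lambda>n. f r * indicator {min s (x n)..max s (x n)} r = f r * indicator {s} r) sequentially"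
      proof (cases "r = s")
        case False
        have "eventually (\<lambda>n. dist (x n) s < \<bar>r - s\<bar>) sequentially"
          using x(2) False by (intro tendstoD) auto
        then show ?thesis
          by (rule eventually_mono) (use False in \<open>auto simp: indicator_def dist_real_def\<close>)
      qed simp
      then show "(\<lambda>n. f r * indicator {min s (x n)..max s (x n)} r) \<longlonglongrightarrow> f r * indicator {s} r"
        by (rule tendsto_eventually)
    qed
  qed (use fin in \<open>auto simp: indicator_def\<close>)
  moreover have "(\<integral>\<^sup>+r. f r * indicator {s} r \<partial>lborel) = 0"
    by (subst nn_integral_0_iff_AE) (auto intro!: AE_I[of _ _ "{s}"] simp: indicator_def)
  ultimately have J: "J \<longlonglongrightarrow> 0" by simp
  have le: "ennreal \<bar>\<phi> (x n) - \<phi> s\<bar> \<le> J n" for n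
    using \<phi>[of s "x n"] \<phi>[of "x n" s] x(1) s unfolding J_def
    by (cases "x n" s rule: linorder_cases) (auto simp: abs_minus_commute min_def max_def)
  have "(\<lambda>n. ennreal \<bar>\<phi> (x n) - \<phi> s\<bar>) \<longlonglongrightarrow> 0"
    by (rule tendsto_sandwich[OF _ _ tendsto_const J]) (auto simp: le)
  then have "(\<lambda>n. \<bar>\<phi> (x n) - \<phi> s\<bar>) \<longlonglongrightarrow> 0"
    by (simp add: ennreal_tendsto_0_iff)
  then show "(\<phi> \<circ> x) \<longlonglongrightarrow> \<phi> s"
    by (simp add: o_def LIM_zero_iff tendsto_rabs_zero_iff)
qed

text \<open>Along the curve u is continuous. If it takes the value c, first at t1 and last at t2,
  the increment is at most |u(a) - c| + |c - u(b)|, which charges g only before t1 and after t2, and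
  there the curve runs inside A. If c is not taken, the whole curve lies in A.\<close>

lemma good_curve_indicator:
  assumes g: "g \<in> borel_measurable borel" and \<gamma>: "arc_length_curve \<gamma> l" and fin: "path_int g \<gamma> 0 l < \<infinity>"
    and u: "good_curve g (\<lambda>x. ereal (u x)) \<gamma> l" and A: "\<And>x. u x \<noteq> c \<Longrightarrow> x \<in> A" "A \<in> sets borel"
  shows "good_curve (\<lambda>x. g x * indicator A x) (\<lambda>x. ereal (u x)) \<gamma> l"
  unfolding good_curve_def
proof (intro allI impI)
  fix a b assume ab: "0 \<le> a" "a < b" "b \<le> l"
  let ?h = "\<lambda>x. g x * indicator A x"
  note [measurable] = g A(2) arc_length_curve_continuous[OF \<gamma>]
  have le: "ennreal \<bar>u (\<gamma> s) - u (\<gamma> t)\<bar> \<le> path_int g \<gamma> s t" if "0 \<le> s" "s < t" "t \<le> l" for s t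
    using u that by (auto simp: good_curve_def)
  have "continuous_on {0..l} (\<lambda>t. u (\<gamma> t))"
  proof (rule path_continuous[where f="\<lambda>t. g (\<gamma> t) * indicator {0..l} t"])
    fix s t assume st: "0 \<le> s" "s < t" "t \<le> l"
    have "path_int g \<gamma> s t = (\<integral>\<^sup>+r. g (\<gamma> r) * indicator {0..l} r * indicator {s..t} r \<partial>lborel)"
      unfolding path_int_def using st by (intro nn_integral_cong) (auto simp: indicator_def)
    then show "ennreal \<bar>u (\<gamma> s) - u (\<gamma> t)\<bar> \<le> (\<integral>\<^sup>+r. g (\<gamma> r) * indicator {0..l} r * indicator {s..t} r \<partial>lborel)"
      using le[OF st] by simp
  qed (use fin in \<open>auto simp: path_int_def\<close>)
  then have cont: "continuous_on {a..b} (\<lambda>t. u (\<gamma> t))" using ab by (auto intro: continuous_on_subset)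
  have h: "ennreal \<bar>u (\<gamma> s) - u (\<gamma> t)\<bar> \<le> path_int ?h \<gamma> s t"
    if st: "a \<le> s" "s < t" "t \<le> b" and ne: "\<And>r. s < r \<Longrightarrow> r < t \<Longrightarrow> u (\<gamma> r) \<noteq> c" for s t
  proof -
    have "path_int g \<gamma> s t = path_int ?h \<gamma> s t"
      unfolding path_int_def
    proof (intro nn_integral_cong_AE AE_I[of _ _ "{s, t}"] subsetI)
      show "emeasure lborel {s, t} = 0"
        using emeasure_lborel_countable[of "{s,t}"] by simp
      fix r assume "r \<in> {x \<in> space lborel. g (\<gamma> x) * indicator {s..t} x \<noteq> g (\<gamma> x) * indicator A (\<gamma> x) * indicator {s..t} x}"
      then show "r \<in> {s, t}" using ne[of r] A(1)[of "\<gamma> r"] by (force simp: indicator_def split: if_splits)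
    qed auto
    then show ?thesis using le[of s t] st ab by auto
  qed
  define Z where "Z = {t \<in> {a..b}. u (\<gamma> t) = c}"
  show "eabs (ereal (u (\<gamma> a)) - ereal (u (\<gamma> b))) \<le> path_int ?h \<gamma> a b"
  proof (cases "Z = {}")
    case True
    then show ?thesis using h[of a b] ab by (auto simp: Z_def)
  next
    case False
    have "closed ({a..b} \<inter> (\<lambda>t. u (\<gamma> t)) -` {c})"
      using cont by (rule continuous_closed_preimage) auto
    moreover have "Z = {a..b} \<inter> (\<lambda>t. u (\<gamma> t)) -` {c}" by (auto simp: Z_def)
    ultimately have "compact Z" by (simp add: compact_eq_bounded_closed bounded_Int)
    obtain t1 where t1: "t1 \<in> Z" "\<And>t. t \<in> Z \<Longrightarrow> t1 \<le> t"
      using compact_attains_inf[OF \<open>compact Z\<close> False] by blast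
    obtain t2 where t2: "t2 \<in> Z" "\<And>t. t \<in> Z \<Longrightarrow> t \<le> t2"
      using compact_attains_sup[OF \<open>compact Z\<close> False] by blast
    note t = t1 t2
    have 1: "ennreal \<bar>u (\<gamma> a) - c\<bar> \<le> path_int ?h \<gamma> a t1"
    proof (cases "a < t1")
      case True
      then have "u (\<gamma> r) \<noteq> c" if "a < r" "r < t1" for r using t(1) t(2)[of r] that by (auto simp: Z_def)
      then show ?thesis using h[of a t1] t(1) True by (auto simp: Z_def)
    qed (use t(1) in \<open>auto simp: Z_def\<close>)
    have 2: "ennreal \<bar>c - u (\<gamma> b)\<bar> \<le> path_int ?h \<gamma> t2 b"
    proof (cases "t2 < b")
      case True
      then have "u (\<gamma> r) \<noteq> c" if "t2 < r" "r < b" for r using t(3) t(4)[of r] that by (auto simp: Z_def)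
      then show ?thesis using h[of t2 b] t(3) True by (auto simp: Z_def)
    qed (use t(3) in \<open>auto simp: Z_def\<close>)
    have "ennreal \<bar>u (\<gamma> a) - u (\<gamma> b)\<bar> \<le> ennreal \<bar>u (\<gamma> a) - c\<bar> + ennreal \<bar>c - u (\<gamma> b)\<bar>"
      by (simp flip: ennreal_plus)
    also have "\<dots> \<le> path_int ?h \<gamma> a t1 + path_int ?h \<gamma> t1 b"
      using t by (intro add_mono order_trans[OF 1] order_trans[OF 2] path_int_subset) auto
    also have "\<dots> = path_int ?h \<gamma> a b"
      using t ab by (intro path_int_add[symmetric])
        (auto simp: Z_def intro: continuous_on_subset[OF arc_length_curve_continuous[OF \<gamma>]])
    finally show ?thesis by simp
  qed
qed

lemma weak_grad_indicator:
  assumes M: "0 < p" "sets borel \<subseteq> sets M" "space M = UNIV"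
    and u: "weak_grad M p g (\<lambda>x. ereal (u x))" and fin: "(\<integral>\<^sup>+x. g x epowr p \<partial>M) < \<infinity>"
    and A: "\<And>x. u x \<noteq> c \<Longrightarrow> x \<in> A" "A \<in> sets borel"
  shows "weak_grad M p (\<lambda>x. g x * indicator A x) (\<lambda>x. ereal (u x))"
proof -
  note [measurable] = A(2) weak_grad_borel[OF u]
  have "ae_curve M p (\<lambda>\<gamma> l. good_curve g (\<lambda>x. ereal (u x)) \<gamma> l \<and> path_int g \<gamma> 0 l < \<infinity>)"
    using u by (intro ae_curve_conj M ae_curve_finite fin) (auto simp: weak_grad_def)
  then have "ae_curve M p (good_curve (\<lambda>x. g x * indicator A x) (\<lambda>x. ereal (u x)))"
    by (rule ae_curve_mono) (auto intro!: good_curve_indicator[of g _ _ u c A] A)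
  then show ?thesis by (simp add: weak_grad_def)
qed

text \<open>Where \<open>f1 \<le> f2\<close> holds on a compact set the increments are controlled by \<open>f1\<close> on short
  intervals meeting that set and by \<open>f2\<close> on all others, so no differentiation theorem is needed.\<close>
lemma increment_le_integral_min:
  fixes D :: "real \<Rightarrow> real \<Rightarrow> ennreal" and f1 f2 :: "real \<Rightarrow> ennreal"
  assumes ab: "a < b" and [measurable]: "f1 \<in> borel_measurable borel" "f2 \<in> borel_measurable borel"
    and fin: "(\<integral>\<^sup>+t. f1 t \<partial>lborel) < \<infinity>" "(\<integral>\<^sup>+t. f2 t \<partial>lborel) < \<infinity>"
    and tri: "\<And>r s t. D r t \<le> D r s + D s t"
    and D1: "\<And>s t. a \<le> s \<Longrightarrow> s < t \<Longrightarrow> t \<le> b \<Longrightarrow> D s t \<le> (\<integral>\<^sup>+r. f1 r * indicator {s..t} r \<partial>lborel)"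
    and D2: "\<And>s t. a \<le> s \<Longrightarrow> s < t \<Longrightarrow> t \<le> b \<Longrightarrow> D s t \<le> (\<integral>\<^sup>+r. f2 r * indicator {s..t} r \<partial>lborel)"
  shows "D a b \<le> (\<integral>\<^sup>+r. min (f1 r) (f2 r) * indicator {a..b} r \<partial>lborel)"
proof (rule ennreal_le_epsilon)
  fix e :: real assume e: "0 < e"
  define \<mu> where "\<mu> = density lborel (\<lambda>t. f1 t + f2 t)"
  define S where "S = {t. f1 t \<le> f2 t}"
  have [measurable]: "S \<in> sets borel" unfolding S_def by measurable
  have sets: "sets \<mu> = sets borel" by (simp add: \<mu>_def)
  have \<mu>fin: "emeasure \<mu> (space \<mu>) \<noteq> \<infinity>"
    using fin by (simp add: \<mu>_def emeasure_density nn_integral_add less_top)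
  have \<mu>S: "emeasure \<mu> A \<noteq> \<infinity>" for A
    using \<mu>fin emeasure_space[of \<mu> A] by (auto simp: top_unique)
  obtain U where U: "S \<subseteq> U" "open U" "emeasure \<mu> U < emeasure \<mu> S + ennreal (e / 2)"
  proof -
    have "\<exists>U\<in>{U. S \<subseteq> U \<and> open U}. emeasure \<mu> U < emeasure \<mu> S + ennreal (e / 2)"
      by (rule INF_approx_ennreal[OF _ outer_regular[OF sets \<mu>fin]]) (use \<mu>S e in auto)
    then show ?thesis using that by auto
  qed
  obtain K where K: "K \<subseteq> S" "compact K" "emeasure \<mu> S < emeasure \<mu> K + ennreal (e / 2)"
  proof -
    have "\<exists>K\<in>{K. K \<subseteq> S \<and> compact K}. emeasure \<mu> S < emeasure \<mu> K + ennreal (e / 2)"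
      by (rule SUP_approx_ennreal[OF _ _ inner_regular[OF sets \<mu>fin]]) (use \<mu>S e in auto)
    then show ?thesis using that by auto
  qed
  have [measurable]: "U \<in> sets borel" "K \<in> sets borel"
    using U K by (auto intro: borel_open borel_compact)
  have US: "emeasure \<mu> (U - S) \<le> ennreal (e / 2)"
    using U \<mu>S[of S] \<mu>S[of U] by (subst emeasure_Diff) (auto simp: sets ennreal_minus_le_iff)
  have SK: "emeasure \<mu> (S - K) \<le> ennreal (e / 2)"
    using K \<mu>S[of S] \<mu>S[of K] by (subst emeasure_Diff) (auto simp: sets ennreal_minus_le_iff)
  obtain d where d: "d > 0" "(\<Union>x\<in>K. ball x d) \<subseteq> U"
    using compact_subset_open_imp_ball_epsilon_subset[of K U] U K by blast
  \<comment> \<open>\<open>F\<close> equals the minimum on \<open>K\<close> and off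
    \<open>U\<close>. On \<open>U - K\<close> it is at most the sum of both densities, and this set
    has small \<mu> measure.\<close>
  define F where "F t = f1 t * indicator U t + f2 t * indicator (- K) t" for t
  have [measurable]: "F \<in> borel_measurable borel" unfolding F_def by measurable
  \<comment> \<open>A piece shorter than \<open>d\<close> either misses \<open>K\<close>, so that
    \<open>f2\<close> is charged, or lies in \<open>U\<close>, so that \<open>f1\<close> is.\<close>
  have DF: "D s t \<le> (\<integral>\<^sup>+r. F r * indicator {s..t} r \<partial>lborel)" if st: "a \<le> s" "s < t" "t \<le> b" "t - s < d" for s t
  proof (cases "{s..t} \<inter> K = {}")
    case True
    then have "f2 r * indicator {s..t} r \<le> F r * indicator {s..t} r" for r
      by (auto simp: F_def indicator_def)
    then show ?thesis by (intro order_trans[OF D2[OF st(1-3)]] nn_integral_mono)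
  next
    case False
    then obtain x where x: "x \<in> {s..t}" "x \<in> K" by blast
    have "{s..t} \<subseteq> ball x d" using x st by (auto simp: dist_real_def)
    then have "{s..t} \<subseteq> U" using d x by blast
    then have "f1 r * indicator {s..t} r \<le> F r * indicator {s..t} r" for r
      by (auto simp: F_def indicator_def)
    then show ?thesis by (intro order_trans[OF D1[OF st(1-3)]] nn_integral_mono)
  qed
  obtain n :: nat where n: "(b - a) / d < n" using reals_Archimedean2 by blast
  have n0: "n > 0" using n d ab by (cases n) (auto simp: field_simps)
  define h where "h = (b - a) / n"
  have h: "0 < h" "h < d" "a + n * h = b" using n n0 d ab by (auto simp: h_def field_simps)
  have chain: "i < n \<Longrightarrow> D a (a + Suc i * h) \<le> (\<integral>\<^sup>+r. F r * indicator {a..a + Suc i * h} r \<partial>lborel)" for i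
  proof (induction i)
    case 0
    have "h \<le> n * h" using n0 h by (cases n) auto
    then show ?case using DF[of a "a + h"] h ab by auto
  next
    case (Suc i)
    let ?s = "a + Suc i * h" and ?t = "a + Suc (Suc i) * h"
    have "Suc (Suc i) * h \<le> n * h" using Suc.prems h by (intro mult_right_mono) auto
    then have t: "a \<le> ?s" "?s < ?t" "?t \<le> b" "?t - ?s < d" using h by (auto simp: algebra_simps)
    have "D a ?t \<le> D a ?s + D ?s ?t" by (rule tri)
    also have "\<dots> \<le> (\<integral>\<^sup>+r. F r * indicator {a..?s} r \<partial>lborel) + (\<integral>\<^sup>+r. F r * indicator {?s..?t} r \<partial>lborel)"
      using Suc.prems t by (intro add_mono Suc.IH DF) auto
    also have "\<dots> = (\<integral>\<^sup>+r. F r * indicator {a..?t} r \<partial>lborel)"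
      using path_int_add[of F a ?t id ?s] t by (simp add: path_int_def)
    finally show ?case .
  qed
  have "D a b \<le> (\<integral>\<^sup>+r. F r * indicator {a..b} r \<partial>lborel)"
    using chain[of "n - 1"] n0 h by simp
  also have "\<dots> \<le> (\<integral>\<^sup>+r. min (f1 r) (f2 r) * indicator {a..b} r
      + ((f1 r + f2 r) * indicator (U - S) r + (f1 r + f2 r) * indicator (S - K) r) \<partial>lborel)"
    by (intro nn_integral_mono) (auto simp: F_def indicator_def S_def min_def add_increasing add_increasing2)
  also have "\<dots> = (\<integral>\<^sup>+r. min (f1 r) (f2 r) * indicator {a..b} r \<partial>lborel) + (emeasure \<mu> (U - S) + emeasure \<mu> (S - K))"
    by (simp add: nn_integral_add \<mu>_def emeasure_density)
  also have "\<dots> \<le> (\<integral>\<^sup>+r. min (f1 r) (f2 r) * indicator {a..b} r \<partial>lborel) + (ennreal (e / 2) + ennreal (e / 2))"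
    by (intro add_mono US SK order_refl)
  also have "ennreal (e / 2) + ennreal (e / 2) = ennreal e" using e by (simp flip: ennreal_plus)
  finally show "D a b \<le> (\<integral>\<^sup>+r. min (f1 r) (f2 r) * indicator {a..b} r \<partial>lborel) + ennreal e" .
qed

lemma weak_grad_min:
  assumes M: "0 < p" "sets borel \<subseteq> sets M" "space M = UNIV"
    and g: "weak_grad M p g u" and h: "weak_grad M p h u"
    and fin: "ae_curve M p (\<lambda>\<gamma> l. path_int g \<gamma> 0 l < \<infinity>)" "ae_curve M p (\<lambda>\<gamma> l. path_int h \<gamma> 0 l < \<infinity>)"
  shows "weak_grad M p (\<lambda>x. min (g x) (h x)) u"
proof -
  note [measurable] = weak_grad_borel[OF g] weak_grad_borel[OF h]
  have "ae_curve M p (\<lambda>\<gamma> l. (good_curve g u \<gamma> l \<and> good_curve h u \<gamma> l) \<and> path_int g \<gamma> 0 l < \<infinity> \<and> path_int h \<gamma> 0 l < \<infinity>)"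
    using g h by (intro ae_curve_conj M fin) (auto simp: weak_grad_def)
  then have "ae_curve M p (\<lambda>\<gamma> l. eabs (u (\<gamma> 0) - u (\<gamma> l)) \<le> path_int (\<lambda>x. min (g x) (h x)) \<gamma> 0 l)"
  proof (rule ae_curve_mono, elim conjE)
    fix \<gamma> l assume \<gamma>: "arc_length_curve \<gamma> l" and *: "good_curve g u \<gamma> l" "good_curve h u \<gamma> l"
      "path_int g \<gamma> 0 l < \<infinity>" "path_int h \<gamma> 0 l < \<infinity>"
    note [measurable] = arc_length_curve_continuous[OF \<gamma>]
    have eq: "path_int k \<gamma> s t = (\<integral>\<^sup>+r. k (\<gamma> r) * indicator {0..l} r * indicator {s..t} r \<partial>lborel)" if "0 \<le> s" "t \<le> l" for k s t
      unfolding path_int_def using that by (intro nn_integral_cong) (auto simp: indicator_def)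
    have "eabs (u (\<gamma> 0) - u (\<gamma> l)) \<le>
      (\<integral>\<^sup>+r. min (g (\<gamma> r) * indicator {0..l} r) (h (\<gamma> r) * indicator {0..l} r) * indicator {0..l} r \<partial>lborel)"
    proof (rule increment_le_integral_min[where D="\<lambda>s t. eabs (u (\<gamma> s) - u (\<gamma> t))"])
      show "0 < l" using \<gamma> by (simp add: arc_length_curve_def)
      show "(\<integral>\<^sup>+t. g (\<gamma> t) * indicator {0..l} t \<partial>lborel) < \<infinity>" "(\<integral>\<^sup>+t. h (\<gamma> t) * indicator {0..l} t \<partial>lborel) < \<infinity>"
        using * by (auto simp: path_int_def)
    qed (use * eabs_triangle in \<open>auto simp: good_curve_def eq[symmetric]\<close>)
    also have "\<dots> = path_int (\<lambda>x. min (g x) (h x)) \<gamma> 0 l"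
      unfolding path_int_def by (intro nn_integral_cong) (auto simp: indicator_def)
    finally show "eabs (u (\<gamma> 0) - u (\<gamma> l)) \<le> path_int (\<lambda>x. min (g x) (h x)) \<gamma> 0 l" .
  qed
  then show ?thesis by (intro weak_grad_I0) auto
qed

text \<open>Monotone convergence from above along almost every curve; it starts from the finite
  integral of \<open>h 0\<close>.\<close>

lemma weak_grad_INF:
  fixes h :: "nat \<Rightarrow> 'a::metric_space \<Rightarrow> ennreal"
  assumes M: "0 < p" "sets borel \<subseteq> sets M" "space M = UNIV"
    and h: "\<And>n. weak_grad M p (h n) u" and dec: "decseq h"
    and fin: "ae_curve M p (\<lambda>\<gamma> l. path_int (h 0) \<gamma> 0 l < \<infinity>)"
  shows "weak_grad M p (\<lambda>x. INF n. h n x) u"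
proof (rule weak_grad_I0)
  note [measurable] = weak_grad_borel[OF h]
  show "(\<lambda>x. INF n. h n x) \<in> borel_measurable borel" by measurable
  have "ae_curve M p (\<lambda>\<gamma> l. (\<forall>n. good_curve (h n) u \<gamma> l) \<and> path_int (h 0) \<gamma> 0 l < \<infinity>)"
    using h by (intro ae_curve_conj ae_curve_all M fin) (auto simp: weak_grad_def)
  then show "ae_curve M p (\<lambda>\<gamma> l. eabs (u (\<gamma> 0) - u (\<gamma> l)) \<le> path_int (\<lambda>x. INF n. h n x) \<gamma> 0 l)"
  proof (rule ae_curve_mono, elim conjE)
    fix \<gamma> l assume \<gamma>: "arc_length_curve \<gamma> l" and *: "\<forall>n. good_curve (h n) u \<gamma> l" "path_int (h 0) \<gamma> 0 l < \<infinity>"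
    note [measurable] = arc_length_curve_continuous[OF \<gamma>]
    have "path_int (\<lambda>x. INF n. h n x) \<gamma> 0 l = (\<integral>\<^sup>+r. (INF n. h n (\<gamma> r) * indicator {0..l} r) \<partial>lborel)"
      unfolding path_int_def by (intro nn_integral_cong) (auto simp: indicator_def)
    also have "\<dots> = (INF n. path_int (h n) \<gamma> 0 l)"
      unfolding path_int_def
    proof (rule nn_integral_monotone_convergence_INF_decseq)
      show "decseq (\<lambda>n r. h n (\<gamma> r) * indicator {0..l} r)"
        by (rule antimonoI) (auto intro!: le_funI mult_right_mono decseqD[OF dec, THEN le_funD])
      show "(\<integral>\<^sup>+r. h 0 (\<gamma> r) * indicator {0..l} r \<partial>lborel) < \<infinity>"
        using * by (simp add: path_int_def)
    qed simp
    finally have "path_int (\<lambda>x. INF n. h n x) \<gamma> 0 l = (INF n. path_int (h n) \<gamma> 0 l)" .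
    then show "eabs (u (\<gamma> 0) - u (\<gamma> l)) \<le> path_int (\<lambda>x. INF n. h n x) \<gamma> 0 l"
      using * \<gamma> by (auto simp: good_curve_def arc_length_curve_def intro!: INF_greatest)
  qed
qed

section \<open>Minimal weak upper gradients\<close>

text \<open>Keeps the Borel measure \<open>N\<close> beside its completion \<open>M\<close>:
  nonnegative integrals agree, but Fubini and the energies of gradients are handled for Borel
  functions on \<open>N\<close>. Fixing the constants here lets all later constants be definitions
  depending on the space only.\<close>

locale pi_space =
  fixes M N :: "'a::metric_space measure" and p CD CP K :: real
  assumes sets_N: "sets N = sets borel" and M_eq: "M = completion N"
    and ball_pos: "0 < r \<Longrightarrow> 0 < emeasure N (ball x r)"
    and ball_fin: "emeasure N (ball x r) < \<infinity>"
    and complete: "complete (UNIV :: 'a set)"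
    and p: "1 < p" and CD: "1 \<le> CD" and CP: "0 < CP" and K: "1 \<le> K"
    and doubling: "0 < r \<Longrightarrow> emeasure N (ball x (2 * r)) \<le> ennreal CD * emeasure N (ball x r)"
    and poincare: "0 < r \<Longrightarrow> u \<in> Dirichlet_loc M p \<Longrightarrow> (\<integral>\<^sup>+y. eabs (u y) \<partial>M) < \<infinity> \<Longrightarrow>
           (\<integral>\<^sup>+y\<in>ball x r. eabs (u y - ereal (ball_average M u x r)) \<partial>M) / emeasure M (ball x r)
           \<le> ennreal (CP * diameter (ball x r)) *
             ((\<integral>\<^sup>+y\<in>ball x (K * r). min_gradient M p u y epowr p \<partial>M)
                / emeasure M (ball x (K * r))) epowr (1 / p)"
begin

lemma p0: "0 < p" using p by simp

lemma space_N [simp]: "space N = UNIV"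
  using sets_eq_imp_space_eq[OF sets_N] by simp

lemma space_M: "space M = UNIV" by (simp add: M_eq)

lemma sets_N_M: "sets N \<subseteq> sets M"
  by (auto simp: M_eq)

lemma borel_M: "sets borel \<subseteq> sets M"
  using sets_N_M by (simp add: sets_N)

lemmas curve_measure = p0 borel_M space_M

lemma measurable_N [simp]: "borel_measurable N = borel_measurable borel"
  by (rule measurable_cong_sets) (auto simp: sets_N)

lemma measurable_M: "f \<in> borel_measurable borel \<Longrightarrow> f \<in> borel_measurable M"
  using borel_M by (auto simp: measurable_def space_M)

lemma nn_integral_M: "nn_integral M f = nn_integral N f"
  by (simp add: M_eq nn_integral_completion)

lemma emeasure_M: "A \<in> sets borel \<Longrightarrow> emeasure M A = emeasure N A"
  by (simp add: M_eq sets_N)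

lemma AE_M: "(AE x in N. P x) \<Longrightarrow> (AE x in M. P x)"
  unfolding M_eq by (rule AE_completion)

lemma AE_N: assumes "AE x in M. P x" shows "AE x in N. P x"
proof -
  obtain A where A: "{x \<in> space M. \<not> P x} \<subseteq> A" "emeasure M A = 0" "A \<in> sets M"
    using assms by (rule AE_E)
  then have "A \<in> null_sets (completion N)" by (auto simp: M_eq)
  then obtain B where B: "A \<subseteq> B" "B \<in> null_sets N"
    unfolding null_sets_completion_iff2 by (elim bexE)
  show ?thesis by (rule AE_I'[OF B(2)]) (use A B space_M in auto)
qed

lemma ball_borel [measurable]: "ball x r \<in> sets borel" by simp

lemma ball_sets [simp, measurable]: "ball x r \<in> sets N" by (simp add: sets_N)

lemma ball_setsM [simp, measurable]: "ball x r \<in> sets M" using sets_N_M by auto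

section \<open>Doubling and properness\<close>

definition mb :: "'a \<Rightarrow> real \<Rightarrow> real" where "mb x r = measure N (ball x r)"

lemma emeasure_ball: "emeasure N (ball x r) = ennreal (mb x r)"
  using ball_fin[of x r] unfolding mb_def by (intro emeasure_eq_ennreal_measure) auto

lemma mb_pos: "0 < r \<Longrightarrow> 0 < mb x r"
  using ball_pos[of r x] by (simp add: emeasure_ball ennreal_less_zero_iff)

lemma mb_nonneg [simp]: "0 \<le> mb x r" by (simp add: mb_def)

lemma mb_mono: "ball x r \<subseteq> ball y s \<Longrightarrow> mb x r \<le> mb y s"
  using emeasure_mono[of "ball x r" "ball y s" N] by (simp add: emeasure_ball)

lemma mb_doubling: "0 < r \<Longrightarrow> mb x (2 * r) \<le> CD * mb x r"
  using doubling[of r x] CD by (simp add: emeasure_ball flip: ennreal_mult)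

lemma mb_doubling_pow: "0 < r \<Longrightarrow> mb x (2 ^ n * r) \<le> CD ^ n * mb x r"
proof (induction n)
  case (Suc n)
  have "mb x (2 ^ Suc n * r) \<le> CD * mb x (2 ^ n * r)"
    using mb_doubling[of "2 ^ n * r" x] Suc.prems by (simp add: mult_ac)
  also have "\<dots> \<le> CD * (CD ^ n * mb x r)" using Suc CD by (intro mult_left_mono) auto
  finally show ?case by simp
qed simp

lemma ball_subset: "dist x y + r \<le> s \<Longrightarrow> ball x r \<subseteq> ball y s"
  using dist_triangle[of y _ x] by (auto simp: dist_commute) (smt (verit) dist_commute dist_triangle)

text \<open>The form in which doubling is applied: the centers may differ, and the power of
  \<open>CD\<close> counts how often the second ball must be doubled to swallow the first.\<close>

lemma mb_comp: "0 < s \<Longrightarrow> dist x y + r \<le> 2 ^ n * s \<Longrightarrow> mb x r \<le> CD ^ n * mb y s"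
  using mb_mono[OF ball_subset[of x y r "2 ^ n * s"]] mb_doubling_pow[of s y n] by linarith

lemma UN_ball: "(\<Union>n::nat. ball x n) = UNIV"
  using reals_Archimedean2 by (auto simp: set_eq_iff)

lemma sigma_finite_N: "sigma_finite_measure N"
proof
  show "\<exists>A. countable A \<and> A \<subseteq> sets N \<and> \<Union> A = space N \<and> (\<forall>a\<in>A. emeasure N a \<noteq> \<infinity>)"
    using ball_fin UN_ball[of undefined]
    by (intro exI[of _ "range (\<lambda>n::nat. ball undefined n)"]) (auto simp: less_top)
qed

text \<open>A maximal e-separated subset of the ball is a net. Its size is bounded because the balls
  of radius e / 2 about its points are disjoint, stay in a slightly larger ball and by doubling each
  carry a fixed fraction of \<open>mb x R\<close>.\<close>

lemma finite_net:
  fixes x :: 'a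
  assumes e: "0 < e"
  shows "\<exists>T. finite T \<and> ball x R \<subseteq> (\<Union>t\<in>T. ball t e)"
proof (cases "0 < R")
  case True
  define S where "S T \<longleftrightarrow> finite T \<and> T \<subseteq> ball x R \<and> (\<forall>s\<in>T. \<forall>t\<in>T. s \<noteq> t \<longrightarrow> e \<le> dist s t)" for T
  obtain n where n: "2 * R + e \<le> 2 ^ n * (e / 2)"
  proof -
    obtain n where "(2 * R + e) / (e / 2) < 2 ^ n" using real_arch_pow[of 2] by auto
    then show ?thesis using that[of n] e by (simp add: field_simps)
  qed
  have card: "real (card T) \<le> CD ^ n * mb x (R + e / 2) / mb x R" if T: "S T" for T
  proof -
    have disj: "disjoint_family_on (\<lambda>t. ball t (e / 2)) T"
      unfolding disjoint_family_on_def
    proof (intro ballI impI)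
      fix s t assume "s \<in> T" "t \<in> T" "s \<noteq> t"
      then have "e \<le> dist s t" using T by (auto simp: S_def)
      then show "ball s (e / 2) \<inter> ball t (e / 2) = {}"
        using dist_triangle_half_l by (fastforce simp: dist_commute)
    qed
    have "(\<Sum>t\<in>T. ennreal (mb t (e / 2))) = emeasure N (\<Union>t\<in>T. ball t (e / 2))"
      using T disj by (subst sum_emeasure[symmetric]) (auto simp: S_def emeasure_ball)
    also have "\<dots> \<le> emeasure N (ball x (R + e / 2))"
    proof (intro emeasure_mono UN_least ball_subset)
      fix t assume "t \<in> T"
      then show "dist t x + e / 2 \<le> R + e / 2" using T by (auto simp: S_def dist_commute)
    qed auto
    finally have 1: "(\<Sum>t\<in>T. mb t (e / 2)) \<le> mb x (R + e / 2)"
      by (simp add: emeasure_ball sum_ennreal sum_nonneg)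
    have "mb x R / CD ^ n \<le> mb t (e / 2)" if "t \<in> T" for t
    proof -
      have "mb x R \<le> CD ^ n * mb t (e / 2)"
        using T that n e True by (intro mb_comp) (auto simp: S_def)
      then show ?thesis using CD by (simp add: divide_le_eq mult.commute)
    qed
    then have "(\<Sum>t\<in>T. mb x R / CD ^ n) \<le> (\<Sum>t\<in>T. mb t (e / 2))" by (rule sum_mono)
    with 1 have "card T * (mb x R / CD ^ n) \<le> mb x (R + e / 2)" by simp
    then show ?thesis using CD mb_pos[OF True, of x] by (simp add: field_simps)
  qed
  define m where "m = nat \<lceil>CD ^ n * mb x (R + e / 2) / mb x R\<rceil>"
  have "card T < Suc m" if "S T" for T
    using card[OF that] unfolding m_def by linarith
  moreover have "S {}" by (simp add: S_def)
  ultimately obtain T where T: "S T" "\<And>T'. S T' \<Longrightarrow> card T' \<le> card T"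
    using ex_has_greatest_nat[of S "{}" card "Suc m"] by blast
  have "ball x R \<subseteq> (\<Union>t\<in>T. ball t e)"
  proof (rule ccontr)
    assume "\<not> ?thesis"
    then obtain y where y: "y \<in> ball x R" "\<And>t. t \<in> T \<Longrightarrow> e \<le> dist t y" by force
    have "y \<notin> T" using y(2)[of y] e by auto
    moreover have "S (insert y T)"
      using T(1) y by (auto simp: S_def dist_commute)
    ultimately show False using T(2)[of "insert y T"] T(1) by (auto simp: S_def)
  qed
  then show ?thesis using T by (auto simp: S_def)
next
  case False
  then have "ball x R = {}" by simp
  then show ?thesis by (intro exI[of _ "{}"]) auto
qed

text \<open>Completeness and finite nets make the space proper.\<close>

lemma compact_cball: fixes x :: 'a shows "compact (cball x R)"
  unfolding compact_eq_totally_bounded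
proof (intro conjI allI impI)
  show "complete (cball x R)" using complete_closed_subset[OF closed_cball subset_UNIV complete] .
  fix e :: real assume "0 < e"
  then obtain T where "finite T" "ball x (R + 1) \<subseteq> (\<Union>t\<in>T. ball t e)" 
    using finite_net[of e x "R + 1"] by blast
  moreover have "cball x R \<subseteq> ball x (R + 1)" by auto
  ultimately show "\<exists>k. finite k \<and> cball x R \<subseteq> (\<Union>t\<in>k. ball t e)" by blast
qed

text \<open>By properness a local condition follows from finitely many balls on each bounded set.
  Countably many conditions remain, which is what modulus arguments and the joint minimization of
  energies can handle.\<close>

lemma Lp_loc_iff:
  "g \<in> Lp_loc M p \<longleftrightarrow> g \<in> borel_measurable M \<and> (\<forall>n::nat. (\<integral>\<^sup>+y\<in>ball x0 n. g y epowr p \<partial>M) < \<infinity>)"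
proof
  assume g: "g \<in> Lp_loc M p"
  then have gM [measurable]: "g \<in> borel_measurable M" unfolding Lp_loc_def by blast
  have "(\<integral>\<^sup>+y\<in>ball x0 n. g y epowr p \<partial>M) < \<infinity>" for n :: nat
  proof -
    obtain r where r: "\<And>x. 0 < r x" "\<And>x. (\<integral>\<^sup>+y\<in>ball x (r x). g y epowr p \<partial>M) < \<infinity>"
    proof -
      have "\<forall>x. \<exists>r. 0 < r \<and> (\<integral>\<^sup>+y\<in>ball x r. g y epowr p \<partial>M) < \<infinity>"
        using g unfolding Lp_loc_def by blast
      from choice[OF this] show ?thesis using that by blast
    qed
    obtain T where T: "finite T" "cball x0 n \<subseteq> (\<Union>t\<in>T. ball t (r t))"
    proof (rule compactE_image[OF compact_cball, of UNIV "\<lambda>x. ball x (r x)" x0 "real n"])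
      show "cball x0 (real n) \<subseteq> (\<Union>x. ball x (r x))" using r(1) centre_in_ball by blast
    qed (use that in auto)
    have "(\<integral>\<^sup>+y\<in>ball x0 n. g y epowr p \<partial>M) \<le> (\<integral>\<^sup>+y. (\<Sum>t\<in>T. g y epowr p * indicator (ball t (r t)) y) \<partial>M)"
    proof (intro nn_integral_mono)
      fix y
      show "g y epowr p * indicator (ball x0 n) y \<le> (\<Sum>t\<in>T. g y epowr p * indicator (ball t (r t)) y)"
      proof (cases "y \<in> ball x0 n")
        case True
        then have "y \<in> cball x0 n" by auto
        then obtain t where "t \<in> T" "y \<in> ball t (r t)" using T by blast
        then show ?thesis using T member_le_sum[of t T "\<lambda>t. g y epowr p * indicator (ball t (r t)) y"]
          by (auto simp: indicator_def)
      qed simp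
    qed
    also have "\<dots> = (\<Sum>t\<in>T. (\<integral>\<^sup>+y\<in>ball t (r t). g y epowr p \<partial>M))"
      by (intro nn_integral_sum) measurable
    also have "\<dots> < \<infinity>" using r(2) T by (induction T rule: infinite_finite_induct) auto
    finally show ?thesis .
  qed
  then show "g \<in> borel_measurable M \<and> (\<forall>n::nat. (\<integral>\<^sup>+y\<in>ball x0 n. g y epowr p \<partial>M) < \<infinity>)" by simp
next
  assume g: "g \<in> borel_measurable M \<and> (\<forall>n::nat. (\<integral>\<^sup>+y\<in>ball x0 n. g y epowr p \<partial>M) < \<infinity>)"
  show "g \<in> Lp_loc M p" unfolding Lp_loc_def
  proof (intro CollectI conjI allI)
    fix x
    obtain n :: nat where n: "dist x x0 + 1 < n" using reals_Archimedean2 by blast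
    have "ball x 1 \<subseteq> ball x0 n" using n by (intro ball_subset) auto
    then have "(\<integral>\<^sup>+y\<in>ball x 1. g y epowr p \<partial>M) \<le> (\<integral>\<^sup>+y\<in>ball x0 n. g y epowr p \<partial>M)"
      by (intro nn_integral_mono mult_left_mono) (auto simp: indicator_def)
    then show "\<exists>r>0. (\<integral>\<^sup>+y\<in>ball x r. g y epowr p \<partial>M) < \<infinity>"
      using g by (intro exI[of _ 1]) (auto intro: le_less_trans)
  qed (use g in simp)
qed

text \<open>An almost everywhere equal function would not do, since curves may run inside a null
  set. Raising the value to \<infinity> on a Borel null set keeps every gradient inequality along
  curves.\<close>

lemma borel_majorant:
  fixes g :: "'a \<Rightarrow> ennreal"
  assumes "g \<in> borel_measurable M"
  obtains g' where "g' \<in> borel_measurable borel" "\<And>x. g x \<le> g' x" "AE x in N. g x = g' x"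
proof -
  obtain h where h: "h \<in> borel_measurable N" "AE x in N. g x = h x"
    using completion_ex_borel_measurable[OF assms[unfolded M_eq]] by auto
  obtain A where A: "{x \<in> space N. g x \<noteq> h x} \<subseteq> A" "A \<in> null_sets N"
  proof -
    obtain B where "{x \<in> space N. \<not> g x = h x} \<subseteq> B" "emeasure N B = 0" "B \<in> sets N"
      using h(2) by (rule AE_E)
    then show ?thesis using that[of B] by auto
  qed
  have [measurable]: "h \<in> borel_measurable borel" "A \<in> sets borel" using h A by (auto simp: null_sets_def sets_N)
  show ?thesis
  proof (rule that[of "\<lambda>x. if x \<in> A then \<infinity> else h x"])
    show "AE x in N. g x = (if x \<in> A then \<infinity> else h x)"
      using AE_not_in[OF A(2)] h(2) by eventually_elim auto
    show "g x \<le> (if x \<in> A then \<infinity> else h x)" for x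
      using A(1) by (cases "x \<in> A") force+
  qed measurable
qed

text \<open>A curve is compact, hence contained in one of countably many balls.\<close>

lemma ae_curve_finite_loc:
  assumes [measurable]: "g \<in> borel_measurable borel" and g: "\<And>n::nat. (\<integral>\<^sup>+y\<in>ball x0 n. g y epowr p \<partial>M) < \<infinity>"
  shows "ae_curve M p (\<lambda>\<gamma> l. path_int g \<gamma> 0 l < \<infinity>)"
proof -
  have "ae_curve M p (\<lambda>\<gamma> l. \<forall>n::nat. path_int (\<lambda>x. g x * indicator (ball x0 n) x) \<gamma> 0 l < \<infinity>)"
  proof (intro ae_curve_all curve_measure ae_curve_finite)
    fix n :: nat
    have "(\<integral>\<^sup>+x. (g x * indicator (ball x0 n) x) epowr p \<partial>M) = (\<integral>\<^sup>+y\<in>ball x0 n. g y epowr p \<partial>M)"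
      by (intro nn_integral_cong) (auto simp: indicator_def)
    then show "(\<integral>\<^sup>+x. (g x * indicator (ball x0 n) x) epowr p \<partial>M) < \<infinity>" using g by simp
  qed measurable
  then show ?thesis
  proof (rule ae_curve_mono)
    fix \<gamma> l assume \<gamma>: "arc_length_curve \<gamma> l"
      and *: "\<forall>n::nat. path_int (\<lambda>x. g x * indicator (ball x0 n) x) \<gamma> 0 l < \<infinity>"
    have "bounded (\<gamma> ` {0..l})"
      by (intro compact_imp_bounded compact_continuous_image arc_length_curve_continuous[OF \<gamma>]) auto
    then obtain e where e: "\<And>t. t \<in> {0..l} \<Longrightarrow> dist x0 (\<gamma> t) \<le> e"
      unfolding bounded_any_center[of "\<gamma> ` {0..l}" x0] by blast
    obtain n :: nat where n: "e < n" using reals_Archimedean2 by blast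
    have "path_int g \<gamma> 0 l = path_int (\<lambda>x. g x * indicator (ball x0 n) x) \<gamma> 0 l"
      unfolding path_int_def
    proof (rule nn_integral_cong)
      fix t show "g (\<gamma> t) * indicator {0..l} t = g (\<gamma> t) * indicator (ball x0 n) (\<gamma> t) * indicator {0..l} t"
        using e[of t] n by (auto simp: indicator_def)
    qed
    then show "path_int g \<gamma> 0 l < \<infinity>" using * by simp
  qed
qed

section \<open>Locally integrable weak upper gradients and their minimal element\<close>

definition loc_grads :: "('a \<Rightarrow> ereal) \<Rightarrow> ('a \<Rightarrow> ennreal) set" where
  "loc_grads u = {g \<in> Lp_loc M p. weak_grad M p g u}"

lemma weak_grad_weak_upper_gradient: "weak_grad M p g u \<Longrightarrow> weak_upper_gradient M p g u"
  using weak_grad_borel[of M p g u] measurable_M[of g] weak_grad_iff[of g M p u]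
  unfolding weak_upper_gradient_def by blast

lemma Lp_loc_cong_AE:
  assumes "g \<in> Lp_loc M p" "g' \<in> borel_measurable M" "AE x in N. g x = g' x" shows "g' \<in> Lp_loc M p"
proof -
  have "(\<integral>\<^sup>+y\<in>ball x0 n. g y epowr p \<partial>M) = (\<integral>\<^sup>+y\<in>ball x0 n. g' y epowr p \<partial>M)" for x0 n
  proof (rule nn_integral_cong_AE)
    show "AE y in M. g y epowr p * indicator (ball x0 n) y = g' y epowr p * indicator (ball x0 n) y"
      using AE_M[OF assms(3)] by eventually_elim simp
  qed
  then show ?thesis using assms(1,2) unfolding Lp_loc_def by (simp only: mem_Collect_eq simp_thms)
qed

lemma weak_upper_gradient_majorant:
  assumes "weak_upper_gradient M p g u"
  obtains g' where "weak_grad M p g' u" "\<And>x. g x \<le> g' x" "AE x in N. g x = g' x"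
proof -
  have gM: "g \<in> borel_measurable M" using assms unfolding weak_upper_gradient_def by blast
  obtain g' where g': "g' \<in> borel_measurable borel" "\<And>x. g x \<le> g' x" "AE x in N. g x = g' x"
    using borel_majorant[OF gM] by metis
  have "ae_curve M p (gradient_ineq g u)"
    unfolding ae_curve_def using assms[unfolded weak_upper_gradient_def] by (rule conjunct2)
  then have "ae_curve M p (gradient_ineq g' u)"
  proof (rule ae_curve_mono)
    fix \<gamma> l assume "gradient_ineq g u \<gamma> l"
    then show "gradient_ineq g' u \<gamma> l"
      unfolding gradient_ineq_def curve_integral_eq by (rule order_trans[OF _ path_int_mono[OF g'(2)]])
  qed
  then have "weak_grad M p g' u" unfolding weak_grad_iff[OF g'(1)] ae_curve_def .
  then show ?thesis using g'(2,3) by (rule that)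
qed

lemma loc_grads_iff:
  "g \<in> loc_grads u \<longleftrightarrow> weak_grad M p g u \<and> (\<forall>n::nat. (\<integral>\<^sup>+y\<in>ball x0 n. g y epowr p \<partial>M) < \<infinity>)"
  unfolding loc_grads_def Lp_loc_iff[of _ x0] using weak_grad_borel measurable_M by blast

lemma loc_grads_finite: "g \<in> loc_grads u \<Longrightarrow> ae_curve M p (\<lambda>\<gamma> l. path_int g \<gamma> 0 l < \<infinity>)"
  using ae_curve_finite_loc[of g undefined] weak_grad_borel unfolding loc_grads_iff[of _ _ undefined] by blast

lemma loc_grads_le:
  assumes "g \<in> loc_grads u" "weak_grad M p h u" "\<And>x. h x \<le> g x" shows "h \<in> loc_grads u"
  unfolding loc_grads_iff[of _ _ undefined]
proof (intro conjI allI assms)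
  fix n :: nat
  have "(\<integral>\<^sup>+y\<in>ball undefined n. h y epowr p \<partial>M) \<le> (\<integral>\<^sup>+y\<in>ball undefined n. g y epowr p \<partial>M)"
    using p0 assms(3) by (intro nn_integral_mono mult_right_mono epowr_mono) auto
  also have "\<dots> < \<infinity>" using assms(1) unfolding loc_grads_iff[of _ _ undefined] by blast
  finally show "(\<integral>\<^sup>+y\<in>ball undefined n. h y epowr p \<partial>M) < \<infinity>" .
qed

lemma loc_grads_min:
  assumes "g \<in> loc_grads u" "h \<in> loc_grads u" shows "(\<lambda>x. min (g x) (h x)) \<in> loc_grads u"
proof (rule loc_grads_le[OF assms(1)])
  show "weak_grad M p (\<lambda>x. min (g x) (h x)) u"
    using assms loc_grads_finite by (intro weak_grad_min curve_measure) (auto simp: loc_grads_def)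
qed simp

lemma weak_upper_gradient_loc_grads:
  assumes "h \<in> Lp_loc M p" "weak_upper_gradient M p h u"
  obtains g where "g \<in> loc_grads u" "\<And>x. h x \<le> g x" "AE x in N. h x = g x"
proof -
  obtain g where g: "weak_grad M p g u" "\<And>x. h x \<le> g x" "AE x in N. h x = g x"
    using weak_upper_gradient_majorant[OF assms(2)] by metis
  have "g \<in> Lp_loc M p"
    by (rule Lp_loc_cong_AE[OF assms(1) measurable_M[OF weak_grad_borel[OF g(1)]] g(3)])
  then show ?thesis using that g by (simp add: loc_grads_def)
qed

lemma AE_ball_all:
  assumes "\<And>n::nat. AE x in N. x \<in> ball x0 n \<longrightarrow> P x" shows "AE x in N. P x"
proof -
  have "AE x in N. \<forall>n::nat. x \<in> ball x0 n \<longrightarrow> P x" unfolding AE_all_countable using assms by blast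
  then show ?thesis
  proof eventually_elim
    case (elim x)
    moreover obtain n :: nat where "x \<in> ball x0 n" using UN_ball[of x0] by blast
    ultimately show ?case by blast
  qed
qed

text \<open>The class is closed under minima and decreasing limits, so one decreasing sequence can
  minimize the energy on all balls of an exhaustion at once. A competitor cannot be smaller on a set
  of positive measure, because its minimum with the limit would have less energy on some
  ball.\<close>

lemma minimal_loc_grad_exists:
  assumes ne: "loc_grads u \<noteq> {}"
  obtains h where "h \<in> loc_grads u" "\<And>k. k \<in> loc_grads u \<Longrightarrow> AE x in N. h x \<le> k x"
proof -
  define J where "J n g = (\<integral>\<^sup>+y\<in>ball (undefined::'a) (real n). g y epowr p \<partial>M)" for n :: nat and g
  define I where "I n = (INF g\<in>loc_grads u. J n g)" for n
  have fin: "J n g < \<infinity>" if "g \<in> loc_grads u" for n g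
    using that unfolding J_def loc_grads_iff[of _ _ undefined] by blast
  have Ifin: "I n \<noteq> \<infinity>" for n
    using ne fin INF_lower[of _ "loc_grads u" "J n"] unfolding I_def by (metis ex_in_conv infinity_ennreal_def leD)
  have "\<exists>g. g \<in> loc_grads u \<and> J n g < I n + ennreal (1 / Suc i)" for n i
    using INF_approx_ennreal[OF _ I_def Ifin, of "1 / Suc i" n] by auto
  then obtain G where G: "\<And>n i. G n i \<in> loc_grads u" "\<And>n i. J n (G n i) < I n + ennreal (1 / Suc i)"
    by metis
  \<comment> \<open>Enumerating the pairs (n, i) makes a single running minimum compete with every
    near-minimizer on every ball.\<close>
  define G' where "G' k = (case prod_decode k of (n, i) \<Rightarrow> G n i)" for k
  define H where "H = rec_nat (G' 0) (\<lambda>k h x. min (h x) (G' (Suc k) x))"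
  have H: "H 0 = G' 0" "\<And>k. H (Suc k) = (\<lambda>x. min (H k x) (G' (Suc k) x))" by (auto simp: H_def)
  have G': "G' k \<in> loc_grads u" for k using G by (auto simp: G'_def split: prod.splits)
  have Hl: "H k \<in> loc_grads u" for k
    by (induction k) (auto simp: H G' loc_grads_min)
  have HG: "H k x \<le> G' k x" for k x by (cases k) (auto simp: H)
  have dec: "decseq H" by (rule decseq_SucI) (auto simp: H le_fun_def)
  define h where "h x = (INF k. H k x)" for x
  have hH: "h x \<le> H k x" for x k unfolding h_def by (rule INF_lower) auto
  have h: "h \<in> loc_grads u"
  proof (rule loc_grads_le[OF Hl[of 0]])
    show "weak_grad M p h u" unfolding h_def
      using Hl by (intro weak_grad_INF curve_measure dec loc_grads_finite[OF Hl]) (auto simp: loc_grads_def)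
  qed (rule hH)
  have Jmono: "J n f \<le> J n g" if "\<And>x. f x \<le> g x" for n f g
    unfolding J_def using p0 that by (intro nn_integral_mono mult_right_mono epowr_mono) auto
  have Jh: "J n h \<le> I n" for n
  proof (rule ennreal_le_epsilon)
    fix e :: real assume "0 < e"
    then obtain i where i: "1 / Suc i < e" using nat_approx_posE by metis
    have "J n h \<le> J n (G n i)"
    proof (rule Jmono)
      fix x show "h x \<le> G n i x"
        using hH[of x "prod_encode (n, i)"] HG[of "prod_encode (n, i)" x] by (simp add: G'_def)
    qed
    also have "\<dots> \<le> I n + ennreal (1 / Suc i)" using G by (simp add: less_imp_le)
    also have "\<dots> \<le> I n + ennreal e" using i by (intro add_left_mono ennreal_leI) auto
    finally show "J n h \<le> I n + ennreal e" .
  qed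
  show ?thesis
  proof (rule that[OF h])
    fix k assume k: "k \<in> loc_grads u"
    let ?m = "\<lambda>x. min (h x) (k x)"
    have m: "?m \<in> loc_grads u" by (rule loc_grads_min[OF h k])
    have [measurable]: "h \<in> borel_measurable borel" "k \<in> borel_measurable borel"
      using h k by (auto simp: loc_grads_def weak_grad_borel)
    show "AE x in N. h x \<le> k x"
    proof (rule AE_ball_all)
      fix n :: nat
      let ?B = "ball (undefined::'a) (real n)"
      have "J n h \<le> J n ?m" using Jh[of n] m unfolding I_def by (auto intro: order_trans INF_lower)
      moreover have "J n ?m \<le> J n h" by (rule Jmono) simp
      ultimately have eq: "(\<integral>\<^sup>+y\<in>?B. h y epowr p \<partial>N) = (\<integral>\<^sup>+y\<in>?B. ?m y epowr p \<partial>N)"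
        by (simp add: J_def nn_integral_M)
      have fin': "(\<integral>\<^sup>+y\<in>?B. ?m y epowr p \<partial>N) \<noteq> \<infinity>"
        using fin[OF m, of n] by (simp add: J_def nn_integral_M less_top)
      have le: "?m y epowr p * indicator ?B y \<le> h y epowr p * indicator ?B y" for y
        using p0 by (intro mult_right_mono epowr_mono) auto
      have "(\<integral>\<^sup>+y. (h y epowr p * indicator ?B y - ?m y epowr p * indicator ?B y) \<partial>N) = 0"
        using fin' le eq by (subst nn_integral_diff) (auto simp: sets_N diff_eq_0_iff_ennreal less_top)
      then have ae: "AE y in N. h y epowr p * indicator ?B y - ?m y epowr p * indicator ?B y = 0"
        by (subst (asm) nn_integral_0_iff_AE) auto
      have ae2: "AE y in N. h y epowr p * indicator ?B y \<noteq> \<infinity>"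
        using fin[OF h, of n] by (intro nn_integral_PInf_AE) (auto simp: J_def nn_integral_M)
      show "AE x in N. x \<in> ?B \<longrightarrow> h x \<le> k x"
        using ae ae2
      proof eventually_elim
        case (elim y)
        show ?case
        proof
          assume y: "y \<in> ?B"
          then have "h y epowr p \<le> ?m y epowr p" using elim by (simp add: diff_eq_0_iff_ennreal)
          then have "h y \<le> ?m y" using p0 by (simp add: epowr_le_iff epowr_inverse_cancel)
          then show "h y \<le> k y" by simp
        qed
      qed
    qed
  qed
qed

lemma min_gradient_minimal:
  assumes "loc_grads u \<noteq> {}"
  shows "is_minimal_weak_upper_gradient M p (min_gradient M p u) u"
proof -
  obtain h where h: "h \<in> loc_grads u" "\<And>k. k \<in> loc_grads u \<Longrightarrow> AE x in N. h x \<le> k x"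
    using minimal_loc_grad_exists[OF assms] by metis
  have "is_minimal_weak_upper_gradient M p h u"
    unfolding is_minimal_weak_upper_gradient_def
  proof (intro conjI ballI impI)
    fix k assume k: "k \<in> Lp_loc M p" "weak_upper_gradient M p k u"
    then obtain k' where k': "k' \<in> loc_grads u" "AE x in N. k x = k' x"
      using weak_upper_gradient_loc_grads by metis
    have "AE x in N. h x \<le> k x" using h(2)[OF k'(1)] k'(2) by eventually_elim simp
    then show "AE x in M. h x \<le> k x" by (rule AE_M)
  qed (use h(1) weak_grad_weak_upper_gradient in \<open>auto simp: loc_grads_def\<close>)
  then show ?thesis unfolding min_gradient_def by (rule someI[of "\<lambda>g. is_minimal_weak_upper_gradient M p g u"])
qed

text \<open>The chosen gradient is measurable only for the completion; this replaces it by a Borel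
  majorant that is still minimal.\<close>

lemma min_gradient_obtain:
  assumes "loc_grads u \<noteq> {}"
  obtains g where "g \<in> loc_grads u" "AE x in N. min_gradient M p u x = g x"
    "\<And>h. h \<in> loc_grads u \<Longrightarrow> AE x in N. g x \<le> h x"
proof -
  note * = min_gradient_minimal[OF assms, unfolded is_minimal_weak_upper_gradient_def]
  obtain g where g: "g \<in> loc_grads u" "AE x in N. min_gradient M p u x = g x"
    using weak_upper_gradient_loc_grads * by metis
  show ?thesis
  proof (rule that[OF g])
    fix h assume "h \<in> loc_grads u"
    then have "AE x in M. min_gradient M p u x \<le> h x"
      using * weak_grad_weak_upper_gradient by (auto simp: loc_grads_def)
    from AE_N[OF this] g(2) show "AE x in N. g x \<le> h x" by eventually_elim simp
  qed
qed

section \<open>Energies and Newtonian functions\<close>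

definition energy :: "('a \<Rightarrow> ennreal) \<Rightarrow> ennreal" where "energy g = (\<integral>\<^sup>+x. g x epowr p \<partial>N)"

text \<open>The certificates: any such \<open>g\<close> bounds the energy of the chosen minimal
  gradient from above, so test functions can be built without computing a minimal gradient.\<close>

definition Lp_grad :: "('a \<Rightarrow> ennreal) \<Rightarrow> ('a \<Rightarrow> ereal) \<Rightarrow> bool" where
  "Lp_grad g u \<longleftrightarrow> weak_grad M p g u \<and> energy g < \<infinity>"

lemma Lp_grad_loc_grads: assumes "Lp_grad g u" shows "g \<in> loc_grads u"
  unfolding loc_grads_iff[of _ _ undefined]
proof (intro conjI allI)
  show "weak_grad M p g u" using assms by (simp add: Lp_grad_def)
  fix n :: nat
  have "(\<integral>\<^sup>+y\<in>ball undefined n. g y epowr p \<partial>M) \<le> (\<integral>\<^sup>+y. g y epowr p \<partial>M)"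
    by (intro nn_integral_mono) (auto simp: indicator_def)
  also have "\<dots> < \<infinity>" using assms by (simp add: nn_integral_M Lp_grad_def energy_def)
  finally show "(\<integral>\<^sup>+y\<in>ball undefined n. g y epowr p \<partial>M) < \<infinity>" .
qed

lemma p_energy_N: "p_energy M p u = (\<integral>\<^sup>+x. min_gradient M p u x epowr p \<partial>N)"
  by (simp add: p_energy_def nn_integral_M)

lemma min_gradient_le:
  assumes "Lp_grad h u" shows "AE x in N. min_gradient M p u x \<le> h x"
proof -
  have ne: "loc_grads u \<noteq> {}" using Lp_grad_loc_grads[OF assms] by auto
  obtain g where g: "AE x in N. min_gradient M p u x = g x"
    "\<And>h. h \<in> loc_grads u \<Longrightarrow> AE x in N. g x \<le> h x"
    using min_gradient_obtain[OF ne] by metis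
  from g(1) g(2)[OF Lp_grad_loc_grads[OF assms]] show ?thesis by eventually_elim simp
qed

lemma p_energy_le: assumes "Lp_grad h u" shows "p_energy M p u \<le> energy h"
  unfolding p_energy_N energy_def
proof (rule nn_integral_mono_AE)
  show "AE x in N. min_gradient M p u x epowr p \<le> h x epowr p"
    using min_gradient_le[OF assms] by eventually_elim (use p0 in \<open>auto intro: epowr_mono\<close>)
qed

lemma newtonian_norm_epowr:
  "newtonian_norm M p u epowr p = (\<integral>\<^sup>+x. eabs (u x) epowr p \<partial>N) + p_energy M p u"
  using p0 by (simp add: newtonian_norm_def epowr_inverse_cancel nn_integral_M)

lemma newtonianD:
  assumes "u \<in> newtonian M p"
  obtains g where "Lp_grad g u" "energy g = p_energy M p u" "u \<in> borel_measurable M"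
    "(\<integral>\<^sup>+x. eabs (u x) epowr p \<partial>N) < \<infinity>"
proof -
  obtain g0 where g0: "g0 \<in> Lp_loc M p" "upper_gradient g0 u" and u: "u \<in> borel_measurable M"
    and fin: "newtonian_norm M p u < \<infinity>" using assms unfolding newtonian_def by blast
  have ne: "loc_grads u \<noteq> {}" using g0(1) upper_gradient_weak_grad[OF g0(2), of M p] by (auto simp: loc_grads_def)
  obtain g where g: "g \<in> loc_grads u" "AE x in N. min_gradient M p u x = g x"
    using min_gradient_obtain[OF ne] by metis
  have eq: "energy g = p_energy M p u"
    unfolding p_energy_N energy_def
  proof (rule nn_integral_cong_AE)
    show "AE x in N. g x epowr p = min_gradient M p u x epowr p" using g(2) by eventually_elim simp
  qed
  have "newtonian_norm M p u epowr p < \<infinity>" using fin by simp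
  then have fin2: "(\<integral>\<^sup>+x. eabs (u x) epowr p \<partial>N) + p_energy M p u < \<infinity>"
    unfolding newtonian_norm_epowr .
  show ?thesis
  proof (rule that)
    show "Lp_grad g u" using g(1) eq fin2 by (auto simp: Lp_grad_def loc_grads_def)
  qed (use eq u fin2 in auto)
qed

text \<open>Adding the witness of the exceptional family makes the inequality trivial on bad curves
  and keeps the energy finite. This provides the genuine upper gradient demanded by
  \<open>newtonian\<close>.\<close>

lemma Lp_grad_upper_gradient:
  assumes "Lp_grad g u" shows "\<exists>g'\<in>Lp_loc M p. upper_gradient g' u"
proof -
  have "weak_grad M p g u" and gb [measurable]: "g \<in> borel_measurable borel"
    using assms by (auto simp: Lp_grad_def weak_grad_borel)
  then have "ae_curve M p (good_curve g u)" by (simp add: weak_grad_def)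
  then obtain \<rho> where \<rho> [measurable]: "\<rho> \<in> borel_measurable borel" and \<rho>fin: "(\<integral>\<^sup>+x. \<rho> x epowr p \<partial>M) < \<infinity>"
    and good: "\<And>\<gamma> l. arc_length_curve \<gamma> l \<Longrightarrow> path_int \<rho> \<gamma> 0 l < \<infinity> \<Longrightarrow> good_curve g u \<gamma> l"
    using ae_curve_obtain by metis
  let ?h = "\<lambda>x. g x + \<rho> x"
  have hb: "?h \<in> borel_measurable borel" by measurable
  have "upper_gradient ?h u"
    unfolding upper_gradient_on_def
  proof (intro conjI allI impI hb, elim conjE)
    fix \<gamma> :: "real \<Rightarrow> 'a" and l assume \<gamma>: "arc_length_curve \<gamma> l"
    have eq: "path_int ?h \<gamma> 0 l = path_int g \<gamma> 0 l + path_int \<rho> \<gamma> 0 l"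
      by (intro path_int_plus gb \<rho> arc_length_curve_continuous[OF \<gamma>])
    show "gradient_ineq ?h u \<gamma> l"
    proof (cases "path_int \<rho> \<gamma> 0 l < \<infinity>")
      case True
      then have "gradient_ineq g u \<gamma> l" using good \<gamma> good_curve_gradient_ineq by blast
      then show ?thesis by (auto simp: gradient_ineq_def curve_integral_eq eq intro: add_increasing2)
    next
      case False
      then show ?thesis by (simp add: gradient_ineq_def curve_integral_eq eq not_less top_unique)
    qed
  qed
  moreover have "?h \<in> Lp_loc M p"
    unfolding Lp_loc_iff[of _ undefined]
  proof (intro conjI allI measurable_M hb)
    fix n :: nat
    have "(\<integral>\<^sup>+y\<in>ball undefined n. ?h y epowr p \<partial>M) \<le> (\<integral>\<^sup>+y. ennreal (2 powr p) * (g y epowr p + \<rho> y epowr p) \<partial>M)"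
      using p0 by (intro nn_integral_mono) (auto simp: indicator_def epowr_add_le)
    also have "\<dots> = ennreal (2 powr p) * (energy g + (\<integral>\<^sup>+x. \<rho> x epowr p \<partial>N))"
      by (simp add: nn_integral_M nn_integral_cmult nn_integral_add energy_def)
    also have "\<dots> < \<infinity>" using assms \<rho>fin by (simp add: Lp_grad_def nn_integral_M ennreal_mult_less_top)
    finally show "(\<integral>\<^sup>+y\<in>ball undefined n. ?h y epowr p \<partial>M) < \<infinity>" .
  qed
  ultimately show ?thesis by blast
qed

lemma newtonianI:
  assumes u: "u \<in> borel_measurable M" "(\<integral>\<^sup>+x. eabs (u x) epowr p \<partial>N) < \<infinity>" and g: "Lp_grad g u"
  shows "u \<in> newtonian M p"
proof -
  have "newtonian_norm M p u epowr p < \<infinity>"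
    using u(2) p_energy_le[OF g] g unfolding newtonian_norm_epowr by (auto simp: Lp_grad_def intro: le_less_trans)
  then have "newtonian_norm M p u < \<infinity>" by simp
  then show ?thesis using u Lp_grad_upper_gradient[OF g] by (simp add: newtonian_def)
qed

lemma Lp_grad_contraction:
  "Lp_grad g u \<Longrightarrow> (\<And>x y. eabs (v x - v y) \<le> eabs (u x - u y)) \<Longrightarrow> Lp_grad g v"
  unfolding Lp_grad_def using weak_grad_contraction by blast

lemma Lp_grad_borel [measurable_dest]: "Lp_grad g u \<Longrightarrow> g \<in> borel_measurable borel"
  unfolding Lp_grad_def using weak_grad_borel by blast

lemma energy_mono: "(\<And>x. g x \<le> h x) \<Longrightarrow> energy g \<le> energy h"
  unfolding energy_def using p0 by (intro nn_integral_mono epowr_mono) auto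

lemma energy_add_le:
  assumes [measurable]: "g \<in> borel_measurable borel" "h \<in> borel_measurable borel"
  shows "energy (\<lambda>x. g x + h x) \<le> ennreal (2 powr p) * (energy g + energy h)"
proof -
  have "energy (\<lambda>x. g x + h x) \<le> (\<integral>\<^sup>+x. ennreal (2 powr p) * (g x epowr p + h x epowr p) \<partial>N)"
    unfolding energy_def using p0 by (intro nn_integral_mono epowr_add_le) auto
  then show ?thesis by (simp add: nn_integral_cmult nn_integral_add energy_def)
qed

lemma energy_cmult:
  assumes [measurable]: "g \<in> borel_measurable borel" and "0 \<le> c"
  shows "energy (\<lambda>x. ennreal c * g x) = ennreal (c powr p) * energy g"
  using assms by (simp add: energy_def epowr_mult epowr_ennreal nn_integral_cmult)

lemma Lp_grad_cmult:
  assumes "Lp_grad g u" "\<And>x y. eabs (v x - v y) \<le> ennreal c * eabs (u x - u y)" "0 \<le> c"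
  shows "Lp_grad (\<lambda>x. ennreal c * g x) v"
  using assms weak_grad_cmult[of M p g u v c] energy_cmult[of g c]
  by (auto simp: Lp_grad_def weak_grad_borel ennreal_mult_less_top)

lemma Lp_grad_add:
  assumes "Lp_grad g u" "Lp_grad h v" "\<And>x y. eabs (w x - w y) \<le> eabs (u x - u y) + eabs (v x - v y)"
  shows "Lp_grad (\<lambda>x. g x + h x) w"
proof -
  have [measurable]: "g \<in> borel_measurable borel" "h \<in> borel_measurable borel" using assms Lp_grad_borel by auto
  have "energy (\<lambda>x. g x + h x) < \<infinity>"
    using energy_add_le[of g h] assms by (auto simp: Lp_grad_def ennreal_mult_less_top intro: le_less_trans)
  then show ?thesis
    using assms weak_grad_add[OF curve_measure, of g u h v w] by (auto simp: Lp_grad_def)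
qed

lemma Lp_grad_indicator:
  assumes "Lp_grad g (\<lambda>x. ereal (u x))" "\<And>x. u x \<noteq> c \<Longrightarrow> x \<in> A" "A \<in> sets borel"
  shows "Lp_grad (\<lambda>x. g x * indicator A x) (\<lambda>x. ereal (u x))"
proof -
  have "energy (\<lambda>x. g x * indicator A x) \<le> energy g"
    by (intro energy_mono) (auto simp: indicator_def)
  moreover have "weak_grad M p (\<lambda>x. g x * indicator A x) (\<lambda>x. ereal (u x))"
    using assms by (intro weak_grad_indicator[where c=c] curve_measure)
      (auto simp: Lp_grad_def energy_def nn_integral_M)
  ultimately show ?thesis using assms(1) by (auto simp: Lp_grad_def)
qed

text \<open>Passing to \<open>clip\<close> makes a function real and bounded without enlarging its
  gradients; infinite values disappear here.\<close>

definition clip :: "ereal \<Rightarrow> real" where "clip a = real_of_ereal (max 0 (min 1 a))"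

lemma clip_range [simp]: "0 \<le> clip a" "clip a \<le> 1"
  unfolding clip_def by (cases a; auto simp: max_def min_def)+

lemma clip_real [simp]: "clip (ereal x) = max 0 (min 1 x)"
  by (auto simp: clip_def max_def min_def)

lemma clip_infinity [simp]: "clip \<infinity> = 1" "clip (-\<infinity>) = 0"
  by (auto simp: clip_def max_def min_def)

lemma clip_eq_1: "1 \<le> a \<Longrightarrow> clip a = 1" and clip_eq_0: "a \<le> 0 \<Longrightarrow> clip a = 0"
  by (cases a; auto)+

lemma clip_contraction: "eabs (ereal (clip a) - ereal (clip b)) \<le> eabs (a - b)"
  unfolding eabs_real_diff by (cases a; cases b) (auto simp: eabs_def intro!: ennreal_leI)

lemma abs_contraction: "eabs (\<bar>a\<bar> - \<bar>b\<bar>) \<le> eabs (a - b)" for a b :: ereal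
  by (cases a; cases b) (auto simp: eabs_def intro!: ennreal_leI)

lemma clip_le_eabs: "ennreal (clip a) \<le> eabs a" "ennreal (clip \<bar>a\<bar>) \<le> eabs a"
  by (cases a; auto simp: eabs_def intro!: ennreal_leI)+

lemma clip_measurable [measurable]: "f \<in> borel_measurable R \<Longrightarrow> (\<lambda>x. clip (f x)) \<in> borel_measurable R"
  unfolding clip_def
  by (intro borel_measurable_real_of_ereal borel_measurable_max borel_measurable_min borel_measurable_const)

lemma Lp_grad_clip: "Lp_grad g u \<Longrightarrow> Lp_grad g (\<lambda>x. ereal (clip (u x)))"
  by (erule Lp_grad_contraction) (rule clip_contraction)

lemma Lp_grad_clip_abs: "Lp_grad g u \<Longrightarrow> Lp_grad g (\<lambda>x. ereal (clip \<bar>u x\<bar>))"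
  by (erule Lp_grad_contraction) (rule order_trans[OF clip_contraction abs_contraction])

end

section \<open>Sets of capacity zero\<close>

lemma add_le_ennrealD: "a + b \<le> ennreal e \<Longrightarrow> a < \<infinity> \<and> b < \<infinity>"
  by (cases a; cases b) (auto simp: top_unique)

lemma eabs_SUP_diff_le:
  fixes f :: "'c \<Rightarrow> 'b \<Rightarrow> real"
  assumes f: "\<And>n x. 0 \<le> f n x" "\<And>n x. f n x \<le> B"
  shows "eabs (ereal (SUP n. f n x) - ereal (SUP n. f n y)) \<le> (SUP n. eabs (ereal (f n x) - ereal (f n y)))"
proof -
  define D where "D = (SUP n. ennreal \<bar>f n x - f n y\<bar>)"
  have bdd: "bdd_above (range (\<lambda>n. f n z))" for z using f by (intro bdd_aboveI[of _ B]) auto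
  have "\<bar>f n x - f n y\<bar> \<le> B" for n using f(1)[of n x] f(2)[of n x] f(1)[of n y] f(2)[of n y] by linarith
  then have "D \<le> ennreal B" unfolding D_def by (intro SUP_least ennreal_leI)
  then obtain d where d: "D = ennreal d" "0 \<le> d" by (cases D) (auto simp: top_unique)
  have le: "\<bar>f n x - f n y\<bar> \<le> d" for n
  proof -
    have "ennreal \<bar>f n x - f n y\<bar> \<le> D" unfolding D_def by (rule SUP_upper) simp
    then show ?thesis using d by simp
  qed
  have "f n x \<le> (SUP n. f n y) + d" for n
    using le[of n] cSUP_upper[OF UNIV_I bdd[of y], of n] by linarith
  then have 1: "(SUP n. f n x) \<le> (SUP n. f n y) + d" by (intro cSUP_least) auto
  have "f n y \<le> (SUP n. f n x) + d" for n
    using le[of n] cSUP_upper[OF UNIV_I bdd[of x], of n] by linarith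
  then have 2: "(SUP n. f n y) \<le> (SUP n. f n x) + d" by (intro cSUP_least) auto
  have "\<bar>(SUP n. f n x) - (SUP n. f n y)\<bar> \<le> d" using 1 2 by linarith
  then show ?thesis using d by (simp add: D_def[symmetric] ennreal_leI)
qed

context pi_space
begin

text \<open>A certificate that the Sobolev capacity is at most \<open>e\<close>: a test function
  truncated to [0, 1] with any gradient, so that neither the norm nor the minimal gradient has to be
  evaluated.\<close>

definition small_cap :: "'a set \<Rightarrow> ennreal \<Rightarrow> bool" where
  "small_cap Z e \<longleftrightarrow> (\<exists>v g. v \<in> borel_measurable M \<and> (\<forall>x. 0 \<le> v x \<and> v x \<le> 1) \<and> (\<forall>x\<in>Z. v x = 1) \<and>
     Lp_grad g (\<lambda>x. ereal (v x)) \<and> (\<integral>\<^sup>+x. ennreal (v x) epowr p \<partial>N) + energy g \<le> e)"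

definition zero_cap :: "'a set \<Rightarrow> bool" where
  "zero_cap Z \<longleftrightarrow> (\<forall>e>0::real. small_cap Z (ennreal e))"

lemma small_cap_obtain:
  assumes "small_cap Z e"
  obtains v g where "v \<in> borel_measurable M" "\<And>x. 0 \<le> v x" "\<And>x. v x \<le> 1" "\<And>x. x \<in> Z \<Longrightarrow> v x = 1"
    "Lp_grad g (\<lambda>x. ereal (v x))" "(\<integral>\<^sup>+x. ennreal (v x) epowr p \<partial>N) + energy g \<le> e"
  using assms unfolding small_cap_def by blast

lemma zero_cap_iff: "sobolev_capacity M p Z = 0 \<longleftrightarrow> zero_cap Z"
proof
  assume Z: "sobolev_capacity M p Z = 0"
  show "zero_cap Z" unfolding zero_cap_def
  proof (intro allI impI)
    fix e :: real assume "0 < e"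
    then have "sobolev_capacity M p Z < ennreal e" using Z by simp
    then obtain u where u: "u \<in> newtonian M p" "\<And>x. x \<in> Z \<Longrightarrow> u x = 1" "newtonian_norm M p u epowr p < ennreal e"
      unfolding sobolev_capacity_def INF_less_iff by auto
    obtain g where g: "Lp_grad g u" "energy g = p_energy M p u" "u \<in> borel_measurable M"
      using newtonianD[OF u(1)] by metis
    show "small_cap Z (ennreal e)" unfolding small_cap_def
    proof (intro exI[of _ "\<lambda>x. clip (u x)"] exI[of _ g] conjI)
      show "(\<lambda>x. clip (u x)) \<in> borel_measurable M" using g(3) by measurable
      show "Lp_grad g (\<lambda>x. ereal (clip (u x)))" by (rule Lp_grad_clip[OF g(1)])
      have "(\<integral>\<^sup>+x. ennreal (clip (u x)) epowr p \<partial>N) \<le> (\<integral>\<^sup>+x. eabs (u x) epowr p \<partial>N)"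
        using p0 by (intro nn_integral_mono epowr_mono clip_le_eabs) auto
      then have "(\<integral>\<^sup>+x. ennreal (clip (u x)) epowr p \<partial>N) + energy g \<le> newtonian_norm M p u epowr p"
        unfolding newtonian_norm_epowr g(2) by (rule add_right_mono)
      then show "(\<integral>\<^sup>+x. ennreal (clip (u x)) epowr p \<partial>N) + energy g \<le> ennreal e"
        using u(3) by (meson less_imp_le order_trans)
    qed (use u(2) in \<open>auto intro: clip_eq_1\<close>)
  qed
next
  assume Z: "zero_cap Z"
  have "sobolev_capacity M p Z \<le> 0 + ennreal e" if "0 < e" for e
  proof -
    obtain v g where v: "v \<in> borel_measurable M" "\<And>x. 0 \<le> v x" "\<And>x. v x \<le> 1" "\<And>x. x \<in> Z \<Longrightarrow> v x = 1"
      "Lp_grad g (\<lambda>x. ereal (v x))" "(\<integral>\<^sup>+x. ennreal (v x) epowr p \<partial>N) + energy g \<le> ennreal e"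
    proof -
      have "small_cap Z (ennreal e)" using Z \<open>0 < e\<close> unfolding zero_cap_def by blast
      then show thesis using that by (rule small_cap_obtain)
    qed
    have I: "(\<integral>\<^sup>+x. eabs (ereal (v x)) epowr p \<partial>N) = (\<integral>\<^sup>+x. ennreal (v x) epowr p \<partial>N)"
      using v(2) by simp
    have fin: "(\<integral>\<^sup>+x. ennreal (v x) epowr p \<partial>N) < \<infinity>"
      using add_le_ennrealD[OF v(6)] by blast
    have "(\<lambda>x. ereal (v x)) \<in> newtonian M p"
      by (rule newtonianI[OF _ _ v(5)]) (use v(1) I fin in auto)
    then have "sobolev_capacity M p Z \<le> newtonian_norm M p (\<lambda>x. ereal (v x)) epowr p"
      unfolding sobolev_capacity_def using v(4) by (intro INF_lower) auto
    also have "\<dots> \<le> (\<integral>\<^sup>+x. ennreal (v x) epowr p \<partial>N) + energy g"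
      unfolding newtonian_norm_epowr I by (intro add_left_mono p_energy_le v(5))
    also have "\<dots> \<le> ennreal e" by (rule v(6))
    finally show ?thesis by simp
  qed
  then have "sobolev_capacity M p Z \<le> 0" by (rule ennreal_le_epsilon)
  then show "sobolev_capacity M p Z = 0" by simp
qed

lemma small_cap_mono: "small_cap Z e \<Longrightarrow> Z' \<subseteq> Z \<Longrightarrow> e \<le> e' \<Longrightarrow> small_cap Z' e'"
  unfolding small_cap_def by (meson order_trans subsetD)

lemma zero_cap_subset: "zero_cap Z \<Longrightarrow> Z' \<subseteq> Z \<Longrightarrow> zero_cap Z'"
  unfolding zero_cap_def using small_cap_mono by blast

lemma Lp_grad_SUP:
  assumes v: "\<And>n. Lp_grad (g n) (\<lambda>x. ereal (v n x))" "\<And>n x. 0 \<le> v n x" "\<And>n x. v n x \<le> B"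
    and fin: "energy (\<lambda>x. SUP n::nat. g n x) < \<infinity>"
  shows "Lp_grad (\<lambda>x. SUP n. g n x) (\<lambda>x. ereal (SUP n. v n x))"
  unfolding Lp_grad_def
proof
  have [measurable]: "g n \<in> borel_measurable borel" for n using Lp_grad_borel v(1) by auto
  show "weak_grad M p (\<lambda>x. SUP n. g n x) (\<lambda>x. ereal (SUP n. v n x))"
  proof (rule weak_grad_SUP[OF curve_measure])
    show "weak_grad M p (\<lambda>x. SUP n. g n x) (\<lambda>x. ereal (v n x))" for n
    proof (rule weak_grad_mono)
      show "weak_grad M p (g n) (\<lambda>x. ereal (v n x))" using v(1) by (simp add: Lp_grad_def)
    qed (auto intro: SUP_upper)
  qed (rule eabs_SUP_diff_le[OF v(2,3)])
qed (rule fin)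

lemma energy_SUP_le:
  assumes [measurable]: "\<And>n. g n \<in> borel_measurable borel"
  shows "energy (\<lambda>x. SUP n::nat. g n x) \<le> (\<Sum>n. energy (g n))"
proof -
  have "energy (\<lambda>x. SUP n::nat. g n x) \<le> (\<integral>\<^sup>+x. (\<Sum>n. g n x epowr p) \<partial>N)"
    unfolding energy_def by (intro nn_integral_mono epowr_SUP_le_suminf p0)
  also have "\<dots> = (\<Sum>n. energy (g n))"
    unfolding energy_def by (intro nn_integral_suminf) simp
  finally show ?thesis .
qed

lemma nn_integral_suminf_M:
  assumes "\<And>n. f n \<in> borel_measurable M"
  shows "(\<integral>\<^sup>+x. (\<Sum>n. f n x) \<partial>N) = (\<Sum>n. \<integral>\<^sup>+x. f n x \<partial>N)"
  using nn_integral_suminf[of f M] assms by (simp add: nn_integral_M)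

text \<open>Countable subadditivity: the supremum of the test functions has the supremum of the
  gradients as a gradient, and p-th powers of suprema are dominated by sums.\<close>

lemma small_cap_UN:
  assumes "\<And>n::nat. small_cap (Z n) (e n)" and fin: "(\<Sum>n. e n) < \<infinity>"
  shows "small_cap (\<Union>n. Z n) (\<Sum>n. e n)"
proof -
  have "\<forall>n. \<exists>v g. v \<in> borel_measurable M \<and> (\<forall>x. 0 \<le> v x \<and> v x \<le> 1) \<and> (\<forall>x\<in>Z n. v x = 1) \<and>
     Lp_grad g (\<lambda>x. ereal (v x)) \<and> (\<integral>\<^sup>+x. ennreal (v x) epowr p \<partial>N) + energy g \<le> e n"
    using assms(1) unfolding small_cap_def by blast
  then obtain v g where v: "\<And>n. v n \<in> borel_measurable M" "\<And>n x. 0 \<le> v n x" "\<And>n x. v n x \<le> 1"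
    "\<And>n x. x \<in> Z n \<Longrightarrow> v n x = 1" "\<And>n. Lp_grad (g n) (\<lambda>x. ereal (v n x))"
    "\<And>n. (\<integral>\<^sup>+x. ennreal (v n x) epowr p \<partial>N) + energy (g n) \<le> e n"
    by metis
  note [measurable] = v(1)
  have gb [measurable]: "\<And>n. g n \<in> borel_measurable borel" using Lp_grad_borel v(5) by blast
  define w where "w x = (SUP n. v n x)" for x
  have bdd: "bdd_above (range (\<lambda>n. v n x))" for x using v(3) by (intro bdd_aboveI[of _ 1]) auto
  have vw: "v n x \<le> w x" for n x unfolding w_def by (rule cSUP_upper[OF UNIV_I bdd])
  have w1: "w x \<le> 1" for x unfolding w_def using v(3) by (intro cSUP_least) auto
  have w0: "0 \<le> w x" for x using vw[of 0 x] v(2)[of 0 x] by linarith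
  have "energy (\<lambda>x. SUP n. g n x) \<le> (\<Sum>n. energy (g n))" by (rule energy_SUP_le) measurable
  moreover have "(\<integral>\<^sup>+x. ennreal (w x) epowr p \<partial>N) \<le> (\<Sum>n. \<integral>\<^sup>+x. ennreal (v n x) epowr p \<partial>N)"
  proof -
    have "(\<integral>\<^sup>+x. ennreal (w x) epowr p \<partial>N) \<le> (\<integral>\<^sup>+x. (\<Sum>n. ennreal (v n x) epowr p) \<partial>N)"
    proof (intro nn_integral_mono)
      fix x
      have "ennreal (w x) \<le> (SUP n. ennreal (v n x))"
      proof -
        have "(SUP n. ennreal (v n x)) \<le> ennreal 1" using v(3) by (intro SUP_least ennreal_leI)
        then obtain s where s: "(SUP n. ennreal (v n x)) = ennreal s" "0 \<le> s"
          by (cases "SUP n. ennreal (v n x)") (auto simp: top_unique)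
        have "v n x \<le> s" for n
          using SUP_upper[of n UNIV "\<lambda>n. ennreal (v n x)"] s v(2) by simp
        then have "w x \<le> s" unfolding w_def by (intro cSUP_least) auto
        then show ?thesis using s by (simp add: ennreal_leI)
      qed
      then have "ennreal (w x) epowr p \<le> (SUP n. ennreal (v n x)) epowr p" using p0 by (intro epowr_mono) auto
      also have "\<dots> \<le> (\<Sum>n. ennreal (v n x) epowr p)" by (rule epowr_SUP_le_suminf[OF p0])
      finally show "ennreal (w x) epowr p \<le> (\<Sum>n. ennreal (v n x) epowr p)" .
    qed
    also have "\<dots> = (\<Sum>n. \<integral>\<^sup>+x. ennreal (v n x) epowr p \<partial>N)" by (intro nn_integral_suminf_M) measurable
    finally show ?thesis .
  qed
  moreover have "(\<Sum>n. \<integral>\<^sup>+x. ennreal (v n x) epowr p \<partial>N) + (\<Sum>n. energy (g n)) \<le> (\<Sum>n. e n)"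
    using v(6) by (subst suminf_add) (auto intro!: suminf_le)
  ultimately have le: "(\<integral>\<^sup>+x. ennreal (w x) epowr p \<partial>N) + energy (\<lambda>x. SUP n. g n x) \<le> (\<Sum>n. e n)"
    by (meson add_mono order_trans)
  then have "energy (\<lambda>x. SUP n. g n x) < \<infinity>" using fin 
    by (auto intro!: le_less_trans[OF _ fin[unfolded infinity_ennreal_def]] intro: order_trans[OF _ le])
  then have "Lp_grad (\<lambda>x. SUP n. g n x) (\<lambda>x. ereal (w x))"
    unfolding w_def by (intro Lp_grad_SUP[where B=1] v) auto
  moreover have "w \<in> borel_measurable M" unfolding w_def using bdd by measurable
  moreover have "w x = 1" if "x \<in> (\<Union>n. Z n)" for x
    using that v(4) vw w1 by (metis UN_E order_antisym)
  ultimately show ?thesis unfolding small_cap_def using w0 w1 le by blast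
qed

lemma zero_cap_UN: assumes "\<And>n::nat. zero_cap (Z n)" shows "zero_cap (\<Union>n. Z n)"
  unfolding zero_cap_def
proof (intro allI impI)
  fix e :: real assume e: "0 < e"
  have sum: "(\<Sum>n. ennreal (e / 2 * (1/2) ^ n)) = ennreal e"
    using e sums_mult[OF geometric_sums[of "1/2 :: real"], of "e / 2"]
    by (subst suminf_ennreal2) (auto simp: sums_iff)
  have "small_cap (\<Union>n. Z n) (\<Sum>n. ennreal (e / 2 * (1/2) ^ n))"
    using assms e sum by (intro small_cap_UN) (auto simp: zero_cap_def)
  then show "small_cap (\<Union>n. Z n) (ennreal e)" by (simp only: sum)
qed

lemma zero_cap_Un: "zero_cap Y \<Longrightarrow> zero_cap Z \<Longrightarrow> zero_cap (Y \<union> Z)"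
  using zero_cap_UN[of "\<lambda>n. if n = 0 then Y else Z"] by (rule zero_cap_subset) (auto split: if_splits)

text \<open>Chebyshev's inequality for Borel majorants of test functions with norms tending to
  0.\<close>

lemma zero_cap_null:
  assumes "zero_cap Z" obtains A where "Z \<subseteq> A" "A \<in> null_sets N"
proof -
  have "\<exists>A. Z \<subseteq> A \<and> A \<in> sets borel \<and> emeasure N A \<le> ennreal (1 / Suc n)" for n :: nat
  proof -
    have "small_cap Z (ennreal (1 / Suc n))" using assms unfolding zero_cap_def by simp
    then obtain v g where v: "v \<in> borel_measurable M" "\<And>x. 0 \<le> v x" "\<And>x. v x \<le> 1" "\<And>x. x \<in> Z \<Longrightarrow> v x = 1"
      "Lp_grad g (\<lambda>x. ereal (v x))" "(\<integral>\<^sup>+x. ennreal (v x) epowr p \<partial>N) + energy g \<le> ennreal (1 / Suc n)"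
      by (rule small_cap_obtain) blast
    have vM: "(\<lambda>x. ennreal (v x)) \<in> borel_measurable M" using v(1) by measurable
    obtain w where w: "w \<in> borel_measurable borel" "\<And>x. ennreal (v x) \<le> w x" "AE x in N. ennreal (v x) = w x"
      by (rule borel_majorant[OF vM]) (rule that)
    note [measurable] = w(1)
    have "emeasure N {x. 1 \<le> w x} = (\<integral>\<^sup>+x. indicator {x. 1 \<le> w x} x \<partial>N)" by (simp add: sets_N)
    also have "\<dots> \<le> (\<integral>\<^sup>+x. w x epowr p \<partial>N)"
      using epowr_mono[of 1 _ p] p0 by (intro nn_integral_mono) (auto simp: indicator_def)
    also have "\<dots> = (\<integral>\<^sup>+x. ennreal (v x) epowr p \<partial>N)"
    proof (rule nn_integral_cong_AE)
      show "AE x in N. w x epowr p = ennreal (v x) epowr p" using w(3) by eventually_elim simp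
    qed
    also have "\<dots> \<le> ennreal (1 / Suc n)" using v(6) by (meson order_trans add_increasing2 order_refl zero_le)
    finally have "emeasure N {x. 1 \<le> w x} \<le> ennreal (1 / Suc n)" .
    moreover have "Z \<subseteq> {x. 1 \<le> w x}" using v(4) w(2) by (metis (mono_tags, lifting) ennreal_1 mem_Collect_eq subsetI)
    moreover have "{x. 1 \<le> w x} \<in> sets borel" by measurable
    ultimately show ?thesis by blast
  qed
  then obtain A where A: "\<And>n. Z \<subseteq> A n" "\<And>n. A n \<in> sets borel" "\<And>n. emeasure N (A n) \<le> ennreal (1 / Suc n)"
    by metis
  have "emeasure N (\<Inter>n. A n) \<le> 0 + ennreal e" if "0 < e" for e
  proof -
    obtain n where "1 / Suc n < e" using nat_approx_posE[OF \<open>0 < e\<close>] by metis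
    then have "ennreal (1 / Suc n) \<le> ennreal e" by (intro ennreal_leI) auto
    moreover have "emeasure N (\<Inter>n. A n) \<le> emeasure N (A n)" by (intro emeasure_mono) (auto simp: sets_N A)
    ultimately show ?thesis using order_trans[OF _ order_trans[OF A(3)[of n]]] by simp
  qed
  then have "emeasure N (\<Inter>n. A n) \<le> 0" by (rule ennreal_le_epsilon)
  then have "emeasure N (\<Inter>n. A n) = 0" by simp
  moreover have "(\<Inter>n. A n) \<in> sets N"
    unfolding sets_N by (rule sets.countable_INT) (use A(2) in auto)
  ultimately have "(\<Inter>n. A n) \<in> null_sets N" by (rule null_setsI)
  moreover have "Z \<subseteq> (\<Inter>n. A n)" using A(1) by blast
  ultimately show ?thesis using that by blast
qed

text \<open>Test functions for Z with rapidly decreasing norms are summed, together with their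
  gradients, to a function \<open>r\<close> in L^p. A curve meeting Z collects at least a fixed
  amount from every summand: either the gradient integral is at least 1/2, or the test function
  stays above 1/2 along the whole curve. Its integral of \<open>r\<close> is therefore
  infinite.\<close>

lemma zero_cap_avoid:
  assumes "zero_cap Z"
  shows "ae_curve M p (\<lambda>\<gamma> l. \<forall>t\<in>{0..l}. \<gamma> t \<notin> Z)"
proof -
  define Q where "Q n w g v \<longleftrightarrow> w \<in> borel_measurable borel \<and> (\<forall>x. ennreal (v x) \<le> w x) \<and> (\<forall>x\<in>Z. v x = 1) \<and> (\<forall>x. 0 \<le> v x) \<and>
    Lp_grad g (\<lambda>x. ereal (v x)) \<and> (\<integral>\<^sup>+x. w x epowr p \<partial>N) + energy g \<le> ennreal ((1/4) ^ n)"
    for n :: nat and w g v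
  have "\<forall>n. \<exists>w g v. Q n w g v"
  proof
    fix n :: nat
    have "small_cap Z (ennreal ((1/4) ^ n))" using assms unfolding zero_cap_def by simp
    then obtain v g where v: "v \<in> borel_measurable M" "\<And>x. 0 \<le> v x" "\<And>x. v x \<le> 1" "\<And>x. x \<in> Z \<Longrightarrow> v x = 1"
      "Lp_grad g (\<lambda>x. ereal (v x))" "(\<integral>\<^sup>+x. ennreal (v x) epowr p \<partial>N) + energy g \<le> ennreal ((1/4) ^ n)"
      by (rule small_cap_obtain) blast
    have vM: "(\<lambda>x. ennreal (v x)) \<in> borel_measurable M" using v(1) by measurable
    obtain w where w: "w \<in> borel_measurable borel" "\<And>x. ennreal (v x) \<le> w x" "AE x in N. ennreal (v x) = w x"
      by (rule borel_majorant[OF vM]) (rule that)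
    have "(\<integral>\<^sup>+x. w x epowr p \<partial>N) = (\<integral>\<^sup>+x. ennreal (v x) epowr p \<partial>N)"
    proof (rule nn_integral_cong_AE)
      show "AE x in N. w x epowr p = ennreal (v x) epowr p" using w(3) by eventually_elim simp
    qed
    then have "Q n w g v" unfolding Q_def using v w by auto
    then show "\<exists>w g v. Q n w g v" by blast
  qed
  then obtain w g v where Q: "\<And>n. Q n (w n) (g n) (v n)" by metis
  have w [measurable]: "\<And>n. w n \<in> borel_measurable borel" and vw: "\<And>n x. ennreal (v n x) \<le> w n x"
    and v1: "\<And>n x. x \<in> Z \<Longrightarrow> v n x = 1" and v0: "\<And>n x. 0 \<le> v n x" and g: "\<And>n. Lp_grad (g n) (\<lambda>x. ereal (v n x))"
    and le: "\<And>n. (\<integral>\<^sup>+x. w n x epowr p \<partial>N) + energy (g n) \<le> ennreal ((1/4) ^ n)"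
    using Q unfolding Q_def by blast+
  have gb [measurable]: "\<And>n. g n \<in> borel_measurable borel" using Lp_grad_borel g by blast
  define r where "r x = (\<Sum>n. w n x + g n x)" for x
  have rb: "r \<in> borel_measurable borel" unfolding r_def[abs_def] by measurable
  obtain C where C: "0 < C" "\<And>b :: nat \<Rightarrow> ennreal.
    (\<Sum>n. b n) epowr p \<le> ennreal C * (\<Sum>n. ennreal (2 powr (1 * real n)) * b n epowr p)"
    by (rule epowr_suminf_le[OF p0 zero_less_one]) (rule that)
  \<comment> \<open>The bounds 4^(-n) outweigh the weights 2^n with which p-th powers of sums are
    estimated.\<close>
  have wg: "(\<integral>\<^sup>+x. (w n x + g n x) epowr p \<partial>N) \<le> ennreal (2 powr p * (1/4) ^ n)" for n
  proof -
    have "(\<integral>\<^sup>+x. (w n x + g n x) epowr p \<partial>N) \<le> ennreal (2 powr p) * ((\<integral>\<^sup>+x. w n x epowr p \<partial>N) + energy (g n))"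
      using energy_add_le[OF w gb, of n n] by (simp add: energy_def)
    also have "\<dots> \<le> ennreal (2 powr p) * ennreal ((1/4) ^ n)" by (intro mult_left_mono le) auto
    finally show ?thesis by (simp flip: ennreal_mult)
  qed
  have r_fin: "(\<integral>\<^sup>+x. r x epowr p \<partial>M) < \<infinity>"
  proof -
    have "(\<integral>\<^sup>+x. r x epowr p \<partial>M) \<le> (\<integral>\<^sup>+x. ennreal C * (\<Sum>n. ennreal (2 powr (1 * real n)) * (w n x + g n x) epowr p) \<partial>N)"
      unfolding nn_integral_M r_def by (intro nn_integral_mono C)
    also have "\<dots> = ennreal C * (\<Sum>n. ennreal (2 powr n) * (\<integral>\<^sup>+x. (w n x + g n x) epowr p \<partial>N))"
      by (simp add: nn_integral_cmult nn_integral_suminf)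
    also have "\<dots> \<le> ennreal C * (\<Sum>n. ennreal (2 powr p * (1/2) ^ n))"
    proof (intro mult_left_mono suminf_le)
      fix n
      have "ennreal (2 powr n) * (\<integral>\<^sup>+x. (w n x + g n x) epowr p \<partial>N) \<le> ennreal (2 powr n) * ennreal (2 powr p * (1/4) ^ n)"
        by (intro mult_left_mono wg) auto
      also have "\<dots> = ennreal (2 powr p * (1/2) ^ n)"
        by (simp add: powr_realpow power_divide mult_ac field_simps flip: ennreal_mult power_mult_distrib)
      finally show "ennreal (2 powr n) * (\<integral>\<^sup>+x. (w n x + g n x) epowr p \<partial>N) \<le> ennreal (2 powr p * (1/2) ^ n)" .
    qed auto
    also have "\<dots> < \<infinity>"
      by (subst suminf_ennreal2) (auto simp: summable_mult ennreal_mult_less_top)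
    finally show ?thesis .
  qed
  have "ae_curve M p (\<lambda>\<gamma> l. path_int r \<gamma> 0 l < \<infinity> \<and> (\<forall>n. good_curve (g n) (\<lambda>x. ereal (v n x)) \<gamma> l))"
    using g by (intro ae_curve_conj ae_curve_all curve_measure ae_curve_finite r_fin rb) (auto simp: Lp_grad_def weak_grad_def)
  then show ?thesis
  proof (rule ae_curve_mono, elim conjE, intro ballI notI)
    fix \<gamma> l t assume \<gamma>: "arc_length_curve \<gamma> l" and fin: "path_int r \<gamma> 0 l < \<infinity>"
      and good: "\<forall>n. good_curve (g n) (\<lambda>x. ereal (v n x)) \<gamma> l" and t: "t \<in> {0..l}" "\<gamma> t \<in> Z"
    have l: "0 < l" using \<gamma> by (simp add: arc_length_curve_def)
    note [measurable] = arc_length_curve_continuous[OF \<gamma>]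
    define c where "c = min (1/2) (l/2)"
    have c: "0 < c" using l by (simp add: c_def)
    have ge: "ennreal c \<le> path_int (\<lambda>x. w n x + g n x) \<gamma> 0 l" for n
    proof (cases "path_int (g n) \<gamma> 0 l < ennreal (1/2)")
      case True
      have half: "ennreal (1/2) \<le> w n (\<gamma> s)" if s: "s \<in> {0..l}" for s
      proof -
        have "ennreal \<bar>v n (\<gamma> s) - 1\<bar> \<le> path_int (g n) \<gamma> 0 l"
        proof (cases s t rule: linorder_cases)
          case less
          then have "ennreal \<bar>v n (\<gamma> s) - v n (\<gamma> t)\<bar> \<le> path_int (g n) \<gamma> s t"
            using good s t by (auto simp: good_curve_def)
          also have "\<dots> \<le> path_int (g n) \<gamma> 0 l" using s t by (intro path_int_subset) auto
          finally show ?thesis using v1[OF t(2)] by simp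
        next
          case greater
          then have "ennreal \<bar>v n (\<gamma> t) - v n (\<gamma> s)\<bar> \<le> path_int (g n) \<gamma> t s"
            using good s t by (auto simp: good_curve_def)
          also have "\<dots> \<le> path_int (g n) \<gamma> 0 l" using s t by (intro path_int_subset) auto
          finally show ?thesis using v1[OF t(2)] by (simp add: abs_minus_commute)
        qed (use v1[OF t(2)] in simp)
        then have "ennreal \<bar>v n (\<gamma> s) - 1\<bar> < ennreal (1/2)" using True by simp
        then have "\<bar>v n (\<gamma> s) - 1\<bar> < 1/2" by (subst (asm) ennreal_less_iff) auto
        then have "1/2 \<le> v n (\<gamma> s)" by linarith
        then show ?thesis using vw[of n "\<gamma> s"] by (meson ennreal_leI order_trans)
      qed
      have "ennreal c \<le> ennreal (1/2 * l)" by (intro ennreal_leI) (simp add: c_def)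
      also have "\<dots> = ennreal (1/2) * ennreal l" using l by (intro ennreal_mult) auto
      also have "\<dots> = (\<integral>\<^sup>+s. ennreal (1/2) * indicator {0..l} s \<partial>lborel)" using l by (subst nn_integral_cmult) auto
      also have "\<dots> \<le> path_int (\<lambda>x. w n x + g n x) \<gamma> 0 l"
        unfolding path_int_def using half by (intro nn_integral_mono) (auto simp: indicator_def add_increasing2)
      finally show ?thesis .
    next
      case False
      have "ennreal c \<le> ennreal (1/2)" by (intro ennreal_leI) (simp add: c_def)
      also have "\<dots> \<le> path_int (g n) \<gamma> 0 l" using False by simp
      also have "\<dots> \<le> path_int (\<lambda>x. w n x + g n x) \<gamma> 0 l" by (intro path_int_mono) (auto intro: add_increasing)
      finally show ?thesis .
    qed
    have "path_int r \<gamma> 0 l = (\<integral>\<^sup>+s. (\<Sum>n. (w n (\<gamma> s) + g n (\<gamma> s)) * indicator {0..l} s) \<partial>lborel)"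
      unfolding path_int_def r_def by simp
    also have "\<dots> = (\<Sum>n. path_int (\<lambda>x. w n x + g n x) \<gamma> 0 l)"
    proof -
      have "(\<lambda>s. (w n (\<gamma> s) + g n (\<gamma> s)) * indicator {0..l} s) \<in> borel_measurable borel" for n
        by (rule path_measurable[where g="\<lambda>x. w n x + g n x", OF _ arc_length_curve_continuous[OF \<gamma>]]) measurable
      then show ?thesis unfolding path_int_def by (intro nn_integral_suminf) simp
    qed
    also have "(\<Sum>n. ennreal c) \<le> \<dots>" by (intro suminf_le ge) auto
    finally have "(\<Sum>n::nat. ennreal c) < \<infinity>" using fin by (auto intro: le_less_trans)
    then obtain S where S: "(\<Sum>n::nat. ennreal c) = ennreal S" "0 \<le> S"
      by (cases "\<Sum>n::nat. ennreal c") auto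
    obtain k :: nat where k: "S / c < k" using reals_Archimedean2 by blast
    have "ennreal (k * c) = (\<Sum>n<k. ennreal c)" using c by (simp add: ennreal_mult ennreal_of_nat_eq_real_of_nat)
    also have "\<dots> \<le> ennreal S" unfolding S(1)[symmetric] by (rule sum_le_suminf) auto
    finally show False using S(2) c k by (simp add: field_simps)
  qed
qed

text \<open>Almost every curve misses the set where the two functions differ.\<close>

lemma Lp_grad_modify:
  assumes u: "Lp_grad g u" and Z: "zero_cap Z" and v: "\<And>x. x \<notin> Z \<Longrightarrow> v x = u x"
  shows "Lp_grad g v"
proof -
  have "ae_curve M p (\<lambda>\<gamma> l. good_curve g u \<gamma> l \<and> (\<forall>t\<in>{0..l}. \<gamma> t \<notin> Z))"
    using u by (intro ae_curve_conj curve_measure zero_cap_avoid Z) (auto simp: Lp_grad_def weak_grad_def)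
  then have "ae_curve M p (good_curve g v)"
    by (rule ae_curve_mono) (auto simp: good_curve_def v)
  then show ?thesis using u by (simp add: Lp_grad_def weak_grad_def)
qed

lemma measurable_modify:
  assumes u: "u \<in> borel_measurable M" and Z: "zero_cap Z" and v: "\<And>x. x \<notin> Z \<Longrightarrow> v x = (u x :: ereal)"
  shows "v \<in> borel_measurable M"
proof -
  obtain A where A: "Z \<subseteq> A" "A \<in> null_sets N" using zero_cap_null[OF Z] .
  have sub: "B \<in> sets M" if "B \<subseteq> A" for B
    using null_sets_completion_subset[OF that null_sets_completionI[OF A(2)]] unfolding M_eq by auto
  show ?thesis
  proof (rule measurableI)
    fix S :: "ereal set" assume S: "S \<in> sets borel"
    have vu: "v x = u x" if "x \<notin> A" for x using that A(1) v by blast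
    have "v -` S \<inter> space M = (u -` S \<inter> space M - A) \<union> (v -` S \<inter> A)"
      by (auto simp: space_M vu)
    moreover have "u -` S \<inter> space M - A \<in> sets M" using measurable_sets[OF u S] sub[of A] by auto
    moreover have "v -` S \<inter> A \<in> sets M" by (rule sub) auto
    ultimately show "v -` S \<inter> space M \<in> sets M" by auto
  qed simp
qed

end

section \<open>Averages over balls\<close>

lemma ennreal_divide_le_imp: "0 < m \<Longrightarrow> a / ennreal m \<le> b \<Longrightarrow> a \<le> b * ennreal m"
proof -
  assume m: "0 < m" and ab: "a / ennreal m \<le> b"
  have "a = a / ennreal m * ennreal m"
    using m by (cases a) (auto simp: divide_ennreal ennreal_top_divide ennreal_top_mult simp flip: ennreal_mult)
  also have "\<dots> \<le> b * ennreal m" using ab by (intro mult_right_mono) auto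
  finally show ?thesis .
qed

context pi_space
begin

section \<open>Separability and Fubini over balls\<close>

lemma countable_dense:
  obtains D :: "'a set" where "countable D" "\<And>x e. 0 < e \<Longrightarrow> \<exists>z\<in>D. dist x z < e"
proof -
  have "\<forall>n::nat. \<exists>T. finite T \<and> ball undefined n \<subseteq> (\<Union>t\<in>T. ball t (1 / Suc n) :: 'a set)"
    using finite_net by simp
  then obtain T where T: "\<And>n. finite (T n)" "\<And>n::nat. ball undefined n \<subseteq> (\<Union>t\<in>T n. ball t (1 / Suc n) :: 'a set)"
    by metis
  show ?thesis
  proof (rule that[of "\<Union>n. T n"])
    show "countable (\<Union>n. T n)" using T(1) by (auto intro: countable_finite)
    fix x :: 'a and e :: real assume "0 < e"
    then obtain n where n: "1 / Suc n < e" by (metis nat_approx_posE)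
    obtain m :: nat where m: "dist undefined x < m" using reals_Archimedean2 by blast
    have "x \<in> ball undefined (max n m)" using m by simp
    then obtain z where z: "z \<in> T (max n m)" "x \<in> ball z (1 / Suc (max n m))" using T(2) by blast
    have "1 / Suc (max n m) \<le> 1 / Suc n" by (simp add: field_simps)
    then have "dist x z < e" using z n by (simp add: dist_commute)
    then show "\<exists>z\<in>\<Union>n. T n. dist x z < e" using z by blast
  qed
qed

text \<open>Separability and rational radii exhibit the set as a countable union of measurable
  rectangles; the exchange of integrals over balls rests on this.\<close>

lemma dist_less_sets: "{(x, y). dist x y < r} \<in> sets (N \<Otimes>\<^sub>M N)"
proof -
  obtain D :: "'a set" where D: "countable D" "\<And>x e. 0 < e \<Longrightarrow> \<exists>z\<in>D. dist x z < e"
    using countable_dense by blast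
  have "{(x, y). dist x y < r} = (\<Union>z\<in>D. \<Union>q\<in>\<rat>. ball z q \<times> ball z (r - q))"
  proof (intro set_eqI iffI; clarify)
    fix x y :: 'a assume xy: "dist x y < r"
    define d where "d = (r - dist x y) / 2"
    have d: "0 < d" using xy by (simp add: d_def)
    then obtain z where z: "z \<in> D" "dist x z < d" using D(2) by blast
    obtain q where q: "q \<in> \<rat>" "dist x z < q" "q < d" using Rats_dense_in_real[OF z(2)] by blast
    have "dist z y \<le> dist x z + dist x y" by (metis dist_commute dist_triangle)
    then have "dist z y < r - q" using z q by (simp add: d_def)
    then have "(x, y) \<in> ball z q \<times> ball z (r - q)" using q by (simp add: dist_commute)
    then show "(x, y) \<in> (\<Union>z\<in>D. \<Union>q\<in>\<rat>. ball z q \<times> ball z (r - q))"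
      using z(1) q(1) by blast
  next
    fix x y z :: 'a and q :: real assume "x \<in> ball z q" "y \<in> ball z (r - q)"
    then show "dist x y < r" using dist_triangle[of x y z] by (simp add: dist_commute)
  qed
  also have "\<dots> \<in> sets (N \<Otimes>\<^sub>M N)"
    by (intro sets.countable_UN'' D countable_rat) auto
  finally show ?thesis .
qed

lemma measurable_dist_less [measurable]:
  "(\<lambda>(x, y). indicator {(x, y). dist x y < r} (x, y) :: ennreal) \<in> borel_measurable (N \<Otimes>\<^sub>M N)"
  using dist_less_sets by (simp add: case_prod_beta')

lemma ball_indicator: "indicator {(x, y). dist x y < r} (x, y) = indicator (ball x r) y"
  "indicator {(x, y). dist x y < r} (x, y) = indicator (ball y r) x"
  by (auto simp: indicator_def dist_commute)

lemma fubini_ball: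
  assumes [measurable]: "a \<in> borel_measurable borel" "f \<in> borel_measurable borel"
  shows "(\<integral>\<^sup>+x. a x * (\<integral>\<^sup>+y\<in>ball x r. f y \<partial>N) \<partial>N) = (\<integral>\<^sup>+y. f y * (\<integral>\<^sup>+x\<in>ball y r. a x \<partial>N) \<partial>N)"
proof -
  interpret sigma_finite_measure N by (rule sigma_finite_N)
  interpret pair_sigma_finite N N ..
  have [measurable]: "a \<in> borel_measurable N" "f \<in> borel_measurable N" by simp_all
  let ?F = "\<lambda>(x, y). a x * (f y * indicator {(x, y). dist x y < r} (x, y))"
  have F [measurable]: "?F \<in> borel_measurable (N \<Otimes>\<^sub>M N)"
    using dist_less_sets by measurable
  have "(\<integral>\<^sup>+x. a x * (\<integral>\<^sup>+y\<in>ball x r. f y \<partial>N) \<partial>N) = (\<integral>\<^sup>+x. (\<integral>\<^sup>+y. ?F (x, y) \<partial>N) \<partial>N)"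
  proof (rule nn_integral_cong)
    fix x
    have "(\<integral>\<^sup>+y. ?F (x, y) \<partial>N) = (\<integral>\<^sup>+y. a x * (f y * indicator (ball x r) y) \<partial>N)"
      by (intro nn_integral_cong) (simp add: ball_indicator(1)[of r x])
    then show "a x * (\<integral>\<^sup>+y\<in>ball x r. f y \<partial>N) = (\<integral>\<^sup>+y. ?F (x, y) \<partial>N)"
      by (simp add: nn_integral_cmult)
  qed
  also have "\<dots> = (\<integral>\<^sup>+y. (\<integral>\<^sup>+x. ?F (x, y) \<partial>N) \<partial>N)"
    by (rule Fubini'[symmetric]) (use F in simp)
  also have "\<dots> = (\<integral>\<^sup>+y. f y * (\<integral>\<^sup>+x\<in>ball y r. a x \<partial>N) \<partial>N)"
  proof (rule nn_integral_cong)
    fix y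
    have "(\<integral>\<^sup>+x. ?F (x, y) \<partial>N) = (\<integral>\<^sup>+x. f y * (a x * indicator (ball y r) x) \<partial>N)"
      by (intro nn_integral_cong) (simp add: ball_indicator(2)[of r _ y] mult_ac)
    then show "(\<integral>\<^sup>+x. ?F (x, y) \<partial>N) = f y * (\<integral>\<^sup>+x\<in>ball y r. a x \<partial>N)"
      by (simp add: nn_integral_cmult)
  qed
  finally show ?thesis .
qed

lemma measurable_ball_integral [measurable]:
  assumes [measurable]: "f \<in> borel_measurable borel"
  shows "(\<lambda>x. \<integral>\<^sup>+y\<in>ball x r. f y \<partial>N) \<in> borel_measurable borel"
proof -
  interpret sigma_finite_measure N by (rule sigma_finite_N)
  have [measurable]: "f \<in> borel_measurable N" by simp
  have "(\<lambda>x. \<integral>\<^sup>+y. f y * indicator {(x, y). dist x y < r} (x, y) \<partial>N) \<in> borel_measurable N"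
    using dist_less_sets by measurable
  also have "(\<lambda>x. \<integral>\<^sup>+y. f y * indicator {(x, y). dist x y < r} (x, y) \<partial>N) = (\<lambda>x. \<integral>\<^sup>+y\<in>ball x r. f y \<partial>N)"
    by (intro ext nn_integral_cong) (simp add: ball_indicator(1))
  finally show ?thesis by simp
qed

lemma measurable_mb [measurable]: "(\<lambda>x. mb x r) \<in> borel_measurable borel"
proof -
  have "(\<lambda>x. enn2real (\<integral>\<^sup>+y\<in>ball x r. 1 \<partial>N)) \<in> borel_measurable borel" by measurable
  then show ?thesis by (simp add: emeasure_ball)
qed

text \<open>After exchanging the integrals, the centers x whose ball contains a given y fill the
  ball of radius \<rho> about y, and doubling compares its measure with \<open>mb x r\<close>. The
  factor 2 in \<open>2 * \<rho>\<close> covers the distance of the centers plus the radius.\<close>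

lemma ball_maximal_le:
  assumes [measurable]: "b \<in> borel_measurable borel" "f \<in> borel_measurable borel" "B \<in> borel_measurable borel"
    and r: "0 < r" "2 * \<rho> \<le> 2 ^ n * r" and B: "\<And>x y. dist y x < \<rho> \<Longrightarrow> b x \<le> B y"
  shows "(\<integral>\<^sup>+x. b x * ((\<integral>\<^sup>+y\<in>ball x \<rho>. f y \<partial>N) / ennreal (mb x r)) \<partial>N) \<le> ennreal (CD ^ n) * (\<integral>\<^sup>+y. f y * B y \<partial>N)"
proof -
  have "(\<integral>\<^sup>+x. b x * ((\<integral>\<^sup>+y\<in>ball x \<rho>. f y \<partial>N) / ennreal (mb x r)) \<partial>N)
     = (\<integral>\<^sup>+x. (b x / ennreal (mb x r)) * (\<integral>\<^sup>+y\<in>ball x \<rho>. f y \<partial>N) \<partial>N)"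
    by (intro nn_integral_cong) (simp add: divide_ennreal_def mult_ac)
  also have "\<dots> = (\<integral>\<^sup>+y. f y * (\<integral>\<^sup>+x\<in>ball y \<rho>. b x / ennreal (mb x r) \<partial>N) \<partial>N)"
    by (intro fubini_ball) measurable
  also have "\<dots> \<le> (\<integral>\<^sup>+y. f y * (ennreal (CD ^ n) * B y) \<partial>N)"
  proof (intro nn_integral_mono mult_left_mono)
    fix y
    have "(\<integral>\<^sup>+x\<in>ball y \<rho>. b x / ennreal (mb x r) \<partial>N) \<le> (\<integral>\<^sup>+x. (B y * ennreal (CD ^ n / mb y \<rho>)) * indicator (ball y \<rho>) x \<partial>N)"
    proof (intro nn_integral_mono)
      fix x
      show "b x / ennreal (mb x r) * indicator (ball y \<rho>) x \<le> (B y * ennreal (CD ^ n / mb y \<rho>)) * indicator (ball y \<rho>) x"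
      proof (cases "x \<in> ball y \<rho>")
        case True
        then have \<rho>: "0 < \<rho>" by (auto intro: le_less_trans[OF zero_le_dist])
        have "mb y \<rho> \<le> CD ^ n * mb x r"
          using True r by (intro mb_comp) auto
        then have "1 / mb x r \<le> CD ^ n / mb y \<rho>"
          using mb_pos[OF r(1), of x] mb_pos[OF \<rho>, of y] by (simp add: field_simps)
        then have "b x * ennreal (1 / mb x r) \<le> B y * ennreal (CD ^ n / mb y \<rho>)"
          using B True by (intro mult_mono ennreal_leI) auto
        moreover have "b x / ennreal (mb x r) = b x * ennreal (1 / mb x r)"
          using mb_pos[OF r(1), of x] by (simp add: divide_ennreal_def inverse_ennreal inverse_eq_divide)
        ultimately show ?thesis using True by (simp only: indicator_simps mult_1_right)
      qed simp
    qed
    also have "\<dots> = B y * ennreal (CD ^ n / mb y \<rho>) * ennreal (mb y \<rho>)"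
      by (subst nn_integral_cmult) (auto simp: emeasure_ball)
    also have "\<dots> \<le> ennreal (CD ^ n) * B y"
    proof (cases "mb y \<rho> = 0")
      case False
      then have "ennreal (CD ^ n / mb y \<rho>) * ennreal (mb y \<rho>) = ennreal (CD ^ n)"
        using CD by (simp flip: ennreal_mult)
      then show ?thesis by (simp add: mult.assoc) (simp add: mult.commute)
    qed simp
    finally show "(\<integral>\<^sup>+x\<in>ball y \<rho>. b x / ennreal (mb x r) \<partial>N) \<le> ennreal (CD ^ n) * B y" .
  qed auto
  also have "\<dots> = ennreal (CD ^ n) * (\<integral>\<^sup>+y. f y * B y \<partial>N)"
    by (subst nn_integral_cmult[symmetric]) (auto simp: mult_ac)
  finally show ?thesis .
qed

section \<open>Averages and the Poincare inequality\<close>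

definition nu :: "('a \<Rightarrow> ennreal) \<Rightarrow> 'a \<Rightarrow> real \<Rightarrow> real" where
  "nu g x r = enn2real (\<integral>\<^sup>+y\<in>ball x r. g y epowr p \<partial>N)"

lemma nu_nonneg [simp]: "0 \<le> nu g x r" by (simp add: nu_def)

lemma nu_eq: assumes "energy g < \<infinity>" shows "(\<integral>\<^sup>+y\<in>ball x r. g y epowr p \<partial>N) = ennreal (nu g x r)"
proof -
  have "(\<integral>\<^sup>+y\<in>ball x r. g y epowr p \<partial>N) \<le> energy g"
    unfolding energy_def by (intro nn_integral_mono) (auto simp: indicator_def)
  then show ?thesis using assms by (simp add: nu_def)
qed

lemma nu_mono: assumes "energy g < \<infinity>" "ball x r \<subseteq> ball y s" shows "nu g x r \<le> nu g y s"
proof -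
  have "(\<integral>\<^sup>+z\<in>ball x r. g z epowr p \<partial>N) \<le> (\<integral>\<^sup>+z\<in>ball y s. g z epowr p \<partial>N)"
    using assms(2) by (intro nn_integral_mono mult_left_mono) (auto simp: indicator_def)
  then show ?thesis using assms(1) by (simp add: nu_eq)
qed

text \<open>Integrability is included because the Poincare inequality is assumed for integrable
  functions.\<close>

definition nice :: "('a \<Rightarrow> real) \<Rightarrow> ('a \<Rightarrow> ennreal) \<Rightarrow> bool" where
  "nice u g \<longleftrightarrow> u \<in> borel_measurable M \<and> (\<forall>x. 0 \<le> u x \<and> u x \<le> 1) \<and> (\<integral>\<^sup>+x. ennreal (u x) \<partial>N) < \<infinity> \<and>
     Lp_grad g (\<lambda>x. ereal (u x))"

lemma niceD:
  assumes "nice u g"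
  shows "u \<in> borel_measurable M" "0 \<le> u x" "u x \<le> 1" "(\<integral>\<^sup>+x. ennreal (u x) \<partial>N) < \<infinity>"
    "Lp_grad g (\<lambda>x. ereal (u x))" "energy g < \<infinity>" "g \<in> borel_measurable borel"
  using assms Lp_grad_borel unfolding nice_def Lp_grad_def by auto

definition avg :: "('a \<Rightarrow> real) \<Rightarrow> 'a \<Rightarrow> real \<Rightarrow> real" where
  "avg u x r = (LINT y:ball x r|M. u y) / mb x r"

lemma measure_M_ball: "measure M (ball x r) = mb x r"
  by (simp add: mb_def measure_def emeasure_M)

lemma ball_average_eq: "ball_average M (\<lambda>y. ereal (u y)) x r = avg u x r"
  by (simp add: ball_average_def avg_def measure_M_ball)

lemma nice_set_integrable: assumes "nice u g" shows "set_integrable M (ball x r) u"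
  unfolding set_integrable_def
proof (rule integrableI_bounded_set_indicator[where B=1])
  show "AE y in M. y \<in> ball x r \<longrightarrow> norm (u y) \<le> 1" using niceD[OF assms] by auto
qed (use niceD[OF assms] ball_fin in \<open>auto simp: emeasure_M\<close>)

lemma avg_diff_le:
  assumes u: "nice u g" and r: "0 < r"
  shows "ennreal \<bar>avg u x r - a\<bar> \<le> (\<integral>\<^sup>+y\<in>ball x r. ennreal \<bar>u y - a\<bar> \<partial>N) / ennreal (mb x r)"
proof -
  have m: "0 < mb x r" by (rule mb_pos[OF r])
  have i: "set_integrable M (ball x r) u" by (rule nice_set_integrable[OF u])
  have ic: "set_integrable M (ball x r) (\<lambda>_. a)"
    unfolding set_integrable_def
    by (rule integrableI_bounded_set_indicator[where B="\<bar>a\<bar>"]) (use ball_fin in \<open>auto simp: emeasure_M\<close>)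
  have "(LINT y:ball x r|M. a) = a * mb x r"
    using ball_fin[of x r] by (subst set_integral_const) (auto simp: emeasure_M measure_M_ball)
  then have "avg u x r - a = (LINT y:ball x r|M. u y - a) / mb x r"
    using m set_integral_diff(2)[OF i ic] by (simp add: avg_def field_simps)
  then have "\<bar>avg u x r - a\<bar> = \<bar>LINT y:ball x r|M. u y - a\<bar> / mb x r" using m by simp
  also have "\<dots> \<le> (LINT y:ball x r|M. \<bar>u y - a\<bar>) / mb x r"
    using m set_integral_norm_bound[OF set_integral_diff(1)[OF i ic]] by (intro divide_right_mono) auto
  finally have 1: "ennreal \<bar>avg u x r - a\<bar> \<le> ennreal ((LINT y:ball x r|M. \<bar>u y - a\<bar>) / mb x r)" by (rule ennreal_leI)
  have "set_integrable M (ball x r) (\<lambda>y. \<bar>u y - a\<bar>)"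
    using set_integral_diff(1)[OF i ic] by (rule set_integrable_abs)
  then have "(\<integral>\<^sup>+y. ennreal (indicator (ball x r) y *\<^sub>R \<bar>u y - a\<bar>) \<partial>M) = ennreal (LINT y:ball x r|M. \<bar>u y - a\<bar>)"
    unfolding set_lebesgue_integral_def set_integrable_def by (intro nn_integral_eq_integral) auto
  also have "(\<integral>\<^sup>+y. ennreal (indicator (ball x r) y *\<^sub>R \<bar>u y - a\<bar>) \<partial>M) = (\<integral>\<^sup>+y\<in>ball x r. ennreal \<bar>u y - a\<bar> \<partial>N)"
    unfolding nn_integral_M by (intro nn_integral_cong) (auto simp: indicator_def)
  finally have "ennreal ((LINT y:ball x r|M. \<bar>u y - a\<bar>) / mb x r) = (\<integral>\<^sup>+y\<in>ball x r. ennreal \<bar>u y - a\<bar> \<partial>N) / ennreal (mb x r)"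
    using m by (simp add: divide_ennreal set_lebesgue_integral_def)
  with 1 show ?thesis by simp
qed

lemma nice_Dirichlet_loc: assumes "nice u g" shows "(\<lambda>x. ereal (u x)) \<in> Dirichlet_loc M p"
proof -
  obtain g' where g': "g' \<in> Lp_loc M p" "upper_gradient g' (\<lambda>x. ereal (u x))"
    using Lp_grad_upper_gradient niceD(5)[OF assms] by blast
  have "\<exists>r>0. \<exists>g. upper_gradient_on (ball x r) g (\<lambda>x. ereal (u x)) \<and> (\<integral>\<^sup>+y\<in>ball x r. g y epowr p \<partial>M) < \<infinity>" for x
  proof -
    obtain r where "r > 0" "(\<integral>\<^sup>+y\<in>ball x r. g' y epowr p \<partial>M) < \<infinity>" using g'(1) unfolding Lp_loc_def by blast
    moreover have "upper_gradient_on (ball x r) g' (\<lambda>x. ereal (u x))"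
      using g'(2) unfolding upper_gradient_on_def by blast
    ultimately show ?thesis by blast
  qed
  moreover have "(\<lambda>x. ereal (u x)) \<in> borel_measurable M" using niceD(1)[OF assms] by measurable
  ultimately show ?thesis unfolding Dirichlet_loc_def by blast
qed

text \<open>Any gradient in L^p may stand in for the minimal one, which it dominates almost
  everywhere.\<close>

lemma nice_poincare:
  assumes u: "nice u g" and r: "0 < r"
  shows "(\<integral>\<^sup>+y\<in>ball x r. ennreal \<bar>u y - avg u x r\<bar> \<partial>N)
    \<le> ennreal (mb x r * (2 * CP * r) * (nu g x (K * r) / mb x (K * r)) powr (1 / p))"
proof -
  have Kr: "0 < K * r" using K r by simp
  note m = mb_pos[OF r, of x] mb_pos[OF Kr, of x]
  have fin: "(\<integral>\<^sup>+y. eabs (ereal (u y)) \<partial>M) < \<infinity>" using niceD(2,4)[OF u] by (simp add: nn_integral_M)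
  have "(\<integral>\<^sup>+y\<in>ball x r. ennreal \<bar>u y - avg u x r\<bar> \<partial>N) / ennreal (mb x r)
    \<le> ennreal (CP * diameter (ball x r)) *
      ((\<integral>\<^sup>+y\<in>ball x (K * r). min_gradient M p (\<lambda>y. ereal (u y)) y epowr p \<partial>N) / ennreal (mb x (K * r))) epowr (1 / p)"
    using poincare[OF r nice_Dirichlet_loc[OF u] fin, of x]
    unfolding ball_average_eq nn_integral_M eabs_real_diff by (simp add: emeasure_M emeasure_ball)
  also have "\<dots> \<le> ennreal (CP * (2 * r)) * (ennreal (nu g x (K * r) / mb x (K * r))) epowr (1 / p)"
  proof (rule mult_mono[OF ennreal_leI epowr_mono])
    have "diameter (ball x r) \<le> 2 * r"
    proof -
      have "dist a b \<le> 2 * r" if "a \<in> ball x r" "b \<in> ball x r" for a b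
        using that dist_triangle3[of a b x] by simp
      then show ?thesis using r by (auto simp: diameter_def intro!: cSUP_least)
    qed
    then show "CP * diameter (ball x r) \<le> CP * (2 * r)" using CP by simp
    have "(\<integral>\<^sup>+y\<in>ball x (K * r). min_gradient M p (\<lambda>y. ereal (u y)) y epowr p \<partial>N) \<le> (\<integral>\<^sup>+y\<in>ball x (K * r). g y epowr p \<partial>N)"
    proof (rule nn_integral_mono_AE)
      show "AE y in N. min_gradient M p (\<lambda>y. ereal (u y)) y epowr p * indicator (ball x (K * r)) y
        \<le> g y epowr p * indicator (ball x (K * r)) y"
        using min_gradient_le[OF niceD(5)[OF u]]
        by eventually_elim (use p0 in \<open>auto intro!: mult_right_mono epowr_mono\<close>)
    qed
    then have "(\<integral>\<^sup>+y\<in>ball x (K * r). min_gradient M p (\<lambda>y. ereal (u y)) y epowr p \<partial>N) / ennreal (mb x (K * r))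
        \<le> ennreal (nu g x (K * r)) / ennreal (mb x (K * r))"
      unfolding nu_eq[OF niceD(6)[OF u]] by (rule divide_right_mono_ennreal)
    then show "(\<integral>\<^sup>+y\<in>ball x (K * r). min_gradient M p (\<lambda>y. ereal (u y)) y epowr p \<partial>N) / ennreal (mb x (K * r))
        \<le> ennreal (nu g x (K * r) / mb x (K * r))" using m by (simp add: divide_ennreal)
  qed (use p0 in auto)
  also have "\<dots> = ennreal (2 * CP * r * (nu g x (K * r) / mb x (K * r)) powr (1 / p))"
    using CP r m by (simp add: epowr_ennreal mult_ac flip: ennreal_mult)
  finally have "(\<integral>\<^sup>+y\<in>ball x r. ennreal \<bar>u y - avg u x r\<bar> \<partial>N)
    \<le> ennreal (2 * CP * r * (nu g x (K * r) / mb x (K * r)) powr (1 / p)) * ennreal (mb x r)"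
    by (rule ennreal_divide_le_imp[OF m(1)])
  also have "\<dots> = ennreal (mb x r * (2 * CP * r) * (nu g x (K * r) / mb x (K * r)) powr (1 / p))"
    using CP r m by (simp add: mult_ac flip: ennreal_mult)
  finally show ?thesis .
qed

section \<open>Dyadic radii and comparison of averages\<close>

definition rr :: "nat \<Rightarrow> real" where "rr k = (1 / 2) ^ k"

lemma rr_pos [simp]: "0 < rr k" "0 \<le> rr k" and rr_le_1: "rr k \<le> 1"
  by (auto simp: rr_def power_le_one)

lemma rr_Suc: "rr (Suc k) = rr k / 2" by (simp add: rr_def)

lemma rr_add: "rr (k + i) = rr k * rr i" by (simp add: rr_def power_add)

lemma rr_mono: "i \<le> k \<Longrightarrow> rr k \<le> rr i"
  by (simp add: rr_def power_decreasing)

text \<open>\<open>L\<close> is the dilation of the Poincare inequality, enlarged to a power of 2.\<close>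
definition mL :: nat where "mL = (SOME m. 4 * K \<le> 2 ^ m \<and> 3 \<le> m)"
definition L :: real where "L = 2 ^ mL"

lemma mL: "4 * K \<le> L" "3 \<le> mL"
proof -
  obtain m where m: "4 * K < 2 ^ m" using real_arch_pow[of 2 "4 * K"] by auto
  have "(2::real) ^ m \<le> 2 ^ (m + 3)" by (intro power_increasing) auto
  then have "4 * K \<le> 2 ^ (m + 3) \<and> 3 \<le> m + 3" using m by linarith
  then have "4 * K \<le> 2 ^ mL \<and> 3 \<le> mL" unfolding mL_def by (rule someI)
  then show "4 * K \<le> L" "3 \<le> mL" by (auto simp: L_def)
qed

lemma L8: "8 \<le> L"
proof -
  have "(2::real) ^ 3 \<le> L" unfolding L_def using mL(2) by (intro power_increasing) auto
  then show ?thesis by simp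
qed

text \<open>A scaled energy density. Up to a constant, its p-th root bounds the change of averages
  at scale \<open>rr j\<close>, and its power 1 / (p - 1) is a term of the Wolff sum.\<close>

definition om :: "('a \<Rightarrow> ennreal) \<Rightarrow> nat \<Rightarrow> 'a \<Rightarrow> real" where
  "om g j y = rr j powr p * (nu g y (L * rr j) / mb y (rr j))"

lemma om_nonneg [simp]: "0 \<le> om g j y" by (simp add: om_def)

lemma om_root: "(om g j y) powr (1 / p) = rr j * (nu g y (L * rr j) / mb y (rr j)) powr (1 / p)"
  using p0 unfolding om_def by (subst powr_mult) (auto simp: powr_powr)

lemma avg_shift:
  assumes u: "nice u g" and st: "0 < s" "0 < t" and sub: "ball y s \<subseteq> ball z t" and c: "mb z t \<le> c * mb y s"
  shows "\<bar>avg u y s - avg u z t\<bar> \<le> c * (2 * CP * t) * (nu g z (K * t) / mb z (K * t)) powr (1 / p)"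
proof -
  note m = mb_pos[OF st(1), of y] mb_pos[OF st(2), of z]
  let ?q = "(nu g z (K * t) / mb z (K * t)) powr (1 / p)"
  have c0: "0 < c" using c m by (smt (verit) mult_nonpos_nonneg)
  have "ennreal \<bar>avg u y s - avg u z t\<bar> \<le> (\<integral>\<^sup>+w\<in>ball y s. ennreal \<bar>u w - avg u z t\<bar> \<partial>N) / ennreal (mb y s)"
    by (rule avg_diff_le[OF u st(1)])
  also have "\<dots> \<le> (\<integral>\<^sup>+w\<in>ball z t. ennreal \<bar>u w - avg u z t\<bar> \<partial>N) / ennreal (mb y s)"
    using sub by (intro divide_right_mono_ennreal nn_integral_mono mult_left_mono) (auto simp: indicator_def)
  also have "\<dots> \<le> ennreal (mb z t * (2 * CP * t) * ?q) / ennreal (mb y s)"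
    by (intro divide_right_mono_ennreal nice_poincare u st)
  also have "\<dots> = ennreal (mb z t * (2 * CP * t) * ?q / mb y s)"
    using m CP st by (intro divide_ennreal) auto
  finally have "\<bar>avg u y s - avg u z t\<bar> \<le> mb z t * (2 * CP * t) * ?q / mb y s"
    using m CP st by (subst (asm) ennreal_le_iff) auto
  also have "\<dots> \<le> (c * mb y s) * (2 * CP * t) * ?q / mb y s"
    using c m CP st by (intro divide_right_mono mult_right_mono) auto
  finally show ?thesis using m by simp
qed

lemma avg_near:
  assumes u: "nice u g" and st: "0 < s" "rr j \<le> t" "t \<le> 4 * rr j"
    and sub: "ball y s \<subseteq> ball z t" and c: "mb z t \<le> c * mb y s"
  shows "\<bar>avg u y s - avg u z t\<bar> \<le> 8 * c * CP * (om g j z) powr (1 / p)"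
proof -
  have t: "0 < t" using st rr_pos(1)[of j] by linarith
  have "0 < c" using c mb_pos[OF st(1), of y] mb_pos[OF t, of z] by (smt (verit) mult_nonpos_nonneg)
  have "K * t \<le> (L / 4) * (4 * rr j)" using mL K t st by (intro mult_mono) auto
  then have Kt: "K * t \<le> L * rr j" by simp
  have "1 * t \<le> K * t" using K t by (intro mult_right_mono) auto
  then have "rr j \<le> K * t" using st by simp
  then have "mb z (rr j) \<le> mb z (K * t)" by (intro mb_mono) auto
  moreover have "nu g z (K * t) \<le> nu g z (L * rr j)"
    using Kt by (intro nu_mono niceD(6)[OF u]) auto
  ultimately have "nu g z (K * t) / mb z (K * t) \<le> nu g z (L * rr j) / mb z (rr j)"
    using mb_pos[of "rr j" z] by (intro frac_le) auto
  then have "(nu g z (K * t) / mb z (K * t)) powr (1 / p) \<le> (nu g z (L * rr j) / mb z (rr j)) powr (1 / p)"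
    using p0 by (intro powr_mono2) auto
  then have "c * (2 * CP * t) * (nu g z (K * t) / mb z (K * t)) powr (1 / p)
    \<le> c * (2 * CP * (4 * rr j)) * (nu g z (L * rr j) / mb z (rr j)) powr (1 / p)"
    using \<open>0 < c\<close> CP t st by (intro mult_mono) auto
  also have "\<dots> = 8 * c * CP * (om g j z) powr (1 / p)" by (simp add: om_root)
  finally show ?thesis using avg_shift[OF u st(1) t sub c] by linarith
qed

lemma avg_step: assumes u: "nice u g"
  shows "\<bar>avg u y (rr (Suc j)) - avg u y (rr j)\<bar> \<le> 8 * CD * CP * (om g j y) powr (1 / p)"
proof (rule avg_near[OF u])
  show "mb y (rr j) \<le> CD * mb y (rr (Suc j))" using mb_doubling[of "rr (Suc j)" y] by (simp add: rr_Suc)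
  show "ball y (rr (Suc j)) \<subseteq> ball y (rr j)" by (rule subset_ball) (simp add: rr_Suc)
qed auto

lemma avg_nn: assumes u: "nice u g"
  shows "avg u x r = enn2real (\<integral>\<^sup>+y\<in>ball x r. ennreal (u y) \<partial>N) / mb x r"
proof -
  have "(\<integral>\<^sup>+y. ennreal (indicator (ball x r) y *\<^sub>R u y) \<partial>M) = ennreal (LINT y:ball x r|M. u y)"
    using nice_set_integrable[OF u, of x r] niceD(2)[OF u]
    unfolding set_lebesgue_integral_def set_integrable_def by (intro nn_integral_eq_integral) auto
  moreover have "(\<integral>\<^sup>+y. ennreal (indicator (ball x r) y *\<^sub>R u y) \<partial>M) = (\<integral>\<^sup>+y\<in>ball x r. ennreal (u y) \<partial>N)"
    unfolding nn_integral_M by (intro nn_integral_cong) (auto simp: indicator_def)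
  moreover have "0 \<le> (LINT y:ball x r|M. u y)"
    unfolding set_lebesgue_integral_def using niceD(2)[OF u] by (intro integral_nonneg_AE) auto
  ultimately have "(LINT y:ball x r|M. u y) = enn2real (\<integral>\<^sup>+y\<in>ball x r. ennreal (u y) \<partial>N)"
    by (metis enn2real_ennreal)
  then show ?thesis by (simp add: avg_def)
qed

section \<open>Convergence of dyadic averages\<close>

lemma borel_representative:
  assumes "u \<in> borel_measurable M"
  obtains u0 :: "'a \<Rightarrow> real" where "u0 \<in> borel_measurable borel" "AE x in N. u x = u0 x"
  using completion_ex_borel_measurable_real[of u N] assms by (auto simp: M_eq)

lemma measurable_avg: assumes u: "nice u g" shows "(\<lambda>x. avg u x r) \<in> borel_measurable borel"
proof -
  obtain u0 where u0: "u0 \<in> borel_measurable borel" "AE x in N. u x = u0 x"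
    by (rule borel_representative[OF niceD(1)[OF u]]) (rule that)
  note [measurable] = u0(1)
  have "(\<integral>\<^sup>+y\<in>ball x r. ennreal (u y) \<partial>N) = (\<integral>\<^sup>+y\<in>ball x r. ennreal (u0 y) \<partial>N)" for x
  proof (rule nn_integral_cong_AE)
    show "AE y in N. ennreal (u y) * indicator (ball x r) y = ennreal (u0 y) * indicator (ball x r) y"
      using u0(2) by eventually_elim simp
  qed
  then show ?thesis unfolding avg_nn[OF u] by simp
qed

lemma powr_le_1_add: assumes "0 \<le> x" shows "x powr (1 / p) \<le> 1 + x"
proof -
  have "ennreal (x powr (1 / p)) \<le> ennreal (1 + x)"
    using epowr_le_self_add1[of "1 / p" "ennreal x"] p assms by (simp add: epowr_ennreal)
  then show ?thesis using assms by (subst (asm) ennreal_le_iff) auto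
qed

text \<open>The error is first averaged over balls about auxiliary centers z. There both
  \<open>u0\<close> and its averages are compared with the average over the doubled ball by the
  Poincare inequality. Replacing the root s^(1/p) by 1 + s makes the bound linear in \<nu>, so that
  it integrates over z.\<close>

lemma avg_error_integral:
  assumes u: "nice u g" and u0: "u0 \<in> borel_measurable borel" "AE x in N. u x = u0 x"
  shows "\<exists>C\<ge>0. \<forall>k. (\<integral>\<^sup>+y\<in>ball x0 R. ennreal \<bar>u0 y - avg u y (rr k)\<bar> \<partial>N) \<le> ennreal (C * rr k)"
proof -
  note [measurable] = u0(1) measurable_avg[OF u]
  define A where "A = ball x0 R"
  define B where "B = ball x0 (R + 1)"
  have [measurable]: "A \<in> sets borel" "B \<in> sets borel" by (auto simp: A_def B_def)
  define C2 where "C2 = (1 + CD) * CD * 4 * CP"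
  have C2: "0 < C2" using CD CP by (simp add: C2_def)
  have gfin: "energy g < \<infinity>" and [measurable]: "g \<in> borel_measurable borel" using niceD[OF u] by auto
  define C where "C = CD * C2 * (mb x0 (R + 1) + CD ^ (mL + 1) * enn2real (energy g))"
  show ?thesis
  proof (intro exI[of _ C] conjI allI)
    show "0 \<le> C" using CD C2 by (simp add: C_def)
    fix k
    define r where "r = rr k"
    have r: "0 < r" "r \<le> 1" using rr_le_1[of k] by (auto simp: r_def)
    define F where "F y = ennreal \<bar>u0 y - avg u y r\<bar>" for y
    have [measurable]: "F \<in> borel_measurable borel" unfolding F_def[abs_def] by measurable
    have inner: "(\<integral>\<^sup>+y\<in>ball z r. F y * indicator A y \<partial>N) / ennreal (mb z r)
      \<le> ennreal (C2 * r) * (indicator B z * (1 + (\<integral>\<^sup>+y\<in>ball z (L * r). g y epowr p \<partial>N) / ennreal (mb z r)))" for z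
    proof (cases "z \<in> B")
      case False
      have "(\<lambda>y. F y * indicator A y * indicator (ball z r) y) = (\<lambda>_. 0)"
      proof
        fix y
        have "\<not> (y \<in> A \<and> y \<in> ball z r)"
          using False r dist_triangle[of x0 z y] by (auto simp: A_def B_def dist_commute)
        then show "F y * indicator A y * indicator (ball z r) y = 0" unfolding indicator_def by auto
      qed
      then have "(\<integral>\<^sup>+y\<in>ball z r. F y * indicator A y \<partial>N) = 0" by (simp only: nn_integral_const mult_zero_left)
      then show ?thesis by simp
    next
      case True
      have m: "0 < mb z r" by (rule mb_pos[OF r(1)])
      define a where "a = avg u z (2 * r)"
      define dev where "dev = (\<integral>\<^sup>+y\<in>ball z (2 * r). ennreal \<bar>u y - a\<bar> \<partial>N)"
      have "F y * indicator A y * indicator (ball z r) y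
         \<le> ennreal \<bar>u0 y - a\<bar> * indicator (ball z (2 * r)) y + dev * ennreal (CD / mb z r) * indicator (ball z r) y" for y
      proof (cases "y \<in> ball z r")
        case yz: True
        have sub: "ball y r \<subseteq> ball z (2 * r)" using yz by (intro ball_subset) (auto simp: dist_commute)
        have my: "0 < mb y r" by (rule mb_pos[OF r(1)])
        have le: "mb z r \<le> CD * mb y r" using mb_comp[OF r(1), of z y r 1] yz by simp
        have "ennreal \<bar>avg u y r - a\<bar> \<le> (\<integral>\<^sup>+w\<in>ball y r. ennreal \<bar>u w - a\<bar> \<partial>N) / ennreal (mb y r)"
          by (rule avg_diff_le[OF u r(1)])
        also have "\<dots> \<le> dev / ennreal (mb y r)"
          unfolding dev_def using sub by (intro divide_right_mono_ennreal nn_integral_mono mult_left_mono) (auto simp: indicator_def)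
        also have "\<dots> = dev * ennreal (1 / mb y r)"
          using my by (simp add: divide_ennreal_def inverse_ennreal inverse_eq_divide)
        also have "\<dots> \<le> dev * ennreal (CD / mb z r)"
          using my m le by (intro mult_left_mono ennreal_leI) (auto simp: field_simps)
        finally have 1: "ennreal \<bar>avg u y r - a\<bar> \<le> dev * ennreal (CD / mb z r)" .
        have "F y \<le> ennreal \<bar>u0 y - a\<bar> + ennreal \<bar>avg u y r - a\<bar>"
          unfolding F_def by (simp flip: ennreal_plus)
        also have "\<dots> \<le> ennreal \<bar>u0 y - a\<bar> + dev * ennreal (CD / mb z r)" using 1 by (rule add_left_mono)
        finally have "F y \<le> ennreal \<bar>u0 y - a\<bar> + dev * ennreal (CD / mb z r)" .
        moreover have "y \<in> ball z (2 * r)" using yz r by simp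
        ultimately show ?thesis using yz by (auto simp: indicator_def)
      qed simp
      then have "(\<integral>\<^sup>+y\<in>ball z r. F y * indicator A y \<partial>N) \<le>
        (\<integral>\<^sup>+y. ennreal \<bar>u0 y - a\<bar> * indicator (ball z (2 * r)) y + dev * ennreal (CD / mb z r) * indicator (ball z r) y \<partial>N)"
        by (intro nn_integral_mono) auto
      also have "\<dots> = (\<integral>\<^sup>+y\<in>ball z (2 * r). ennreal \<bar>u0 y - a\<bar> \<partial>N) + dev * ennreal (CD / mb z r) * ennreal (mb z r)"
        by (subst nn_integral_add) (auto simp: nn_integral_cmult emeasure_ball)
      also have "(\<integral>\<^sup>+y\<in>ball z (2 * r). ennreal \<bar>u0 y - a\<bar> \<partial>N) = dev"
        unfolding dev_def
      proof (rule nn_integral_cong_AE)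
        show "AE y in N. ennreal \<bar>u0 y - a\<bar> * indicator (ball z (2 * r)) y = ennreal \<bar>u y - a\<bar> * indicator (ball z (2 * r)) y"
          using u0(2) by eventually_elim simp
      qed
      also have "dev + dev * ennreal (CD / mb z r) * ennreal (mb z r) = ennreal (1 + CD) * dev"
      proof -
        have "ennreal (CD / mb z r) * ennreal (mb z r) = ennreal CD" using m CD by (simp flip: ennreal_mult)
        then have "dev * ennreal (CD / mb z r) * ennreal (mb z r) = ennreal CD * dev"
          by (simp only: mult.assoc) (simp only: mult.commute)
        then show ?thesis using CD by (simp add: ennreal_plus distrib_right)
      qed
      also have "\<dots> \<le> ennreal (1 + CD) * ennreal (CD * mb z r * (4 * CP * r) * (1 + nu g z (L * r) / mb z r))"
      proof (intro mult_left_mono)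
        have r2: "0 < 2 * r" using r by simp
        have eq: "2 * CP * (2 * r) = 4 * CP * r" by simp
        have "dev \<le> ennreal (mb z (2 * r) * (2 * CP * (2 * r)) * (nu g z (K * (2 * r)) / mb z (K * (2 * r))) powr (1 / p))"
          unfolding dev_def a_def by (rule nice_poincare[OF u r2])
        also have "\<dots> \<le> ennreal ((CD * mb z r) * (4 * CP * r) * (1 + nu g z (L * r) / mb z r))"
        proof (unfold eq, rule ennreal_leI, rule mult_mono[OF mult_right_mono])
          show "mb z (2 * r) \<le> CD * mb z r" by (rule mb_doubling[OF r(1)])
          have "1 * r \<le> K * (2 * r)" using K r by (intro mult_mono) auto
          then have "mb z r \<le> mb z (K * (2 * r))" by (intro mb_mono) auto
          moreover have "(K * 2) * r \<le> L * r" using mL K r by (intro mult_right_mono) auto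
          then have "nu g z (K * (2 * r)) \<le> nu g z (L * r)" using gfin by (intro nu_mono) (auto simp: mult.assoc)
          ultimately have "nu g z (K * (2 * r)) / mb z (K * (2 * r)) \<le> nu g z (L * r) / mb z r"
            using m by (intro frac_le) auto
          moreover have "0 \<le> nu g z (K * (2 * r)) / mb z (K * (2 * r))" by simp
          ultimately show "(nu g z (K * (2 * r)) / mb z (K * (2 * r))) powr (1 / p) \<le> 1 + nu g z (L * r) / mb z r"
            using powr_le_1_add by (meson add_left_mono order_trans)
        qed (use CP CD r in auto)
        finally show "dev \<le> ennreal (CD * mb z r * (4 * CP * r) * (1 + nu g z (L * r) / mb z r))" .
      qed simp
      also have "\<dots> = ennreal ((C2 * r) * (1 + nu g z (L * r) / mb z r)) * ennreal (mb z r)"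
      proof -
        define q where "q = 1 + nu g z (L * r) / mb z r"
        have q: "0 \<le> q" by (simp add: q_def)
        have "ennreal (1 + CD) * ennreal (CD * mb z r * (4 * CP * r) * q) = ennreal ((1 + CD) * (CD * mb z r * (4 * CP * r) * q))"
          using q CD CP r m by (intro ennreal_mult[symmetric]) auto
        also have "(1 + CD) * (CD * mb z r * (4 * CP * r) * q) = (C2 * r * q) * mb z r" by (simp only: C2_def mult_ac)
        also have "ennreal \<dots> = ennreal (C2 * r * q) * ennreal (mb z r)" using q C2 r m by (intro ennreal_mult) auto
        finally show ?thesis by (simp only: q_def)
      qed
      finally have "(\<integral>\<^sup>+y\<in>ball z r. F y * indicator A y \<partial>N) / ennreal (mb z r)
         \<le> ennreal ((C2 * r) * (1 + nu g z (L * r) / mb z r)) * ennreal (mb z r) / ennreal (mb z r)"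
        by (rule divide_right_mono_ennreal)
      also have "\<dots> = ennreal ((C2 * r) * (1 + nu g z (L * r) / mb z r))"
        using m C2 r by (simp add: divide_ennreal flip: ennreal_mult)
      also have "\<dots> = ennreal (C2 * r) * (1 + ennreal (nu g z (L * r)) / ennreal (mb z r))"
        using m C2 r by (simp add: divide_ennreal ennreal_mult ennreal_plus flip: ennreal_1)
      finally show ?thesis using True nu_eq[OF gfin, of z "L * r"] by simp
    qed
    \<comment> \<open>A factor of at least 1 is inserted: by doubling, \<open>1 / mb z r\<close>
      integrates over the ball about y to at least \<open>1 / CD\<close>. It brings in the auxiliary
      center z.\<close>
    have "(\<integral>\<^sup>+y\<in>A. F y \<partial>N) \<le> (\<integral>\<^sup>+y. F y * indicator A y * (ennreal CD * (\<integral>\<^sup>+z\<in>ball y r. 1 / ennreal (mb z r) \<partial>N)) \<partial>N)"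
    proof (intro nn_integral_mono)
      fix y
      have my: "0 < mb y r" by (rule mb_pos[OF r(1)])
      have "1 = ennreal CD * (\<integral>\<^sup>+z. ennreal (1 / (CD * mb y r)) * indicator (ball y r) z \<partial>N)"
        using CD my by (subst nn_integral_cmult) (auto simp: emeasure_ball simp flip: ennreal_mult)
      also have "\<dots> \<le> ennreal CD * (\<integral>\<^sup>+z\<in>ball y r. 1 / ennreal (mb z r) \<partial>N)"
      proof (intro mult_left_mono nn_integral_mono)
        fix z
        show "ennreal (1 / (CD * mb y r)) * indicator (ball y r) z \<le> 1 / ennreal (mb z r) * indicator (ball y r) z"
        proof (cases "z \<in> ball y r")
          case True
          then have "mb z r \<le> CD * mb y r" using mb_comp[OF r(1), of z y r 1] by (simp add: dist_commute)
          then have "ennreal (1 / (CD * mb y r)) \<le> ennreal (1 / mb z r)"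
            using mb_pos[OF r(1), of z] by (intro ennreal_leI) (simp add: frac_le)
          also have "\<dots> = 1 / ennreal (mb z r)"
            using mb_pos[OF r(1), of z] by (simp add: divide_ennreal_def inverse_ennreal inverse_eq_divide)
          finally show ?thesis using True by (simp only: indicator_simps mult_1_right)
        qed simp
      qed auto
      finally show "F y * indicator A y \<le> F y * indicator A y * (ennreal CD * (\<integral>\<^sup>+z\<in>ball y r. 1 / ennreal (mb z r) \<partial>N))"
        using mult_left_mono[of 1 "ennreal CD * (\<integral>\<^sup>+z\<in>ball y r. 1 / ennreal (mb z r) \<partial>N)" "F y * indicator A y"] by simp
    qed
    also have "\<dots> = ennreal CD * (\<integral>\<^sup>+y. (F y * indicator A y) * (\<integral>\<^sup>+z\<in>ball y r. 1 / ennreal (mb z r) \<partial>N) \<partial>N)"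
    proof -
      have [measurable]: "(\<lambda>y. (F y * indicator A y) * (\<integral>\<^sup>+z\<in>ball y r. 1 / ennreal (mb z r) \<partial>N)) \<in> borel_measurable borel"
        by measurable
      show ?thesis by (subst nn_integral_cmult[symmetric]) (simp, intro nn_integral_cong mult.left_commute)
    qed
    also have "(\<integral>\<^sup>+y. (F y * indicator A y) * (\<integral>\<^sup>+z\<in>ball y r. 1 / ennreal (mb z r) \<partial>N) \<partial>N)
      = (\<integral>\<^sup>+z. 1 / ennreal (mb z r) * (\<integral>\<^sup>+y\<in>ball z r. F y * indicator A y \<partial>N) \<partial>N)"
      by (rule fubini_ball) measurable
    also have "\<dots> \<le> (\<integral>\<^sup>+z. ennreal (C2 * r) * (indicator B z * (1 + (\<integral>\<^sup>+y\<in>ball z (L * r). g y epowr p \<partial>N) / ennreal (mb z r))) \<partial>N)"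
      by (intro nn_integral_mono order_trans[OF _ inner]) (simp add: divide_ennreal_def mult.commute)
    also have "\<dots> = ennreal (C2 * r) * (emeasure N B + (\<integral>\<^sup>+z. indicator B z * ((\<integral>\<^sup>+y\<in>ball z (L * r). g y epowr p \<partial>N) / ennreal (mb z r)) \<partial>N))"
      by (simp add: nn_integral_cmult nn_integral_add distrib_left sets_N)
    also have "\<dots> \<le> ennreal (C2 * r) * (ennreal (mb x0 (R + 1)) + ennreal (CD ^ (mL + 1)) * (\<integral>\<^sup>+y. g y epowr p * 1 \<partial>N))"
    proof (intro mult_left_mono add_mono ball_maximal_le)
      show "2 * (L * r) \<le> 2 ^ (mL + 1) * r" by (simp add: L_def)
      show "emeasure N B \<le> ennreal (mb x0 (R + 1))" by (simp add: B_def emeasure_ball)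
      show "(indicator B x :: ennreal) \<le> 1" for x by (auto simp: indicator_def)
    qed (measurable, auto simp: r)
    also have "(\<integral>\<^sup>+y. g y epowr p * 1 \<partial>N) = ennreal (enn2real (energy g))" using gfin by (simp add: energy_def)
    finally have "(\<integral>\<^sup>+y\<in>A. F y \<partial>N) \<le> ennreal CD * (ennreal (C2 * r) * (ennreal (mb x0 (R + 1)) + ennreal (CD ^ (mL + 1)) * ennreal (enn2real (energy g))))"
      by (simp add: mult_left_mono)
    also have "\<dots> = ennreal (C * r)"
      using CD C2 r by (simp add: C_def mult_ac flip: ennreal_mult ennreal_plus)
    finally show "(\<integral>\<^sup>+y\<in>ball x0 R. ennreal \<bar>u0 y - avg u y (rr k)\<bar> \<partial>N) \<le> ennreal (C * rr k)"
      by (simp add: F_def A_def r_def)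
  qed
qed

text \<open>The L^1 errors on bounded sets are of order \<open>rr k\<close>, hence summable, and a
  summable series of errors tends to 0 almost everywhere; no covering argument is needed.\<close>

lemma avg_tendsto:
  assumes u: "nice u g" shows "AE x in N. (\<lambda>k. avg u x (rr k)) \<longlonglongrightarrow> u x"
proof -
  obtain u0 where u0: "u0 \<in> borel_measurable borel" "AE x in N. u x = u0 x"
    by (rule borel_representative[OF niceD(1)[OF u]]) (rule that)
  note [measurable] = u0(1) measurable_avg[OF u]
  have "AE x in N. (\<lambda>k. avg u x (rr k)) \<longlonglongrightarrow> u0 x"
  proof (rule AE_ball_all)
    fix n :: nat
    let ?B = "ball (undefined::'a) (real n)"
    obtain C where C: "0 \<le> C" "\<And>k. (\<integral>\<^sup>+y\<in>?B. ennreal \<bar>u0 y - avg u y (rr k)\<bar> \<partial>N) \<le> ennreal (C * rr k)"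
      using avg_error_integral[OF u u0, of undefined "real n"] by blast
    have "(\<integral>\<^sup>+y. (\<Sum>k. ennreal \<bar>u0 y - avg u y (rr k)\<bar> * indicator ?B y) \<partial>N)
      = (\<Sum>k. \<integral>\<^sup>+y\<in>?B. ennreal \<bar>u0 y - avg u y (rr k)\<bar> \<partial>N)"
      by (intro nn_integral_suminf) simp
    also have "\<dots> \<le> (\<Sum>k. ennreal (C * rr k))" by (intro suminf_le C) auto
    also have "\<dots> < \<infinity>"
      using C(1) by (subst suminf_ennreal2) (auto simp: rr_def intro!: summable_mult)
    finally have "AE y in N. (\<Sum>k. ennreal \<bar>u0 y - avg u y (rr k)\<bar> * indicator ?B y) \<noteq> \<infinity>"
      by (intro nn_integral_PInf_AE) auto
    then show "AE y in N. y \<in> ?B \<longrightarrow> (\<lambda>k. avg u y (rr k)) \<longlonglongrightarrow> u0 y"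
    proof eventually_elim
      case (elim y)
      show ?case
      proof
        assume y: "y \<in> ?B"
        then have "(\<Sum>k. ennreal \<bar>u0 y - avg u y (rr k)\<bar>) \<noteq> top" using elim by (simp only: indicator_simps mult_1_right infinity_ennreal_def not_False_eq_True simp_thms)
        then have "summable (\<lambda>k. \<bar>u0 y - avg u y (rr k)\<bar>)" by (intro summable_suminf_not_top) auto
        then have "(\<lambda>k. \<bar>u0 y - avg u y (rr k)\<bar>) \<longlonglongrightarrow> 0" by (rule summable_LIMSEQ_zero)
        then have "(\<lambda>k. avg u y (rr k) - u0 y) \<longlonglongrightarrow> 0"
          by (subst (asm) abs_minus_commute) (rule tendsto_rabs_zero_cancel)
        then show "(\<lambda>k. avg u y (rr k)) \<longlonglongrightarrow> u0 y" by (rule LIM_zero_cancel)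
      qed
    qed
  qed
  with u0(2) show ?thesis by eventually_elim simp
qed

section \<open>From the first power to the p-th power in the Poincare inequality\<close>

lemma ennreal_om:
  assumes "energy g < \<infinity>"
  shows "ennreal (om g j y) = ennreal (rr j powr p) * ((\<integral>\<^sup>+z\<in>ball y (L * rr j). g z epowr p \<partial>N) / ennreal (mb y (rr j)))"
  using mb_pos[of "rr j" y] by (simp add: om_def nu_eq[OF assms] divide_ennreal ennreal_mult[symmetric])

lemma measurable_om [measurable]:
  assumes [measurable]: "g \<in> borel_measurable borel" shows "(\<lambda>y. om g j y) \<in> borel_measurable borel"
  unfolding om_def nu_def by measurable

lemma om_integral:
  assumes [measurable]: "g \<in> borel_measurable borel" "b \<in> borel_measurable borel" "B \<in> borel_measurable borel"
    and g: "energy g < \<infinity>" and B: "\<And>x y. dist y x < L * rr j \<Longrightarrow> b x \<le> B y"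
  shows "(\<integral>\<^sup>+x. b x * ennreal (om g j x) \<partial>N) \<le> ennreal (CD ^ (mL + 1) * rr j powr p) * (\<integral>\<^sup>+y. g y epowr p * B y \<partial>N)"
proof -
  have "(\<integral>\<^sup>+x. b x * ennreal (om g j x) \<partial>N)
    = ennreal (rr j powr p) * (\<integral>\<^sup>+x. b x * ((\<integral>\<^sup>+z\<in>ball x (L * rr j). g z epowr p \<partial>N) / ennreal (mb x (rr j))) \<partial>N)"
    unfolding ennreal_om[OF g] by (subst nn_integral_cmult[symmetric]) (simp, intro nn_integral_cong mult.left_commute)
  also have "\<dots> \<le> ennreal (rr j powr p) * (ennreal (CD ^ (mL + 1)) * (\<integral>\<^sup>+y. g y epowr p * B y \<partial>N))"
    by (intro mult_left_mono ball_maximal_le B) (auto simp: L_def)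
  also have "\<dots> = ennreal (CD ^ (mL + 1) * rr j powr p) * (\<integral>\<^sup>+y. g y epowr p * B y \<partial>N)"
    using CD by (simp add: ennreal_mult mult_ac)
  finally show ?thesis .
qed

text \<open>The base case moves the center from x to y through the ball of radius
  \<open>4 * rr k\<close> about y, at the cost of two comparisons; the rest telescopes.\<close>

lemma avg_chain:
  assumes u: "nice u g" and xy: "dist x y < 2 * rr k"
  shows "\<bar>avg u y (rr (k + n)) - avg u x (rr k)\<bar> \<le> 16 * CD ^ 3 * CP * (om g k y powr (1 / p) + (\<Sum>i<n. om g (k + i) y powr (1 / p)))"
proof (induction n)
  case 0
  have CD1: "CD * 1 \<le> CD * CD ^ 2" using CD by (intro mult_left_mono one_le_power) auto
  have "dist x y + rr k \<le> 4 * rr k" "dist y x + 4 * rr k \<le> 8 * rr k"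
    using xy rr_pos(1)[of k] dist_commute[of x y] by linarith+
  then have d: "dist x y + rr k \<le> 4 * rr k" "dist y x + 4 * rr k \<le> 2 ^ 3 * rr k" by simp_all
  have sub: "ball x (rr k) \<subseteq> ball y (4 * rr k)" by (rule ball_subset[OF d(1)])
  have "mb y (4 * rr k) \<le> CD ^ 3 * mb x (rr k)"
    by (rule mb_comp[OF rr_pos(1) d(2)])
  then have 1: "\<bar>avg u x (rr k) - avg u y (4 * rr k)\<bar> \<le> 8 * CD ^ 3 * CP * (om g k y) powr (1 / p)"
    using sub by (intro avg_near[OF u]) auto
  have "mb y (4 * rr k) \<le> CD ^ 3 * mb y (rr k)" by (intro mb_comp) auto
  then have 2: "\<bar>avg u y (rr k) - avg u y (4 * rr k)\<bar> \<le> 8 * CD ^ 3 * CP * (om g k y) powr (1 / p)"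
  proof (intro avg_near[OF u])
    show "ball y (rr k) \<subseteq> ball y (4 * rr k)" by (rule subset_ball) simp
  qed auto
  from 1 2 show ?case by simp
next
  case (Suc n)
  have "8 * CD * CP * om g (k + n) y powr (1 / p) \<le> 16 * CD ^ 3 * CP * om g (k + n) y powr (1 / p)"
  proof (intro mult_right_mono mult_mono)
    have "CD ^ 1 \<le> CD ^ 3" using CD by (intro power_increasing) auto
    then show "CD \<le> CD ^ 3" by simp
  qed (use CD CP in auto)
  moreover have "\<bar>avg u y (rr (k + Suc n)) - avg u y (rr (k + n))\<bar> \<le> 8 * CD * CP * om g (k + n) y powr (1 / p)"
    using avg_step[OF u, of y "k + n"] by simp
  ultimately have "\<bar>avg u y (rr (k + Suc n)) - avg u x (rr k)\<bar> \<le>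
    16 * CD ^ 3 * CP * (om g k y powr (1 / p) + (\<Sum>i<n. om g (k + i) y powr (1 / p)))
    + 16 * CD ^ 3 * CP * om g (k + n) y powr (1 / p)" using Suc.IH by linarith
  then show ?case by (simp add: distrib_left)
qed

text \<open>At almost every y the oscillation telescopes into p-th roots of \<open>om\<close>.
  Weighting the scales by 2^i turns the p-th power of the sum into a sum of terms \<open>om\<close>,
  and integrating one of them gains \<open>rr i powr p\<close>. The product decays like 2^(i (1 -
  p)), which is summable since p > 1. The doubled ball is the support of the test functions built
  from it.\<close>

lemma poincare_pp:
  "\<exists>C>0. \<forall>u g x k. nice u g \<longrightarrow>
    (\<integral>\<^sup>+y\<in>ball x (2 * rr k). ennreal \<bar>u y - avg u x (rr k)\<bar> epowr p \<partial>N) \<le> ennreal (C * rr k powr p * nu g x (2 * L * rr k))"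
proof -
  obtain Q where Q: "0 < Q" "\<And>b :: nat \<Rightarrow> ennreal.
    (\<Sum>n. b n) epowr p \<le> ennreal Q * (\<Sum>n. ennreal (2 powr (1 * real n)) * b n epowr p)"
    by (rule epowr_suminf_le[OF p0 zero_less_one]) (rule that)
  define C1 where "C1 = 32 * CD ^ 3 * CP"
  have C1: "0 < C1" using CD CP by (simp add: C1_def)
  define \<theta> where "\<theta> = (2::real) powr (1 - p)"
  have \<theta>: "0 < \<theta>" "\<theta> < 1" using p by (auto simp: \<theta>_def powr_less_one)
  define C where "C = C1 powr p * Q * (CD ^ (mL + 1) * (1 / (1 - \<theta>)))"
  have C: "0 < C" using C1 Q CD \<theta> by (simp add: C_def)
  show ?thesis
  proof (intro exI[of _ C] conjI allI impI C)
    fix u g k and x :: 'a assume u: "nice u g"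
    have gfin: "energy g < \<infinity>" and [measurable]: "g \<in> borel_measurable borel" using niceD[OF u] by auto
    let ?B = "ball x (2 * rr k)"
    have pw: "ennreal \<bar>u y - avg u x (rr k)\<bar> epowr p * indicator ?B y
      \<le> ennreal (C1 powr p * Q) * (\<Sum>i. ennreal (2 powr i) * (indicator ?B y * ennreal (om g (k + i) y)))"
      if lim: "(\<lambda>k. avg u y (rr k)) \<longlonglongrightarrow> u y" for y
    proof (cases "y \<in> ?B")
      case True
      define b where "b i = ennreal (om g (k + i) y powr (1 / p))" for i
      have le: "ennreal \<bar>avg u y (rr (k + n)) - avg u x (rr k)\<bar> \<le> ennreal C1 * (\<Sum>i. b i)" for n
      proof -
        let ?s = "\<Sum>i<Suc n. om g (k + i) y powr (1 / p)"
        have "om g k y powr (1 / p) \<le> ?s"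
          using member_le_sum[of 0 "{..<Suc n}" "\<lambda>i. om g (k + i) y powr (1 / p)"] by simp
        moreover have "(\<Sum>i<n. om g (k + i) y powr (1 / p)) \<le> ?s" by simp
        ultimately have "om g k y powr (1 / p) + (\<Sum>i<n. om g (k + i) y powr (1 / p)) \<le> 2 * ?s" by linarith
        then have "16 * CD ^ 3 * CP * (om g k y powr (1 / p) + (\<Sum>i<n. om g (k + i) y powr (1 / p))) \<le> 16 * CD ^ 3 * CP * (2 * ?s)"
          using CD CP by (intro mult_left_mono) auto
        moreover have "\<bar>avg u y (rr (k + n)) - avg u x (rr k)\<bar> \<le>
          16 * CD ^ 3 * CP * (om g k y powr (1 / p) + (\<Sum>i<n. om g (k + i) y powr (1 / p)))"
          using True by (intro avg_chain[OF u]) auto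
        ultimately have "\<bar>avg u y (rr (k + n)) - avg u x (rr k)\<bar> \<le> 16 * CD ^ 3 * CP * (2 * ?s)" by linarith
        also have "\<dots> = C1 * ?s" by (simp add: C1_def)
        finally have "\<bar>avg u y (rr (k + n)) - avg u x (rr k)\<bar> \<le> C1 * ?s" .
        then have "ennreal \<bar>avg u y (rr (k + n)) - avg u x (rr k)\<bar> \<le> ennreal (C1 * ?s)" by (rule ennreal_leI)
        also have "\<dots> = ennreal C1 * (\<Sum>i<Suc n. b i)"
          using C1 by (simp add: b_def ennreal_mult sum_nonneg sum_ennreal del: sum.lessThan_Suc)
        also have "\<dots> \<le> ennreal C1 * (\<Sum>i. b i)" by (intro mult_left_mono sum_le_suminf) auto
        finally show ?thesis .
      qed
      have "(\<lambda>n. ennreal \<bar>avg u y (rr (k + n)) - avg u x (rr k)\<bar>) \<longlonglongrightarrow> ennreal \<bar>u y - avg u x (rr k)\<bar>"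
        using LIMSEQ_ignore_initial_segment[OF lim, of k]
        by (intro tendsto_ennrealI tendsto_rabs tendsto_diff tendsto_const) (simp add: add.commute)
      then have "ennreal \<bar>u y - avg u x (rr k)\<bar> \<le> ennreal C1 * (\<Sum>i. b i)"
        by (rule LIMSEQ_le_const2) (use le in blast)
      then have "ennreal \<bar>u y - avg u x (rr k)\<bar> epowr p \<le> (ennreal C1 * (\<Sum>i. b i)) epowr p"
        using p0 by (intro epowr_mono) auto
      also have "\<dots> = ennreal (C1 powr p) * (\<Sum>i. b i) epowr p"
        using C1 by (simp add: epowr_mult epowr_ennreal)
      also have "\<dots> \<le> ennreal (C1 powr p) * (ennreal Q * (\<Sum>i. ennreal (2 powr (1 * real i)) * b i epowr p))"
        by (intro mult_left_mono Q) auto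
      also have "\<dots> = ennreal (C1 powr p * Q) * (\<Sum>i. ennreal (2 powr i) * ennreal (om g (k + i) y))"
        using Q p0 by (simp add: b_def epowr_ennreal powr_powr ennreal_mult mult.assoc)
      finally show ?thesis using True by (simp only: indicator_simps mult_1_right mult_1_left)
    qed simp
    have "(\<integral>\<^sup>+y\<in>?B. ennreal \<bar>u y - avg u x (rr k)\<bar> epowr p \<partial>N)
      \<le> (\<integral>\<^sup>+y. ennreal (C1 powr p * Q) * (\<Sum>i. ennreal (2 powr i) * (indicator ?B y * ennreal (om g (k + i) y))) \<partial>N)"
    proof (rule nn_integral_mono_AE)
      show "AE y in N. ennreal \<bar>u y - avg u x (rr k)\<bar> epowr p * indicator ?B y
        \<le> ennreal (C1 powr p * Q) * (\<Sum>i. ennreal (2 powr i) * (indicator ?B y * ennreal (om g (k + i) y)))"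
        using avg_tendsto[OF u] by eventually_elim (rule pw)
    qed
    also have "\<dots> = ennreal (C1 powr p * Q) * (\<Sum>i. ennreal (2 powr i) * (\<integral>\<^sup>+y. indicator ?B y * ennreal (om g (k + i) y) \<partial>N))"
      by (simp add: nn_integral_cmult nn_integral_suminf)
    also have "\<dots> \<le> ennreal (C1 powr p * Q) * (\<Sum>i. ennreal (CD ^ (mL + 1) * rr k powr p * nu g x (2 * L * rr k) * \<theta> ^ i))"
    proof (intro mult_left_mono suminf_le)
      fix i
      have "(\<integral>\<^sup>+y. indicator ?B y * ennreal (om g (k + i) y) \<partial>N)
        \<le> ennreal (CD ^ (mL + 1) * rr (k + i) powr p) * (\<integral>\<^sup>+y\<in>ball x (2 * L * rr k). g y epowr p \<partial>N)"
      proof (rule om_integral)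
        fix z y :: 'a assume zy: "dist y z < L * rr (k + i)"
        show "indicator ?B z \<le> (indicator (ball x (2 * L * rr k)) y :: ennreal)"
        proof (cases "z \<in> ?B")
          case True
          have "dist x y \<le> dist x z + dist y z" by (metis dist_commute dist_triangle)
          also have "\<dots> < 2 * rr k + L * rr k"
          proof -
            have "L * rr (k + i) \<le> L * rr k" using rr_mono[of k "k + i"] L8 by (intro mult_left_mono) auto
            then show ?thesis using True zy by simp
          qed
          also have "\<dots> \<le> 2 * L * rr k" using L8 mult_right_mono[of 2 L "rr k"] by (simp add: algebra_simps)
          finally show ?thesis by (simp add: indicator_def)
        qed simp
      qed (use gfin in auto)
      then have "ennreal (2 powr i) * (\<integral>\<^sup>+y. indicator ?B y * ennreal (om g (k + i) y) \<partial>N)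
        \<le> ennreal (2 powr i) * (ennreal (CD ^ (mL + 1) * rr (k + i) powr p) * ennreal (nu g x (2 * L * rr k)))"
        unfolding nu_eq[OF gfin] by (intro mult_left_mono) auto
      also have "\<dots> = ennreal (2 powr i * (CD ^ (mL + 1) * rr (k + i) powr p * nu g x (2 * L * rr k)))"
        using CD by (simp add: ennreal_mult)
      also have "2 powr i * (CD ^ (mL + 1) * rr (k + i) powr p * nu g x (2 * L * rr k))
         = CD ^ (mL + 1) * rr k powr p * nu g x (2 * L * rr k) * \<theta> ^ i"
      proof -
        have "\<theta> ^ i = 2 powr ((1 - p) * i)" by (simp add: \<theta>_def powr_powr flip: powr_realpow)
        also have "\<dots> = 2 powr i * 2 powr (- (p * i))" by (simp add: left_diff_distrib powr_diff powr_minus_divide)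
        also have "2 powr (- (p * i)) = rr i powr p"
          by (simp add: rr_def powr_powr powr_minus_divide powr_divide power_one_over mult.commute flip: powr_realpow)
        finally have "\<theta> ^ i = 2 powr i * rr i powr p" .
        moreover have "rr (k + i) powr p = rr k powr p * rr i powr p" by (simp add: rr_add powr_mult)
        ultimately show ?thesis by simp
      qed
      finally show "ennreal (2 powr i) * (\<integral>\<^sup>+y. indicator ?B y * ennreal (om g (k + i) y) \<partial>N)
         \<le> ennreal (CD ^ (mL + 1) * rr k powr p * nu g x (2 * L * rr k) * \<theta> ^ i)" .
    qed auto
    also have "(\<Sum>i. ennreal (CD ^ (mL + 1) * rr k powr p * nu g x (2 * L * rr k) * \<theta> ^ i))
      = ennreal (CD ^ (mL + 1) * rr k powr p * nu g x (2 * L * rr k) * (1 / (1 - \<theta>)))"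
      using \<theta> CD by (subst suminf_ennreal2) (auto simp: summable_mult summable_geometric suminf_mult suminf_geometric)
    also have "ennreal (C1 powr p * Q) * \<dots> = ennreal (C * rr k powr p * nu g x (2 * L * rr k))"
      using C1 Q CD \<theta> by (simp add: C_def mult_ac flip: ennreal_mult)
    finally show "(\<integral>\<^sup>+y\<in>?B. ennreal \<bar>u y - avg u x (rr k)\<bar> epowr p \<partial>N) \<le> ennreal (C * rr k powr p * nu g x (2 * L * rr k))" .
  qed
qed

definition CPP :: real where
  "CPP = (SOME C. 0 < C \<and> (\<forall>u g x k. nice u g \<longrightarrow>
    (\<integral>\<^sup>+y\<in>ball x (2 * rr k). ennreal \<bar>u y - avg u x (rr k)\<bar> epowr p \<partial>N) \<le> ennreal (C * rr k powr p * nu g x (2 * L * rr k))))"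

lemma CPP_pos: "0 < CPP" and CPP:
  "nice u g \<Longrightarrow> (\<integral>\<^sup>+y\<in>ball x (2 * rr k). ennreal \<bar>u y - avg u x (rr k)\<bar> epowr p \<partial>N) \<le> ennreal (CPP * rr k powr p * nu g x (2 * L * rr k))"
  using someI_ex[OF poincare_pp] unfolding CPP_def[symmetric] by blast+

section \<open>Cutoffs and level set test functions\<close>

lemma Lipschitz_Lp_grad:
  assumes u: "\<And>x y. \<bar>u x - u y\<bar> \<le> l * dist x y" "0 \<le> l" and A: "\<And>x. x \<notin> A \<Longrightarrow> u x = c" "A \<in> sets borel" "emeasure N A < \<infinity>"
  shows "Lp_grad (\<lambda>x. ennreal l * indicator A x) (\<lambda>x. ereal (u x))"
    and "energy (\<lambda>x. ennreal l * indicator A x) = ennreal (l powr p) * emeasure N A"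
proof -
  note [measurable] = A(2)
  show *: "energy (\<lambda>x. ennreal l * indicator A x) = ennreal (l powr p) * emeasure N A"
  proof -
    have "energy (\<lambda>x. ennreal l * indicator A x) = ennreal (l powr p) * energy (\<lambda>x. indicator A x)"
      using u(2) by (intro energy_cmult) auto
    also have "energy (\<lambda>x. indicator A x) = (\<integral>\<^sup>+x. indicator A x \<partial>N)"
      unfolding energy_def by (intro nn_integral_cong) (auto simp: indicator_def)
    finally show ?thesis by (simp add: sets_N)
  qed
  have "weak_grad M p (\<lambda>x. ennreal l * indicator A x) (\<lambda>x. ereal (u x))"
    unfolding weak_grad_def
  proof (intro conjI ae_curveI good_curve_indicator[where c=c])
    fix \<gamma> :: "real \<Rightarrow> 'a" and s assume \<gamma>: "arc_length_curve \<gamma> s"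
    show "good_curve (\<lambda>_. ennreal l) (\<lambda>x. ereal (u x)) \<gamma> s" by (rule Lipschitz_good_curve[OF u \<gamma>])
    show "path_int (\<lambda>_. ennreal l) \<gamma> 0 s < \<infinity>"
      using \<gamma> by (simp add: path_int_def nn_integral_cmult ennreal_mult_less_top arc_length_curve_def)
  qed (use A in auto)
  then show "Lp_grad (\<lambda>x. ennreal l * indicator A x) (\<lambda>x. ereal (u x))"
    unfolding Lp_grad_def * using A(3) by (simp add: ennreal_mult_less_top)
qed

definition cutoff :: "'a \<Rightarrow> real \<Rightarrow> 'a \<Rightarrow> real" where
  "cutoff x r y = max 0 (min 1 (2 - dist x y / r))"

lemma cutoff:
  assumes r: "0 < r"
  shows "0 \<le> cutoff x r y" "cutoff x r y \<le> 1" "y \<in> ball x r \<Longrightarrow> cutoff x r y = 1"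
    "y \<notin> ball x (2 * r) \<Longrightarrow> cutoff x r y = 0" "\<bar>cutoff x r y - cutoff x r z\<bar> \<le> 1 / r * dist y z"
    "cutoff x r \<in> borel_measurable borel"
proof -
  have "\<bar>dist x y - dist x z\<bar> \<le> dist y z" using abs_dist_diff_le[of x y z] dist_triangle3[of x y z] dist_triangle[of x z y]
    by (simp add: abs_le_iff dist_commute)
  then have "\<bar>dist x y / r - dist x z / r\<bar> \<le> dist y z / r"
    using r by (simp add: divide_right_mono flip: diff_divide_distrib)
  then show "\<bar>cutoff x r y - cutoff x r z\<bar> \<le> 1 / r * dist y z" unfolding cutoff_def by simp
  have "continuous_on UNIV (cutoff x r)" unfolding cutoff_def
    using r by (intro continuous_intros) auto
  then show "cutoff x r \<in> borel_measurable borel" by (rule borel_measurable_continuous_onI)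
qed (use r in \<open>auto simp: cutoff_def field_simps\<close>)

text \<open>The factor 4^p consists of 2^p for adding two gradients and 2^p for the slope 2 /
  \<delta>. In the bracket, 1 stands for the energy of \<open>u\<close> and the other summand for
  the cutoff, whose slope 1 / r is at most 2 / \<open>rr k\<close>.\<close>

definition CT :: real where "CT = 4 powr p * (1 + 2 powr p * CPP)"

lemma CT_pos: "0 < CT" using CPP_pos by (simp add: CT_def add_pos_pos)

text \<open>The second summand of the gradient is the cutoff's; it is charged only where the oscillation
  of \<open>u\<close> exceeds \<open>\<delta> / 2\<close>, a set whose measure the Poincare inequality controls.\<close>
lemma level_set_test_function:
  assumes u: "nice u g" and \<delta>: "0 < \<delta>" and r: "0 < r" "r \<le> rr k" "rr k \<le> 2 * r" and s: "\<bar>s\<bar> = (1::real)"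
  shows "\<exists>f h. f \<in> borel_measurable M \<and> (\<forall>y. 0 \<le> f y \<and> f y \<le> 1) \<and>
    (\<forall>y\<in>ball x r. \<delta> \<le> s * (u y - avg u x (rr k)) \<longrightarrow> f y = 1) \<and> (\<forall>y. y \<notin> ball x (2 * r) \<longrightarrow> f y = 0) \<and>
    Lp_grad h (\<lambda>y. ereal (f y)) \<and> energy h \<le> ennreal (CT * \<delta> powr (-p) * nu g x (2 * L * rr k)) \<and>
    (\<integral>\<^sup>+y. ennreal (f y) epowr p \<partial>N) \<le> ennreal (CT * \<delta> powr (-p) * nu g x (2 * L * rr k))"
proof -
  define a where "a = avg u x (rr k)"
  define \<phi> where "\<phi> y = 2 / \<delta> * (s * (u y - a)) - 1" for y
  define \<eta> where "\<eta> = cutoff x r"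
  note \<eta> = cutoff[OF r(1), where x=x, folded \<eta>_def]
  \<comment> \<open>A lattice substitute for the product: it is 1 where both factors are 1 and
    vanishes where one of them is nonpositive, and its increments are bounded by the sum of theirs,
    so no product rule is involved.\<close>
  define f where "f y = max 0 (min 1 (\<phi> y) + \<eta> y - 1)" for y
  note uM [measurable] = niceD(1)[OF u]
  have [measurable]: "\<eta> \<in> borel_measurable M" by (intro measurable_M \<eta>)
  have gfin: "energy g < \<infinity>" and gb [measurable]: "g \<in> borel_measurable borel" using niceD[OF u] by auto
  have fM: "f \<in> borel_measurable M" unfolding f_def[abs_def] \<phi>_def[abs_def] by measurable
  have f01: "0 \<le> f y" "f y \<le> 1" for y using \<eta>(2)[of y] by (auto simp: f_def)
  obtain u0 where u0: "u0 \<in> borel_measurable borel" "AE y in N. u y = u0 y"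
    by (rule borel_representative[OF uM]) (rule that)
  note [measurable] = u0(1)
  obtain N0 where N0: "{y \<in> space N. \<not> u y = u0 y} \<subseteq> N0" "emeasure N N0 = 0" "N0 \<in> sets N"
    using u0(2) by (rule AE_E)
  have [measurable]: "N0 \<in> sets borel" using N0(3) by (simp add: sets_N)
  define S where "S = {y \<in> ball x (2 * r). \<delta> / 2 < \<bar>u0 y - a\<bar>}"
  \<comment> \<open>\<open>f\<close> is built from \<open>u\<close> itself, while a set to which
    gradients are restricted must be Borel; the exceptional null set \<open>N0\<close> bridges the
    difference.\<close>
  define A where "A = ball x (2 * r) \<inter> (S \<union> N0)"
  have [measurable]: "S \<in> sets borel" unfolding S_def by measurable
  have Ab [measurable]: "A \<in> sets borel" unfolding A_def by measurable
  have fA: "y \<in> A" if "f y \<noteq> 0" for y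
  proof -
    have 1: "1 < min 1 (\<phi> y) + \<eta> y" using that by (auto simp: f_def max_def split: if_splits)
    have yb: "y \<in> ball x (2 * r)" using 1 \<eta>(4)[of y] by (cases "y \<in> ball x (2 * r)") auto
    have "0 < \<phi> y" using 1 \<eta>(2)[of y] by auto
    then have "\<delta> / 2 < s * (u y - a)" using \<delta> by (simp add: \<phi>_def field_simps)
    moreover have "s * (u y - a) \<le> \<bar>s\<bar> * \<bar>u y - a\<bar>" unfolding abs_mult[symmetric] by (rule abs_ge_self)
    ultimately have "\<delta> / 2 < \<bar>u y - a\<bar>" unfolding s mult_1_left by (rule less_le_trans)
    moreover have "u y = u0 y \<or> y \<in> N0" using N0(1) by auto
    ultimately show ?thesis using yb by (auto simp: A_def S_def)
  qed
  define V where "V = nu g x (2 * L * rr k)"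
  have V: "0 \<le> V" by (simp add: V_def)
  have NA: "emeasure N A \<le> ennreal ((2 / \<delta>) powr p * (CPP * rr k powr p * V))"
  proof -
    have "emeasure N A \<le> emeasure N (S \<union> N0)" by (intro emeasure_mono) (auto simp: A_def sets_N)
    also have "\<dots> = emeasure N S" using N0 by (intro emeasure_Un_null_set) (auto simp: sets_N)
    also have "\<dots> = (\<integral>\<^sup>+y. indicator S y \<partial>N)" by (simp add: sets_N)
    also have "\<dots> \<le> (\<integral>\<^sup>+y. ennreal ((2 / \<delta>) powr p) * (ennreal \<bar>u0 y - a\<bar> epowr p * indicator (ball x (2 * rr k)) y) \<partial>N)"
    proof (intro nn_integral_mono)
      fix y
      show "(indicator S y :: ennreal) \<le> ennreal ((2 / \<delta>) powr p) * (ennreal \<bar>u0 y - a\<bar> epowr p * indicator (ball x (2 * rr k)) y)"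
      proof (cases "y \<in> S")
        case True
        then have "y \<in> ball x (2 * rr k)" "\<delta> / 2 < \<bar>u0 y - a\<bar>" using r by (auto simp: S_def)
        moreover from this(2) have "1 \<le> (2 / \<delta> * \<bar>u0 y - a\<bar>) powr p" using \<delta> p0 by (intro ge_one_powr_ge_zero) (auto simp: field_simps)
        then have "1 \<le> (2 / \<delta>) powr p * \<bar>u0 y - a\<bar> powr p" by (subst (asm) powr_mult)
        then have "ennreal 1 \<le> ennreal ((2 / \<delta>) powr p) * ennreal (\<bar>u0 y - a\<bar> powr p)"
          by (subst ennreal_mult[symmetric]) (auto intro: ennreal_leI)
        ultimately show ?thesis using True by (simp add: epowr_ennreal)
      qed simp
    qed
    also have "\<dots> = ennreal ((2 / \<delta>) powr p) * (\<integral>\<^sup>+y\<in>ball x (2 * rr k). ennreal \<bar>u0 y - a\<bar> epowr p \<partial>N)"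
      by (intro nn_integral_cmult) simp
    also have "(\<integral>\<^sup>+y\<in>ball x (2 * rr k). ennreal \<bar>u0 y - a\<bar> epowr p \<partial>N) = (\<integral>\<^sup>+y\<in>ball x (2 * rr k). ennreal \<bar>u y - a\<bar> epowr p \<partial>N)"
    proof (rule nn_integral_cong_AE)
      show "AE y in N. ennreal \<bar>u0 y - a\<bar> epowr p * indicator (ball x (2 * rr k)) y
        = ennreal \<bar>u y - a\<bar> epowr p * indicator (ball x (2 * rr k)) y" using u0(2) by eventually_elim simp
    qed
    also have "\<dots> \<le> ennreal (CPP * rr k powr p * V)" unfolding a_def V_def by (rule CPP[OF u])
    finally have "emeasure N A \<le> ennreal ((2 / \<delta>) powr p) * ennreal (CPP * rr k powr p * V)"
      by (simp add: mult_left_mono)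
    then show ?thesis using CPP_pos V by (simp add: ennreal_mult)
  qed
  have dpow: "(2 / \<delta>) powr p = 2 powr p * \<delta> powr (-p)" using \<delta> by (simp add: powr_divide powr_minus_divide)
  have rp: "(1 / r) powr p * rr k powr p \<le> 2 powr p"
  proof -
    have "(1 / r) powr p * rr k powr p = (rr k / r) powr p" using r by (simp add: powr_divide)
    also have "\<dots> \<le> 2 powr p" using r p0 by (intro powr_mono2) (auto simp: field_simps)
    finally show ?thesis .
  qed
  define h0 where "h0 y = ennreal (2 / \<delta>) * g y + ennreal (1 / r) * indicator (ball x (2 * r)) y" for y
  have g1: "Lp_grad (\<lambda>y. ennreal (2 / \<delta>) * g y) (\<lambda>y. ereal (min 1 (\<phi> y)))"
  proof (rule Lp_grad_cmult[OF niceD(5)[OF u]])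
    fix y z
    have "\<bar>min 1 (\<phi> y) - min 1 (\<phi> z)\<bar> \<le> \<bar>\<phi> y - \<phi> z\<bar>" by auto
    also have "\<phi> y - \<phi> z = 2 / \<delta> * (s * (u y - u z))" by (simp add: \<phi>_def algebra_simps)
    also have "\<bar>\<dots>\<bar> = 2 / \<delta> * \<bar>u y - u z\<bar>" using \<delta> s by (simp add: abs_mult)
    finally show "eabs (ereal (min 1 (\<phi> y)) - ereal (min 1 (\<phi> z))) \<le> ennreal (2 / \<delta>) * eabs (ereal (u y) - ereal (u z))"
      unfolding eabs_real_diff using \<delta> by (simp add: ennreal_leI flip: ennreal_mult)
  qed (use \<delta> in simp)
  have g2: "Lp_grad (\<lambda>y. ennreal (1 / r) * indicator (ball x (2 * r)) y) (\<lambda>y. ereal (\<eta> y))"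
    using \<eta> r ball_fin by (intro Lipschitz_Lp_grad(1)[where c=0]) auto
  have "Lp_grad h0 (\<lambda>y. ereal (f y))"
    unfolding h0_def[abs_def]
  proof (rule Lp_grad_add[OF g1 g2])
    fix y z
    have "\<bar>f y - f z\<bar> \<le> \<bar>min 1 (\<phi> y) - min 1 (\<phi> z)\<bar> + \<bar>\<eta> y - \<eta> z\<bar>" unfolding f_def by linarith
    then show "eabs (ereal (f y) - ereal (f z)) \<le> eabs (ereal (min 1 (\<phi> y)) - ereal (min 1 (\<phi> z))) + eabs (ereal (\<eta> y) - ereal (\<eta> z))"
      unfolding eabs_real_diff by (simp add: ennreal_leI flip: ennreal_plus)
  qed
  then have hL: "Lp_grad (\<lambda>y. h0 y * indicator A y) (\<lambda>y. ereal (f y))"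
    by (rule Lp_grad_indicator[OF _ fA Ab])
  have "energy (\<lambda>y. h0 y * indicator A y) \<le> energy (\<lambda>y. ennreal (2 / \<delta>) * (g y * indicator (ball x (2 * rr k)) y) + ennreal (1 / r) * indicator A y)"
    using r by (intro energy_mono) (auto simp: h0_def indicator_def A_def)
  also have "\<dots> \<le> ennreal (2 powr p) * (energy (\<lambda>y. ennreal (2 / \<delta>) * (g y * indicator (ball x (2 * rr k)) y)) + energy (\<lambda>y. ennreal (1 / r) * indicator A y))"
    by (intro energy_add_le) measurable
  also have "energy (\<lambda>y. ennreal (1 / r) * indicator A y) = ennreal ((1 / r) powr p) * emeasure N A"
  proof -
    have "energy (\<lambda>x. indicator A x) = (\<integral>\<^sup>+x. indicator A x \<partial>N)"
      unfolding energy_def by (intro nn_integral_cong) (auto simp: indicator_def)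
    then show ?thesis using r by (subst energy_cmult) (auto simp: sets_N)
  qed
  also have "energy (\<lambda>y. ennreal (2 / \<delta>) * (g y * indicator (ball x (2 * rr k)) y)) = ennreal ((2 / \<delta>) powr p) * ennreal (nu g x (2 * rr k))"
  proof -
    have "energy (\<lambda>y. g y * indicator (ball x (2 * rr k)) y) = (\<integral>\<^sup>+y\<in>ball x (2 * rr k). g y epowr p \<partial>N)"
      unfolding energy_def by (intro nn_integral_cong) (auto simp: indicator_def)
    then show ?thesis using \<delta> by (subst energy_cmult) (auto simp: nu_eq[OF gfin])
  qed
  also have "ennreal (2 powr p) * (ennreal ((2 / \<delta>) powr p) * ennreal (nu g x (2 * rr k)) + ennreal ((1 / r) powr p) * emeasure N A)
    \<le> ennreal (2 powr p) * (ennreal ((2 / \<delta>) powr p) * ennreal V + ennreal ((1 / r) powr p) * ennreal ((2 / \<delta>) powr p * (CPP * rr k powr p * V)))"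
  proof (intro mult_left_mono add_mono NA)
    have "2 * rr k \<le> 2 * L * rr k" using L8 by simp
    then show "ennreal (nu g x (2 * rr k)) \<le> ennreal V" unfolding V_def
      by (intro ennreal_leI nu_mono gfin subset_ball)
  qed auto
  also have "\<dots> = ennreal (2 powr p * ((2 / \<delta>) powr p * V + (1 / r) powr p * ((2 / \<delta>) powr p * (CPP * rr k powr p * V))))"
    using V CPP_pos by (simp flip: ennreal_mult ennreal_plus)
  also have "\<dots> \<le> ennreal (CT * \<delta> powr (-p) * V)"
  proof (rule ennreal_leI)
    have "(1 / r) powr p * ((2 / \<delta>) powr p * (CPP * rr k powr p * V)) = ((1 / r) powr p * rr k powr p) * ((2 / \<delta>) powr p * (CPP * V))"
      by (simp only: mult_ac)
    also have "\<dots> \<le> 2 powr p * ((2 / \<delta>) powr p * (CPP * V))"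
      using rp V CPP_pos by (intro mult_right_mono) auto
    finally have "2 powr p * ((2 / \<delta>) powr p * V + (1 / r) powr p * ((2 / \<delta>) powr p * (CPP * rr k powr p * V)))
      \<le> 2 powr p * ((2 / \<delta>) powr p * V + 2 powr p * ((2 / \<delta>) powr p * (CPP * V)))" by (intro mult_left_mono add_left_mono) auto
    also have "\<dots> = (2 powr p * 2 powr p) * (1 + 2 powr p * CPP) * \<delta> powr (-p) * V"
      unfolding dpow by (simp only: distrib_left distrib_right mult_1_right mult_1_left mult_ac)
    also have "2 powr p * 2 powr p = (4::real) powr p" by (simp flip: powr_mult)
    finally show "2 powr p * ((2 / \<delta>) powr p * V + (1 / r) powr p * ((2 / \<delta>) powr p * (CPP * rr k powr p * V))) \<le> CT * \<delta> powr (-p) * V"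
      by (simp only: CT_def)
  qed
  finally have en: "energy (\<lambda>y. h0 y * indicator A y) \<le> ennreal (CT * \<delta> powr (-p) * V)" .
  have "(\<integral>\<^sup>+y. ennreal (f y) epowr p \<partial>N) \<le> (\<integral>\<^sup>+y. indicator A y \<partial>N)"
  proof (intro nn_integral_mono)
    fix y show "ennreal (f y) epowr p \<le> indicator A y"
      using fA[of y] f01[of y] epowr_mono[of "ennreal (f y)" 1 p] p0 by (cases "f y = 0") (auto simp: ennreal_le_1)
  qed
  also have "\<dots> = emeasure N A" by (simp add: sets_N)
  also have "\<dots> \<le> ennreal ((2 / \<delta>) powr p * (CPP * rr k powr p * V))" by (rule NA)
  also have "\<dots> \<le> ennreal (CT * \<delta> powr (-p) * V)"
  proof (rule ennreal_leI)
    have "rr k powr p \<le> 1 powr p" using rr_le_1[of k] p0 by (intro powr_mono2) auto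
    then have "CPP * rr k powr p * V \<le> CPP * 1 * V" using CPP_pos V by (intro mult_mono) auto
    then have "(2 / \<delta>) powr p * (CPP * rr k powr p * V) \<le> (2 / \<delta>) powr p * (CPP * 1 * V)" by (rule mult_left_mono) auto
    also have "\<dots> = (2 powr p * CPP) * (\<delta> powr (-p) * V)" unfolding dpow by (simp only: mult_1_right mult_ac)
    also have "\<dots> \<le> CT * (\<delta> powr (-p) * V)"
    proof (rule mult_right_mono)
      have "1 * (2 powr p * CPP) \<le> 4 powr p * (1 + 2 powr p * CPP)"
        using CPP_pos p0 by (intro mult_mono ge_one_powr_ge_zero) auto
      then show "2 powr p * CPP \<le> CT" by (simp add: CT_def)
    qed (use V in simp)
    finally show "(2 / \<delta>) powr p * (CPP * rr k powr p * V) \<le> CT * \<delta> powr (-p) * V" by (simp only: mult.assoc)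
  qed
  finally have fp: "(\<integral>\<^sup>+y. ennreal (f y) epowr p \<partial>N) \<le> ennreal (CT * \<delta> powr (-p) * V)" .
  have f1: "f y = 1" if "y \<in> ball x r" "\<delta> \<le> s * (u y - a)" for y
  proof -
    have "1 \<le> \<phi> y" using that(2) \<delta> by (simp add: \<phi>_def field_simps)
    then show ?thesis using \<eta>(3)[OF that(1)] by (simp add: f_def)
  qed
  have f0: "f y = 0" if "y \<notin> ball x (2 * r)" for y
    using \<eta>(4)[OF that] by (simp add: f_def)
  show ?thesis
    using fM f01 f1 f0 hL en fp unfolding V_def a_def by (intro exI[of _ f] exI[of _ "\<lambda>y. h0 y * indicator A y"]) blast
qed

section \<open>Lower bound for the capacity of a ball\<close>

lemma nice_supportI:
  assumes "u \<in> borel_measurable M" "\<And>x. 0 \<le> u x" "\<And>x. u x \<le> 1" "\<And>y. y \<notin> ball x r \<Longrightarrow> u y = 0"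
    "Lp_grad g (\<lambda>x. ereal (u x))"
  shows "nice u g"
proof -
  have "(\<integral>\<^sup>+y. ennreal (u y) \<partial>N) \<le> (\<integral>\<^sup>+y. indicator (ball x r) y \<partial>N)"
  proof (intro nn_integral_mono)
    fix y show "ennreal (u y) \<le> indicator (ball x r) y"
      using assms(3,4)[of y] by (cases "y \<in> ball x r") (auto simp: ennreal_le_1)
  qed
  also have "\<dots> < \<infinity>" using ball_fin by simp
  finally show ?thesis using assms by (simp add: nice_def)
qed

text \<open>Otherwise the indicator of the smaller ball would have upper gradient 0, contradicting the
  Poincare inequality on a ball reaching \<open>y\<close>.\<close>
lemma annulus_nonempty:
  fixes x y :: 'a
  assumes r: "0 < r" and y: "3 * r \<le> dist x y"
  shows "\<exists>z. 3 * r \<le> dist x z \<and> dist x z \<le> 7 / 2 * r"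
proof (rule ccontr)
  assume no: "\<not> (\<exists>z. 3 * r \<le> dist x z \<and> dist x z \<le> 7 / 2 * r)"
  define v where "v = (indicator (ball x (3 * r)) :: 'a \<Rightarrow> real)"
  have v: "v z = 1" if "dist x z < 3 * r" for z using that by (simp add: v_def)
  have v0: "v z = 0" if "3 * r \<le> dist x z" for z using that by (simp add: v_def)
  have yfar: "7 / 2 * r < dist x y" using no y by force
  \<comment> \<open>The distance to x varies continuously along a curve and cannot skip the value
    3r.\<close>
  have jump: False if c: "continuous_on {s..t} \<gamma>" and st: "s \<le> t" and *: "dist x (\<gamma> s) < 3 * r \<longleftrightarrow> \<not> dist x (\<gamma> t) < 3 * r" for \<gamma> :: "real \<Rightarrow> 'a" and s t
  proof -
    have c': "continuous_on {s..t} (\<lambda>a. dist x (\<gamma> a))" using c by (intro continuous_intros)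
    have "\<exists>a. s \<le> a \<and> a \<le> t \<and> dist x (\<gamma> a) = 3 * r"
    proof (cases "dist x (\<gamma> s) < 3 * r")
      case True then show ?thesis using * st by (intro IVT' c') auto
    next
      case False then show ?thesis using * st by (intro IVT2' c') auto
    qed
    then obtain a where "dist x (\<gamma> a) = 3 * r" by blast
    then show False using no r by (auto dest!: spec[of _ "\<gamma> a"])
  qed
  have "Lp_grad (\<lambda>_. 0) (\<lambda>z. ereal (v z))"
    unfolding Lp_grad_def weak_grad_def
  proof (intro conjI ae_curveI)
    fix \<gamma> :: "real \<Rightarrow> 'a" and l assume \<gamma>: "arc_length_curve \<gamma> l"
    show "good_curve (\<lambda>_. 0) (\<lambda>z. ereal (v z)) \<gamma> l" unfolding good_curve_def
    proof (intro allI impI)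
      fix s t assume st: "0 \<le> s" "s < t" "t \<le> l"
      have "continuous_on {s..t} \<gamma>" using st by (intro continuous_on_subset[OF arc_length_curve_continuous[OF \<gamma>]]) auto
      then have "dist x (\<gamma> s) < 3 * r \<longleftrightarrow> dist x (\<gamma> t) < 3 * r" using jump st by fastforce
      then have "v (\<gamma> s) = v (\<gamma> t)" by (simp add: v_def indicator_def)
      then show "eabs (ereal (v (\<gamma> s)) - ereal (v (\<gamma> t))) \<le> path_int (\<lambda>_. 0) \<gamma> s t" unfolding eabs_real_diff by simp
    qed
  qed (auto simp: energy_def)
  then have n: "nice v (\<lambda>_. 0)"
    by (intro nice_supportI[where x=x and r="3 * r"]) (auto simp: v_def intro!: measurable_M)
  \<comment> \<open>Large enough for the ball about x to contain the ball of radius r / 2 about y.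
    There the indicator vanishes, since y lies beyond 7/2 r; a constant mean value cannot match both
    1 and 0.\<close>
  define \<rho> where "\<rho> = dist x y + r"
  have \<rho>: "0 < \<rho>" using r by (simp add: \<rho>_def add_nonneg_pos)
  define a where "a = avg v x \<rho>"
  have "nu (\<lambda>_. 0) x (K * \<rho>) = 0" by (simp add: nu_def)
  then have "(\<integral>\<^sup>+z\<in>ball x \<rho>. ennreal \<bar>v z - a\<bar> \<partial>N) \<le> 0"
    using nice_poincare[OF n \<rho>, of x] by (simp add: a_def)
  then have I0: "(\<integral>\<^sup>+z\<in>ball x \<rho>. ennreal \<bar>v z - a\<bar> \<partial>N) = 0" by simp
  have sub: "c = a" if B: "ball w s \<subseteq> ball x \<rho>" "0 < s" "\<And>z. z \<in> ball w s \<Longrightarrow> v z = c" for w s c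
  proof -
    have "(\<integral>\<^sup>+z. ennreal \<bar>c - a\<bar> * indicator (ball w s) z \<partial>N) \<le> (\<integral>\<^sup>+z\<in>ball x \<rho>. ennreal \<bar>v z - a\<bar> \<partial>N)"
    proof (intro nn_integral_mono)
      fix z show "ennreal \<bar>c - a\<bar> * indicator (ball w s) z \<le> ennreal \<bar>v z - a\<bar> * indicator (ball x \<rho>) z"
      proof (cases "z \<in> ball w s")
        case True
        then have "z \<in> ball x \<rho>" using B(1) by blast
        then show ?thesis using True B(3)[OF True] by (simp only: indicator_simps order_refl)
      qed simp
    qed
    then have "ennreal \<bar>c - a\<bar> * ennreal (mb w s) = 0" using I0 by (simp add: nn_integral_cmult emeasure_ball)
    then show "c = a" using mb_pos[OF B(2), of w] by (simp add: ennreal_eq_0_iff)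
  qed
  have "1 = a"
  proof (rule sub[of x r])
    show "ball x r \<subseteq> ball x \<rho>" by (rule subset_ball) (simp add: \<rho>_def)
  qed (use r v in auto)
  moreover have "0 = a"
  proof (rule sub[of y "r / 2"])
    show "ball y (r / 2) \<subseteq> ball x \<rho>" using r by (intro ball_subset) (auto simp: \<rho>_def dist_commute)
    fix z assume "z \<in> ball y (r / 2)"
    then have "3 * r \<le> dist x z" using yfar dist_triangle[of x y z] by (simp add: dist_commute)
    then show "v z = 0" by (rule v0)
  qed (use r in auto)
  ultimately show False by simp
qed

text \<open>Four doublings compare \<open>mb x r\<close> with a ball of radius r / 2 about a point
  of the annulus and two more bound \<open>mb x (4 * r)\<close>, whence \<open>CD ^ 6\<close>;
  \<open>8 * CP\<close> is the Poincare constant for radius 4r.\<close>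

definition CL :: real where "CL = (1 / (8 * CP * CD ^ 6)) powr p"

lemma CL_pos: "0 < CL" using CP CD by (simp add: CL_def)

text \<open>The function is 1 on the ball of radius r about x and 0 on the ball of radius r / 2
  about a point z of the annulus. The bounds 3r and 7/2 r keep the latter outside the support and
  inside the ball of radius 4r. Whatever the mean a is, |1 - a| + |a| is at least 1, so the Poincare
  inequality forces energy.\<close>

lemma energy_lower_bound:
  assumes r: "0 < r" and y: "3 * r \<le> dist x y"
    and f: "f \<in> borel_measurable M" "\<And>z. 0 \<le> f z" "\<And>z. f z \<le> 1" "\<And>z. z \<in> ball x r \<Longrightarrow> f z = 1"
      "\<And>z. z \<notin> ball x (2 * r) \<Longrightarrow> f z = 0" and h: "Lp_grad h (\<lambda>z. ereal (f z))"
  shows "ennreal (CL * mb x r * r powr (-p)) \<le> energy h"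
proof -
  have n: "nice f h" by (rule nice_supportI[OF f(1-3,5) h])
  obtain z where z: "3 * r \<le> dist x z" "dist x z \<le> 7 / 2 * r" using annulus_nonempty[OF r y] by blast
  have r4: "0 < 4 * r" using r by simp
  define a where "a = avg f x (4 * r)"
  define m where "m = mb x r"
  have m: "0 < m" unfolding m_def by (rule mb_pos[OF r])
  define E where "E = enn2real (energy h)"
  have E: "energy h = ennreal E" "0 \<le> E" using niceD(6)[OF n] by (auto simp: E_def)
  have zr: "m \<le> CD ^ 4 * mb z (r / 2)"
    unfolding m_def using r z by (intro mb_comp) auto
  have "(m / CD ^ 4) \<le> \<bar>1 - a\<bar> * m + \<bar>a\<bar> * mb z (r / 2)"
  proof -
    have 1: "m / CD ^ 4 \<le> mb z (r / 2)" using zr CD by (simp add: field_simps)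
    have "m * 1 \<le> m * CD ^ 4" using CD m by (intro mult_left_mono one_le_power) auto
    then have 2: "m / CD ^ 4 \<le> m" using CD by (simp add: field_simps)
    have "m / CD ^ 4 * 1 \<le> m / CD ^ 4 * (\<bar>1 - a\<bar> + \<bar>a\<bar>)" using m CD by (intro mult_left_mono) auto
    also have "\<dots> = \<bar>1 - a\<bar> * (m / CD ^ 4) + \<bar>a\<bar> * (m / CD ^ 4)" by (simp only: distrib_right mult.commute)
    also have "\<dots> \<le> \<bar>1 - a\<bar> * m + \<bar>a\<bar> * mb z (r / 2)" using 1 2 by (intro add_mono mult_left_mono) auto
    finally show ?thesis by simp
  qed
  then have "ennreal (m / CD ^ 4) \<le> ennreal (\<bar>1 - a\<bar> * m + \<bar>a\<bar> * mb z (r / 2))" by (rule ennreal_leI)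
  also have "\<dots> = ennreal \<bar>1 - a\<bar> * emeasure N (ball x r) + ennreal \<bar>a\<bar> * emeasure N (ball z (r / 2))"
    using m by (simp add: emeasure_ball m_def ennreal_mult)
  also have "\<dots> = (\<integral>\<^sup>+w. ennreal \<bar>1 - a\<bar> * indicator (ball x r) w + ennreal \<bar>a\<bar> * indicator (ball z (r / 2)) w \<partial>N)"
    by (simp add: nn_integral_add nn_integral_cmult)
  also have "\<dots> \<le> (\<integral>\<^sup>+w\<in>ball x (4 * r). ennreal \<bar>f w - a\<bar> \<partial>N)"
  proof (intro nn_integral_mono)
    fix w
    show "ennreal \<bar>1 - a\<bar> * indicator (ball x r) w + ennreal \<bar>a\<bar> * indicator (ball z (r / 2)) w
      \<le> ennreal \<bar>f w - a\<bar> * indicator (ball x (4 * r)) w"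
    proof (cases "w \<in> ball x r")
      case True
      then have "w \<notin> ball z (r / 2)" using z r dist_triangle[of x z w] by (auto simp: dist_commute)
      then show ?thesis using True f(4)[OF True] r by (simp add: indicator_def)
    next
      case F: False
      show ?thesis
      proof (cases "w \<in> ball z (r / 2)")
        case True
        then have "dist x w < 4 * r" using z r dist_triangle[of x w z] by (simp add: dist_commute)
        moreover have "2 * r \<le> dist x w" using True z r dist_triangle[of x z w] by (simp add: dist_commute)
        then have "f w = 0" by (intro f(5)) simp
        ultimately show ?thesis using True F by (simp add: indicator_def)
      qed (use F in \<open>simp add: indicator_def\<close>)
    qed
  qed
  also have "\<dots> \<le> ennreal (mb x (4 * r) * (2 * CP * (4 * r)) * (nu h x (K * (4 * r)) / mb x (K * (4 * r))) powr (1 / p))"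
    unfolding a_def by (rule nice_poincare[OF n r4])
  also have "\<dots> \<le> ennreal ((CD ^ 2 * m) * (8 * CP * r) * (E / m) powr (1 / p))"
  proof (rule ennreal_leI)
    have eq: "2 * CP * (4 * r) = 8 * CP * r" by simp
    have "mb x (4 * r) \<le> CD ^ 2 * m" unfolding m_def using r by (intro mb_comp) auto
    moreover have "(nu h x (K * (4 * r)) / mb x (K * (4 * r))) powr (1 / p) \<le> (E / m) powr (1 / p)"
    proof (intro powr_mono2 frac_le)
      have "ennreal (nu h x (K * (4 * r))) \<le> ennreal E"
        unfolding nu_eq[OF niceD(6)[OF n], symmetric] E(1)[symmetric] energy_def
        by (intro nn_integral_mono) (auto simp: indicator_def)
      then show "nu h x (K * (4 * r)) \<le> E" using E(2) by simp
      have "1 * r \<le> K * (4 * r)" using K r by (intro mult_mono) auto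
      then show "m \<le> mb x (K * (4 * r))" unfolding m_def by (intro mb_mono subset_ball) simp
    qed (use p0 E m in auto)
    ultimately show "mb x (4 * r) * (2 * CP * (4 * r)) * (nu h x (K * (4 * r)) / mb x (K * (4 * r))) powr (1 / p)
      \<le> (CD ^ 2 * m) * (8 * CP * r) * (E / m) powr (1 / p)"
      unfolding eq using CP r CD m by (intro mult_mono[OF mult_right_mono]) auto
  qed
  finally have "m / CD ^ 4 \<le> (CD ^ 2 * m) * (8 * CP * r) * (E / m) powr (1 / p)"
    using m CD CP r by (subst (asm) ennreal_le_iff) auto
  then have "m * (1 / CD ^ 4) \<le> m * (CD ^ 2 * (8 * CP * r) * (E / m) powr (1 / p))"
    by (simp add: mult_ac)
  then have "1 / CD ^ 4 \<le> CD ^ 2 * (8 * CP * r) * (E / m) powr (1 / p)"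
    using m by (simp only: mult_le_cancel_left_pos)
  then have "1 / CD ^ 4 / (8 * CP * CD ^ 2) \<le> r * (E / m) powr (1 / p)"
    using CP CD by (simp add: divide_le_eq mult_ac)
  also have "1 / CD ^ 4 / (8 * CP * CD ^ 2) = 1 / (8 * CP * CD ^ 6)"
    by (simp add: mult_ac flip: power_add)
  finally have "CL \<le> (r * (E / m) powr (1 / p)) powr p"
    unfolding CL_def using CP CD p0 by (intro powr_mono2) auto
  also have "\<dots> = r powr p * (E / m)" using r E m p0 by (simp add: powr_mult powr_powr)
  finally have "CL * m \<le> r powr p * E" using m by (simp add: field_simps)
  then have "CL * m * r powr (-p) \<le> (r powr p * E) * r powr (-p)" by (rule mult_right_mono) simp
  also have "\<dots> = E" using r by (simp add: powr_minus)
  finally show ?thesis unfolding E(1) m_def by (rule ennreal_leI)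
qed

end

section \<open>The Wolff potential\<close>

text \<open>The supremum may be uncountable, but its superlevel sets are unions of open
  balls.\<close>

lemma measurable_SUP_balls:
  fixes f :: "'a::metric_space \<Rightarrow> ennreal"
  shows "(\<lambda>x. SUP y. f y * indicator (ball y r) x) \<in> borel_measurable borel"
proof (rule borel_measurableI_greater)
  fix t :: ennreal
  have "{x. t < f y * indicator (ball y r) x} = (if t < f y then ball y r else {})" for y
    by (auto simp: indicator_def)
  then have "{x \<in> space borel. t < (SUP y. f y * indicator (ball y r) x)} = (\<Union>y. if t < f y then ball y r else {})"
    unfolding less_SUP_iff by (simp add: set_eq_iff) blast
  also have "\<dots> \<in> sets borel" by (intro borel_open open_UN) auto
  finally show "{x \<in> space borel. t < (SUP y. f y * indicator (ball y r) x)} \<in> sets borel" .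
qed

text \<open>Bounded support of \<open>g\<close> makes every \<open>c k\<close> bounded with bounded
  support. The bounds may depend on k: they are used only for the three coarsest scales and for
  qualitative finiteness.\<close>

locale wolff = pi_space +
  fixes g x0 R
  assumes gb [measurable]: "g \<in> borel_measurable borel" and gfin: "energy g < \<infinity>"
    and supp: "\<And>y. y \<notin> ball x0 R \<Longrightarrow> g y = 0"
begin

definition E :: real where "E = enn2real (energy g)"

lemma rr_neq [simp]: "rr k \<noteq> 0" using rr_pos(1)[of k] by linarith

lemma E: "energy g = ennreal E" "0 \<le> E" using gfin by (auto simp: E_def)

section \<open>Terms of the Wolff sum\<close>

definition c :: "nat \<Rightarrow> 'a \<Rightarrow> real" where "c k y = om g k y powr (1 / (p - 1))"

lemma c_nonneg [simp]: "0 \<le> c k y" by (simp add: c_def)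

lemma nu_le_E: "nu g x r \<le> E"
proof -
  have "ennreal (nu g x r) \<le> ennreal E"
    unfolding nu_eq[OF gfin, symmetric] E(1)[symmetric] energy_def
    by (intro nn_integral_mono) (auto simp: indicator_def)
  then show ?thesis using E(2) by simp
qed

lemma c_support: assumes "c k y \<noteq> 0" shows "dist y x0 < R + L"
proof (rule ccontr)
  assume far: "\<not> dist y x0 < R + L"
  have "(\<integral>\<^sup>+z\<in>ball y (L * rr k). g z epowr p \<partial>N) = (\<integral>\<^sup>+z. 0 \<partial>N)"
  proof (intro nn_integral_cong)
    fix z
    have "L * rr k \<le> L" using mult_left_mono[OF rr_le_1[of k], of L] L8 by simp
    then have "z \<in> ball y (L * rr k) \<Longrightarrow> z \<notin> ball x0 R"
      using far dist_triangle[of y x0 z] by (auto simp: dist_commute)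
    then show "g z epowr p * indicator (ball y (L * rr k)) z = 0"
      using supp[of z] by (cases "z \<in> ball y (L * rr k)") (auto simp: indicator_def)
  qed
  then have "nu g y (L * rr k) = 0" by (simp add: nu_def)
  then show False using assms by (simp add: c_def om_def)
qed

lemma c_bounded: "\<exists>B>0. \<forall>y. c k y \<le> B"
proof -
  obtain n where "(\<bar>R\<bar> + L + 1) / rr k < 2 ^ n" using real_arch_pow[of 2] by auto
  then have n: "\<bar>R\<bar> + L + 1 \<le> 2 ^ n * rr k" by (simp add: divide_less_eq)
  let ?B = "(E * CD ^ n / mb x0 1) powr (1 / (p - 1))"
  have "c k y \<le> ?B" for y
  proof (cases "c k y = 0")
    case False
    have y: "dist y x0 < R + L" by (rule c_support[OF False])
    have "dist x0 y + 1 \<le> 2 ^ n * rr k" using y n abs_ge_self[of R] by (simp add: dist_commute) 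
    then have m: "mb x0 1 \<le> CD ^ n * mb y (rr k)" by (intro mb_comp) auto
    have mp: "0 < mb x0 1" "0 < mb y (rr k)" by (auto intro: mb_pos)
    have "rr k powr p \<le> 1 powr p" using rr_le_1 p0 by (intro powr_mono2) auto
    then have "om g k y \<le> 1 * (E / mb y (rr k))" unfolding om_def
      using mp nu_le_E by (intro mult_mono divide_right_mono) auto
    also have "\<dots> \<le> E * CD ^ n / mb x0 1"
    proof -
      have "1 / mb y (rr k) \<le> CD ^ n / mb x0 1" using m mp by (simp add: field_simps)
      then have "E * (1 / mb y (rr k)) \<le> E * (CD ^ n / mb x0 1)" using E by (intro mult_left_mono) auto
      then show ?thesis by simp
    qed
    finally show ?thesis unfolding c_def using p by (intro powr_mono2) auto
  qed simp
  moreover have "0 < ?B + 1" by (simp add: add_nonneg_pos)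
  ultimately show ?thesis by (intro exI[of _ "?B + 1"] conjI allI) (auto intro: add_increasing2)
qed

definition Bc :: "nat \<Rightarrow> real" where "Bc k = (SOME B. 0 < B \<and> (\<forall>y. c k y \<le> B))"

lemma Bc: "0 < Bc k" "c k y \<le> Bc k"
  using someI_ex[OF c_bounded[of k]] unfolding Bc_def[symmetric] by blast+

definition Cq :: real where "Cq = (CD ^ (mL + 3)) powr (1 / (p - 1))"

lemma Cq_pos: "0 < Cq" using CD by (simp add: Cq_def)

text \<open>Going up three scales multiplies the radius by 8, and 6/8 + 1/8 < 1 leaves room to move
  the center: the ball about z stays inside the ball about x.\<close>

lemma c_compare:
  assumes d: "dist z x \<le> 6 * L * rr (i + 3)" shows "c (i + 3) z \<le> Cq * c i x"
proof -
  have r: "rr (i + 3) = rr i / 8" by (simp add: rr_def power_add power3_eq_cube)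
  have "ball z (L * rr (i + 3)) \<subseteq> ball x (L * rr i)"
  proof (rule ball_subset)
    have "0 \<le> L * rr i" using L8 by simp
    then show "dist z x + L * rr (i + 3) \<le> L * rr i" using d by (simp add: r)
  qed
  then have 1: "nu g z (L * rr (i + 3)) \<le> nu g x (L * rr i)" by (intro nu_mono gfin)
  have "dist x z + rr i \<le> 2 ^ (mL + 3) * rr (i + 3)"
  proof -
    have "8 * rr i \<le> L * rr i" using L8 by (intro mult_right_mono) auto
    moreover have "dist x z \<le> 3 / 4 * (L * rr i)" using d by (simp add: r dist_commute)
    ultimately have "dist x z + rr i \<le> L * rr i" using rr_pos(1)[of i] by linarith
    moreover have "(2::real) ^ (mL + 3) * rr (i + 3) = L * rr i" by (simp add: L_def r power_add)
    ultimately show ?thesis by simp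
  qed
  then have m: "mb x (rr i) \<le> CD ^ (mL + 3) * mb z (rr (i + 3))" by (intro mb_comp) auto
  have mp: "0 < mb x (rr i)" "0 < mb z (rr (i + 3))" by (auto intro: mb_pos)
  have "1 / mb z (rr (i + 3)) \<le> CD ^ (mL + 3) / mb x (rr i)" using m mp by (simp add: field_simps)
  then have "nu g z (L * rr (i + 3)) * (1 / mb z (rr (i + 3))) \<le> nu g x (L * rr i) * (CD ^ (mL + 3) / mb x (rr i))"
    using 1 by (intro mult_mono) auto
  then have "rr (i + 3) powr p * (nu g z (L * rr (i + 3)) * (1 / mb z (rr (i + 3))))
    \<le> rr i powr p * (nu g x (L * rr i) * (CD ^ (mL + 3) / mb x (rr i)))"
  proof -
    have "rr (i + 3) powr p \<le> rr i powr p" using p0 by (intro powr_mono2 rr_mono) auto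
    moreover assume "nu g z (L * rr (i + 3)) * (1 / mb z (rr (i + 3))) \<le> nu g x (L * rr i) * (CD ^ (mL + 3) / mb x (rr i))"
    ultimately show ?thesis by (rule mult_mono) (use mp in auto)
  qed
  then have "om g (i + 3) z \<le> CD ^ (mL + 3) * om g i x" by (simp add: om_def mult_ac)
  then have "c (i + 3) z \<le> (CD ^ (mL + 3) * om g i x) powr (1 / (p - 1))"
    unfolding c_def using p by (intro powr_mono2) auto
  then show ?thesis by (simp add: powr_mult Cq_def c_def)
qed

section \<open>Lipschitz majorants of the terms and their gradients\<close>

definition a :: "nat \<Rightarrow> 'a \<Rightarrow> ennreal" where
  "a k x = (SUP y. ennreal (c k y / rr k) * indicator (ball y (rr k)) x)"

definition bump :: "nat \<Rightarrow> 'a \<Rightarrow> 'a \<Rightarrow> real" where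
  "bump k y x = c k y * max 0 (1 - dist x y / rr k)"

text \<open>A majorant of \<open>c k\<close> that is Lipschitz at scale \<open>rr k\<close>, with weak upper gradient \<open>a k\<close>.\<close>
definition \<psi> :: "nat \<Rightarrow> 'a \<Rightarrow> real" where "\<psi> k x = (SUP y. bump k y x)"

lemma a_measurable [measurable]: "a k \<in> borel_measurable borel"
  unfolding a_def[abs_def] by (rule measurable_SUP_balls)

lemma a_le: assumes "\<And>y. dist y x < rr k \<Longrightarrow> c k y \<le> B" shows "a k x \<le> ennreal (B / rr k)"
  unfolding a_def
proof (rule SUP_least)
  fix y show "ennreal (c k y / rr k) * indicator (ball y (rr k)) x \<le> ennreal (B / rr k)"
    using assms[of y] by (auto simp: indicator_def intro!: ennreal_leI divide_right_mono)
qed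

lemma bump_bounds: "0 \<le> bump k y x" "bump k y x \<le> Bc k"
proof -
  have "bump k y x \<le> c k y * 1" unfolding bump_def by (intro mult_left_mono) auto
  then show "bump k y x \<le> Bc k" using Bc(2)[of k y] by linarith
qed (simp add: bump_def)

lemma bump_bdd: "bdd_above (range (\<lambda>y. bump k y x))"
  using bump_bounds by (intro bdd_aboveI[of _ "Bc k"]) auto

lemma \<psi>_ge: "bump k y x \<le> \<psi> k x" unfolding \<psi>_def by (rule cSUP_upper[OF UNIV_I bump_bdd])

lemma \<psi>_ge_c: "c k x \<le> \<psi> k x" using \<psi>_ge[of k x x] by (simp add: bump_def)

lemma \<psi>_nonneg: "0 \<le> \<psi> k x" using \<psi>_ge[of k x x] bump_bounds(1)[of k x x] by linarith

lemma \<psi>_le_a: "ennreal (\<psi> k x) \<le> ennreal (rr k) * a k x"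
proof -
  have "a k x \<le> ennreal (Bc k / rr k)" by (rule a_le) (rule Bc)
  then obtain s where s: "a k x = ennreal s" "0 \<le> s" by (cases "a k x") (auto simp: top_unique)
  have "bump k y x \<le> rr k * s" for y
  proof (cases "dist y x < rr k")
    case True
    have "ennreal (c k y / rr k) * indicator (ball y (rr k)) x \<le> ennreal s"
      unfolding s(1)[symmetric] a_def by (rule SUP_upper) simp
    then have "c k y / rr k \<le> s" using True s(2) by (simp add: indicator_def)
    then have "c k y \<le> rr k * s" by (simp add: field_simps)
    moreover have "bump k y x \<le> c k y * 1" unfolding bump_def by (intro mult_left_mono) auto
    ultimately show ?thesis by linarith
  next
    case False
    then have "bump k y x = 0" by (simp add: bump_def dist_commute field_simps max_def)
    then show ?thesis using s(2) by simp
  qed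
  then have "\<psi> k x \<le> rr k * s" unfolding \<psi>_def by (intro cSUP_least) auto
  then show ?thesis using s by (simp add: ennreal_leI flip: ennreal_mult)
qed

lemma bump_Lipschitz: "\<bar>bump k y x - bump k y z\<bar> \<le> c k y / rr k * dist x z"
proof -
  have "\<bar>dist x y - dist z y\<bar> \<le> dist x z" using dist_triangle2[of x y z] dist_triangle2[of z y x]
    dist_triangle[of x y z] dist_triangle[of z y x] by (simp add: abs_le_iff dist_commute)
  then have "\<bar>dist x y / rr k - dist z y / rr k\<bar> \<le> dist x z / rr k"
    by (simp add: divide_right_mono flip: diff_divide_distrib)
  then have "\<bar>max 0 (1 - dist x y / rr k) - max 0 (1 - dist z y / rr k)\<bar> \<le> dist x z / rr k" by linarith
  then have "c k y * \<bar>max 0 (1 - dist x y / rr k) - max 0 (1 - dist z y / rr k)\<bar> \<le> c k y * (dist x z / rr k)"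
    by (rule mult_left_mono) simp
  then show ?thesis by (simp add: bump_def abs_mult flip: right_diff_distrib)
qed

lemma \<psi>_measurable [measurable]: "\<psi> k \<in> borel_measurable borel"
proof (rule borel_measurableI_greater)
  fix t
  have "continuous_on UNIV (bump k y)" for y
    unfolding bump_def by (intro continuous_intros) (simp add: less_imp_neq[OF rr_pos(1), symmetric])
  then have "open {x. t < bump k y x}" for y
    by (intro open_Collect_less continuous_intros) auto
  moreover have "{x \<in> space borel. t < \<psi> k x} = (\<Union>y. {x. t < bump k y x})"
    unfolding \<psi>_def using bump_bdd by (auto simp: less_cSUP_iff)
  ultimately show "{x \<in> space borel. t < \<psi> k x} \<in> sets borel"
    by (metis (no_types, lifting) borel_open open_UN)
qed

lemma \<psi>_weak_grad: "weak_grad M p (a k) (\<lambda>x. ereal (\<psi> k x))"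
  unfolding weak_grad_def
proof (intro conjI a_measurable ae_curveI)
  fix \<gamma> :: "real \<Rightarrow> 'a" and l assume \<gamma>: "arc_length_curve \<gamma> l"
  have good: "good_curve (a k) (\<lambda>x. ereal (bump k y x)) \<gamma> l" for y
  proof -
    have "good_curve (\<lambda>x. ennreal (c k y / rr k) * indicator (ball y (rr k)) x) (\<lambda>x. ereal (bump k y x)) \<gamma> l"
    proof (rule good_curve_indicator[where c=0])
      show "good_curve (\<lambda>_. ennreal (c k y / rr k)) (\<lambda>x. ereal (bump k y x)) \<gamma> l"
        by (rule Lipschitz_good_curve[OF bump_Lipschitz _ \<gamma>]) simp
      show "path_int (\<lambda>_. ennreal (c k y / rr k)) \<gamma> 0 l < \<infinity>"
        using \<gamma> by (simp add: path_int_def nn_integral_cmult ennreal_mult_less_top arc_length_curve_def)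
      show "x \<in> ball y (rr k)" if "bump k y x \<noteq> 0" for x
        using that by (auto simp: bump_def max_def dist_commute field_simps split: if_splits)
    qed (use \<gamma> in auto)
    moreover have "ennreal (c k y / rr k) * indicator (ball y (rr k)) x \<le> a k x" for x
      unfolding a_def by (rule SUP_upper) simp
    ultimately show ?thesis unfolding good_curve_def by (meson order_trans path_int_mono)
  qed
  show "good_curve (a k) (\<lambda>x. ereal (\<psi> k x)) \<gamma> l" unfolding good_curve_def
  proof (intro allI impI)
    fix s t assume st: "0 \<le> s" "s < t" "t \<le> l"
    have "eabs (ereal (\<psi> k (\<gamma> s)) - ereal (\<psi> k (\<gamma> t))) \<le> (SUP y. eabs (ereal (bump k y (\<gamma> s)) - ereal (bump k y (\<gamma> t))))"
      unfolding \<psi>_def by (rule eabs_SUP_diff_le[OF bump_bounds])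
    also have "\<dots> \<le> path_int (a k) \<gamma> s t"
      by (rule SUP_least) (use good st in \<open>unfold good_curve_def, blast\<close>)
    finally show "eabs (ereal (\<psi> k (\<gamma> s)) - ereal (\<psi> k (\<gamma> t))) \<le> path_int (a k) \<gamma> s t" .
  qed
qed

definition dn :: "nat \<Rightarrow> 'a \<Rightarrow> ennreal" where
  "dn i x = (\<integral>\<^sup>+z\<in>ball x (2 * L * rr i). g z epowr p \<partial>N) / ennreal (mb x (rr i))"

lemma dn_measurable [measurable]: "dn i \<in> borel_measurable borel"
  unfolding dn_def[abs_def] by measurable

text \<open>The power p - 1 undoes the root in \<open>c\<close>, so the bound is linear in the
  energy measure and integrates by Fubini. The dilation is doubled in \<open>dn\<close> to absorb
  the distance between x and the centers y.\<close>

lemma a_powr_le: "a i x epowr (p - 1) \<le> ennreal (CD * rr i) * dn i x"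
proof -
  let ?d = "nu g x (2 * L * rr i) / mb x (rr i)"
  have mp: "0 < mb x (rr i)" by (auto intro: mb_pos)
  have dn: "dn i x = ennreal ?d" using mp by (simp add: dn_def nu_eq[OF gfin] divide_ennreal)
  have "c i y \<le> (rr i powr p * (CD * ?d)) powr (1 / (p - 1))" if y: "dist y x < rr i" for y
  proof -
    have "ball y (L * rr i) \<subseteq> ball x (2 * L * rr i)"
    proof (rule ball_subset)
      have "8 * rr i \<le> L * rr i" using L8 by (rule mult_right_mono) simp
      then show "dist y x + L * rr i \<le> 2 * L * rr i" using y rr_pos(1)[of i] by linarith
    qed
    then have 1: "nu g y (L * rr i) \<le> nu g x (2 * L * rr i)" by (intro nu_mono gfin)
    have "mb x (rr i) \<le> CD ^ 1 * mb y (rr i)" using y by (intro mb_comp) (auto simp: dist_commute)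
    then have "1 / mb y (rr i) \<le> CD / mb x (rr i)" using mp mb_pos[of "rr i" y] by (simp add: field_simps)
    then have "nu g y (L * rr i) * (1 / mb y (rr i)) \<le> nu g x (2 * L * rr i) * (CD / mb x (rr i))"
      using 1 by (intro mult_mono) auto
    then have "rr i powr p * (nu g y (L * rr i) * (1 / mb y (rr i))) \<le> rr i powr p * (nu g x (2 * L * rr i) * (CD / mb x (rr i)))"
      by (rule mult_left_mono) auto
    then have "om g i y \<le> rr i powr p * (CD * ?d)" by (simp add: om_def mult_ac)
    then show ?thesis unfolding c_def using p by (intro powr_mono2) auto
  qed
  then have "a i x \<le> ennreal ((rr i powr p * (CD * ?d)) powr (1 / (p - 1)) / rr i)" by (rule a_le)
  then have "a i x epowr (p - 1) \<le> ennreal ((rr i powr p * (CD * ?d)) powr (1 / (p - 1)) / rr i) epowr (p - 1)"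
    using p by (intro epowr_mono) auto
  also have "\<dots> = ennreal (((rr i powr p * (CD * ?d)) powr (1 / (p - 1)) / rr i) powr (p - 1))"
    by (simp add: epowr_ennreal)
  also have "((rr i powr p * (CD * ?d)) powr (1 / (p - 1)) / rr i) powr (p - 1) = rr i powr p * (CD * ?d) / rr i powr (p - 1)"
  proof -
    have "(X powr (1 / (p - 1)) / rr i) powr (p - 1) = X / rr i powr (p - 1)" if "0 \<le> X" for X
      using p that by (simp add: powr_divide powr_powr)
    then show ?thesis using mp CD by simp
  qed
  also have "\<dots> = CD * rr i * ?d" by (simp add: powr_diff)
  also have "ennreal \<dots> = ennreal (CD * rr i) * ennreal ?d" using CD mp by (intro ennreal_mult) auto
  finally show ?thesis by (simp only: dn)
qed

lemma dn_integral:
  assumes [measurable]: "b \<in> borel_measurable borel" "B \<in> borel_measurable borel"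
    and B: "\<And>x y. dist y x < 2 * L * rr i \<Longrightarrow> b x \<le> B y"
  shows "(\<integral>\<^sup>+x. b x * dn i x \<partial>N) \<le> ennreal (CD ^ (mL + 2)) * (\<integral>\<^sup>+y. g y epowr p * B y \<partial>N)"
  unfolding dn_def by (intro ball_maximal_le B) (auto simp: L_def)

section \<open>The truncated potential\<close>

definition v :: "nat \<Rightarrow> 'a \<Rightarrow> real" where "v n x = (\<Sum>i\<le>n. \<psi> i x)"

lemma v_measurable [measurable]: "v n \<in> borel_measurable borel"
  unfolding v_def[abs_def] by measurable

lemma v_nonneg: "0 \<le> v n x" unfolding v_def by (intro sum_nonneg \<psi>_nonneg)

lemma v_mono: "m \<le> n \<Longrightarrow> v m x \<le> v n x"
  unfolding v_def by (intro sum_mono2) (auto intro: \<psi>_nonneg)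

lemma v_weak_grad: "weak_grad M p (\<lambda>x. \<Sum>i\<le>n. a i x) (\<lambda>x. ereal (v n x))"
proof (induction n)
  case 0 then show ?case using \<psi>_weak_grad[of 0] by (simp add: v_def)
next
  case (Suc n)
  have "weak_grad M p (\<lambda>x. (\<Sum>i\<le>n. a i x) + a (Suc n) x) (\<lambda>x. ereal (v (Suc n) x))"
  proof (rule weak_grad_add[OF curve_measure Suc \<psi>_weak_grad])
    fix x y
    have "\<bar>v (Suc n) x - v (Suc n) y\<bar> \<le> \<bar>v n x - v n y\<bar> + \<bar>\<psi> (Suc n) x - \<psi> (Suc n) y\<bar>" by (simp add: v_def)
    then show "eabs (ereal (v (Suc n) x) - ereal (v (Suc n) y)) \<le> eabs (ereal (v n x) - ereal (v n y)) + eabs (ereal (\<psi> (Suc n) x) - ereal (\<psi> (Suc n) y))"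
      unfolding eabs_real_diff by (simp add: ennreal_leI flip: ennreal_plus)
  qed
  then show ?case by simp
qed

text \<open>Purely qualitative, with no uniformity in n: finite energy is what permits restricting
  the gradient to the set where the partial sum lies below the truncation level.\<close>

lemma a_sum_energy: "energy (\<lambda>x. \<Sum>i\<le>n. a i x) < \<infinity>"
proof -
  define B where "B = (\<Sum>i\<le>n. Bc i / rr i)"
  have B0: "0 \<le> B" unfolding B_def using Bc(1) by (intro sum_nonneg) (simp add: less_imp_le)
  have "(\<Sum>i\<le>n. a i x) \<le> ennreal B * indicator (ball x0 (R + L + 1)) x" for x
  proof (cases "x \<in> ball x0 (R + L + 1)")
    case True
    have "(\<Sum>i\<le>n. a i x) \<le> (\<Sum>i\<le>n. ennreal (Bc i / rr i))" by (intro sum_mono a_le Bc)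
    also have "\<dots> = ennreal B" unfolding B_def using Bc(1) by (intro sum_ennreal) (simp add: less_imp_le)
    finally show ?thesis using True by (simp only: indicator_simps mult_1_right)
  next
    case False
    have "a i x \<le> ennreal (0 / rr i)" for i
    proof (rule a_le)
      fix y assume y: "dist y x < rr i"
      have "c i y = 0"
      proof (rule ccontr)
        assume "c i y \<noteq> 0"
        then have "dist y x0 < R + L" by (rule c_support)
        then show False using False y rr_le_1[of i] dist_triangle[of x0 x y] by (simp add: dist_commute)
      qed
      then show "c i y \<le> 0" by simp
    qed
    then have "a i x = 0" for i by simp
    then show ?thesis by simp
  qed
  then have "energy (\<lambda>x. \<Sum>i\<le>n. a i x) \<le> energy (\<lambda>x. ennreal B * indicator (ball x0 (R + L + 1)) x)" by (rule energy_mono)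
  also have "\<dots> = ennreal (B powr p) * energy (\<lambda>x. indicator (ball x0 (R + L + 1)) x)"
    using B0 by (intro energy_cmult) auto
  also have "energy (\<lambda>x. indicator (ball x0 (R + L + 1)) x) = (\<integral>\<^sup>+x. indicator (ball x0 (R + L + 1)) x \<partial>N)"
    unfolding energy_def by (intro nn_integral_cong) (auto simp: indicator_def)
  also have "ennreal (B powr p) * (\<integral>\<^sup>+x. indicator (ball x0 (R + L + 1)) x \<partial>N) < \<infinity>"
    using ball_fin by (simp add: ennreal_mult_less_top)
  finally show ?thesis .
qed

text \<open>Charging the gradient \<open>a j\<close> of \<open>\<psi> j\<close> only below the level \<open>t\<close> makes the sum \<open>H t\<close> of all \<open>b t j\<close> a
  weak upper gradient of the truncated potential.\<close>
definition b :: "real \<Rightarrow> nat \<Rightarrow> 'a \<Rightarrow> ennreal" where "b t j x = (if v j x < t then a j x else 0)"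

text \<open>The majorant that \<open>dn_integral\<close> asks for: the largest value of
  \<open>b t j\<close> at points from which y can be reached within
  \<open>2 * L * rr j\<close>.\<close>

definition bhat :: "real \<Rightarrow> nat \<Rightarrow> 'a \<Rightarrow> ennreal" where
  "bhat t j y = (SUP x. b t j x * indicator (ball x (2 * L * rr j)) y)"

lemma b_measurable [measurable]: "b t j \<in> borel_measurable borel"
  unfolding b_def[abs_def] by measurable

lemma bhat_measurable [measurable]: "bhat t j \<in> borel_measurable borel"
  unfolding bhat_def[abs_def] by (rule measurable_SUP_balls)

lemma b_le_a: "b t j x \<le> a j x" by (simp add: b_def)

lemma b_le_bhat: "dist y x < 2 * L * rr j \<Longrightarrow> b t j x \<le> bhat t j y"
  unfolding bhat_def by (rule SUP_upper2[of x]) (auto simp: indicator_def dist_commute)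

lemma bhat_le:
  assumes "\<And>z. dist z y < (2 * L + 1) * rr j \<Longrightarrow> c j z \<le> B" "0 \<le> B"
  shows "ennreal (rr j) * bhat t j y \<le> ennreal B"
proof -
  have "bhat t j y \<le> ennreal (B / rr j)"
    unfolding bhat_def
  proof (rule SUP_least)
    fix x
    show "b t j x * indicator (ball x (2 * L * rr j)) y \<le> ennreal (B / rr j)"
    proof (cases "y \<in> ball x (2 * L * rr j)")
      case True
      have "a j x \<le> ennreal (B / rr j)"
      proof (rule a_le)
        fix z assume "dist z x < rr j"
        then have "dist z y < (2 * L + 1) * rr j"
          using True dist_triangle[of z y x] by (simp add: distrib_right)
        then show "c j z \<le> B" by (rule assms)
      qed
      then show ?thesis using True b_le_a[of t j x] by (simp only: indicator_simps mult_1_right order_trans)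
    qed simp
  qed
  then have "ennreal (rr j) * bhat t j y \<le> ennreal (rr j) * ennreal (B / rr j)" by (rule mult_left_mono) simp
  also have "\<dots> = ennreal B" using assms(2) by (simp flip: ennreal_mult)
  finally show ?thesis .
qed

text \<open>The scales 0, 1 and 2 cannot be compared with a scale three steps coarser, so they are
  bounded outright.\<close>

definition Kc :: real where "Kc = (\<Sum>j<3. Bc j)"

lemma Kc_nonneg: "0 < t \<Longrightarrow> 0 \<le> Kc + Cq * t"
  unfolding Kc_def
  by (intro add_nonneg_nonneg sum_nonneg mult_nonneg_nonneg less_imp_le[OF Bc(1)] less_imp_le[OF Cq_pos]) simp

text \<open>If \<open>bhat t J y\<close> does not vanish, some \<open>x\<close> near \<open>y\<close> has \<open>v J x < t\<close>, and this one point
  controls all coarser scales.\<close>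
lemma bhat_sum:
  assumes t: "0 < t" shows "(\<Sum>j. ennreal (rr j) * bhat t j y) \<le> ennreal (Kc + Cq * t)"
proof (rule suminf_le_const[OF summableI])
  fix n
  have K0: "0 \<le> Kc + Cq * t" by (rule Kc_nonneg[OF t])
  define S where "S = {j. j < n \<and> bhat t j y \<noteq> 0}"
  have fS: "finite S" by (simp add: S_def)
  have "(\<Sum>j<n. ennreal (rr j) * bhat t j y) = (\<Sum>j\<in>S. ennreal (rr j) * bhat t j y)"
    by (rule sum.mono_neutral_right) (auto simp: S_def)
  also have "\<dots> \<le> ennreal (Kc + Cq * t)"
  proof (cases "S = {}")
    case False
    \<comment> \<open>The finest scale, among the first n, that is still active at y.\<close>
    define J where "J = Max S"
    have J: "J \<in> S" "\<And>j. j \<in> S \<Longrightarrow> j \<le> J" using fS False by (auto simp: J_def)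
    have "\<exists>x. b t J x * indicator (ball x (2 * L * rr J)) y \<noteq> 0"
    proof (rule ccontr)
      assume "\<not> ?thesis"
      then have "\<And>x. b t J x * indicator (ball x (2 * L * rr J)) y = 0" by blast
      then have "bhat t J y = 0" unfolding bhat_def by (simp only: SUP_const[OF UNIV_not_empty])
      then show False using J(1) by (simp add: S_def)
    qed
    then obtain x where x: "b t J x \<noteq> 0" "dist x y < 2 * L * rr J" by (auto simp: indicator_def split: if_splits)
    have vx: "v J x < t" using x(1) by (auto simp: b_def split: if_splits)
    \<comment> \<open>For j at least 3, \<open>c j\<close> near y is compared with
      \<open>c (j - 3)\<close> at the single point x, and these values add up to at most
      \<open>v J x\<close>, which is below t.\<close>
    define T where "T j = (if j < 3 then Bc j else Cq * c (j - 3) x)" for j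
    have T0: "0 \<le> T j" for j using Bc(1)[of j] Cq_pos by (auto simp: T_def)
    have "ennreal (rr j) * bhat t j y \<le> ennreal (T j)" if j: "j \<in> S" for j
    proof (rule bhat_le[OF _ T0])
      fix z assume z: "dist z y < (2 * L + 1) * rr j"
      show "c j z \<le> T j"
      proof (cases "j < 3")
        case True then show ?thesis using Bc(2) by (simp add: T_def)
      next
        case False
        then obtain i where i: "j = i + 3" by (metis add.commute le_Suc_ex not_less)
        have "rr J \<le> rr j" using J(2)[OF j] by (rule rr_mono)
        then have "2 * L * rr J \<le> 2 * L * rr j" using L8 by (intro mult_left_mono) auto
        moreover have "8 * rr j \<le> L * rr j" using L8 by (intro mult_right_mono) auto
        moreover have "(2 * L + 1) * rr j = 2 * (L * rr j) + rr j" by (simp add: algebra_simps)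
        ultimately have "dist z x \<le> 6 * L * rr j"
          using z x(2) dist_triangle[of z x y] rr_pos(1)[of j] dist_commute[of x y] by linarith
        then show ?thesis using c_compare[of z x i] i by (simp add: T_def)
      qed
    qed
    then have "(\<Sum>j\<in>S. ennreal (rr j) * bhat t j y) \<le> (\<Sum>j\<in>S. ennreal (T j))" by (rule sum_mono)
    also have "\<dots> = ennreal (\<Sum>j\<in>S. T j)" by (rule sum_ennreal) (rule T0)
    also have "\<dots> \<le> ennreal (Kc + Cq * t)"
    proof (rule ennreal_leI)
      have "(\<Sum>j\<in>S. T j) \<le> (\<Sum>j\<in>{..<3} \<union> {3..J}. T j)"
        using J(2) by (intro sum_mono2 T0) (auto simp: not_less)
      also have "\<dots> = (\<Sum>j<3. T j) + (\<Sum>j\<in>{3..J}. T j)" by (rule sum.union_disjoint) auto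
      also have "(\<Sum>j<3. T j) = Kc" unfolding Kc_def by (rule sum.cong) (auto simp: T_def)
      also have "(\<Sum>j\<in>{3..J}. T j) = Cq * (\<Sum>j\<in>{3..J}. c (j - 3) x)"
        unfolding sum_distrib_left by (rule sum.cong) (auto simp: T_def)
      also have "(\<Sum>j\<in>{3..J}. c (j - 3) x) = (\<Sum>i\<in>(\<lambda>j. j - 3) ` {3..J}. c i x)"
        by (subst sum.reindex) (auto simp: inj_on_def)
      also have "\<dots> \<le> (\<Sum>i\<le>J. c i x)" by (rule sum_mono2) auto
      also have "\<dots> \<le> v J x" unfolding v_def by (rule sum_mono) (rule \<psi>_ge_c)
      also have "\<dots> \<le> t" using vx by simp
      finally show "(\<Sum>j\<in>S. T j) \<le> Kc + Cq * t" using Cq_pos by (simp add: mult_left_mono)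
    qed
    finally show ?thesis .
  qed (use K0 in simp)
  finally show "(\<Sum>j<n. ennreal (rr j) * bhat t j y) \<le> ennreal (Kc + Cq * t)" .
qed

definition H :: "real \<Rightarrow> 'a \<Rightarrow> ennreal" where "H t x = (\<Sum>j. b t j x)"

lemma H_measurable [measurable]: "H t \<in> borel_measurable borel"
  unfolding H_def[abs_def] by measurable

text \<open>In the double sum the finer factor becomes \<open>dn\<close> and is integrated out,
  leaving the coarser factor as \<open>bhat t j\<close> against the density of \<nu>. What remains
  is the sum of \<open>rr j * bhat t j\<close>, and by \<open>bhat_sum\<close> it grows only
  linearly in t.\<close>

lemma H_energy: "\<exists>C\<ge>0. \<forall>t>0. energy (H t) \<le> ennreal (C * (Kc + Cq * t))"
proof -
  obtain Q where Q: "0 < Q" "\<And>a :: nat \<Rightarrow> ennreal.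
    (\<Sum>j. a j) epowr p \<le> ennreal Q * (\<Sum>j. \<Sum>i. ennreal (2 powr (i / 2)) * a j * a (j + i) epowr (p - 1))"
    by (rule epowr_suminf_double_le[OF p]) (rule that)
  \<comment> \<open>The ratio of the sum over i: the weight 2^(i/2) times the gain 2^(-i) of the
    finer scale.\<close>
  define \<theta> where "\<theta> = (2::real) powr (- 1 / 2)"
  have \<theta>: "0 < \<theta>" "\<theta> < 1" by (auto simp: \<theta>_def powr_less_one)
  define C1 where "C1 = CD * CD ^ (mL + 2)"
  have C1: "0 < C1" using CD by (simp add: C1_def)
  define C where "C = Q * (C1 / (1 - \<theta>)) * E"
  show ?thesis
  proof (intro exI[of _ C] conjI allI impI)
    show "0 \<le> C" using Q C1 \<theta> E by (simp add: C_def)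
    fix t :: real assume t: "0 < t"
    have K0: "0 \<le> Kc + Cq * t" by (rule Kc_nonneg[OF t])
    have "energy (H t) \<le> (\<integral>\<^sup>+x. ennreal Q * (\<Sum>j. \<Sum>i. ennreal (2 powr (i / 2)) * b t j x * b t (j + i) x epowr (p - 1)) \<partial>N)"
      unfolding energy_def H_def by (intro nn_integral_mono Q)
    also have "\<dots> = ennreal Q * (\<Sum>j. \<Sum>i. \<integral>\<^sup>+x. ennreal (2 powr (i / 2)) * b t j x * b t (j + i) x epowr (p - 1) \<partial>N)"
      by (simp add: nn_integral_cmult nn_integral_suminf mult.assoc del: ennreal_suminf_cmult)
    also have "\<dots> \<le> ennreal Q * (\<Sum>j. \<Sum>i. ennreal (C1 * \<theta> ^ i * rr j) * (\<integral>\<^sup>+y. g y epowr p * bhat t j y \<partial>N))"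
    proof (intro mult_left_mono suminf_le)
      fix j i
      have "(\<integral>\<^sup>+x. ennreal (2 powr (i / 2)) * b t j x * b t (j + i) x epowr (p - 1) \<partial>N)
        \<le> (\<integral>\<^sup>+x. ennreal (2 powr (i / 2) * (CD * rr (j + i))) * (b t j x * dn (j + i) x) \<partial>N)"
      proof (intro nn_integral_mono)
        fix x
        have "b t (j + i) x epowr (p - 1) \<le> ennreal (CD * rr (j + i)) * dn (j + i) x"
          using p by (intro order_trans[OF epowr_mono[OF b_le_a] a_powr_le]) auto
        then have "ennreal (2 powr (i / 2)) * b t j x * b t (j + i) x epowr (p - 1)
           \<le> ennreal (2 powr (i / 2)) * b t j x * (ennreal (CD * rr (j + i)) * dn (j + i) x)" by (rule mult_left_mono) simp
        also have "\<dots> = ennreal (2 powr (i / 2) * (CD * rr (j + i))) * (b t j x * dn (j + i) x)"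
          using CD by (subst ennreal_mult) (auto simp: mult_ac)
        finally show "ennreal (2 powr (i / 2)) * b t j x * b t (j + i) x epowr (p - 1)
           \<le> ennreal (2 powr (i / 2) * (CD * rr (j + i))) * (b t j x * dn (j + i) x)" .
      qed
      also have "\<dots> = ennreal (2 powr (i / 2) * (CD * rr (j + i))) * (\<integral>\<^sup>+x. b t j x * dn (j + i) x \<partial>N)"
        by (rule nn_integral_cmult) simp
      also have "\<dots> \<le> ennreal (2 powr (i / 2) * (CD * rr (j + i))) * (ennreal (CD ^ (mL + 2)) * (\<integral>\<^sup>+y. g y epowr p * bhat t j y \<partial>N))"
      proof (intro mult_left_mono dn_integral)
        fix x y :: 'a assume "dist y x < 2 * L * rr (j + i)"
        moreover have "2 * L * rr (j + i) \<le> 2 * L * rr j" using L8 by (intro mult_left_mono rr_mono) auto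
        ultimately show "b t j x \<le> bhat t j y" by (intro b_le_bhat) simp
      qed auto
      also have "\<dots> = ennreal (2 powr (i / 2) * (CD * rr (j + i)) * CD ^ (mL + 2)) * (\<integral>\<^sup>+y. g y epowr p * bhat t j y \<partial>N)"
        using CD by (subst ennreal_mult) (auto simp: mult.assoc)
      also have "2 powr (i / 2) * (CD * rr (j + i)) * CD ^ (mL + 2) = C1 * \<theta> ^ i * rr j"
      proof -
        have "\<theta> ^ i = 2 powr (- real i / 2)" by (simp add: \<theta>_def powr_powr flip: powr_realpow)
        also have "\<dots> = 2 powr (real i / 2) * 2 powr (- real i)" by (simp flip: powr_add)
        also have "2 powr (- real i) = rr i" by (simp add: rr_def powr_minus_divide powr_realpow power_one_over)
        finally have "2 powr (real i / 2) * rr i = \<theta> ^ i" by simp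
        then show ?thesis by (simp add: C1_def rr_add mult_ac)
      qed
      finally show "(\<integral>\<^sup>+x. ennreal (2 powr (i / 2)) * b t j x * b t (j + i) x epowr (p - 1) \<partial>N)
        \<le> ennreal (C1 * \<theta> ^ i * rr j) * (\<integral>\<^sup>+y. g y epowr p * bhat t j y \<partial>N)" .
    qed auto
    also have "\<dots> = ennreal Q * (\<Sum>j. ennreal (C1 / (1 - \<theta>)) * (\<integral>\<^sup>+y. g y epowr p * (ennreal (rr j) * bhat t j y) \<partial>N))"
    proof (intro arg_cong2[where f="(*)"] refl suminf_cong)
      fix j
      have "(\<Sum>i. ennreal (C1 * \<theta> ^ i * rr j)) = ennreal (C1 / (1 - \<theta>) * rr j)"
      proof (subst suminf_ennreal2)
        have s: "(\<lambda>i. C1 * \<theta> ^ i * rr j) sums (C1 * (1 / (1 - \<theta>)) * rr j)"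
          using \<theta> by (intro sums_mult sums_mult2 geometric_sums) auto
        then show "summable (\<lambda>i. C1 * \<theta> ^ i * rr j)" by (rule sums_summable)
        show "ennreal (\<Sum>i. C1 * \<theta> ^ i * rr j) = ennreal (C1 / (1 - \<theta>) * rr j)" using sums_unique[OF s] by simp
      qed (use C1 \<theta> in auto)
      then have "(\<Sum>i. ennreal (C1 * \<theta> ^ i * rr j) * (\<integral>\<^sup>+y. g y epowr p * bhat t j y \<partial>N))
        = ennreal (C1 / (1 - \<theta>)) * (ennreal (rr j) * (\<integral>\<^sup>+y. g y epowr p * bhat t j y \<partial>N))"
      proof -
        have "(\<Sum>i. ennreal (C1 * \<theta> ^ i * rr j) * (\<integral>\<^sup>+y. g y epowr p * bhat t j y \<partial>N))
          = (\<Sum>i. ennreal (C1 * \<theta> ^ i * rr j)) * (\<integral>\<^sup>+y. g y epowr p * bhat t j y \<partial>N)"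
          by (rule ennreal_suminf_multc)
        moreover assume "(\<Sum>i. ennreal (C1 * \<theta> ^ i * rr j)) = ennreal (C1 / (1 - \<theta>) * rr j)"
        ultimately show ?thesis using C1 \<theta> by (simp only: ennreal_mult[of "C1 / (1 - \<theta>)" "rr j"] mult.assoc rr_pos divide_nonneg_pos less_imp_le diff_gt_0_iff_gt)
      qed
      also have "ennreal (rr j) * (\<integral>\<^sup>+y. g y epowr p * bhat t j y \<partial>N) = (\<integral>\<^sup>+y. g y epowr p * (ennreal (rr j) * bhat t j y) \<partial>N)"
        by (subst nn_integral_cmult[symmetric]) (simp, intro nn_integral_cong mult.left_commute)
      finally show "(\<Sum>i. ennreal (C1 * \<theta> ^ i * rr j) * (\<integral>\<^sup>+y. g y epowr p * bhat t j y \<partial>N))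
        = ennreal (C1 / (1 - \<theta>)) * (\<integral>\<^sup>+y. g y epowr p * (ennreal (rr j) * bhat t j y) \<partial>N)" .
    qed
    also have "\<dots> = ennreal Q * (ennreal (C1 / (1 - \<theta>)) * (\<integral>\<^sup>+y. g y epowr p * (\<Sum>j. ennreal (rr j) * bhat t j y) \<partial>N))"
    proof -
      have "(\<integral>\<^sup>+y. g y epowr p * (\<Sum>j. ennreal (rr j) * bhat t j y) \<partial>N) = (\<integral>\<^sup>+y. (\<Sum>j. g y epowr p * (ennreal (rr j) * bhat t j y)) \<partial>N)"
        by simp
      also have "\<dots> = (\<Sum>j. \<integral>\<^sup>+y. g y epowr p * (ennreal (rr j) * bhat t j y) \<partial>N)"
        by (rule nn_integral_suminf) simp
      finally show ?thesis by simp
    qed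
    also have "\<dots> \<le> ennreal Q * (ennreal (C1 / (1 - \<theta>)) * (\<integral>\<^sup>+y. g y epowr p * ennreal (Kc + Cq * t) \<partial>N))"
      by (intro mult_left_mono nn_integral_mono bhat_sum t) auto
    also have "(\<integral>\<^sup>+y. g y epowr p * ennreal (Kc + Cq * t) \<partial>N) = ennreal E * ennreal (Kc + Cq * t)"
      using E(1) by (simp add: nn_integral_multc energy_def)
    also have "ennreal Q * (ennreal (C1 / (1 - \<theta>)) * (ennreal E * ennreal (Kc + Cq * t))) = ennreal (C * (Kc + Cq * t))"
    proof -
      have "ennreal Q * (ennreal w * (ennreal E * ennreal (Kc + Cq * t))) = ennreal (Q * w * E * (Kc + Cq * t))" if "0 \<le> w" for w
        using Q E K0 that by (simp add: ennreal_mult mult.assoc)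
      then show ?thesis unfolding C_def using C1 \<theta> by simp
    qed
    finally show "energy (H t) \<le> ennreal (C * (Kc + Cq * t))" .
  qed
qed

text \<open>The exponent p - 1 makes the terms linear in \<nu>. It suffices for the L^p norm of the
  normalized truncation, which takes values in [0, 1], so that its p-th power is below its (p-1)-th
  power.\<close>

lemma potential_integral:
  "\<exists>C\<ge>0. (\<integral>\<^sup>+x. (\<Sum>i. ennreal (\<psi> i x)) epowr (p - 1) \<partial>N) \<le> ennreal C"
proof -
  have p1: "0 < p - 1" using p by simp
  obtain Q where Q: "0 < Q" "\<And>b :: nat \<Rightarrow> ennreal.
    (\<Sum>n. b n) epowr (p - 1) \<le> ennreal Q * (\<Sum>n. ennreal (2 powr (1 * real n)) * b n epowr (p - 1))"
    by (rule epowr_suminf_le[OF p1 zero_less_one]) (rule that)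
  define \<theta> where "\<theta> = (2::real) powr (1 - p)"
  have \<theta>: "0 < \<theta>" "\<theta> < 1" using p by (auto simp: \<theta>_def powr_less_one)
  define C1 where "C1 = CD * CD ^ (mL + 2) * E"
  have C1: "0 \<le> C1" using CD E by (simp add: C1_def)
  have "(\<integral>\<^sup>+x. (\<Sum>i. ennreal (\<psi> i x)) epowr (p - 1) \<partial>N) \<le> (\<integral>\<^sup>+x. ennreal Q * (\<Sum>i. ennreal (2 powr (1 * real i)) * ennreal (\<psi> i x) epowr (p - 1)) \<partial>N)"
    by (intro nn_integral_mono Q)
  also have "\<dots> = ennreal Q * (\<Sum>i. ennreal (2 powr i) * (\<integral>\<^sup>+x. ennreal (\<psi> i x) epowr (p - 1) \<partial>N))"
    by (simp add: nn_integral_cmult nn_integral_suminf del: ennreal_suminf_cmult)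
  also have "\<dots> \<le> ennreal Q * (\<Sum>i. ennreal (C1 * \<theta> ^ i))"
  proof (intro mult_left_mono suminf_le)
    fix i
    have "(\<integral>\<^sup>+x. ennreal (\<psi> i x) epowr (p - 1) \<partial>N) \<le> (\<integral>\<^sup>+x. ennreal (CD * rr i powr p) * (1 * dn i x) \<partial>N)"
    proof (intro nn_integral_mono)
      fix x
      have "ennreal (\<psi> i x) epowr (p - 1) \<le> (ennreal (rr i) * a i x) epowr (p - 1)"
        using p by (intro epowr_mono \<psi>_le_a) auto
      also have "\<dots> = ennreal (rr i powr (p - 1)) * a i x epowr (p - 1)" by (simp add: epowr_mult epowr_ennreal)
      also have "\<dots> \<le> ennreal (rr i powr (p - 1)) * (ennreal (CD * rr i) * dn i x)"
        by (intro mult_left_mono a_powr_le) auto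
      also have "\<dots> = ennreal (rr i powr (p - 1) * (CD * rr i)) * dn i x"
        using CD by (subst ennreal_mult) (auto simp: mult.assoc)
      also have "rr i powr (p - 1) * (CD * rr i) = CD * rr i powr p" by (simp add: powr_diff)
      finally show "ennreal (\<psi> i x) epowr (p - 1) \<le> ennreal (CD * rr i powr p) * (1 * dn i x)" by simp
    qed
    also have "\<dots> = ennreal (CD * rr i powr p) * (\<integral>\<^sup>+x. 1 * dn i x \<partial>N)"
      by (rule nn_integral_cmult) simp
    also have "\<dots> \<le> ennreal (CD * rr i powr p) * (ennreal (CD ^ (mL + 2)) * (\<integral>\<^sup>+y. g y epowr p * 1 \<partial>N))"
      by (intro mult_left_mono dn_integral) auto
    also have "(\<integral>\<^sup>+y. g y epowr p * 1 \<partial>N) = ennreal E" using E by (simp add: energy_def)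
    also have "ennreal (CD * rr i powr p) * (ennreal (CD ^ (mL + 2)) * ennreal E) = ennreal (C1 * rr i powr p)"
      unfolding C1_def using CD E by (simp add: mult_ac flip: ennreal_mult)
    finally have "ennreal (2 powr i) * (\<integral>\<^sup>+x. ennreal (\<psi> i x) epowr (p - 1) \<partial>N) \<le> ennreal (2 powr i) * ennreal (C1 * rr i powr p)"
      by (rule mult_left_mono) simp
    also have "\<dots> = ennreal (C1 * (2 powr i * rr i powr p))" using C1 by (simp add: mult_ac flip: ennreal_mult)
    also have "2 powr i * rr i powr p = \<theta> ^ i"
    proof -
      have "\<theta> ^ i = 2 powr ((1 - p) * i)" by (simp add: \<theta>_def powr_powr flip: powr_realpow)
      also have "\<dots> = 2 powr i * 2 powr (- (p * i))" by (simp add: left_diff_distrib powr_diff powr_minus_divide)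
      also have "2 powr (- (p * i)) = rr i powr p"
        by (simp add: rr_def powr_powr powr_minus_divide powr_divide power_one_over mult.commute flip: powr_realpow)
      finally show ?thesis by simp
    qed
    finally show "ennreal (2 powr i) * (\<integral>\<^sup>+x. ennreal (\<psi> i x) epowr (p - 1) \<partial>N) \<le> ennreal (C1 * \<theta> ^ i)" .
  qed auto
  also have "(\<Sum>i. ennreal (C1 * \<theta> ^ i)) = ennreal (C1 * (1 / (1 - \<theta>)))"
  proof (subst suminf_ennreal2)
    have s: "(\<lambda>i. C1 * \<theta> ^ i) sums (C1 * (1 / (1 - \<theta>)))"
      using \<theta> by (intro sums_mult geometric_sums) auto
    then show "summable (\<lambda>i. C1 * \<theta> ^ i)" by (rule sums_summable)
    show "ennreal (\<Sum>i. C1 * \<theta> ^ i) = ennreal (C1 * (1 / (1 - \<theta>)))" using sums_unique[OF s] by simp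
  qed (use C1 \<theta> in auto)
  also have "ennreal Q * ennreal (C1 * (1 / (1 - \<theta>))) = ennreal (Q * (C1 * (1 / (1 - \<theta>))))"
    using Q C1 \<theta> by (intro ennreal_mult[symmetric]) auto
  finally have "(\<integral>\<^sup>+x. (\<Sum>i. ennreal (\<psi> i x)) epowr (p - 1) \<partial>N) \<le> ennreal (Q * (C1 * (1 / (1 - \<theta>))))" .
  moreover have "0 \<le> Q * (C1 * (1 / (1 - \<theta>)))" using Q C1 \<theta> by simp
  ultimately show ?thesis by blast
qed

text \<open>Where \<open>v n\<close> is below t, so are all earlier partial sums; there each
  \<open>a i\<close> with i at most n coincides with \<open>b t i\<close>, and \<open>H t\<close>
  dominates the gradients of all truncated partial sums simultaneously.\<close>

lemma truncation_Lp_grad: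
  assumes t: "0 < t"
  shows "Lp_grad (H t) (\<lambda>x. ereal (SUP n. min (v n x) t))"
  unfolding Lp_grad_def
proof
  obtain C where "0 \<le> C" "energy (H t) \<le> ennreal (C * (Kc + Cq * t))" using H_energy t by blast
  then show "energy (H t) < \<infinity>" by (auto intro: le_less_trans)
  show "weak_grad M p (H t) (\<lambda>x. ereal (SUP n. min (v n x) t))"
  proof (rule weak_grad_SUP[OF curve_measure])
    fix n
    have "weak_grad M p (\<lambda>x. \<Sum>i\<le>n. a i x) (\<lambda>x. ereal (min (v n x) t))"
      by (rule weak_grad_contraction[OF v_weak_grad]) (unfold eabs_real_diff, intro ennreal_leI, auto)
    then have "Lp_grad (\<lambda>x. \<Sum>i\<le>n. a i x) (\<lambda>x. ereal (min (v n x) t))"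
      using a_sum_energy by (simp add: Lp_grad_def)
    then have "Lp_grad (\<lambda>x. (\<Sum>i\<le>n. a i x) * indicator {x. v n x < t} x) (\<lambda>x. ereal (min (v n x) t))"
      by (rule Lp_grad_indicator[where c=t]) (auto simp: min_def split: if_splits)
    then have "weak_grad M p (\<lambda>x. (\<Sum>i\<le>n. a i x) * indicator {x. v n x < t} x) (\<lambda>x. ereal (min (v n x) t))"
      by (simp add: Lp_grad_def)
    then show "weak_grad M p (H t) (\<lambda>x. ereal (min (v n x) t))"
    proof (rule weak_grad_mono)
      fix x
      show "(\<Sum>i\<le>n. a i x) * indicator {x. v n x < t} x \<le> H t x"
      proof (cases "v n x < t")
        case True
        have "(\<Sum>i\<le>n. a i x) = (\<Sum>i\<le>n. b t i x)"
          using True v_mono[of _ n x] by (intro sum.cong) (auto simp: b_def intro: le_less_trans)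
        also have "\<dots> \<le> H t x" unfolding H_def by (rule sum_le_suminf) auto
        finally show ?thesis using True by simp
      qed simp
    qed simp
  next
    fix x y
    show "eabs (ereal (SUP n. min (v n x) t) - ereal (SUP n. min (v n y) t))
      \<le> (SUP n. eabs (ereal (min (v n x) t) - ereal (min (v n y) t)))"
      by (rule eabs_SUP_diff_le[where B=t]) (use v_nonneg t in auto)
  qed
qed

lemma wolff_zero_cap: "zero_cap {x. (\<Sum>k. ennreal (c k x)) = \<infinity>}"
  unfolding zero_cap_def
proof (intro allI impI)
  fix e :: real assume e: "0 < e"
  obtain C1 where C1: "0 \<le> C1" "\<And>t. 0 < t \<Longrightarrow> energy (H t) \<le> ennreal (C1 * (Kc + Cq * t))" using H_energy by blast
  obtain C2 where C2: "0 \<le> C2" "(\<integral>\<^sup>+x. (\<Sum>i. ennreal (\<psi> i x)) epowr (p - 1) \<partial>N) \<le> ennreal C2"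
    using potential_integral by blast
  have Kc0: "0 \<le> Kc" unfolding Kc_def using Bc(1) by (intro sum_nonneg) (simp add: less_imp_le)
  define D where "D = C1 * (Kc + Cq) + C2"
  have D: "0 \<le> D" using C1 C2 Kc0 Cq_pos by (simp add: D_def)
  \<comment> \<open>The second entry makes D t^(1 - p) at most e; the first allows
    \<open>Kc + Cq * t\<close> to be bounded by \<open>(Kc + Cq) * t\<close>.\<close>
  define t where "t = max 1 ((D / e) powr (1 / (p - 1)))"
  have t: "1 \<le> t" "0 < t" by (auto simp: t_def)
  have Dt: "D * t powr (1 - p) \<le> e"
  proof -
    have "(D / e) = ((D / e) powr (1 / (p - 1))) powr (p - 1)" using D e p by (simp add: powr_powr)
    also have "\<dots> \<le> t powr (p - 1)" using p by (intro powr_mono2) (auto simp: t_def)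
    finally have "D \<le> e * t powr (p - 1)" using e by (simp add: field_simps)
    then have "D * t powr (1 - p) \<le> e * t powr (p - 1) * t powr (1 - p)" by (rule mult_right_mono) simp
    also have "\<dots> = e" using t by (simp add: mult.assoc flip: powr_add)
    finally show ?thesis .
  qed
  define f where "f x = (SUP n. min (v n x) t)" for x
  define F where "F x = 1 / t * f x" for x
  have bdd: "bdd_above (range (\<lambda>n. min (v n x) t))" for x by (intro bdd_aboveI[of _ t]) auto
  have ft: "f x \<le> t" for x unfolding f_def by (rule cSUP_least) auto
  have fv: "min (v n x) t \<le> f x" for n x unfolding f_def by (rule cSUP_upper[OF UNIV_I bdd])
  have f0: "0 \<le> f x" for x using fv[of 0 x] v_nonneg[of 0 x] t by simp
  have F01: "0 \<le> F x" "F x \<le> 1" for x using f0[of x] ft[of x] t by (auto simp: F_def)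
  have "f \<in> borel_measurable borel" unfolding f_def[abs_def] using bdd by measurable
  then have FM: "F \<in> borel_measurable M" unfolding F_def[abs_def] by (intro measurable_M) measurable
  have Fgrad: "Lp_grad (\<lambda>x. ennreal (1 / t) * H t x) (\<lambda>x. ereal (F x))"
  proof (rule Lp_grad_cmult[OF truncation_Lp_grad[OF t(2)]])
    fix x y
    have "\<bar>F x - F y\<bar> = 1 / t * \<bar>f x - f y\<bar>" using t by (simp add: F_def abs_mult flip: right_diff_distrib diff_divide_distrib)
    then show "eabs (ereal (F x) - ereal (F y)) \<le> ennreal (1 / t) * eabs (ereal (SUP n. min (v n x) t) - ereal (SUP n. min (v n y) t))"
      unfolding eabs_real_diff f_def[symmetric] using t by (simp add: ennreal_mult flip: ennreal_mult)
  qed (use t in simp)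
  have E1: "energy (\<lambda>x. ennreal (1 / t) * H t x) \<le> ennreal (C1 * (Kc + Cq) * t powr (1 - p))"
  proof -
    have "energy (\<lambda>x. ennreal (1 / t) * H t x) = ennreal ((1 / t) powr p) * energy (H t)"
      using t by (intro energy_cmult) auto
    also have "\<dots> \<le> ennreal ((1 / t) powr p) * ennreal (C1 * (Kc + Cq * t))"
      by (intro mult_left_mono C1 t) auto
    also have "\<dots> \<le> ennreal ((1 / t) powr p) * ennreal (C1 * ((Kc + Cq) * t))"
    proof (intro mult_left_mono ennreal_leI)
      have "Kc * 1 \<le> Kc * t" using Kc0 t by (intro mult_left_mono) auto
      then show "Kc + Cq * t \<le> (Kc + Cq) * t" by (simp add: distrib_right)
    qed (use C1 in auto)
    also have "\<dots> = ennreal ((1 / t) powr p * (C1 * ((Kc + Cq) * t)))"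
      using C1 Kc0 Cq_pos t by (intro ennreal_mult[symmetric]) auto
    also have "(1 / t) powr p * (C1 * ((Kc + Cq) * t)) = C1 * (Kc + Cq) * t powr (1 - p)"
      using t by (simp add: powr_diff powr_divide)
    finally show ?thesis .
  qed
  have E2: "(\<integral>\<^sup>+x. ennreal (F x) epowr p \<partial>N) \<le> ennreal (C2 * t powr (1 - p))"
  proof -
    have "(\<integral>\<^sup>+x. ennreal (F x) epowr p \<partial>N) \<le> (\<integral>\<^sup>+x. ennreal ((1 / t) powr (p - 1)) * (\<Sum>i. ennreal (\<psi> i x)) epowr (p - 1) \<partial>N)"
    proof (intro nn_integral_mono)
      fix x
      have fs: "ennreal (f x) \<le> (\<Sum>i. ennreal (\<psi> i x))"
      proof (cases "\<Sum>i. ennreal (\<psi> i x)")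
        case (real s)
        have "v n x \<le> s" for n
        proof -
          have "ennreal (v n x) = (\<Sum>i\<le>n. ennreal (\<psi> i x))" unfolding v_def by (rule sum_ennreal[symmetric]) (rule \<psi>_nonneg)
          also have "\<dots> \<le> ennreal s" unfolding real(2)[symmetric] by (rule sum_le_suminf) auto
          finally show ?thesis using real(1) by simp
        qed
        then have "f x \<le> s" unfolding f_def by (intro cSUP_least) (auto simp: min.coboundedI1)
        then show ?thesis unfolding real(2) by (rule ennreal_leI)
      qed simp
      have "F x powr p \<le> F x powr (p - 1)"
      proof (cases "F x = 0")
        case False
        then show ?thesis using F01[of x] by (intro powr_mono') auto
      qed simp
      then have "ennreal (F x) epowr p \<le> ennreal (F x) epowr (p - 1)" using F01 by (simp add: epowr_ennreal ennreal_leI)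
      also have "\<dots> = (ennreal (1 / t) * ennreal (f x)) epowr (p - 1)"
        unfolding F_def using f0 t by (subst ennreal_mult) auto
      also have "\<dots> = ennreal ((1 / t) powr (p - 1)) * ennreal (f x) epowr (p - 1)"
        using t by (simp add: epowr_mult epowr_ennreal)
      also have "\<dots> \<le> ennreal ((1 / t) powr (p - 1)) * (\<Sum>i. ennreal (\<psi> i x)) epowr (p - 1)"
        using p by (intro mult_left_mono epowr_mono fs) auto
      finally show "ennreal (F x) epowr p \<le> ennreal ((1 / t) powr (p - 1)) * (\<Sum>i. ennreal (\<psi> i x)) epowr (p - 1)" .
    qed
    also have "\<dots> = ennreal ((1 / t) powr (p - 1)) * (\<integral>\<^sup>+x. (\<Sum>i. ennreal (\<psi> i x)) epowr (p - 1) \<partial>N)"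
      by (rule nn_integral_cmult) simp
    also have "\<dots> \<le> ennreal ((1 / t) powr (p - 1)) * ennreal C2" by (intro mult_left_mono C2) auto
    also have "\<dots> = ennreal (C2 * t powr (1 - p))"
    proof -
      have "(1 / t) powr (p - 1) = t powr (1 - p)" using t powr_minus[of t "p - 1"] by (simp add: powr_divide inverse_eq_divide)
      then show ?thesis using C2 by (simp add: mult.commute flip: ennreal_mult)
    qed
    finally show ?thesis .
  qed
  have le: "(\<integral>\<^sup>+x. ennreal (F x) epowr p \<partial>N) + energy (\<lambda>x. ennreal (1 / t) * H t x) \<le> ennreal e"
  proof -
    have "(\<integral>\<^sup>+x. ennreal (F x) epowr p \<partial>N) + energy (\<lambda>x. ennreal (1 / t) * H t x)
      \<le> ennreal (C2 * t powr (1 - p)) + ennreal (C1 * (Kc + Cq) * t powr (1 - p))" by (intro add_mono E1 E2)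
    also have "\<dots> = ennreal (D * t powr (1 - p))"
      unfolding D_def using C1 C2 Kc0 Cq_pos by (simp add: algebra_simps flip: ennreal_plus)
    also have "\<dots> \<le> ennreal e" using Dt by (rule ennreal_leI)
    finally show ?thesis .
  qed
  have one: "F x = 1" if x: "(\<Sum>k. ennreal (c k x)) = \<infinity>" for x
  proof -
    have "\<exists>n. t \<le> v n x"
    proof (rule ccontr)
      assume "\<not> ?thesis"
      then have vt: "v n x < t" for n by (simp add: not_le)
      have "(\<Sum>k. ennreal (c k x)) \<le> ennreal t"
      proof (rule suminf_le_const[OF summableI])
        fix n
        have "(\<Sum>k<n. ennreal (c k x)) \<le> (\<Sum>k\<le>n. ennreal (c k x))" by (intro sum_mono2) auto
        also have "\<dots> = ennreal (\<Sum>k\<le>n. c k x)" by (rule sum_ennreal) simp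
        also have "\<dots> \<le> ennreal t"
        proof (rule ennreal_leI)
          have "(\<Sum>k\<le>n. c k x) \<le> v n x" unfolding v_def by (intro sum_mono \<psi>_ge_c)
          then show "(\<Sum>k\<le>n. c k x) \<le> t" using vt[of n] by linarith
        qed
        finally show "(\<Sum>k<n. ennreal (c k x)) \<le> ennreal t" .
      qed
      then show False using x by (simp add: top_unique)
    qed
    then obtain n where "t \<le> v n x" by blast
    then have "f x = t" using fv[of n x] ft[of x] by simp
    then show ?thesis using t by (simp add: F_def)
  qed
  show "small_cap {x. (\<Sum>k. ennreal (c k x)) = \<infinity>} (ennreal e)"
    unfolding small_cap_def using FM F01 one Fgrad le
    by (intro exI[of _ F] exI[of _ "\<lambda>x. ennreal (1 / t) * H t x"]) blast
qed

end

section \<open>Points of oscillation\<close>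

text \<open>Zorn's lemma is applied to disjoint families such that every ball meeting the family
  meets a member of at least half its radius. Only centers have to be covered, not balls, which
  gives the factor 3 = 1 + 2.\<close>

lemma vitali_covering_balls:
  fixes F :: "'a::metric_space set" and \<rho> :: "'a \<Rightarrow> real"
  assumes \<rho>: "\<And>x. x \<in> F \<Longrightarrow> 0 < \<rho> x" "\<And>x. x \<in> F \<Longrightarrow> \<rho> x \<le> B"
  obtains C where "C \<subseteq> F" "\<And>x y. x \<in> C \<Longrightarrow> y \<in> C \<Longrightarrow> x \<noteq> y \<Longrightarrow> ball x (\<rho> x) \<inter> ball y (\<rho> y) = {}"
    "F \<subseteq> (\<Union>x\<in>C. ball x (3 * \<rho> x))"
proof -
  define meets where "meets x y \<longleftrightarrow> ball x (\<rho> x) \<inter> ball y (\<rho> y) \<noteq> {}" for x y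
  define P where "P = {C. C \<subseteq> F \<and> (\<forall>x\<in>C. \<forall>y\<in>C. x \<noteq> y \<longrightarrow> \<not> meets x y) \<and>
    (\<forall>x\<in>F. (\<exists>c\<in>C. meets x c) \<longrightarrow> (\<exists>c\<in>C. meets x c \<and> \<rho> x \<le> 2 * \<rho> c))}"
  have "\<exists>C\<in>P. \<forall>X\<in>P. C \<subseteq> X \<longrightarrow> X = C"
  proof (rule subset_Zorn')
    fix \<C> assume ch: "subset.chain P \<C>"
    then have sub: "\<And>C. C \<in> \<C> \<Longrightarrow> C \<in> P" and tot: "\<And>C D. C \<in> \<C> \<Longrightarrow> D \<in> \<C> \<Longrightarrow> C \<subseteq> D \<or> D \<subseteq> C"
      unfolding subset_chain_def by blast+
    show "\<Union>\<C> \<in> P" unfolding P_def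
    proof (intro CollectI conjI ballI impI)
      show "\<Union>\<C> \<subseteq> F" using sub unfolding P_def by blast
    next
      fix x y assume xy: "x \<in> \<Union>\<C>" "y \<in> \<Union>\<C>" "x \<noteq> y"
      then obtain C D where "C \<in> \<C>" "D \<in> \<C>" "x \<in> C" "y \<in> D" by blast
      then obtain C' where "C' \<in> \<C>" "x \<in> C'" "y \<in> C'" using tot by blast
      then show "\<not> meets x y" using sub xy(3) unfolding P_def by blast
    next
      fix x assume x: "x \<in> F" "\<exists>c\<in>\<Union>\<C>. meets x c"
      then obtain C where C: "C \<in> \<C>" "\<exists>c\<in>C. meets x c" by blast
      then have "\<exists>c\<in>C. meets x c \<and> \<rho> x \<le> 2 * \<rho> c" using sub[OF C(1)] x(1) unfolding P_def by simp
      then show "\<exists>c\<in>\<Union>\<C>. meets x c \<and> \<rho> x \<le> 2 * \<rho> c" using C(1) by blast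
    qed
  qed
  then obtain C where C: "C \<in> P" and max: "\<And>X. X \<in> P \<Longrightarrow> C \<subseteq> X \<Longrightarrow> X = C" by blast
  have CF: "C \<subseteq> F" and dis: "\<And>x y. x \<in> C \<Longrightarrow> y \<in> C \<Longrightarrow> x \<noteq> y \<Longrightarrow> \<not> meets x y"
    and prp: "\<And>x. x \<in> F \<Longrightarrow> \<exists>c\<in>C. meets x c \<Longrightarrow> \<exists>c\<in>C. meets x c \<and> \<rho> x \<le> 2 * \<rho> c"
    using C unfolding P_def by blast+
  have sym: "meets x y \<longleftrightarrow> meets y x" for x y unfolding meets_def by blast
  have self: "meets x x" if "x \<in> F" for x
  proof -
    have "x \<in> ball x (\<rho> x) \<inter> ball x (\<rho> x)" using \<rho>(1)[OF that] by simp
    then show ?thesis unfolding meets_def by blast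
  qed
  have all: "\<exists>c\<in>C. meets x c" if x: "x \<in> F" for x
  proof (rule ccontr)
    assume no: "\<not> ?thesis"
    define S where "S = {y\<in>F. \<not> (\<exists>c\<in>C. meets y c)}"
    have xS: "x \<in> S" using x no by (simp add: S_def)
    have bdd: "bdd_above (\<rho> ` S)" using \<rho>(2) by (intro bdd_aboveI[of _ B]) (auto simp: S_def)
    define s where "s = Sup (\<rho> ` S)"
    have "\<rho> x \<le> s" unfolding s_def using xS bdd by (intro cSup_upper) auto
    then have "s / 2 < s" using \<rho>(1)[OF x] by simp
    \<comment> \<open>A radius above half the supremum over all unmet balls, so that adding z
      preserves the half-radius condition.\<close>
    then obtain z where z: "z \<in> S" "s / 2 < \<rho> z"
      unfolding s_def using less_cSup_iff[OF _ bdd, of "Sup (\<rho> ` S) / 2"] xS by blast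
    have zF: "z \<in> F" using z by (simp add: S_def)
    have "insert z C \<in> P" unfolding P_def
    proof (intro CollectI conjI ballI impI)
      show "insert z C \<subseteq> F" using CF zF by blast
    next
      fix a b assume "a \<in> insert z C" "b \<in> insert z C" "a \<noteq> b"
      then show "\<not> meets a b" using dis z(1) sym unfolding S_def by blast
    next
      fix y assume y: "y \<in> F" "\<exists>c\<in>insert z C. meets y c"
      show "\<exists>c\<in>insert z C. meets y c \<and> \<rho> y \<le> 2 * \<rho> c"
      proof (cases "\<exists>c\<in>C. meets y c")
        case True then show ?thesis using prp[OF y(1)] by blast
      next
        case False
        then have "meets y z" "y \<in> S" using y by (auto simp: S_def)
        then have "\<rho> y \<le> s" unfolding s_def using bdd by (intro cSup_upper) auto
        then have "\<rho> y \<le> 2 * \<rho> z" using z(2) by linarith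
        then show ?thesis using \<open>meets y z\<close> by blast
      qed
    qed
    then have "z \<in> C" using max[of "insert z C"] by blast
    then show False using z(1) self[OF zF] by (auto simp: S_def)
  qed
  show ?thesis
  proof (rule that[OF CF])
    show "ball x (\<rho> x) \<inter> ball y (\<rho> y) = {}" if "x \<in> C" "y \<in> C" "x \<noteq> y" for x y
      using dis[OF that] by (simp add: meets_def)
    show "F \<subseteq> (\<Union>x\<in>C. ball x (3 * \<rho> x))"
    proof
      fix x assume x: "x \<in> F"
      obtain c where c: "c \<in> C" "meets x c" "\<rho> x \<le> 2 * \<rho> c" using prp[OF x all[OF x]] by blast
      then obtain w where "w \<in> ball x (\<rho> x)" "w \<in> ball c (\<rho> c)" by (auto simp: meets_def)
      then have "dist c x < 3 * \<rho> c" using c(3) dist_triangle[of c x w] by (simp add: dist_commute)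
      then show "x \<in> (\<Union>x\<in>C. ball x (3 * \<rho> x))" using c(1) by auto
    qed
  qed
qed

text \<open>The outer regularity theorem of the library assumes a Polish space as a type class.\<close>
lemma metric_regular:
  fixes \<mu> :: "'a::metric_space measure"
  assumes sets: "sets \<mu> = sets borel" and fin: "emeasure \<mu> UNIV < \<infinity>" and A: "A \<in> sets borel" and e: "0 < (e::real)"
  shows "\<exists>C U. closed C \<and> open U \<and> C \<subseteq> A \<and> A \<subseteq> U \<and> measure \<mu> (U - C) < e"
proof -
  have space: "space \<mu> = UNIV" using sets_eq_imp_space_eq[OF sets] by simp
  interpret finite_measure \<mu> using fin by (intro finite_measureI) (simp add: space)
  have "A \<in> sigma_sets UNIV {S. closed S}" using A by (simp add: borel_eq_closed)
  then show ?thesis using e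
  \<comment> \<open>Approximating by closed sets from inside and open sets from outside at once
    makes the claim symmetric under complements.\<close>
  proof (induction A arbitrary: e rule: sigma_sets.induct)
    case (Basic S)
    then have S: "closed S" by simp
    show ?case
    proof (cases "S = {}")
      case True then show ?thesis using Basic by (intro exI[of _ "{}"]) auto
    next
      case False
      define U where "U n = {x. infdist x S < 1 / Suc n}" for n :: nat
      have oU: "open (U n)" for n unfolding U_def by (intro open_Collect_less continuous_intros)
      have dec: "decseq (\<lambda>n. U n - S)"
      proof (rule decseq_SucI)
        fix n
        have "1 / real (Suc (Suc n)) \<le> 1 / real (Suc n)" by (simp add: field_simps)
        then show "U (Suc n) - S \<subseteq> U n - S" unfolding U_def by fastforce
      qed
      have empty: "(\<Inter>n. U n - S) = {}"
      proof (rule ccontr)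
        assume "(\<Inter>n. U n - S) \<noteq> {}"
        then obtain x where x: "\<And>n. infdist x S < 1 / Suc n" "x \<notin> S" by (auto simp: U_def)
        have "infdist x S \<le> 0"
        proof (rule ccontr)
          assume "\<not> ?thesis"
          then obtain n where "1 / Suc n < infdist x S" by (metis nat_approx_posE not_le)
          then show False using x(1)[of n] by simp
        qed
        then have "infdist x S = 0" using infdist_nonneg[of x S] by linarith
        then show False using in_closed_iff_infdist_zero[OF S False] x(2) by blast
      qed
      have "(\<lambda>n. measure \<mu> (U n - S)) \<longlonglongrightarrow> measure \<mu> (\<Inter>n. U n - S)"
        using dec oU S by (intro finite_Lim_measure_decseq) (auto simp: sets)
      then have "(\<lambda>n. measure \<mu> (U n - S)) \<longlonglongrightarrow> 0" unfolding empty measure_empty .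
      from order_tendstoD(2)[OF this Basic(2)] obtain n where "measure \<mu> (U n - S) < e"
        by (auto simp: eventually_sequentially)
      moreover have "S \<subseteq> U n" by (auto simp: U_def)
      ultimately show ?thesis using S oU by blast
    qed
  next
    case Empty
    then show ?case by (intro exI[of _ "{}"]) auto
  next
    case (Compl A)
    obtain C U where "closed C" "open U" "C \<subseteq> A" "A \<subseteq> U" "measure \<mu> (U - C) < e"
      using Compl(2)[OF Compl(3)] by blast
    moreover have "(UNIV - C) - (UNIV - U) = U - C" by blast
    ultimately show ?case by (intro exI[of _ "UNIV - U"] exI[of _ "UNIV - C"]) (auto simp: open_Diff closed_Diff)
  next
    case (Union A)
    define Q where "Q i C U \<longleftrightarrow> closed C \<and> open U \<and> C \<subseteq> A i \<and> A i \<subseteq> U \<and> measure \<mu> (U - C) < e / 4 * (1 / 2) ^ i" for i C U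
    have "\<exists>C U. Q i C U" for i unfolding Q_def by (rule Union(2)) (use Union(3) in simp)
    then obtain C U where "\<And>i. Q i (C i) (U i)" by metis
    then have CU: "\<And>i. closed (C i)" "\<And>i. open (U i)" "\<And>i. C i \<subseteq> A i" "\<And>i. A i \<subseteq> U i"
      "\<And>i. measure \<mu> (U i - C i) < e / 4 * (1 / 2) ^ i" unfolding Q_def by blast+
    note [measurable] = borel_closed[OF CU(1)] borel_open[OF CU(2)]
    have s: "(\<lambda>i. e / 4 * (1 / 2) ^ i) sums (e / 4 * 2)"
      using sums_mult[OF geometric_sums[of "1 / 2 :: real"], of "e / 4"] by simp
    define V where "V = (\<Union>i. U i)"
    have [measurable]: "V \<in> sets borel" unfolding V_def by measurable
    have sm: "summable (\<lambda>i. measure \<mu> (U i - C i))"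
      using CU(5) by (intro summable_comparison_test'[OF sums_summable[OF s], of 0]) (simp add: less_imp_le)
    have "measure \<mu> (V - (\<Union>i. C i)) \<le> measure \<mu> (\<Union>i. U i - C i)"
      unfolding V_def by (intro finite_measure_mono) (auto simp: sets)
    also have "\<dots> \<le> (\<Sum>i. measure \<mu> (U i - C i))"
      by (intro finite_measure_subadditive_countably sm) (auto simp: sets)
    also have "\<dots> \<le> (\<Sum>i. e / 4 * (1 / 2) ^ i)"
      using CU(5) by (intro suminf_le sm sums_summable[OF s]) (simp add: less_imp_le)
    also have "\<dots> = e / 2" using sums_unique[OF s] by simp
    finally have le: "measure \<mu> (V - (\<Union>i. C i)) < e" using Union(3) by linarith
    have "(\<lambda>n. measure \<mu> (V - (\<Union>i<n. C i))) \<longlonglongrightarrow> measure \<mu> (\<Inter>n. V - (\<Union>i<n. C i))"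
      by (intro finite_Lim_measure_decseq) (auto simp: sets decseq_def)
    also have "(\<Inter>n. V - (\<Union>i<n. C i)) = V - (\<Union>i. C i)" by auto
    finally have "(\<lambda>n. measure \<mu> (V - (\<Union>i<n. C i))) \<longlonglongrightarrow> measure \<mu> (V - (\<Union>i. C i))" .
    from order_tendstoD(2)[OF this le] obtain n where "measure \<mu> (V - (\<Union>i<n. C i)) < e"
      by (auto simp: eventually_sequentially)
    moreover have "closed (\<Union>i<n. C i)" using CU(1) by auto
    moreover have "open V" unfolding V_def using CU(2) by auto
    moreover have "(\<Union>i<n. C i) \<subseteq> (\<Union>i. A i)" "(\<Union>i. A i) \<subseteq> V" unfolding V_def using CU(3,4) by blast+
    ultimately show ?case by blast
  qed
qed

context pi_space
begin

text \<open>The added measure of the ball keeps this quantity above \<open>mb\<close>, so repeated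
  decay leads to a contradiction. It is also the measure for which small open neighbourhoods of null
  sets are chosen.\<close>

definition nup :: "('a \<Rightarrow> ennreal) \<Rightarrow> 'a \<Rightarrow> real \<Rightarrow> real" where "nup g x r = nu g x r + mb x r"

text \<open>\<open>CD ^ (mL + 3)\<close> compensates the loss of measure over mL + 3 dyadic scales;
  the extra 2^p halves the p-th root of the scaled density at every bad step.\<close>

definition C0 :: real where "C0 = CD ^ (mL + 3) * 2 powr p"

lemma C0_pos: "0 < C0" using CD by (simp add: C0_def)

text \<open>Scales are compared in steps of \<open>mL + 3\<close>, so that \<open>2 * L * rr (k + (mL + 3)) = rr (k + 2)\<close>.
  If no scale were good, \<open>nup\<close> would decay faster than the measure of balls permits; before the
  first good scale the averages barely move.\<close>
lemma good_scale:
  assumes u: "nice u g" and om0: "(\<lambda>k. om g k x) \<longlonglongrightarrow> 0"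
    and freq: "\<And>m. \<exists>k\<ge>m. avg u x (rr k) \<le> 1 / 2"
  shows "\<exists>k\<ge>k0. avg u x (rr k) \<le> 3 / 4 \<and> nup g x (2 * L * rr k) \<le> C0 * nup g x (rr (k + 2))"
proof (rule ccontr)
  assume none: "\<not> ?thesis"
  have gfin: "energy g < \<infinity>" using niceD[OF u] by auto
  define q where "q = mL + 3"
  have rq: "2 * L * rr (k + q) = rr (k + 2)" for k
  proof -
    have "2 * L * rr (k + q) = rr k * (2 * (2 ^ mL * rr (mL + 3)))" by (simp add: q_def rr_add L_def)
    also have "2 * (2 ^ mL * rr (mL + 3)) = rr 2" by (simp add: rr_def power_add power_divide power3_eq_cube power2_eq_square)
    finally show ?thesis by (simp only: rr_add)
  qed
  define n where "n k = nup g x (2 * L * rr k)" for k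
  \<comment> \<open>Dominates \<open>om g k x\<close>, but unlike it decays geometrically along a
    chain of bad scales.\<close>
  define w where "w k = rr k powr p * (n k / mb x (rr k))" for k
  have mp: "0 < mb x (rr k)" for k by (rule mb_pos) simp
  have n_mb: "mb x (rr k) \<le> n k" for k
  proof -
    have "1 * rr k \<le> 2 * L * rr k" using L8 by (intro mult_right_mono) auto
    then have "mb x (rr k) \<le> mb x (2 * L * rr k)" by (intro mb_mono subset_ball) simp
    then show ?thesis by (simp add: n_def nup_def add_increasing)
  qed
  have n0: "0 \<le> n k" for k using n_mb[of k] mp[of k] by linarith
  have w0: "0 \<le> w k" for k using n0[of k] by (simp add: w_def)
  have om_w: "om g k x \<le> w k" for k
  proof -
    have "1 * (L * rr k) \<le> 2 * (L * rr k)" using L8 by (intro mult_right_mono) auto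
    then have "nu g x (L * rr k) \<le> nu g x (2 * L * rr k)" by (intro nu_mono gfin subset_ball) simp
    then have "nu g x (L * rr k) \<le> n k" by (simp add: n_def nup_def add_increasing2)
    then show ?thesis unfolding om_def w_def by (intro mult_left_mono divide_right_mono) auto
  qed
  \<comment> \<open>The dilation 2L at scale k + 1 is the dilation L at scale k, so the energy part
    is controlled by \<open>om\<close>; the measure part carries the factor
    \<open>rr (Suc k) powr p\<close>.\<close>
  have w_lim: "w \<longlonglongrightarrow> 0"
  proof (rule LIMSEQ_imp_Suc)
    define D where "D = CD ^ (mL + 1)"
    have le: "w (Suc k) \<le> CD * om g k x + D * rr (Suc k) powr p" for k
    proof -
      have "2 * L * rr (Suc k) = L * rr k" by (simp add: rr_Suc)
      then have nn: "n (Suc k) = nu g x (L * rr k) + mb x (L * rr k)" by (simp only: n_def nup_def)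
      have m1: "mb x (rr k) \<le> CD * mb x (rr (Suc k))" using mb_doubling[of "rr (Suc k)" x] by (simp add: rr_Suc)
      have "rr (Suc k) powr p * (nu g x (L * rr k) / mb x (rr (Suc k))) \<le> rr k powr p * (nu g x (L * rr k) * (CD / mb x (rr k)))"
      proof (rule mult_mono)
        show "rr (Suc k) powr p \<le> rr k powr p" using p0 by (intro powr_mono2 rr_mono) auto
        have "1 / mb x (rr (Suc k)) \<le> CD / mb x (rr k)" using m1 mp[of k] mp[of "Suc k"] by (simp add: field_simps)
        then have "nu g x (L * rr k) * (1 / mb x (rr (Suc k))) \<le> nu g x (L * rr k) * (CD / mb x (rr k))" by (rule mult_left_mono) simp
        then show "nu g x (L * rr k) / mb x (rr (Suc k)) \<le> nu g x (L * rr k) * (CD / mb x (rr k))" by simp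
      qed auto
      also have "\<dots> = CD * om g k x" by (simp add: om_def)
      finally have 1: "rr (Suc k) powr p * (nu g x (L * rr k) / mb x (rr (Suc k))) \<le> CD * om g k x" .
      have "mb x (L * rr k) \<le> D * mb x (rr (Suc k))"
        unfolding D_def by (intro mb_comp) (auto simp: L_def rr_Suc)
      then have "rr (Suc k) powr p * (mb x (L * rr k) / mb x (rr (Suc k))) \<le> rr (Suc k) powr p * D"
        using mp[of "Suc k"] by (intro mult_left_mono) (auto simp: divide_le_eq)
      then show ?thesis using 1 unfolding w_def nn by (simp add: add_divide_distrib distrib_left mult.commute)
    qed
    have "(\<lambda>k. rr (Suc k)) \<longlonglongrightarrow> 0" unfolding rr_def by (intro LIMSEQ_Suc LIMSEQ_power_zero) auto
    then have "(\<lambda>k. rr (Suc k) powr p) \<longlonglongrightarrow> 0 powr p" using p0 by (intro tendsto_powr2 tendsto_const) auto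
    then have "(\<lambda>k. CD * om g k x + D * rr (Suc k) powr p) \<longlonglongrightarrow> CD * 0 + D * 0"
      by (intro tendsto_intros om0) (use p0 in simp)
    then have lim: "(\<lambda>k. CD * om g k x + D * rr (Suc k) powr p) \<longlonglongrightarrow> 0" by simp
    show "(\<lambda>k. w (Suc k)) \<longlonglongrightarrow> 0"
      by (rule tendsto_sandwich[OF always_eventually always_eventually tendsto_const lim]) (intro allI w0 le)+
  qed
  define B where "B = 8 * CD ^ q * CP"
  have B: "0 < B" using CD CP by (simp add: B_def)
  have "(\<lambda>k. w k powr (1 / p)) \<longlonglongrightarrow> 0 powr (1 / p)"
    using p0 w0 by (intro tendsto_powr2[OF w_lim tendsto_const]) auto
  then have "\<forall>\<^sub>F k in sequentially. w k powr (1 / p) < 1 / (8 * B)"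
    using B p0 by (intro order_tendstoD(2)) auto
  then obtain m where m: "\<And>k. m \<le> k \<Longrightarrow> w k powr (1 / p) < 1 / (8 * B)"
    by (auto simp: eventually_sequentially)
  obtain k1 where k1: "max m k0 \<le> k1" "avg u x (rr k1) \<le> 1 / 2" using freq by blast
  \<comment> \<open>Starting from an average of at most 1/2, the changes form a geometric series of
    total at most \<open>2 * B * w k1 powr (1 / p)\<close>, which is below 1/4. The average thus
    stays at most 3/4, so the only way for the next scale not to be good is failure of the doubling
    condition.\<close>
  have step: "n (k1 + j * q) * C0 ^ j \<le> n k1 \<and> w (k1 + j * q) powr (1 / p) \<le> (1 / 2) ^ j * w k1 powr (1 / p) \<and>
      avg u x (rr (k1 + j * q)) \<le> 1 / 2 + 2 * B * w k1 powr (1 / p) * (1 - (1 / 2) ^ j)" for j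
  proof (induction j)
    case 0 then show ?case using k1 by simp
  next
    case (Suc j)
    let ?k = "k1 + j * q"
    let ?s = "w k1 powr (1 / p)"
    have s: "2 * B * ?s \<le> 1 / 4" using m[of k1] k1(1) B by (simp add: field_simps)
    have "2 * B * ?s * (1 - (1 / 2) ^ j) \<le> 2 * B * ?s * 1" using B by (intro mult_left_mono) auto
    then have "avg u x (rr ?k) \<le> 3 / 4" using Suc.IH s by linarith
    moreover have "k0 \<le> ?k" using k1(1) by simp
    ultimately have "\<not> nup g x (2 * L * rr ?k) \<le> C0 * nup g x (rr (?k + 2))" using none by blast
    then have bad: "C0 * n (?k + q) < n ?k" unfolding n_def rq by simp
    have kS: "k1 + Suc j * q = ?k + q" by simp
    have "n (?k + q) * C0 ^ Suc j = (C0 * n (?k + q)) * C0 ^ j" by (simp add: mult_ac)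
    also have "\<dots> \<le> n ?k * C0 ^ j" using bad C0_pos by (intro mult_right_mono) auto
    also have "\<dots> \<le> n k1" using Suc.IH by simp
    finally have A1: "n (?k + q) * C0 ^ Suc j \<le> n k1" .
    have "mb x (rr ?k) \<le> CD ^ q * mb x (rr (?k + q))"
      by (intro mb_comp) (auto simp: rr_def power_add power_one_over)
    then have "1 / mb x (rr (?k + q)) \<le> CD ^ q / mb x (rr ?k)" using mp[of ?k] mp[of "?k + q"] by (simp add: field_simps)
    moreover have "n (?k + q) \<le> n ?k / C0" using bad C0_pos by (simp add: field_simps)
    ultimately have 1: "n (?k + q) * (1 / mb x (rr (?k + q))) \<le> n ?k / C0 * (CD ^ q / mb x (rr ?k))"
      using n0 C0_pos by (intro mult_mono) auto
    have 2: "rr (?k + q) powr p \<le> rr ?k powr p" using p0 by (intro powr_mono2 rr_mono) auto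
    have "rr (?k + q) powr p * (n (?k + q) * (1 / mb x (rr (?k + q)))) \<le> rr ?k powr p * (n ?k / C0 * (CD ^ q / mb x (rr ?k)))"
      by (rule mult_mono[OF 2 1]) (use n0 in auto)
    then have "w (?k + q) \<le> w ?k / 2 powr p" using CD by (simp add: w_def C0_def q_def mult.commute)
    then have "w (?k + q) powr (1 / p) \<le> (w ?k / 2 powr p) powr (1 / p)" using w0 p0 by (intro powr_mono2) auto
    also have "\<dots> = w ?k powr (1 / p) / 2" using w0 p0 by (simp add: powr_divide powr_powr)
    also have "\<dots> \<le> (1 / 2) ^ Suc j * ?s" using Suc.IH by simp
    finally have A2: "w (?k + q) powr (1 / p) \<le> (1 / 2) ^ Suc j * ?s" .
    have "\<bar>avg u x (rr (?k + q)) - avg u x (rr ?k)\<bar> \<le> B * om g ?k x powr (1 / p)"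
      unfolding B_def
    proof (rule avg_near[OF u])
      show "mb x (rr ?k) \<le> CD ^ q * mb x (rr (?k + q))" by fact
      show "ball x (rr (?k + q)) \<subseteq> ball x (rr ?k)" by (intro subset_ball rr_mono) simp
    qed auto
    also have "\<dots> \<le> B * w ?k powr (1 / p)" using om_w[of ?k] p0 B by (intro mult_left_mono powr_mono2) auto
    also have "\<dots> \<le> B * ((1 / 2) ^ j * ?s)" using Suc.IH B by (intro mult_left_mono) auto
    finally have "avg u x (rr (?k + q)) \<le> avg u x (rr ?k) + B * ((1 / 2) ^ j * ?s)" by linarith
    also have "\<dots> \<le> 1 / 2 + 2 * B * ?s * (1 - (1 / 2) ^ j) + B * ((1 / 2) ^ j * ?s)" using Suc.IH by simp
    also have "\<dots> = 1 / 2 + 2 * B * ?s * (1 - (1 / 2) ^ Suc j)" by (simp add: algebra_simps)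
    finally show ?case using A1 A2 unfolding kS by blast
  qed
  \<comment> \<open>Over mL + 3 scales the measure loses at most the factor \<open>CD ^ q\<close>,
    while \<open>n\<close> loses \<open>C0 = CD ^ q * 2 powr p\<close>. As \<open>n\<close>
    dominates the measure, \<open>n k1\<close> would exceed every bound.\<close>
  have grow: "mb x (rr k1) * (2 powr p) ^ j \<le> n k1" for j
  proof -
    have "mb x (rr k1) \<le> CD ^ (q * j) * mb x (rr (k1 + j * q))"
      by (intro mb_comp) (auto simp: rr_def power_add power_one_over mult.commute)
    then have "mb x (rr k1) * (2 powr p) ^ j \<le> CD ^ (q * j) * mb x (rr (k1 + j * q)) * (2 powr p) ^ j"
      by (rule mult_right_mono) simp
    also have "\<dots> = mb x (rr (k1 + j * q)) * C0 ^ j" by (simp add: C0_def q_def power_mult power_mult_distrib)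
    also have "\<dots> \<le> n (k1 + j * q) * C0 ^ j" using n_mb C0_pos by (intro mult_right_mono) auto
    also have "\<dots> \<le> n k1" using step by blast
    finally show ?thesis .
  qed
  have "1 < (2::real) powr p" using p0 using powr_less_mono[of 0 p "2::real"] by simp
  then obtain j where "n k1 / mb x (rr k1) < (2 powr p) ^ j" using real_arch_pow by blast
  then show False using grow[of j] mp[of k1] by (simp add: divide_less_eq mult.commute)
qed

section \<open>Covering the oscillation points at good scales\<close>

lemma small_cap_empty: "small_cap {} 0"
  unfolding small_cap_def
proof (intro exI[of _ "\<lambda>_. 0"] conjI)
  show "Lp_grad (\<lambda>_. 0) (\<lambda>x. ereal 0)"
    using Lipschitz_weak_grad[of "\<lambda>_. 0" 0] by (simp add: Lp_grad_def energy_def)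
qed (auto simp: energy_def)

lemma countable_disjoint_balls:
  assumes "\<And>c. c \<in> C \<Longrightarrow> 0 < \<rho> c" "\<And>x y. x \<in> C \<Longrightarrow> y \<in> C \<Longrightarrow> x \<noteq> y \<Longrightarrow> ball x (\<rho> x) \<inter> ball y (\<rho> y) = ({} :: 'a set)"
  shows "countable C"
proof -
  obtain D :: "'a set" where D: "countable D" "\<And>x e. 0 < e \<Longrightarrow> \<exists>z\<in>D. dist x z < e" using countable_dense by blast
  have "\<forall>c\<in>C. \<exists>z\<in>D. z \<in> ball c (\<rho> c)" using D(2) assms(1) by fastforce
  then obtain h where h: "\<And>c. c \<in> C \<Longrightarrow> h c \<in> D" "\<And>c. c \<in> C \<Longrightarrow> h c \<in> ball c (\<rho> c)" by metis
  have "inj_on h C"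
  proof (rule inj_onI, rule ccontr)
    fix x y assume "x \<in> C" "y \<in> C" "h x = h y" "x \<noteq> y"
    then show False using assms(2)[of x y] h(2)[of x] h(2)[of y] by auto
  qed
  then show ?thesis using h(1) D(1) by (metis countable_image_inj_on countable_subset image_subsetI)
qed

text \<open>F is null for the measure with density g^p + 1 on the ball, so it has an open
  neighbourhood of small measure. Disjoint balls at good scales inside it are chosen by Vitali; each
  larger concentric ball of radius \<open>rr k\<close> contributes a test function equal to 1 on its
  part of F, whose norm the doubling property bounds by the measure of the small ball. The disjoint
  balls sum to a small total.\<close>

lemma oscillation_zero_cap_bounded:
  assumes u: "nice u g" and F1: "\<And>x. x \<in> F \<Longrightarrow> u x = 1" and om0: "\<And>x. x \<in> F \<Longrightarrow> (\<lambda>k. om g k x) \<longlonglongrightarrow> 0"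
    and freq: "\<And>x m. x \<in> F \<Longrightarrow> \<exists>k\<ge>m. avg u x (rr k) \<le> 1 / 2"
    and A: "F \<subseteq> A" "A \<in> null_sets N" and FB: "F \<subseteq> ball x0 R"
  shows "zero_cap F"
  unfolding zero_cap_def
proof (intro allI impI)
  fix e :: real assume e: "0 < e"
  have gfin: "energy g < \<infinity>" and [measurable]: "g \<in> borel_measurable borel" using niceD[OF u] by auto
  define \<mu> where "\<mu> = density N (\<lambda>y. (g y epowr p + 1) * indicator (ball x0 R) y)"
  have sets: "sets \<mu> = sets borel" by (simp add: \<mu>_def sets_N)
  have dm: "(\<lambda>y. (g y epowr p + 1) * indicator (ball x0 R) y) \<in> borel_measurable N" by simp
  have \<mu>ball: "emeasure \<mu> (ball x r) = ennreal (nup g x r)" if "ball x r \<subseteq> ball x0 R" for x r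
  proof -
    have "emeasure \<mu> (ball x r) = (\<integral>\<^sup>+y. g y epowr p * indicator (ball x r) y + indicator (ball x r) y \<partial>N)"
      unfolding \<mu>_def using that
      by (subst emeasure_density[OF dm]) (auto simp: indicator_def distrib_right intro!: nn_integral_cong)
    also have "\<dots> = ennreal (nup g x r)"
      by (subst nn_integral_add) (auto simp: nu_eq[OF gfin] emeasure_ball nup_def)
    finally show ?thesis .
  qed
  have "emeasure \<mu> UNIV \<le> (\<integral>\<^sup>+y. g y epowr p + indicator (ball x0 R) y \<partial>N)"
    unfolding \<mu>_def by (subst emeasure_density[OF dm]) (auto simp: sets_N indicator_def intro!: nn_integral_mono)
  also have "\<dots> < \<infinity>" using gfin ball_fin[of x0 R] by (subst nn_integral_add) (auto simp: energy_def)
  finally have fin: "emeasure \<mu> UNIV < \<infinity>" .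
  interpret \<mu>: finite_measure \<mu> using fin sets_eq_imp_space_eq[OF sets] by (intro finite_measureI) simp
  have Ab: "A \<in> sets borel" using A(2) by (auto simp: null_sets_def sets_N)
  have A0: "emeasure \<mu> A = 0"
  proof -
    have "AE y in N. y \<notin> A" by (rule AE_not_in[OF A(2)])
    then have "(\<integral>\<^sup>+y. ((g y epowr p + 1) * indicator (ball x0 R) y) * indicator A y \<partial>N) = (\<integral>\<^sup>+y. 0 \<partial>N)"
    proof (intro nn_integral_cong_AE)
      assume "AE y in N. y \<notin> A"
      then show "AE y in N. ((g y epowr p + 1) * indicator (ball x0 R) y) * indicator A y = 0"
        by eventually_elim simp
    qed
    then show ?thesis unfolding \<mu>_def using Ab by (subst emeasure_density[OF dm]) (auto simp: sets_N)
  qed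
  \<comment> \<open>The 2 covers norm and energy together; 4^p comes from the level gap 1/4 between
    u = 1 and an average of at most 3/4.\<close>
  define Cst where "Cst = 2 * CT * 4 powr p * C0"
  have Cst: "0 < Cst" using CT_pos C0_pos by (simp add: Cst_def)
  have "0 < e / Cst" using e Cst by simp
  from metric_regular[OF sets fin Ab this] obtain S U where S: "closed S" "open U" "S \<subseteq> A" "A \<subseteq> U" "measure \<mu> (U - S) < e / Cst"
    by blast
  have S0: "measure \<mu> S = 0"
    using emeasure_mono[OF S(3), of \<mu>] A0 Ab by (simp add: sets measure_def)
  have Sb: "S \<in> sets \<mu>" "U \<in> sets \<mu>" using S by (auto simp: sets)
  have "measure \<mu> U = measure \<mu> (U - S) + measure \<mu> S"
    using S Sb \<mu>.finite_measure_Diff[of U S] by auto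
  then have \<mu>U: "measure \<mu> U < e / Cst" using S0 S(5) by simp
  define O' where "O' = U \<inter> ball x0 R"
  have O': "open O'" "F \<subseteq> O'" using S A FB by (auto simp: O'_def)
  have "\<exists>k. avg u x (rr k) \<le> 3 / 4 \<and> nup g x (2 * L * rr k) \<le> C0 * nup g x (rr (k + 2)) \<and> ball x (rr (k + 2)) \<subseteq> O'"
    if x: "x \<in> F" for x
  proof -
    obtain d where d: "0 < d" "ball x d \<subseteq> O'" using O' x by (meson open_contains_ball subsetD)
    obtain k0 where k0: "rr k0 < d" unfolding rr_def using real_arch_pow_inv[OF d(1), of "1/2"] by auto
    obtain k where k: "k0 \<le> k" "avg u x (rr k) \<le> 3 / 4" "nup g x (2 * L * rr k) \<le> C0 * nup g x (rr (k + 2))"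
      using good_scale[OF u om0[OF x] freq[OF x], of k0] by blast
    have "rr (k + 2) \<le> d" using rr_mono[of k0 "k + 2"] k(1) k0 by simp
    then have "ball x (rr (k + 2)) \<subseteq> O'" using d(2) subset_ball by blast
    then show ?thesis using k by blast
  qed
  then obtain kk where kk: "\<And>x. x \<in> F \<Longrightarrow> avg u x (rr (kk x)) \<le> 3 / 4"
    "\<And>x. x \<in> F \<Longrightarrow> nup g x (2 * L * rr (kk x)) \<le> C0 * nup g x (rr (kk x + 2))"
    "\<And>x. x \<in> F \<Longrightarrow> ball x (rr (kk x + 2)) \<subseteq> O'" by metis
  \<comment> \<open>Two scales below the good one, so that the Vitali enlargement by 3 has radius
    3/4 of \<open>rr (kk x)\<close> and fits into the ball on which the test function works.\<close>
  define \<rho> where "\<rho> x = rr (kk x + 2)" for x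
  have \<rho>: "0 < \<rho> x" "\<rho> x \<le> 1" for x by (auto simp: \<rho>_def rr_le_1)
  obtain C where C: "C \<subseteq> F" "\<And>x y. x \<in> C \<Longrightarrow> y \<in> C \<Longrightarrow> x \<noteq> y \<Longrightarrow> ball x (\<rho> x) \<inter> ball y (\<rho> y) = {}"
    "F \<subseteq> (\<Union>x\<in>C. ball x (3 * \<rho> x))"
    by (rule vitali_covering_balls[of F \<rho> 1]) (use \<rho> that in auto)
  have cC: "countable C" using countable_disjoint_balls[of C \<rho>] \<rho> C(2) by blast
  define c where "c = from_nat_into C"
  define I where "I = to_nat_on C ` C"
  have cI: "c n \<in> C" "to_nat_on C (c n) = n" if "n \<in> I" for n
    using that cC unfolding I_def c_def by auto
  define Z where "Z n = (if n \<in> I then F \<inter> ball (c n) (rr (kk (c n))) else {})" for n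
  define Bn where "Bn n = (if n \<in> I then ball (c n) (\<rho> (c n)) else {})" for n
  have "F \<subseteq> (\<Union>n. Z n)"
  proof
    fix x assume x: "x \<in> F"
    then obtain y where y: "y \<in> C" "x \<in> ball y (3 * \<rho> y)" using C(3) by blast
    have "3 * \<rho> y \<le> rr (kk y)" by (simp add: \<rho>_def rr_add) (simp add: rr_def power2_eq_square)
    then have "x \<in> ball y (rr (kk y))" using y(2) by simp
    moreover have "to_nat_on C y \<in> I" "c (to_nat_on C y) = y" using y(1) cC by (auto simp: I_def c_def)
    ultimately show "x \<in> (\<Union>n. Z n)" using x by (intro UN_I[of "to_nat_on C y"]) (auto simp: Z_def)
  qed
  moreover have sum_le: "(\<Sum>n. ennreal Cst * emeasure \<mu> (Bn n)) \<le> ennreal e"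
  proof -
    have "disjoint_family Bn" unfolding disjoint_family_on_def
    proof (intro ballI impI)
      fix m n :: nat assume mn: "m \<noteq> n"
      show "Bn m \<inter> Bn n = {}"
      proof (cases "m \<in> I \<and> n \<in> I")
        case True
        then have "c m \<noteq> c n" using cI(2) mn by metis
        then show ?thesis using C(2)[of "c m" "c n"] cI(1) True by (simp add: Bn_def)
      qed (auto simp: Bn_def)
    qed
    moreover have "range Bn \<subseteq> sets \<mu>" by (auto simp: Bn_def sets)
    ultimately have "(\<Sum>n. emeasure \<mu> (Bn n)) = emeasure \<mu> (\<Union>n. Bn n)"
      using suminf_emeasure by blast
    also have "\<dots> \<le> emeasure \<mu> U"
    proof (rule emeasure_mono[OF _ Sb(2)])
      have "Bn n \<subseteq> O'" for n
        using kk(3)[of "c n"] cI(1)[of n] C(1) by (cases "n \<in> I") (auto simp: Bn_def \<rho>_def)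
      then show "(\<Union>n. Bn n) \<subseteq> U" by (auto simp: O'_def)
    qed
    also have "\<dots> \<le> ennreal (e / Cst)" using \<mu>U by (simp add: \<mu>.emeasure_eq_measure ennreal_leI)
    finally have "ennreal Cst * (\<Sum>n. emeasure \<mu> (Bn n)) \<le> ennreal Cst * ennreal (e / Cst)" by (rule mult_left_mono) simp
    also have "\<dots> = ennreal e" using Cst e by (simp flip: ennreal_mult)
    finally show ?thesis by simp
  qed
  moreover have "small_cap (\<Union>n. Z n) (\<Sum>n. ennreal Cst * emeasure \<mu> (Bn n))"
  proof (rule small_cap_UN)
    fix n
    show "small_cap (Z n) (ennreal Cst * emeasure \<mu> (Bn n))"
    proof (cases "n \<in> I")
      case False then show ?thesis using small_cap_empty by (simp add: Z_def Bn_def)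
    next
      case True
      define x where "x = c n"
      have x: "x \<in> F" using cI(1)[OF True] C(1) by (auto simp: x_def)
      have d4: "(1 / 4 :: real) powr (- p) = 4 powr p" by (simp add: powr_minus powr_divide)
      obtain f h where f: "f \<in> borel_measurable M" "\<forall>y. 0 \<le> f y \<and> f y \<le> 1"
        "\<forall>y\<in>ball x (rr (kk x)). 1 / 4 \<le> 1 * (u y - avg u x (rr (kk x))) \<longrightarrow> f y = 1"
        "Lp_grad h (\<lambda>y. ereal (f y))" "energy h \<le> ennreal (CT * (1 / 4) powr (-p) * nu g x (2 * L * rr (kk x)))"
        "(\<integral>\<^sup>+y. ennreal (f y) epowr p \<partial>N) \<le> ennreal (CT * (1 / 4) powr (-p) * nu g x (2 * L * rr (kk x)))"
        using level_set_test_function[OF u, of "1 / 4" "rr (kk x)" "kk x" 1 x] by auto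
      have "(\<integral>\<^sup>+y. ennreal (f y) epowr p \<partial>N) + energy h \<le> ennreal (CT * 4 powr p * nu g x (2 * L * rr (kk x))) + ennreal (CT * 4 powr p * nu g x (2 * L * rr (kk x)))"
        using f(5,6) unfolding d4 by (intro add_mono)
      also have "\<dots> = ennreal (2 * CT * 4 powr p * nu g x (2 * L * rr (kk x)))" using CT_pos by (simp flip: ennreal_plus)
      also have "\<dots> \<le> ennreal (Cst * nup g x (\<rho> x))"
      proof (rule ennreal_leI)
        have "nu g x (2 * L * rr (kk x)) \<le> nup g x (2 * L * rr (kk x))" by (simp add: nup_def)
        also have "\<dots> \<le> C0 * nup g x (\<rho> x)" unfolding \<rho>_def by (rule kk(2)[OF x])
        finally have "2 * CT * 4 powr p * nu g x (2 * L * rr (kk x)) \<le> 2 * CT * 4 powr p * (C0 * nup g x (\<rho> x))"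
          using CT_pos by (intro mult_left_mono) auto
        then show "2 * CT * 4 powr p * nu g x (2 * L * rr (kk x)) \<le> Cst * nup g x (\<rho> x)" by (simp add: Cst_def mult_ac)
      qed
      also have "\<dots> = ennreal Cst * emeasure \<mu> (Bn n)"
      proof -
        have "ball x (\<rho> x) \<subseteq> ball x0 R" using kk(3)[OF x] by (auto simp: \<rho>_def O'_def)
        then have "emeasure \<mu> (Bn n) = ennreal (nup g x (\<rho> x))" using True by (simp add: Bn_def x_def \<mu>ball)
        then show ?thesis using Cst by (simp add: nup_def ennreal_mult)
      qed
      finally have le: "(\<integral>\<^sup>+y. ennreal (f y) epowr p \<partial>N) + energy h \<le> ennreal Cst * emeasure \<mu> (Bn n)" .
      have "f y = 1" if "y \<in> Z n" for y
      proof -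
        have y: "y \<in> F" "y \<in> ball x (rr (kk x))" using that True by (auto simp: Z_def x_def)
        have "1 / 4 \<le> 1 * (u y - avg u x (rr (kk x)))" using F1[OF y(1)] kk(1)[OF x] by simp
        then show ?thesis using f(3) y(2) by blast
      qed
      then show ?thesis unfolding small_cap_def using f le by blast
    qed
  next
    show "(\<Sum>n. ennreal Cst * emeasure \<mu> (Bn n)) < \<infinity>" using sum_le by (auto intro: le_less_trans)
  qed
  ultimately show "small_cap F (ennreal e)" using small_cap_mono by blast
qed

lemma oscillation_zero_cap:
  assumes u: "nice u g" and F1: "\<And>x. x \<in> F \<Longrightarrow> u x = 1" and om0: "\<And>x. x \<in> F \<Longrightarrow> (\<lambda>k. om g k x) \<longlonglongrightarrow> 0"
    and freq: "\<And>x m. x \<in> F \<Longrightarrow> \<exists>k\<ge>m. avg u x (rr k) \<le> 1 / 2"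
  shows "zero_cap F"
proof -
  have "AE x in N. (\<lambda>k. avg u x (rr k)) \<longlonglongrightarrow> u x" by (rule avg_tendsto[OF u])
  then obtain A where A: "{x \<in> space N. \<not> (\<lambda>k. avg u x (rr k)) \<longlonglongrightarrow> u x} \<subseteq> A" "emeasure N A = 0" "A \<in> sets N"
    by (rule AE_E)
  have FA: "F \<subseteq> A"
  proof
    fix x assume x: "x \<in> F"
    have "\<not> (\<lambda>k. avg u x (rr k)) \<longlonglongrightarrow> u x"
    proof
      assume "(\<lambda>k. avg u x (rr k)) \<longlonglongrightarrow> u x"
      then have "\<forall>\<^sub>F k in sequentially. 1 / 2 < avg u x (rr k)"
        using F1[OF x] by (intro order_tendstoD(1)) auto
      then obtain m where "\<And>k. m \<le> k \<Longrightarrow> 1 / 2 < avg u x (rr k)" by (auto simp: eventually_sequentially)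
      then show False using freq[OF x, of m] by force
    qed
    then show "x \<in> A" using A(1) by auto
  qed
  have "zero_cap (F \<inter> ball undefined (real n))" for n
    by (rule oscillation_zero_cap_bounded[OF u, of _ A]) (use F1 om0 freq FA A in \<open>auto intro: null_setsI\<close>)
  then have "zero_cap (\<Union>n. F \<inter> ball undefined (real n))" by (rule zero_cap_UN)
  moreover have "F \<subseteq> (\<Union>n. F \<inter> ball undefined (real n))" using UN_ball[of "undefined :: 'a"] by blast
  ultimately show ?thesis by (rule zero_cap_subset)
qed

end

section \<open>Thinness\<close>

lemma nn_integral_inverse_0_1: "(\<integral>\<^sup>+r\<in>{0<..<1}. 1 / ennreal r \<partial>lborel) = \<infinity>"
proof -
  have "of_nat n \<le> (\<integral>\<^sup>+r\<in>{0<..<1}. 1 / ennreal r \<partial>lborel)" for n :: nat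
  proof -
    let ?a = "exp (- real n - 1)" and ?b = "exp (- 1 :: real)"
    have "(\<integral>\<^sup>+r. ennreal (1 / r) * indicator {?a..?b} r \<partial>lborel) = ennreal (ln ?b - ln ?a)"
    proof (rule nn_integral_FTC_Icc)
      fix r assume "r \<in> {?a..?b}"
      then have "0 < r" using less_le_trans[OF exp_gt_zero, of "- real n - 1" r] by simp
      then show "DERIV ln r :> 1 / r" "0 \<le> 1 / r" by (auto intro: DERIV_ln_divide)
    qed auto
    then have "of_nat n = (\<integral>\<^sup>+r. ennreal (1 / r) * indicator {?a..?b} r \<partial>lborel)"
      by (simp add: ennreal_of_nat_eq_real_of_nat)
    also have "\<dots> \<le> (\<integral>\<^sup>+r\<in>{0<..<1}. 1 / ennreal r \<partial>lborel)"
    proof (rule nn_integral_mono)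
      fix r :: real
      have "r \<in> {?a..?b} \<Longrightarrow> 0 < r \<and> r < 1"
        using less_le_trans[OF exp_gt_zero, of "- real n - 1" r] by (auto intro: le_less_trans)
      then show "ennreal (1 / r) * indicator {?a..?b} r \<le> 1 / ennreal r * indicator {0<..<1} r"
        using divide_ennreal[of 1 r] by (auto simp: indicator_def)
    qed
    finally show ?thesis .
  qed
  then have "(SUP n. of_nat n :: ennreal) \<le> (\<integral>\<^sup>+r\<in>{0<..<1}. 1 / ennreal r \<partial>lborel)" by (intro SUP_least)
  then show ?thesis by (simp add: ennreal_SUP_of_nat_eq_top top_unique)
qed

lemma ennreal_divide_le_1: "a \<le> b \<Longrightarrow> b \<noteq> 0 \<Longrightarrow> a / b \<le> (1 :: ennreal)"
  using divide_right_mono_ennreal[of a b b] ennreal_divide_self[of b]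
  by (cases "b = top") (auto simp: divide_ennreal_def top_unique less_top)

lemma ennreal_divide_mono:
  assumes "a \<le> ennreal x" "ennreal y \<le> b" "0 \<le> x" "0 < y" shows "a / b \<le> ennreal (x / y)"
proof (cases b)
  case (real z)
  obtain w where w: "a = ennreal w" "0 \<le> w" "w \<le> x" using assms(1,3) by (cases a) (auto simp: top_unique)
  have z: "y \<le> z" using assms(2,4) real by simp
  then have "w / z \<le> x / y" using w assms by (intro frac_le) auto
  then show ?thesis using w z real assms(4) by (simp add: divide_ennreal ennreal_leI)
qed (simp add: divide_ennreal_def)

lemma var_capacity_mono: "A \<subseteq> B \<Longrightarrow> var_capacity M p A G \<le> var_capacity M p B G"
  unfolding var_capacity_def by (intro INF_superset_mono) auto

context pi_space
begin

section \<open>Variational capacities and sets of capacity zero\<close>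

lemma half_power_scale:
  assumes "0 < r" "r \<le> rr m" obtains j where "m \<le> j" "rr (Suc j) < r" "r \<le> rr j"
proof -
  have "\<exists>k. rr k < r" unfolding rr_def using real_arch_pow_inv[OF assms(1), of "1/2"] by auto
  define k where "k = (LEAST k. rr k < r)"
  have k: "rr k < r" unfolding k_def by (rule LeastI_ex) fact
  have least: "r \<le> rr i" if "i < k" for i using not_less_Least[of i "\<lambda>k. rr k < r"] that by (auto simp: k_def)
  have "m < k"
  proof (rule ccontr)
    assume "\<not> m < k" then have "rr m \<le> rr k" by (intro rr_mono) simp
    then show False using k assms by linarith
  qed
  then obtain j where "k = Suc j" "m \<le> j" by (cases k) auto
  then show ?thesis using that[of j] k least[of j] by simp
qed

lemma var_capacity_le:
  assumes f: "f \<in> borel_measurable M" "\<And>x. 0 \<le> f x" "\<And>x. x \<in> A \<Longrightarrow> f x = 1" "\<And>x. x \<notin> G \<Longrightarrow> f x = 0"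
    and h: "Lp_grad h (\<lambda>x. ereal (f x))" and fin: "(\<integral>\<^sup>+x. ennreal (f x) epowr p \<partial>N) < \<infinity>"
  shows "var_capacity M p A G \<le> energy h"
proof -
  have "(\<lambda>x. ereal (f x)) \<in> newtonian M p" by (rule newtonianI[OF _ _ h]) (use f fin in auto)
  then have "(\<lambda>x. ereal (f x)) \<in> newtonian_zero M p G" using f(4) by (simp add: newtonian_zero_def)
  then have "var_capacity M p A G \<le> p_energy M p (\<lambda>x. ereal (f x))"
    unfolding var_capacity_def using f(3) by (intro INF_lower) auto
  also have "\<dots> \<le> energy h" by (rule p_energy_le[OF h])
  finally show ?thesis .
qed

text \<open>Clipping an admissible function preserves its gradient, so lower bounds need testing
  only on functions with values in [0, 1] that equal 1 on A.\<close>

lemma var_capacity_greatest: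
  assumes "\<And>f h. f \<in> borel_measurable M \<Longrightarrow> (\<And>x. 0 \<le> f x) \<Longrightarrow> (\<And>x. f x \<le> 1) \<Longrightarrow> (\<And>x. x \<in> A \<Longrightarrow> f x = 1) \<Longrightarrow>
    (\<And>x. x \<notin> G \<Longrightarrow> f x = 0) \<Longrightarrow> Lp_grad h (\<lambda>x. ereal (f x)) \<Longrightarrow> (\<integral>\<^sup>+x. ennreal (f x) epowr p \<partial>N) < \<infinity> \<Longrightarrow> t \<le> energy h"
  shows "t \<le> var_capacity M p A G"
  unfolding var_capacity_def
proof (rule INF_greatest, clarify)
  fix u assume u: "u \<in> newtonian_zero M p G" and A: "\<forall>x\<in>A. 1 \<le> u x"
  then have "u \<in> newtonian M p" and G: "\<And>x. x \<notin> G \<Longrightarrow> u x = 0" by (auto simp: newtonian_zero_def)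
  then obtain g where g: "Lp_grad g u" "energy g = p_energy M p u" "u \<in> borel_measurable M" "(\<integral>\<^sup>+x. eabs (u x) epowr p \<partial>N) < \<infinity>"
    using newtonianD by metis
  have "(\<integral>\<^sup>+x. ennreal (clip (u x)) epowr p \<partial>N) \<le> (\<integral>\<^sup>+x. eabs (u x) epowr p \<partial>N)"
    using p0 by (intro nn_integral_mono epowr_mono clip_le_eabs) auto
  then have "(\<integral>\<^sup>+x. ennreal (clip (u x)) epowr p \<partial>N) < \<infinity>" using g(4) by (rule le_less_trans)
  moreover have "(\<lambda>x. clip (u x)) \<in> borel_measurable M" using g(3) by measurable
  ultimately have "t \<le> energy g"
    using A G by (intro assms[of "\<lambda>x. clip (u x)" g] Lp_grad_clip g(1)) (auto intro: clip_eq_1 clip_eq_0)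
  then show "t \<le> p_energy M p u" by (simp add: g(2))
qed

text \<open>An admissible function may be set to 1 on the additional points: the change happens on a
  set of capacity zero and is invisible to gradients and integrals.\<close>

lemma var_capacity_zero_cap:
  assumes Z: "zero_cap Z" and A: "A' \<subseteq> A \<union> Z" "A' \<subseteq> G"
  shows "var_capacity M p A' G \<le> var_capacity M p A G"
proof (rule var_capacity_greatest)
  fix f h assume f: "f \<in> borel_measurable M" "\<And>x. 0 \<le> f x" "\<And>x. x \<in> A \<Longrightarrow> f x = 1"
    "\<And>x. x \<notin> G \<Longrightarrow> f x = 0" "Lp_grad h (\<lambda>x. ereal (f x))" "(\<integral>\<^sup>+x. ennreal (f x) epowr p \<partial>N) < \<infinity>"
  define f' where "f' x = (if x \<in> A' then 1 else f x)" for x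
  define Z' where "Z' = Z \<inter> A' - A"
  have Z': "zero_cap Z'" by (rule zero_cap_subset[OF Z]) (auto simp: Z'_def)
  have eq: "f' x = f x" if "x \<notin> Z'" for x using that A(1) f(3) by (auto simp: f'_def Z'_def)
  show "var_capacity M p A' G \<le> energy h"
  proof (rule var_capacity_le)
    have "(\<lambda>x. ereal (f' x)) \<in> borel_measurable M"
      by (rule measurable_modify[OF _ Z', of "\<lambda>x. ereal (f x)"]) (use f(1) eq in auto)
    then show "f' \<in> borel_measurable M" by simp
    show "Lp_grad h (\<lambda>x. ereal (f' x))" by (rule Lp_grad_modify[OF f(5) Z']) (simp add: eq)
    obtain T where T: "Z' \<subseteq> T" "T \<in> null_sets N" using zero_cap_null[OF Z'] .
    have "(\<integral>\<^sup>+x. ennreal (f' x) epowr p \<partial>N) = (\<integral>\<^sup>+x. ennreal (f x) epowr p \<partial>N)"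
    proof (rule nn_integral_cong_AE)
      show "AE x in N. ennreal (f' x) epowr p = ennreal (f x) epowr p"
        using AE_not_in[OF T(2)] 
      proof eventually_elim
        case (elim x)
        then have "x \<notin> Z'" using T(1) by blast
        then show ?case by (simp add: eq)
      qed
    qed
    then show "(\<integral>\<^sup>+x. ennreal (f' x) epowr p \<partial>N) < \<infinity>" using f(6) by simp
  qed (use f A(2) in \<open>auto simp: f'_def\<close>)
qed

lemma thin_at_le:
  assumes "thin_at M p A x"
    and le: "\<And>r. 0 < r \<Longrightarrow> var_capacity M p (B \<inter> ball x r) (ball x (2 * r)) \<le> var_capacity M p (A \<inter> ball x r) (ball x (2 * r))"
  shows "thin_at M p B x"
proof -
  have q: "0 \<le> 1 / (p - 1)" using p by simp
  show ?thesis
    unfolding thin_at_def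
    by (rule le_less_trans[OF nn_integral_mono assms(1)[unfolded thin_at_def]])
      (use q in \<open>auto simp: indicator_def intro!: divide_right_mono_ennreal epowr_mono le\<close>)
qed

lemma thin_at_mono: "thin_at M p A x \<Longrightarrow> B \<subseteq> A \<Longrightarrow> thin_at M p B x"
  by (erule thin_at_le) (intro var_capacity_mono, blast)

lemma thin_at_zero_cap: "thin_at M p A x \<Longrightarrow> zero_cap Z \<Longrightarrow> thin_at M p (A \<union> Z) x"
proof (erule thin_at_le)
  fix r :: real assume "zero_cap Z" "0 < r"
  then show "var_capacity M p ((A \<union> Z) \<inter> ball x r) (ball x (2 * r)) \<le> var_capacity M p (A \<inter> ball x r) (ball x (2 * r))"
    by (intro var_capacity_zero_cap[of Z]) (auto simp: subset_ball)
qed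

lemma var_capacity_ball_lower:
  assumes "0 < r" "3 * r \<le> dist x (y :: 'a)"
  shows "ennreal (CL * mb x r * r powr (-p)) \<le> var_capacity M p (ball x r) (ball x (2 * r))"
  by (rule var_capacity_greatest) (rule energy_lower_bound[OF assms])

lemma cutoff_nice: assumes "0 < r" shows "\<exists>g. nice (cutoff x r) g"
proof -
  have "Lp_grad (\<lambda>y. ennreal (1 / r) * indicator (ball x (2 * r)) y) (\<lambda>y. ereal (cutoff x r y))"
    by (rule Lipschitz_Lp_grad(1)[where c=0])
      (use assms cutoff[OF assms, where x=x] ball_fin[of x "2 * r"] in auto)
  then have "nice (cutoff x r) (\<lambda>y. ennreal (1 / r) * indicator (ball x (2 * r)) y)"
    by (rule nice_supportI[of _ x "2 * r", rotated 4]) (use cutoff[OF assms, where x=x] measurable_M in auto)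
  then show ?thesis by blast
qed

lemma var_capacity_ball_finite:
  assumes r: "0 < r" shows "var_capacity M p (ball x r) (ball x (2 * r)) < \<infinity>"
proof -
  obtain g where g: "nice (cutoff x r) g" using cutoff_nice[OF r] by blast
  have "(\<integral>\<^sup>+y. ennreal (cutoff x r y) epowr p \<partial>N) \<le> (\<integral>\<^sup>+y. ennreal (cutoff x r y) \<partial>N)"
  proof (rule nn_integral_mono)
    fix y show "ennreal (cutoff x r y) epowr p \<le> ennreal (cutoff x r y)"
      using cutoff(1,2)[OF r, of x y] powr_mono'[of 1 p "cutoff x r y"] p by (simp add: epowr_ennreal ennreal_leI)
  qed
  then have "(\<integral>\<^sup>+y. ennreal (cutoff x r y) epowr p \<partial>N) < \<infinity>" using niceD(4)[OF g] by (rule le_less_trans)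
  then have "var_capacity M p (ball x r) (ball x (2 * r)) \<le> energy g"
    by (intro var_capacity_le[of "cutoff x r"] niceD(1,2,5)[OF g] cutoff(3,4)[OF r])
  then show ?thesis using niceD(6)[OF g] by (rule le_less_trans)
qed

end

context wolff
begin

text \<open>Since averages exceed 1/2, zeros of u lie at least 1/2 below them, and the level set
  test function with sign -1 bounds the numerator. The second point y supplies the lower bound for
  the capacity of small balls. The quotient is at most \<open>W * om g j x\<close>, and the power 1
  / (p - 1) turns it into a multiple of \<open>c j x\<close>.\<close>

lemma thin_at_zeros:
  assumes u: "nice u g" and fin: "(\<Sum>k. ennreal (c k x)) < \<infinity>" and xy: "x \<noteq> (y :: 'a)"
    and avg: "\<And>k. m0 \<le> k \<Longrightarrow> 1 / 2 < avg u x (rr k)"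
  shows "thin_at M p {z. u z = 0} x"
proof -
  define q where "q = 1 / (p - 1)"
  have q: "0 < q" using p by (simp add: q_def)
  define cap where "cap A r = var_capacity M p (A \<inter> ball x r) (ball x (2 * r))" for A r
  define F where "F r = (if cap UNIV r = 0 then 1 else (cap {z. u z = 0} r / cap UNIV r) epowr q)" for r
  have F1: "F r \<le> 1" for r
  proof -
    have "cap {z. u z = 0} r \<le> cap UNIV r" unfolding cap_def by (intro var_capacity_mono) auto
    then have "(cap {z. u z = 0} r / cap UNIV r) epowr q \<le> 1 epowr q" if "cap UNIV r \<noteq> 0"
      using that q by (intro epowr_mono ennreal_divide_le_1) auto
    then show ?thesis by (simp add: F_def)
  qed
  define W where "W = CT * 2 powr p * CD ^ 2 / CL"
  have W: "0 < W" using CT_pos CL_pos CD by (simp add: W_def)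
  define B where "B = W powr q"
  have B: "0 < B" using W by (simp add: B_def)
  obtain m1 where m1: "rr m1 < dist x y / 3"
    unfolding rr_def using real_arch_pow_inv[of "dist x y / 3" "1/2"] xy by auto
  define m where "m = max m0 m1"
  have m: "m0 \<le> m" "3 * rr m \<le> dist x y" using m1 rr_mono[of m1 m] by (auto simp: m_def)
  \<comment> \<open>The test function uses scale j + 1 because its energy lives on the dilation
    \<open>2 * L * rr (Suc j) = L * rr j\<close>, exactly the one in \<open>om g j\<close>.\<close>
  have Fc: "F r \<le> ennreal (B * c j x)" if j: "m \<le> j" and r: "rr (Suc (Suc j)) < r" "r \<le> rr (Suc j)" for j r
  proof -
    have r0: "0 < r" using r rr_pos(1)[of "Suc (Suc j)"] by linarith
    have r2: "rr (Suc j) \<le> 2 * r" using r by (simp add: rr_Suc)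
    obtain f h where f: "f \<in> borel_measurable M" "\<forall>z. 0 \<le> f z \<and> f z \<le> 1"
      "\<forall>z\<in>ball x r. 1 / 2 \<le> - 1 * (u z - avg u x (rr (Suc j))) \<longrightarrow> f z = 1" "\<forall>z. z \<notin> ball x (2 * r) \<longrightarrow> f z = 0"
      "Lp_grad h (\<lambda>z. ereal (f z))" "energy h \<le> ennreal (CT * (1 / 2) powr (-p) * nu g x (2 * L * rr (Suc j)))"
      "(\<integral>\<^sup>+z. ennreal (f z) epowr p \<partial>N) \<le> ennreal (CT * (1 / 2) powr (-p) * nu g x (2 * L * rr (Suc j)))"
      using level_set_test_function[OF u _ r0 r(2) r2, of "1 / 2" "- 1" x] by auto
    have d2: "(1 / 2 :: real) powr (- p) = 2 powr p" by (simp add: powr_minus powr_divide)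
    have L2: "2 * L * rr (Suc j) = L * rr j" by (simp add: rr_Suc)
    have "(\<integral>\<^sup>+z. ennreal (f z) epowr p \<partial>N) < \<infinity>" using f(7) by (rule le_less_trans) simp
    then have "cap {z. u z = 0} r \<le> energy h"
      unfolding cap_def using avg[of "Suc j"] m(1) j f by (intro var_capacity_le[OF f(1)]) (auto intro: less_imp_le)
    also have "\<dots> \<le> ennreal (CT * 2 powr p * nu g x (L * rr j))" using f(6) unfolding d2 L2 .
    finally have num: "cap {z. u z = 0} r \<le> ennreal (CT * 2 powr p * nu g x (L * rr j))" .
    have "3 * r \<le> dist x y" using r(2) rr_mono[of m "Suc j"] j m(2) by simp
    then have den: "ennreal (CL * mb x r * r powr (-p)) \<le> cap UNIV r"
      using var_capacity_ball_lower[OF r0] by (simp add: cap_def)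
    have mr: "0 < mb x r" by (rule mb_pos[OF r0])
    have d0: "0 < CL * mb x r * r powr (-p)" using CL_pos mr r0 by simp
    have "mb x (rr j) \<le> CD ^ 2 * mb x r"
      using r0 r by (intro mb_comp) (auto simp: rr_Suc)
    then have "1 / mb x r \<le> CD ^ 2 * (1 / mb x (rr j))" using mr mb_pos[of "rr j" x] by (simp add: field_simps)
    moreover have "r powr p \<le> rr j powr p" using r r0 p0 rr_mono[of j "Suc j"] by (intro powr_mono2) auto
    ultimately have "r powr p * (1 / mb x r) \<le> rr j powr p * (CD ^ 2 * (1 / mb x (rr j)))" by (intro mult_mono) auto
    then have "CT * 2 powr p / CL * nu g x (L * rr j) * (r powr p * (1 / mb x r))
      \<le> CT * 2 powr p / CL * nu g x (L * rr j) * (rr j powr p * (CD ^ 2 * (1 / mb x (rr j))))"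
      using CT_pos CL_pos by (intro mult_left_mono) auto
    then have rat: "CT * 2 powr p * nu g x (L * rr j) / (CL * mb x r * r powr (-p)) \<le> W * om g j x"
      using r0 by (simp add: W_def om_def powr_minus field_simps)
    have "cap {z. u z = 0} r / cap UNIV r \<le> ennreal (CT * 2 powr p * nu g x (L * rr j) / (CL * mb x r * r powr (-p)))"
      using CT_pos by (intro ennreal_divide_mono num den d0) auto
    also have "\<dots> \<le> ennreal (W * om g j x)" by (rule ennreal_leI[OF rat])
    finally have "(cap {z. u z = 0} r / cap UNIV r) epowr q \<le> ennreal (W * om g j x) epowr q"
      using q by (intro epowr_mono) auto
    also have "\<dots> = ennreal (B * c j x)"
      using W om_nonneg[of g j x] by (simp add: epowr_ennreal B_def c_def q_def powr_mult)
    finally show ?thesis using den d0 by (auto simp: F_def)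
  qed
  have pos2: "0 < rr (Suc (Suc j))" for j by (rule rr_pos)
  \<comment> \<open>Large radii use only that the integrand is at most 1 / r; below
    \<open>rr (Suc m)\<close> exactly one dyadic interval contains r.\<close>
  have "F r / ennreal r * indicator {0<..<1} r
    \<le> ennreal (1 / rr (Suc m)) * indicator {0<..<1} r + (\<Sum>j. ennreal (B * c j x / rr (Suc (Suc j))) * indicator {rr (Suc (Suc j))<..rr (Suc j)} r)"
    (is "?l r \<le> ?a r + ?s r") for r
  proof (cases "0 < r \<and> r < 1")
    case True
    show ?thesis
    proof (cases "r \<le> rr (Suc m)")
      case False
      then have r: "rr (Suc m) \<le> r" by simp
      have "F r / ennreal r \<le> ennreal (1 / rr (Suc m))"
        using F1[of r] by (intro ennreal_divide_mono) (auto intro: ennreal_leI r)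
      then show ?thesis using True by (simp add: add_increasing2)
    next
      case le: True
      then obtain i where i: "Suc m \<le> i" "rr (Suc i) < r" "r \<le> rr i"
        using half_power_scale True by blast
      then obtain j where j: "i = Suc j" "m \<le> j" by (cases i) auto
      have "F r / ennreal r \<le> ennreal (B * c j x / rr (Suc (Suc j)))"
        using Fc[of j r] i j B by (intro ennreal_divide_mono) (auto intro!: ennreal_leI)
      also have "\<dots> = (\<Sum>j\<in>{j}. ennreal (B * c j x / rr (Suc (Suc j))) * indicator {rr (Suc (Suc j))<..rr (Suc j)} r)"
        using i j by simp
      also have "\<dots> \<le> ?s r" by (rule sum_le_suminf) auto
      finally show ?thesis using True by (simp add: add_increasing)
    qed
  qed auto
  then have "(\<integral>\<^sup>+r. ?l r \<partial>lborel) \<le> (\<integral>\<^sup>+r. ?a r + ?s r \<partial>lborel)" by (intro nn_integral_mono)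
  also have "\<dots> = ennreal (1 / rr (Suc m)) + (\<Sum>j. ennreal (B / 1 * c j x))"
  proof -
    \<comment> \<open>The interval has length \<open>rr (Suc (Suc j))\<close>, which cancels the
      bound for 1 / r.\<close>
    have "(\<integral>\<^sup>+r. ennreal (B * c j x / rr (Suc (Suc j))) * indicator {rr (Suc (Suc j))<..rr (Suc j)} r \<partial>lborel) = ennreal (B / 1 * c j x)" for j
    proof -
      have "rr (Suc (Suc j)) \<le> rr (Suc j)" by (rule rr_mono) simp
      then have "(\<integral>\<^sup>+r. ennreal (B * c j x / rr (Suc (Suc j))) * indicator {rr (Suc (Suc j))<..rr (Suc j)} r \<partial>lborel)
        = ennreal (B * c j x / rr (Suc (Suc j))) * ennreal (rr (Suc j) - rr (Suc (Suc j)))"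
        by (subst nn_integral_cmult_indicator) auto
      also have "\<dots> = ennreal (B / 1 * c j x)" using B by (simp add: rr_Suc flip: ennreal_mult)
      finally show ?thesis .
    qed
    moreover have "(\<integral>\<^sup>+r. ?a r \<partial>lborel) = ennreal (1 / rr (Suc m))"
      by (subst nn_integral_cmult_indicator) auto
    ultimately show ?thesis by (simp add: nn_integral_add nn_integral_suminf)
  qed
  also have "\<dots> = ennreal (1 / rr (Suc m)) + ennreal B * (\<Sum>j. ennreal (c j x))"
    using B by (simp add: ennreal_mult)
  also have "\<dots> < \<infinity>" using fin by (simp add: ennreal_mult_less_top)
  finally show ?thesis unfolding thin_at_def F_def cap_def q_def Int_UNIV_left .
qed

end

context pi_space
begin

text \<open>The exceptional set collects the points with divergent Wolff sum and the oscillation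
  points with convergent sum; for the latter, convergence makes \<open>om\<close> tend to 0, as the
  covering argument requires.\<close>

lemma nice_thin_at_zeros:
  assumes u: "nice u g" and supp: "\<And>y. y \<notin> ball x0 R \<Longrightarrow> u y = 0" and two: "a \<noteq> (b :: 'a)"
  shows "\<exists>Z. zero_cap Z \<and> (\<forall>x. x \<notin> Z \<longrightarrow> u x = 1 \<longrightarrow> thin_at M p {z. u z = 0} x)"
proof -
  \<comment> \<open>A gradient vanishing off the support of u, to satisfy the bounded support
    assumption of the potential.\<close>
  define g' where "g' = (\<lambda>x. g x * indicator (ball x0 R) x)"
  have "Lp_grad g' (\<lambda>x. ereal (u x))" unfolding g'_def
    by (rule Lp_grad_indicator[where c=0]) (use supp niceD(5)[OF u] in auto)
  then have u': "nice u g'" using niceD[OF u] unfolding nice_def by blast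
  interpret wolff M N p CD CP K g' x0 R
    by unfold_locales (use niceD[OF u'] in \<open>auto simp: g'_def\<close>)
  define F where "F = {x. u x = 1 \<and> (\<Sum>k. ennreal (c k x)) < \<infinity> \<and> (\<forall>m. \<exists>k\<ge>m. avg u x (rr k) \<le> 1 / 2)}"
  have "zero_cap F"
  proof (rule oscillation_zero_cap[OF u'])
    fix x assume "x \<in> F"
    then have "(\<Sum>k. ennreal (c k x)) \<noteq> top" by (auto simp: F_def)
    then have "summable (\<lambda>k. c k x)" by (rule summable_suminf_not_top[OF c_nonneg])
    then have "(\<lambda>k. c k x) \<longlonglongrightarrow> 0" by (rule summable_LIMSEQ_zero)
    then have "(\<lambda>k. c k x powr (p - 1)) \<longlonglongrightarrow> 0 powr (p - 1)"
      using p by (intro tendsto_powr2 tendsto_const) auto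
    moreover have "c k x powr (p - 1) = om g' k x" for k
      using p om_nonneg[of g' k x] by (simp add: c_def powr_powr)
    ultimately show "(\<lambda>k. om g' k x) \<longlonglongrightarrow> 0" using p by simp
  qed (auto simp: F_def)
  then have "zero_cap ({x. (\<Sum>k. ennreal (c k x)) = \<infinity>} \<union> F)" using wolff_zero_cap by (intro zero_cap_Un)
  moreover have "thin_at M p {z. u z = 0} x" if "x \<notin> {x. (\<Sum>k. ennreal (c k x)) = \<infinity>} \<union> F" "u x = 1" for x
  proof -
    have fin: "(\<Sum>k. ennreal (c k x)) < \<infinity>" using that(1) by (simp add: less_top)
    have "\<not> (\<forall>m. \<exists>k\<ge>m. avg u x (rr k) \<le> 1 / 2)" 
    proof
      assume "\<forall>m. \<exists>k\<ge>m. avg u x (rr k) \<le> 1 / 2"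
      then have "x \<in> F" unfolding F_def using fin that(2) by (intro CollectI conjI)
      then show False using that(1) by (elim notE) (rule UnI2)
    qed
    then obtain m where m: "\<And>k. m \<le> k \<Longrightarrow> 1 / 2 < avg u x (rr k)" by (meson not_le)
    obtain y where "x \<noteq> y" using two by metis
    then show ?thesis by (rule thin_at_zeros[OF u' fin _ m])
  qed
  ultimately show ?thesis by blast
qed

text \<open>Every point where u does not vanish has \<open>v n m\<close> equal to 1 for some n and
  m, and all these functions vanish where u does. Removing the countable union of their exceptional
  sets leaves a finely open set, since sets of capacity zero do not affect thinness; it is nonempty
  because u is not zero quasi everywhere.\<close>

lemma newtonian_zero_finely_open:
  assumes u: "u \<in> newtonian_zero M p E" and ne: "\<not> quasi_everywhere M p (\<lambda>x. u x = 0)" and two: "a \<noteq> (b :: 'a)"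
  shows "\<exists>U. finely_open M p U \<and> U \<noteq> {} \<and> U \<subseteq> E"
proof -
  have uN: "u \<in> newtonian M p" and uE: "\<And>x. x \<notin> E \<Longrightarrow> u x = 0" using u by (auto simp: newtonian_zero_def)
  obtain g where g: "Lp_grad g u" and uM: "u \<in> borel_measurable M" using newtonianD[OF uN] by metis
  define w where "w n y = min (clip \<bar>u y\<bar>) (cutoff undefined (real (Suc n)) y)" for n :: nat and y
  define v where "v n m y = min 1 (real m * w n y)" for n m :: nat and y
  have n0: "0 < real (Suc n)" for n by simp
  note cut = cutoff[OF n0, where x="undefined :: 'a"]
  have w0: "0 \<le> w n y" for n y using cut(1)[of n y] by (simp add: w_def)
  have "\<exists>h. nice (v n m) h" for n m
  proof -
    obtain k where k: "nice (cutoff undefined (real (Suc n))) k" using cutoff_nice[OF n0[of n]] by blast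
    have "Lp_grad (\<lambda>y. g y + k y) (\<lambda>y. ereal (w n y))"
    proof (rule Lp_grad_add[OF Lp_grad_clip_abs[OF g] niceD(5)[OF k]])
      fix y z show "eabs (ereal (w n y) - ereal (w n z)) \<le> eabs (ereal (clip \<bar>u y\<bar>) - ereal (clip \<bar>u z\<bar>))
        + eabs (ereal (cutoff undefined (real (Suc n)) y) - ereal (cutoff undefined (real (Suc n)) z))"
        unfolding eabs_real_diff w_def by (simp add: ennreal_leI flip: ennreal_plus)
    qed
    then have "Lp_grad (\<lambda>y. ennreal (real m) * (g y + k y)) (\<lambda>y. ereal (v n m y))"
    proof (rule Lp_grad_cmult)
      fix y z
      have "\<bar>real m * w n y - real m * w n z\<bar> = real m * \<bar>w n y - w n z\<bar>" by (simp add: abs_mult flip: right_diff_distrib)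
      then have "\<bar>v n m y - v n m z\<bar> \<le> real m * \<bar>w n y - w n z\<bar>" unfolding v_def by linarith
      then show "eabs (ereal (v n m y) - ereal (v n m z)) \<le> ennreal (real m) * eabs (ereal (w n y) - ereal (w n z))"
        unfolding eabs_real_diff by (simp add: ennreal_leI flip: ennreal_mult)
    qed simp
    then have "nice (v n m) (\<lambda>y. ennreal (real m) * (g y + k y))"
    proof (rule nice_supportI[rotated 4])
      note [measurable] = uM niceD(1)[OF k]
      have "(\<lambda>y. clip \<bar>u y\<bar>) \<in> borel_measurable M" by (intro clip_measurable) measurable
      then show "v n m \<in> borel_measurable M" unfolding v_def[abs_def] w_def by measurable
      fix y show "v n m y = 0" if "y \<notin> ball undefined (2 * real (Suc n))"
        unfolding v_def w_def cut(4)[OF that] by simp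
    qed (use w0 in \<open>auto simp: v_def\<close>)
    then show ?thesis by blast
  qed
  moreover have "v n m y = 0" if "y \<notin> ball undefined (2 * real (Suc n))" for n m y
    unfolding v_def w_def cut(4)[OF that] by simp
  ultimately have "\<exists>Z. zero_cap Z \<and> (\<forall>x. x \<notin> Z \<longrightarrow> v n m x = 1 \<longrightarrow> thin_at M p {z. v n m z = 0} x)" for n m
    using nice_thin_at_zeros[OF _ _ two] by meson
  then obtain Z where Z: "\<And>n m. zero_cap (Z n m)"
    "\<And>n m x. x \<notin> Z n m \<Longrightarrow> v n m x = 1 \<Longrightarrow> thin_at M p {z. v n m z = 0} x" by metis
  define Y where "Y = (\<Union>n m. Z n m)"
  have Y: "zero_cap Y" unfolding Y_def by (intro zero_cap_UN Z)
  define U where "U = {x. u x \<noteq> 0} - Y"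
  have "finely_open M p U" unfolding finely_open_def
  proof
    fix x assume x: "x \<in> U"
    then have "0 < clip \<bar>u x\<bar>" by (cases "u x") (auto simp: U_def)
    then obtain m :: nat where m: "1 / clip \<bar>u x\<bar> < m" using reals_Archimedean2 by blast
    obtain n :: nat where "x \<in> ball undefined n" using UN_ball[of "undefined :: 'a"] by blast
    then have "x \<in> ball undefined (real (Suc n))" by simp
    then have "w n x = clip \<bar>u x\<bar>" by (simp add: w_def cut(3) del: of_nat_Suc)
    then have "v n m x = 1" using m \<open>0 < clip \<bar>u x\<bar>\<close> by (simp add: v_def field_simps)
    moreover have "x \<notin> Z n m" using x by (auto simp: U_def Y_def)
    ultimately have "thin_at M p {z. v n m z = 0} x" by (intro Z)
    moreover have "{z. u z = 0} \<subseteq> {z. v n m z = 0}"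
      using cut(1)[of n] clip_eq_0[of 0] by (auto simp: v_def w_def min_def)
    ultimately have "thin_at M p {z. u z = 0} x" by (rule thin_at_mono)
    from thin_at_zero_cap[OF this Y] have "thin_at M p ({z. u z = 0} \<union> Y) x" .
    then show "thin_at M p (- U) x" by (rule thin_at_mono) (auto simp: U_def)
  qed
  moreover have "U \<noteq> {}"
  proof
    assume "U = {}"
    then have "\<forall>x. x \<notin> Y \<longrightarrow> u x = 0" by (auto simp: U_def)
    then show False using ne Y by (auto simp: quasi_everywhere_def zero_cap_iff)
  qed
  moreover have "U \<subseteq> E" using uE by (auto simp: U_def)
  ultimately show ?thesis by blast
qed

text \<open>Otherwise both capacities agree at every radius, the integrand is 1 / r throughout, and
  its integral diverges at 0.\<close>

lemma thin_at_capacity_less: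
  assumes thin: "thin_at M p (- E) x"
  shows "\<exists>s>0. var_capacity M p (ball x s - E) (ball x (2 * s)) < var_capacity M p (ball x s) (ball x (2 * s))"
proof (rule ccontr)
  assume "\<not> ?thesis"
  then have nless: "var_capacity M p (ball x s) (ball x (2 * s)) \<le> var_capacity M p (ball x s - E) (ball x (2 * s))" if "0 < s" for s
    using that by (meson not_le)
  have eq: "var_capacity M p (- E \<inter> ball x s) (ball x (2 * s)) = var_capacity M p (ball x s) (ball x (2 * s))" if "0 < s" for s
  proof -
    have "- E \<inter> ball x s = ball x s - E" by blast
    moreover have "var_capacity M p (ball x s - E) (ball x (2 * s)) \<le> var_capacity M p (ball x s) (ball x (2 * s))"
      by (rule var_capacity_mono) blast
    ultimately show ?thesis using nless that by (simp add: order_antisym)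
  qed
  have "(\<integral>\<^sup>+r\<in>{0<..<1}. 1 / ennreal r \<partial>lborel) < \<infinity>"
  proof (rule le_less_trans[OF nn_integral_mono thin[unfolded thin_at_def]])
    fix r :: real
    have "1 epowr q = 1" for q by (simp add: epowr_def)
    \<comment> \<open>Finiteness of the capacity of the ball makes the quotient equal to 1; if that
      capacity vanishes, the value 1 comes from the convention in \<open>thin_at\<close>.\<close>
    then show "1 / ennreal r * indicator {0<..<1} r
      \<le> (if var_capacity M p (ball x r) (ball x (2 * r)) = 0 then 1
         else (var_capacity M p (- E \<inter> ball x r) (ball x (2 * r)) / var_capacity M p (ball x r) (ball x (2 * r))) epowr (1 / (p - 1)))
        / ennreal r * indicator {0<..<1} r"
      using var_capacity_ball_finite[of r x] by (auto simp: indicator_def eq)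
  qed
  then show False by (simp add: nn_integral_inverse_0_1)
qed

text \<open>If the cut-off complement of u were zero quasi everywhere, u would be at least 1 on the
  ball outside a set of capacity zero. It would then compete for the capacity of the whole ball
  although its energy is strictly smaller.\<close>

lemma capacity_less_newtonian_zero:
  assumes s: "0 < s" and less: "var_capacity M p (ball x s - E) (ball x (2 * s)) < var_capacity M p (ball x s) (ball x (2 * s))"
  shows "\<exists>w \<in> newtonian_zero M p E. \<not> quasi_everywhere M p (\<lambda>y. w y = 0)"
proof -
  obtain u where u: "u \<in> newtonian_zero M p (ball x (2 * s))" "\<And>y. y \<in> ball x s - E \<Longrightarrow> 1 \<le> u y"
    "p_energy M p u < var_capacity M p (ball x s) (ball x (2 * s))"
    using less unfolding var_capacity_def[of _ _ "ball x s - E"] INF_less_iff by auto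
  then have uN: "u \<in> newtonian M p" by (simp add: newtonian_zero_def)
  obtain g where g: "Lp_grad g u" and uM [measurable]: "u \<in> borel_measurable M" using newtonianD[OF uN] by metis
  have s2: "0 < s / 2" using s by simp
  obtain k where k: "nice (cutoff x (s / 2)) k" using cutoff_nice[OF s2] by blast
  \<comment> \<open>The cutoff with radius s / 2 is positive exactly on the ball of radius s, so w
    vanishes off that ball while its zeros inside reveal where u is at least 1.\<close>
  define w where "w y = min (1 - clip (u y)) (cutoff x (s / 2) y)" for y
  have w0: "0 \<le> w y" "w y \<le> 1" for y using cutoff(1,2)[OF s2, of x y] by (auto simp: w_def)
  have w_off: "w y = 0" if "y \<notin> ball x s" for y
  proof -
    have "cutoff x (s / 2) y = 0" by (rule cutoff(4)[OF s2]) (use that in simp)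
    then show ?thesis by (simp add: w_def)
  qed
  have "Lp_grad (\<lambda>y. g y + k y) (\<lambda>y. ereal (w y))"
  proof (rule Lp_grad_add[OF Lp_grad_clip[OF g] niceD(5)[OF k]])
    fix y z show "eabs (ereal (w y) - ereal (w z)) \<le> eabs (ereal (clip (u y)) - ereal (clip (u z)))
      + eabs (ereal (cutoff x (s / 2) y) - ereal (cutoff x (s / 2) z))"
      unfolding eabs_real_diff w_def by (simp add: ennreal_leI flip: ennreal_plus)
  qed
  then have n: "nice w (\<lambda>y. g y + k y)"
  proof (rule nice_supportI[rotated 4])
    note [measurable] = niceD(1)[OF k]
    show "w \<in> borel_measurable M" unfolding w_def[abs_def] by measurable
  qed (use w0 w_off in auto)
  have "(\<integral>\<^sup>+y. eabs (ereal (w y)) epowr p \<partial>N) \<le> (\<integral>\<^sup>+y. ennreal (w y) \<partial>N)"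
  proof (rule nn_integral_mono)
    fix y show "eabs (ereal (w y)) epowr p \<le> ennreal (w y)"
      using w0[of y] powr_mono'[of 1 p "w y"] p by (simp add: epowr_ennreal ennreal_leI)
  qed
  then have "(\<integral>\<^sup>+y. eabs (ereal (w y)) epowr p \<partial>N) < \<infinity>" using niceD(4)[OF n] by (rule le_less_trans)
  then have "(\<lambda>y. ereal (w y)) \<in> newtonian M p"
    by (intro newtonianI[OF _ _ niceD(5)[OF n]]) (use niceD(1)[OF n] in auto)
  moreover have "w y = 0" if "y \<notin> E" for y
  proof (cases "y \<in> ball x s")
    case True
    then show ?thesis using clip_eq_1[OF u(2)[of y]] that cutoff(1)[OF s2, of x y] by (simp add: w_def)
  qed (rule w_off)
  ultimately have "(\<lambda>y. ereal (w y)) \<in> newtonian_zero M p E" by (simp add: newtonian_zero_def)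
  moreover have "\<not> quasi_everywhere M p (\<lambda>y. ereal (w y) = 0)"
  proof
    assume "quasi_everywhere M p (\<lambda>y. ereal (w y) = 0)"
    then obtain Z where Z: "zero_cap Z" "\<And>y. y \<notin> Z \<Longrightarrow> w y = 0"
      by (auto simp: quasi_everywhere_def zero_cap_iff)
    have "1 \<le> u y" if "y \<in> ball x s - Z" for y
    proof -
      have "0 < cutoff x (s / 2) y" using that s by (simp add: cutoff_def field_simps)
      moreover have "w y = 0" using that Z by blast
      ultimately have "clip (u y) = 1" unfolding w_def by linarith
      then show ?thesis by (cases "u y") (auto simp: max_def min_def split: if_splits)
    qed
    then have "var_capacity M p (ball x s - Z) (ball x (2 * s)) \<le> p_energy M p u"
      unfolding var_capacity_def using u(1) by (intro INF_lower) auto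
    moreover have "var_capacity M p (ball x s) (ball x (2 * s)) \<le> var_capacity M p (ball x s - Z) (ball x (2 * s))"
      using s by (intro var_capacity_zero_cap[OF Z(1)]) (auto simp: subset_ball)
    ultimately show False using u(3) by (meson leD order_trans)
  qed
  ultimately show ?thesis by (intro bexI)
qed

section \<open>Fine interior and the equivalences\<close>

lemma finely_open_Union: assumes "\<And>U. U \<in> \<U> \<Longrightarrow> finely_open M p U" shows "finely_open M p (\<Union>\<U>)"
  unfolding finely_open_def
proof
  fix x assume "x \<in> \<Union>\<U>"
  then obtain U where U: "x \<in> U" "U \<in> \<U>" by blast
  then have "thin_at M p (- U) x" using assms by (simp add: finely_open_def)
  then show "thin_at M p (- \<Union>\<U>) x" by (rule thin_at_mono) (use U in blast)
qed

text \<open>Arbitrary unions of finely open sets are finely open, so the union is itself a candidate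
  and \<open>GREATEST\<close> denotes an actual maximum.\<close>

lemma fine_interior_Union: "fine_interior M p E = \<Union>{U. finely_open M p U \<and> U \<subseteq> E}"
  unfolding fine_interior_def
  by (rule Greatest_equality) (auto intro: finely_open_Union)

end

lemma pi_space_exists:
  fixes M :: "'a::metric_space measure"
  assumes M: "metric_measure M" and complete: "complete (UNIV :: 'a set)" and p: "1 < p"
    and doub: "doubling_measure M" and poin: "poincare_inequality M p"
  shows "\<exists>N CD CP K. pi_space M N p CD CP K"
proof -
  obtain N where N: "sets N = sets borel" "M = completion N"
    and ball: "\<And>x r. 0 < r \<Longrightarrow> 0 < emeasure M (ball x r) \<and> emeasure M (ball x r) < \<infinity>"
    using M unfolding metric_measure_def by metis
  obtain C where C: "\<And>x r. 0 < r \<Longrightarrow> emeasure M (ball x (2 * r)) \<le> ennreal C * emeasure M (ball x r)"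
    using doub unfolding doubling_measure_def by metis
  obtain CP K where CP: "0 < CP" "1 \<le> K" and P: "\<forall>x r u. 0 < r \<and> u \<in> Dirichlet_loc M p \<and> (\<integral>\<^sup>+y. eabs (u y) \<partial>M) < \<infinity> \<longrightarrow>
     (\<integral>\<^sup>+y\<in>ball x r. eabs (u y - ereal (ball_average M u x r)) \<partial>M) / emeasure M (ball x r)
           \<le> ennreal (CP * diameter (ball x r)) *
             ((\<integral>\<^sup>+y\<in>ball x (K * r). min_gradient M p u y epowr p \<partial>M)
                / emeasure M (ball x (K * r))) epowr (1 / p)"
    using poin unfolding poincare_inequality_def by blast
  have eN: "emeasure N (ball x r) = emeasure M (ball x r)" for x r
    using N by simp
  \<comment> \<open>The doubling constant is raised to at least 1, so that its powers are monotone
    in the exponent.\<close>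
  have "pi_space M N p (max 1 C) CP K"
  proof
    show "emeasure N (ball x r) < \<infinity>" for x r
      using ball[of r x] by (cases "0 < r") (auto simp: eN ball_empty)
    show "emeasure N (ball x (2 * r)) \<le> ennreal (max 1 C) * emeasure N (ball x r)" if "0 < r" for x r
    proof -
      have "emeasure N (ball x (2 * r)) \<le> ennreal C * emeasure N (ball x r)" unfolding eN by (rule C[OF that])
      also have "\<dots> \<le> ennreal (max 1 C) * emeasure N (ball x r)" by (intro mult_right_mono ennreal_leI) auto
      finally show ?thesis .
    qed
    show "(\<integral>\<^sup>+y\<in>ball x r. eabs (u y - ereal (ball_average M u x r)) \<partial>M) / emeasure M (ball x r)
      \<le> ennreal (CP * diameter (ball x r)) *
        ((\<integral>\<^sup>+y\<in>ball x (K * r). min_gradient M p u y epowr p \<partial>M) / emeasure M (ball x (K * r))) epowr (1 / p)"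
      if "0 < r" "u \<in> Dirichlet_loc M p" "(\<integral>\<^sup>+y. eabs (u y) \<partial>M) < \<infinity>" for x r u
      by (rule P[rule_format]) (intro conjI that)
    show "0 < emeasure N (ball x r)" if "0 < r" for x r using ball[OF that] by (simp only: eN)
  qed (rule N complete p CP max.cobounded1)+
  then show ?thesis by (intro exI)
qed

theorem theorem7p2:
  fixes M :: "'a::metric_space measure" and p :: real and E :: "'a set"
  assumes "metric_measure M"
    and "complete (UNIV :: 'a set)"
    and "\<exists>x y :: 'a. x \<noteq> y"
    and "1 < p"
    and "doubling_measure M"
    and "poincare_inequality M p"
  shows "((\<not> (\<forall>u \<in> newtonian_zero M p E. quasi_everywhere M p (\<lambda>x. u x = 0)))
            \<longleftrightarrow> (\<exists>U. finely_open M p U \<and> U \<noteq> {} \<and> U \<subseteq> E))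
       \<and> ((\<exists>U. finely_open M p U \<and> U \<noteq> {} \<and> U \<subseteq> E)
            \<longleftrightarrow> fine_interior M p E \<noteq> {})
       \<and> ((\<exists>U. finely_open M p U \<and> U \<noteq> {} \<and> U \<subseteq> E)
            \<longleftrightarrow> (\<exists>x\<in>E. thin_at M p (- E) x))
       \<and> ((\<exists>x\<in>E. thin_at M p (- E) x)
            \<longleftrightarrow> (\<exists>x\<in>E. \<exists>s>0. var_capacity M p (ball x s - E) (ball x (2 * s))
                               < var_capacity M p (ball x s) (ball x (2 * s))))"
    (is "(?a \<longleftrightarrow> ?b) \<and> (?b \<longleftrightarrow> ?f) \<and> (?b \<longleftrightarrow> ?c) \<and> (?c \<longleftrightarrow> ?d)")
proof -
  obtain N CD CP K where "pi_space M N p CD CP K" using pi_space_exists assms by blast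
  then interpret pi_space M N p CD CP K .
  have ab: "?a \<Longrightarrow> ?b" using newtonian_zero_finely_open assms(3) by blast
  have bc: ?c if b: ?b
  proof -
    obtain U x where U: "finely_open M p U" "x \<in> U" "U \<subseteq> E" using b by blast
    then have "thin_at M p (- U) x" by (simp add: finely_open_def)
    then have "thin_at M p (- E) x" by (rule thin_at_mono) (use U in blast)
    then show ?c using U by blast
  qed
  have cd: "?c \<Longrightarrow> ?d" using thin_at_capacity_less by blast
  have da: "?d \<Longrightarrow> ?a" using capacity_less_newtonian_zero by blast
  have bf: "?b \<longleftrightarrow> ?f" unfolding fine_interior_Union by blast
  show ?thesis using ab bc cd da bf by argo
qed

end
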